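(* Let $N\in\{3,4\}$, $2^*=\frac{2N}{N-2}$, $a,b>0$, $\alpha>1$, $\beta>1$, $\alpha+\beta<2^*$ and $\alpha+\beta>2+\frac4N$; set $\gamma:=\frac{N(\alpha+\beta-2)}2$. Let $\Lambda\subset(0,\infty)$ be unbounded and for each $\nu\in\Lambda$ let $(u_\nu,v_\nu)$ be a normalized ground state of the coupled system with parameter $\nu$ whose components are positive and radially symmetric and whose Lagrange multipliers are positive. Then, with $s_\nu=(\gamma-2)^{-1}\ln\nu$, $$\mathrm{dist}_H\big(s_\nu\star(u_\nu,v_\nu),\mathcal G(a,b)\big)\to0\quad\text{as }\nu\to+\infty.$$
   Context: $H=H^1(\mathbb R^N)^2$. $I_\nu(u,v)=\frac12\int(|\nabla u|^2+|\nabla v|^2)-\frac1{2^*}\int(|u|^{2^*}+|v|^{2^*})-\nu\int|u|^\alpha|v|^\beta$, $P_\nu(u,v)=\int(|\nabla u|^2+|\nabla v|^2)-\int(|u|^{2^*}+|v|^{2^*})-\nu\gamma\int|u|^\alpha|v|^\beta$, $\mathcal T(a,b)=\{(u,v)\in H:\|u\|_2=a,\|v\|_2=b\}$, $\mathcal P_\nu(a,b)=\{(u,v)\in\mathcal T(a,b):P_\nu=0\}$, $m_\nu(a,b)=\inf_{\mathcal P_\nu(a,b)}I_\nu$. A normalized ground state of the coupled system is $(u,v)\in\mathcal P_\nu(a,b)$ with $I_\nu(u,v)=m_\nu(a,b)$ that weakly solves, for some $\lambda_1,\lambda_2\in\mathbb R$, $-\Delta u+\lambda_1u=|u|^{2^*-2}u+\nu\alpha|u|^{\alpha-2}|v|^\beta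 u$, $-\Delta v+\lambda_2v=|v|^{2^*-2}v+\nu\beta|u|^\alpha|v|^{\beta-2}v$. Limit problem: $K(u,v)=\frac12\int(|\nabla u|^2+|\nabla v|^2)-\int|u|^\alpha|v|^\beta$, $L(u,v)=\int(|\nabla u|^2+|\nabla v|^2)-\gamma\int|u|^\alpha|v|^\beta$, $\mathcal L(a,b)=\{(u,v)\in\mathcal T(a,b):L=0\}$; a normalized ground state of the limit system is a weak solution $(u,v)\in\mathcal T(a,b)$ of $-\Delta u+\lambda_1u=\alpha|u|^{\alpha-2}|v|^\beta u$, $-\Delta v+\lambda_2v=\beta|u|^\alpha|v|^{\beta-2}v$ (some $\lambda_1,\lambda_2$) with $K(u,v)=\inf_{\mathcal L(a,b)}K$. $\mathcal G(a,b)$ is the set of such solutions with $\lambda_1,\lambda_2>0$. $s\star u(x)=e^{Ns/2}u(e^sx)$, $s\star(u,v)=(s\star u,s\star v)$. *)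

theory Defs
  imports "HOL-Analysis.Analysis"
begin

definition pdiff :: "'n::finite \<Rightarrow> (real^'n \<Rightarrow> real) \<Rightarrow> real^'n \<Rightarrow> real" where
  "pdiff i f x = frechet_derivative f (at x) (axis i 1)"

definition cgrad :: "(real^'n::finite \<Rightarrow> real) \<Rightarrow> real^'n \<Rightarrow> real^'n" where
  "cgrad f x = (\<chi> i. pdiff i f x)"

definition C_inf :: "(real^'n::finite \<Rightarrow> real) \<Rightarrow> bool" where
  "C_inf f \<longleftrightarrow> (\<forall>is::'n list. \<forall>x. (fold pdiff is f) differentiable (at x))"

definition test_fun :: "(real^'n::finite \<Rightarrow> real) \<Rightarrow> bool" where
  "test_fun \<phi> \<longleftrightarrow> C_inf \<phi> \<and> compact (closure {x. \<phi> x \<noteq> 0})"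

definition weak_grad :: "(real^'n::finite \<Rightarrow> real) \<Rightarrow> (real^'n \<Rightarrow> real^'n) \<Rightarrow> bool" where
  "weak_grad u g \<longleftrightarrow> (\<forall>\<phi>. test_fun \<phi> \<longrightarrow> (\<forall>i.
      integrable lebesgue (\<lambda>x. u x * pdiff i \<phi> x) \<and>
      integrable lebesgue (\<lambda>x. g x $ i * \<phi> x) \<and>
      (\<integral>x. u x * pdiff i \<phi> x \<partial>lebesgue) = - (\<integral>x. g x $ i * \<phi> x \<partial>lebesgue)))"

definition L2grad :: "(real^'n::finite \<Rightarrow> real) \<Rightarrow> (real^'n \<Rightarrow> real^'n) \<Rightarrow> bool" where
  "L2grad u g \<longleftrightarrow> weak_grad u g \<and> g \<in> borel_measurable lebesgue \<and>
      integrable lebesgue (\<lambda>x. (norm (g x))\<^sup>2)"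

definition H1 :: "(real^'n::finite \<Rightarrow> real) \<Rightarrow> bool" where
  "H1 u \<longleftrightarrow> u \<in> borel_measurable lebesgue \<and> integrable lebesgue (\<lambda>x. (u x)\<^sup>2) \<and>
      (\<exists>g. L2grad u g)"

text \<open>The weak gradient (unique a.e. for H^1 functions).\<close>
definition wgrad :: "(real^'n::finite \<Rightarrow> real) \<Rightarrow> real^'n \<Rightarrow> real^'n" where
  "wgrad u = (SOME g. L2grad u g)"

definition dirichlet :: "(real^'n::finite \<Rightarrow> real) \<Rightarrow> real" where
  "dirichlet u = (\<integral>x. (norm (wgrad u x))\<^sup>2 \<partial>lebesgue)"

definition L2norm :: "(real^'n::finite \<Rightarrow> real) \<Rightarrow> real" where
  "L2norm u = sqrt (\<integral>x. (u x)\<^sup>2 \<partial>lebesgue)"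

definition Lp_int :: "real \<Rightarrow> (real^'n::finite \<Rightarrow> real) \<Rightarrow> real" where
  "Lp_int p u = (\<integral>x. \<bar>u x\<bar> powr p \<partial>lebesgue)"

definition coup :: "real \<Rightarrow> real \<Rightarrow> (real^'n::finite \<Rightarrow> real) \<Rightarrow> (real^'n \<Rightarrow> real) \<Rightarrow> real" where
  "coup \<alpha> \<beta> u v = (\<integral>x. \<bar>u x\<bar> powr \<alpha> * \<bar>v x\<bar> powr \<beta> \<partial>lebesgue)"

definition H1norm :: "(real^'n::finite \<Rightarrow> real) \<Rightarrow> real" where
  "H1norm u = sqrt ((\<integral>x. (u x)\<^sup>2 \<partial>lebesgue) + dirichlet u)"

definition Hdist :: "(real^'n::finite \<Rightarrow> real) \<times> (real^'n \<Rightarrow> real) \<Rightarrow>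
     (real^'n \<Rightarrow> real) \<times> (real^'n \<Rightarrow> real) \<Rightarrow> real" where
  "Hdist w z = sqrt ((H1norm (\<lambda>x. fst w x - fst z x))\<^sup>2 + (H1norm (\<lambda>x. snd w x - snd z x))\<^sup>2)"

definition Hdist_set :: "(real^'n::finite \<Rightarrow> real) \<times> (real^'n \<Rightarrow> real) \<Rightarrow>
     ((real^'n \<Rightarrow> real) \<times> (real^'n \<Rightarrow> real)) set \<Rightarrow> real" where
  "Hdist_set w G = Inf (Hdist w ` G)"

definition crit :: "'n::finite itself \<Rightarrow> real" where
  "crit _ = 2 * real CARD('n) / (real CARD('n) - 2)"

definition gam :: "'n::finite itself \<Rightarrow> real \<Rightarrow> real \<Rightarrow> real" where
  "gam _ \<alpha> \<beta> = real CARD('n) * (\<alpha> + \<beta> - 2) / 2"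

definition I_nu :: "real \<Rightarrow> real \<Rightarrow> real \<Rightarrow> (real^'n::finite \<Rightarrow> real) \<Rightarrow> (real^'n \<Rightarrow> real) \<Rightarrow> real" where
  "I_nu \<alpha> \<beta> \<nu> u v = 1/2 * (dirichlet u + dirichlet v)
     - 1 / crit TYPE('n) * (Lp_int (crit TYPE('n)) u + Lp_int (crit TYPE('n)) v)
     - \<nu> * coup \<alpha> \<beta> u v"

definition P_nu :: "real \<Rightarrow> real \<Rightarrow> real \<Rightarrow> (real^'n::finite \<Rightarrow> real) \<Rightarrow> (real^'n \<Rightarrow> real) \<Rightarrow> real" where
  "P_nu \<alpha> \<beta> \<nu> u v = (dirichlet u + dirichlet v)
     - (Lp_int (crit TYPE('n)) u + Lp_int (crit TYPE('n)) v)
     - \<nu> * gam TYPE('n) \<alpha> \<beta> * coup \<alpha> \<beta> u v"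

definition Tset :: "real \<Rightarrow> real \<Rightarrow> ((real^'n::finite \<Rightarrow> real) \<times> (real^'n \<Rightarrow> real)) set" where
  "Tset a b = {(u, v). H1 u \<and> H1 v \<and> L2norm u = a \<and> L2norm v = b}"

definition Pset :: "real \<Rightarrow> real \<Rightarrow> real \<Rightarrow> real \<Rightarrow> real \<Rightarrow> ((real^'n::finite \<Rightarrow> real) \<times> (real^'n \<Rightarrow> real)) set" where
  "Pset \<alpha> \<beta> \<nu> a b = {(u, v). (u, v) \<in> Tset a b \<and> P_nu \<alpha> \<beta> \<nu> u v = 0}"

definition m_nu :: "'n::finite itself \<Rightarrow> real \<Rightarrow> real \<Rightarrow> real \<Rightarrow> real \<Rightarrow> real \<Rightarrow> real" where
  "m_nu _ \<alpha> \<beta> \<nu> a b = Inf ((\<lambda>(u, v). I_nu \<alpha> \<beta> \<nu> u v) ` (Pset \<alpha> \<beta> \<nu> a b :: ((real^'n \<Rightarrow> real) \<times> _) set))"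

definition weak_sol :: "real \<Rightarrow> (real^'n::finite \<Rightarrow> real) \<Rightarrow> (real^'n \<Rightarrow> real) \<Rightarrow> bool" where
  "weak_sol lam w f \<longleftrightarrow> (\<forall>\<phi>. test_fun \<phi> \<longrightarrow>
     (\<integral>x. wgrad w x \<bullet> cgrad \<phi> x + lam * w x * \<phi> x \<partial>lebesgue) = (\<integral>x. f x * \<phi> x \<partial>lebesgue))"

definition coupled_sol :: "real \<Rightarrow> real \<Rightarrow> real \<Rightarrow> real \<Rightarrow> real \<Rightarrow>
    (real^'n::finite \<Rightarrow> real) \<Rightarrow> (real^'n \<Rightarrow> real) \<Rightarrow> bool" where
  "coupled_sol \<alpha> \<beta> \<nu> lam1 lam2 u v \<longleftrightarrow>
     weak_sol lam1 u (\<lambda>x. \<bar>u x\<bar> powr (crit TYPE('n) - 2) * u x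
                        + \<nu> * \<alpha> * \<bar>u x\<bar> powr (\<alpha> - 2) * \<bar>v x\<bar> powr \<beta> * u x) \<and>
     weak_sol lam2 v (\<lambda>x. \<bar>v x\<bar> powr (crit TYPE('n) - 2) * v x
                        + \<nu> * \<beta> * \<bar>u x\<bar> powr \<alpha> * \<bar>v x\<bar> powr (\<beta> - 2) * v x)"

definition norm_ground_state :: "real \<Rightarrow> real \<Rightarrow> real \<Rightarrow> real \<Rightarrow> real \<Rightarrow>
    (real^'n::finite \<Rightarrow> real) \<Rightarrow> (real^'n \<Rightarrow> real) \<Rightarrow> bool" where
  "norm_ground_state \<alpha> \<beta> \<nu> a b u v \<longleftrightarrow>
     (u, v) \<in> Pset \<alpha> \<beta> \<nu> a b \<and> I_nu \<alpha> \<beta> \<nu> u v = m_nu TYPE('n) \<alpha> \<beta> \<nu> a b \<and>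
     (\<exists>lam1 lam2. coupled_sol \<alpha> \<beta> \<nu> lam1 lam2 u v)"

definition K_fun :: "real \<Rightarrow> real \<Rightarrow> (real^'n::finite \<Rightarrow> real) \<Rightarrow> (real^'n \<Rightarrow> real) \<Rightarrow> real" where
  "K_fun \<alpha> \<beta> u v = 1/2 * (dirichlet u + dirichlet v) - coup \<alpha> \<beta> u v"

definition L_fun :: "real \<Rightarrow> real \<Rightarrow> (real^'n::finite \<Rightarrow> real) \<Rightarrow> (real^'n \<Rightarrow> real) \<Rightarrow> real" where
  "L_fun \<alpha> \<beta> u v = (dirichlet u + dirichlet v) - gam TYPE('n) \<alpha> \<beta> * coup \<alpha> \<beta> u v"

definition Lset :: "real \<Rightarrow> real \<Rightarrow> real \<Rightarrow> real \<Rightarrow> ((real^'n::finite \<Rightarrow> real) \<times> (real^'n \<Rightarrow> real)) set" where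
  "Lset \<alpha> \<beta> a b = {(u, v). (u, v) \<in> Tset a b \<and> L_fun \<alpha> \<beta> u v = 0}"

definition limit_sol :: "real \<Rightarrow> real \<Rightarrow> real \<Rightarrow> real \<Rightarrow>
    (real^'n::finite \<Rightarrow> real) \<Rightarrow> (real^'n \<Rightarrow> real) \<Rightarrow> bool" where
  "limit_sol \<alpha> \<beta> lam1 lam2 u v \<longleftrightarrow>
     weak_sol lam1 u (\<lambda>x. \<alpha> * \<bar>u x\<bar> powr (\<alpha> - 2) * \<bar>v x\<bar> powr \<beta> * u x) \<and>
     weak_sol lam2 v (\<lambda>x. \<beta> * \<bar>u x\<bar> powr \<alpha> * \<bar>v x\<bar> powr (\<beta> - 2) * v x)"

definition Gset :: "real \<Rightarrow> real \<Rightarrow> real \<Rightarrow> real \<Rightarrow> ((real^'n::finite \<Rightarrow> real) \<times> (real^'n \<Rightarrow> real)) set" where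
  "Gset \<alpha> \<beta> a b = {(u, v). (u, v) \<in> Tset a b \<and>
      (\<exists>lam1 lam2. lam1 > 0 \<and> lam2 > 0 \<and> limit_sol \<alpha> \<beta> lam1 lam2 u v) \<and>
      K_fun \<alpha> \<beta> u v = Inf ((\<lambda>(w, z). K_fun \<alpha> \<beta> w z) ` (Lset \<alpha> \<beta> a b :: ((real^'n \<Rightarrow> real) \<times> _) set))}"

definition star :: "real \<Rightarrow> (real^'n::finite \<Rightarrow> real) \<Rightarrow> real^'n \<Rightarrow> real" where
  "star s u x = exp (real CARD('n) * s / 2) * u (exp s *\<^sub>R x)"

definition star2 :: "real \<Rightarrow> (real^'n::finite \<Rightarrow> real) \<times> (real^'n \<Rightarrow> real) \<Rightarrow>
    (real^'n \<Rightarrow> real) \<times> (real^'n \<Rightarrow> real)" where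
  "star2 s w = (star s (fst w), star s (snd w))"

definition radial :: "(real^'n::finite \<Rightarrow> real) \<Rightarrow> bool" where
  "radial u \<longleftrightarrow> (\<forall>x y. norm x = norm y \<longrightarrow> u x = u y)"

end

theory Submission
  imports Defs "HOL-Complex_Analysis.Great_Picard"
begin

text \<open>Put \<open>s = s\<^sub>\<nu>\<close>. The dilation \<open>s \<star> _\<close> turns the coupled system into one with coupling constant 1 in which the
critical terms carry the factor \<open>\<epsilon> = exp ((2 - 2*) s)\<close>, and \<open>\<epsilon> \<rightarrow> 0\<close>. Moving elements of \<open>\<L>(a,b)\<close> along dilations onto
the Pohozaev manifold shows that the rescaled energies are at most \<open>inf K\<close>; since on that manifold the energy
controls the Dirichlet energy, the rescaled ground states are bounded in \<open>H\<close>.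

Positive radial functions in \<open>H\<close> are given by profiles on the half line that are uniformly Hoelder continuous on
compact intervals and obey Strauss bounds at 0 and at infinity. So a diagonal argument gives pointwise convergence
of profiles, the radial equation passes to the limit in its integrated form, and the coupling integrals converge by
dominated convergence. No Sobolev embedding or Rellich theorem is needed: Hardy's inequality on the half
line bounds the critical integral. The limit multipliers are nonnegative, and they are positive because a nonnegative
radial supersolution \<open>- \<Delta>u \<ge> 0\<close> in \<open>L\<^sup>2\<close> vanishes for \<open>N \<le> 4\<close>. Comparing the energy identities of the sequence and of
the limit then turns the Fatou inequalities for masses and Dirichlet energies into equalities, which gives strong
convergence. Finally the limit has \<open>L = 0\<close> and energy at most \<open>inf K\<close>, so it belongs to \<open>\<G>(a,b)\<close>.\<close>

text \<open>The critical term is treated as a perturbation of the limit system: the estimates for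
  the system hold uniformly for \<epsilon> between 0 and 1, and \<epsilon> = 0 is the limit. The
  first obstacle is that profiles converge only pointwise while gradients must converge too. The
  integrated radial equation expresses \<open>F'\<close> by the \<open>flux\<close> of data free of
  derivatives, so pointwise convergence of \<open>F\<close>, dominated by \<open>dom0\<close>,
  already gives pointwise convergence of \<open>F'\<close>; Fatou and Scheffe then suffice and weak
  compactness is avoided. The second obstacle is loss of mass, since radial functions do not embed
  compactly into L2. A lower bound for the Dirichlet energies, independent of \<epsilon>, excludes
  it: with the Pohozaev identity it makes the limit coupling integral nonzero, so both components
  survive, Liouville makes both multipliers positive, and each component satisfies its own energy
  identity. The lower bound on \<alpha> + \<beta> acts twice: it gives \<gamma> > 2, and it makes
  the coupling density integrable at infinity under the Strauss bound.\<close>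

section \<open>Smooth functions on open subsets of the line\<close>

primrec ndiff :: "nat \<Rightarrow> real set \<Rightarrow> (real \<Rightarrow> real) \<Rightarrow> bool" where
  "ndiff 0 S f \<longleftrightarrow> True"
| "ndiff (Suc n) S f \<longleftrightarrow> (\<forall>x\<in>S. f differentiable at x) \<and> ndiff n S (deriv f)"

lemma ndiff_cong:
  assumes "open S" "\<And>x. x \<in> S \<Longrightarrow> f x = g x" "ndiff n S f"
  shows "ndiff n S g"
  using assms(2,3)
proof (induction n arbitrary: f g)
  case (Suc n)
  have ev: "eventually (\<lambda>y. f y = g y) (nhds x)" if "x \<in> S" for x
    using eventually_nhds_in_open[OF assms(1) that] by eventually_elim (use Suc.prems in auto)
  have "g differentiable at x" if "x \<in> S" for x
  proof -
    have "f differentiable at x" using Suc.prems(2) that by simp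
    then obtain f' where "(f has_derivative f') (at x)" unfolding differentiable_def by (elim exE)
    then have "(g has_derivative f') (at x)"
      by (rule has_derivative_transform_within_open[OF _ assms(1) that]) (use Suc.prems in auto)
    then show ?thesis by (auto simp: differentiable_def)
  qed
  moreover have "ndiff n S (deriv g)"
    by (rule Suc.IH[of "deriv f"]) (use Suc.prems ev in \<open>auto intro!: deriv_cong_ev\<close>)
  ultimately show ?case by auto
qed auto

lemma ndiff_SucI:
  assumes "open S" "\<And>x. x \<in> S \<Longrightarrow> (f has_real_derivative f' x) (at x)" "ndiff n S f'"
  shows "ndiff (Suc n) S f"
proof -
  have "ndiff n S (deriv f)"
    by (rule ndiff_cong[OF assms(1) _ assms(3)]) (use DERIV_imp_deriv[OF assms(2)] in auto)
  then show ?thesis using assms(2) by (auto simp: real_differentiable_def)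
qed

lemma ndiff_SucD: "ndiff (Suc n) S f \<Longrightarrow> ndiff n S f"
  by (induction n arbitrary: f) auto

lemma ndiff_deriv: "ndiff (Suc n) S f \<Longrightarrow> x \<in> S \<Longrightarrow> (f has_real_derivative deriv f x) (at x)"
  by (auto simp: DERIV_deriv_iff_real_differentiable)

lemma ndiff_const: "open S \<Longrightarrow> ndiff n S (\<lambda>x. c)"
  by (induction n arbitrary: c) (auto simp del: ndiff.simps(2) intro!: ndiff_SucI derivative_eq_intros)

lemma ndiff_ident: "open S \<Longrightarrow> ndiff n S (\<lambda>x. x)"
  by (cases n) (auto simp del: ndiff.simps(2) intro!: ndiff_SucI[where f'="\<lambda>x. 1"] ndiff_const)

lemma ndiff_add:
  assumes "open S" shows "ndiff n S f \<Longrightarrow> ndiff n S g \<Longrightarrow> ndiff n S (\<lambda>x. f x + g x)"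
proof (induction n arbitrary: f g)
  case (Suc n)
  show ?case
    by (rule ndiff_SucI[OF assms, where f'="\<lambda>x. deriv f x + deriv g x"])
      (use Suc in \<open>auto intro!: DERIV_add simp: DERIV_deriv_iff_real_differentiable\<close>)
qed auto

lemma ndiff_mult:
  assumes "open S" shows "ndiff n S f \<Longrightarrow> ndiff n S g \<Longrightarrow> ndiff n S (\<lambda>x. f x * g x)"
proof (induction n arbitrary: f g)
  case (Suc n)
  show ?case
  proof (rule ndiff_SucI[OF assms, where f'="\<lambda>x. deriv f x * g x + deriv g x * f x"])
    show "((\<lambda>x. f x * g x) has_real_derivative deriv f x * g x + deriv g x * f x) (at x)" if "x \<in> S" for x
      by (rule DERIV_mult) (use that Suc in \<open>auto simp: DERIV_deriv_iff_real_differentiable\<close>)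
    show "ndiff n S (\<lambda>x. deriv f x * g x + deriv g x * f x)"
      using Suc.prems Suc.prems[THEN ndiff_SucD] by (intro ndiff_add assms Suc.IH) auto
  qed
qed auto

lemma ndiff_cmult: "open S \<Longrightarrow> ndiff n S f \<Longrightarrow> ndiff n S (\<lambda>x. c * f x)"
  by (intro ndiff_mult ndiff_const)

lemma ndiff_diff: "open S \<Longrightarrow> ndiff n S f \<Longrightarrow> ndiff n S g \<Longrightarrow> ndiff n S (\<lambda>x. f x - g x)"
  using ndiff_add[of S n f "\<lambda>x. (-1) * g x"] ndiff_cmult[of S n g "-1"] by simp

lemma ndiff_Un: "ndiff n S f \<Longrightarrow> ndiff n T f \<Longrightarrow> ndiff n (S \<union> T) f"
  by (induction n arbitrary: f) auto

lemma ndiff_compose: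
  assumes "open S" "open T" "g ` S \<subseteq> T"
  shows "ndiff n T f \<Longrightarrow> ndiff n S g \<Longrightarrow> ndiff n S (\<lambda>x. f (g x))"
proof (induction n arbitrary: f)
  case (Suc n)
  show ?case
  proof (rule ndiff_SucI[OF assms(1), where f'="\<lambda>x. deriv f (g x) * deriv g x"])
    show "((\<lambda>x. f (g x)) has_real_derivative deriv f (g x) * deriv g x) (at x)" if "x \<in> S" for x
      by (rule DERIV_chain2) (use that Suc.prems assms in \<open>auto simp: DERIV_deriv_iff_real_differentiable\<close>)
    show "ndiff n S (\<lambda>x. deriv f (g x) * deriv g x)"
      using Suc.prems Suc.IH[of "deriv f"] Suc.prems(2)[THEN ndiff_SucD] by (intro ndiff_mult assms) auto
  qed
qed auto

lemma ndiff_powr: "ndiff n {0<..} (\<lambda>x. x powr p)"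
proof (induction n arbitrary: p)
  case (Suc n)
  show ?case
    by (rule ndiff_SucI[where f'="\<lambda>x. p * x powr (p - 1)"])
      (auto intro!: has_real_derivative_powr ndiff_cmult Suc)
qed auto

text \<open>Smoothness is relative to an open set because powers \<open>t powr p\<close> are smooth
  only for t > 0. Functions on the whole line are glued from two pieces by \<open>smooth_Un\<close>,
  the second piece being a half line on which they vanish.\<close>

definition smooth :: "real set \<Rightarrow> (real \<Rightarrow> real) \<Rightarrow> bool" where
  "smooth S f \<longleftrightarrow> (\<forall>n. ndiff n S f)"

lemma smooth_const: "open S \<Longrightarrow> smooth S (\<lambda>x. c)"
  and smooth_ident: "open S \<Longrightarrow> smooth S (\<lambda>x. x)"
  and smooth_add: "open S \<Longrightarrow> smooth S f \<Longrightarrow> smooth S g \<Longrightarrow> smooth S (\<lambda>x. f x + g x)"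
  and smooth_diff: "open S \<Longrightarrow> smooth S f \<Longrightarrow> smooth S g \<Longrightarrow> smooth S (\<lambda>x. f x - g x)"
  and smooth_mult: "open S \<Longrightarrow> smooth S f \<Longrightarrow> smooth S g \<Longrightarrow> smooth S (\<lambda>x. f x * g x)"
  and smooth_powr: "smooth {0<..} (\<lambda>x. x powr p)"
  and smooth_Un: "smooth S f \<Longrightarrow> smooth T f \<Longrightarrow> smooth (S \<union> T) f"
  unfolding smooth_def
  by (simp_all add: ndiff_const ndiff_ident ndiff_add ndiff_diff ndiff_mult ndiff_powr ndiff_Un)

lemma smooth_compose:
  "open S \<Longrightarrow> open T \<Longrightarrow> g ` S \<subseteq> T \<Longrightarrow> smooth T f \<Longrightarrow> smooth S g \<Longrightarrow> smooth S (\<lambda>x. f (g x))"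
  unfolding smooth_def by (intro allI, rule ndiff_compose) auto

lemma smooth_cong: "open S \<Longrightarrow> (\<And>x. x \<in> S \<Longrightarrow> f x = g x) \<Longrightarrow> smooth S f \<Longrightarrow> smooth S g"
  unfolding smooth_def by (intro allI, rule ndiff_cong[of S f]) auto

lemma smooth_deriv: "smooth S f \<Longrightarrow> smooth S (deriv f)"
  unfolding smooth_def by (metis ndiff.simps(2))

lemma smooth_DERIV: "smooth S f \<Longrightarrow> x \<in> S \<Longrightarrow> (f has_real_derivative deriv f x) (at x)"
  unfolding smooth_def using ndiff_deriv by blast

lemma smooth_isCont: "smooth S f \<Longrightarrow> x \<in> S \<Longrightarrow> isCont f x"
  using smooth_DERIV DERIV_isCont by blast

lemma smooth_continuous_on: "smooth S f \<Longrightarrow> continuous_on S f"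
  using smooth_isCont continuous_at_imp_continuous_on by blast

lemma smoothI_DERIV:
  assumes "open S" "\<And>x. x \<in> S \<Longrightarrow> (f has_real_derivative f' x) (at x)" "smooth S f'"
  shows "smooth S f"
  unfolding smooth_def
proof
  fix n show "ndiff n S f"
    using ndiff_SucI[OF assms(1,2), of n] assms(3) ndiff_SucD by (auto simp: smooth_def simp del: ndiff.simps)
qed

lemma tendsto_inverse_power_exp: "((\<lambda>t::real. (1/t)^k * exp (-1/t)) \<longlongrightarrow> 0) (at_right 0)"
proof -
  have "((\<lambda>t::real. inverse t ^ k / exp (inverse t)) \<longlongrightarrow> 0) (at_right 0)"
    by (rule filterlim_compose[OF tendsto_power_div_exp_0 filterlim_inverse_at_top_right])
  then show ?thesis by (simp add: exp_minus field_simps)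
qed

lemma deriv_eq_0_if_locally_zero:
  fixes f :: "real \<Rightarrow> real"
  assumes S: "open S" "x \<in> S" and f: "\<And>y. y \<in> S \<Longrightarrow> f y = 0"
  shows "deriv f x = 0"
proof -
  have "\<forall>\<^sub>F y in nhds x. f y = 0" using eventually_nhds_in_open[OF S] by eventually_elim (rule f)
  then have "deriv f x = deriv (\<lambda>_. 0) x" by (intro deriv_cong_ev) auto
  then show ?thesis by simp
qed

section \<open>Smooth cutoffs\<close>

text \<open>The flat function exp(-1/t), extended by 0, with the factors (1/t)^k that its
  derivatives produce. With k as a parameter the family is closed under differentiation up to linear
  combinations, so smoothness is a single induction.\<close>

definition expinv :: "nat \<Rightarrow> real \<Rightarrow> real" where
  "expinv k t = (if t > 0 then (1/t)^k * exp (-1/t) else 0)"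

lemma expinv_DERIV: "(expinv k has_real_derivative (- real k * expinv (Suc k) t + expinv (k+2) t)) (at t)"
proof (cases "t = 0")
  case False
  show ?thesis
  proof (cases "t > 0")
    case True
    have "((\<lambda>t. (1/t)^k * exp (-1/t)) has_real_derivative (- real k * expinv (Suc k) t + expinv (k+2) t)) (at t)"
    proof -
      have "((\<lambda>t. (1/t)^k * exp (-1/t)) has_real_derivative
          real k * (1/t)^(k - 1) * (- 1/t^2) * exp (-1/t) + (1/t)^k * (exp (-1/t) * (1/t^2))) (at t)"
        using True by (auto intro!: derivative_eq_intros simp: power2_eq_square)
      moreover have "real k * (1/t)^(k - 1) * (- 1/t^2) = - real k * (1/t)^Suc k"
        using True by (cases k) (auto simp: power2_eq_square field_simps)
      ultimately have "((\<lambda>t. (1/t)^k * exp (-1/t)) has_real_derivative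
          - real k * (1/t)^Suc k * exp (-1/t) + (1/t)^k * (exp (-1/t) * (1/t^2))) (at t)"
        by (simp only:)
      moreover have "- real k * (1/t)^Suc k * exp (-1/t) + (1/t)^k * (exp (-1/t) * (1/t^2)) =
          - real k * expinv (Suc k) t + expinv (k+2) t"
        using True by (simp add: expinv_def power2_eq_square)
      ultimately show ?thesis by (simp only:)
    qed
    then show ?thesis
      by (rule has_field_derivative_transform_within_open[of _ _ _ "{0<..}"]) (use True in \<open>auto simp: expinv_def\<close>)
  next
    case f: False
    have "((\<lambda>t::real. 0) has_real_derivative (- real k * expinv (Suc k) t + expinv (k+2) t)) (at t)"
      using f False by (auto simp: expinv_def)
    then show ?thesis
      by (rule has_field_derivative_transform_within_open[of _ _ _ "{..<0}"]) (use False f in \<open>auto simp: expinv_def\<close>)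
  qed
next
  case True
  \<comment> \<open>At the origin the right difference quotient is (1/y)^(k+1) exp(-1/y) and the
    left one is 0.\<close>
  have 1: "((\<lambda>y. (expinv k y - expinv k 0) / (y - 0)) \<longlongrightarrow> 0) (at_right 0)"
    by (rule Lim_transform_eventually[OF tendsto_inverse_power_exp[of "Suc k"]])
      (auto simp: eventually_at_filter expinv_def)
  have 2: "((\<lambda>y. (expinv k y - expinv k 0) / (y - 0)) \<longlongrightarrow> 0) (at_left 0)"
    by (rule Lim_transform_eventually[OF tendsto_const]) (auto simp: eventually_at_filter expinv_def)
  have "(expinv k has_real_derivative 0) (at 0)"
    unfolding has_field_derivative_iff using 1 2 by (simp add: filterlim_at_split)
  then show ?thesis using True by (simp add: expinv_def)
qed

lemma smooth_expinv: "smooth UNIV (expinv k)"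
proof -
  have "ndiff n UNIV (expinv k)" for n
  proof (induction n arbitrary: k)
    case (Suc n)
    show ?case
      by (rule ndiff_SucI[OF _ expinv_DERIV], simp) (intro ndiff_add ndiff_cmult Suc open_UNIV)
  qed auto
  then show ?thesis by (simp add: smooth_def)
qed

text \<open>As \<open>n\<close> grows these smooth functions increase to the indicator of the interval from \<open>a\<close> to \<open>b\<close>.\<close>

definition bump :: "real \<Rightarrow> real \<Rightarrow> nat \<Rightarrow> real \<Rightarrow> real" where
  "bump a b n t = expinv 0 (real (Suc n) * (t - a)) * expinv 0 (real (Suc n) * (b - t))"

lemma smooth_bump: "smooth UNIV (bump a b n)"
  unfolding bump_def[abs_def]
  by (intro smooth_mult smooth_compose[OF _ _ _ smooth_expinv] smooth_diff smooth_ident smooth_const) auto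

lemma bump_eq_0: "t \<notin> {a<..<b} \<Longrightarrow> bump a b n t = 0"
  by (auto simp: bump_def expinv_def zero_less_mult_iff)

lemma bump_pos: "t \<in> {a<..<b} \<Longrightarrow> bump a b n t > 0"
  by (auto simp: bump_def expinv_def zero_less_mult_iff)

lemma bump_nonneg: "bump a b n t \<ge> 0"
  using bump_pos[of t a b n] bump_eq_0[of t a b n] by (cases "t \<in> {a<..<b}") auto

lemma bump_le_indicator: "bump a b n t \<le> indicator {a<..<b} t"
proof (cases "t \<in> {a<..<b}")
  case True
  then show ?thesis
    by (auto simp: bump_def expinv_def zero_less_mult_iff intro!: mult_le_one)
qed (simp add: bump_eq_0)

lemma bump_tendsto_indicator: "(\<lambda>n. bump a b n t) \<longlonglongrightarrow> indicator {a<..<b} t"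
proof (cases "t \<in> {a<..<b}")
  case True
  have *: "(\<lambda>n. exp (- (1 / (real (Suc n) * s)))) \<longlonglongrightarrow> exp (- 0)" for s :: real
  proof (intro tendsto_exp tendsto_minus)
    have "(\<lambda>n. (1 / s) * inverse (real (Suc n))) \<longlonglongrightarrow> (1/s) * 0"
      by (intro tendsto_mult tendsto_const LIMSEQ_inverse_real_of_nat)
    then show "(\<lambda>n. 1 / (real (Suc n) * s)) \<longlonglongrightarrow> 0" by (simp add: field_simps)
  qed
  have "(\<lambda>n. exp (- (1 / (real (Suc n) * (t - a)))) * exp (- (1 / (real (Suc n) * (b - t))))) \<longlonglongrightarrow> exp (-0) * exp (-0)"
    by (intro tendsto_mult *)
  then show ?thesis
    using True by (simp add: bump_def expinv_def zero_less_mult_iff)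
qed (simp add: bump_eq_0)

lemma antiderivative_exists:
  assumes "continuous_on UNIV (f::real \<Rightarrow> real)"
  obtains F where "\<And>x. (F has_real_derivative f x) (at x)"
proof -
  have "((\<lambda>u. LBINT y=0..u. f y) has_real_derivative f x) (at x)" for x
  proof -
    \<comment> \<open>This interval contains the base point 0 and has x in its interior.\<close>
    let ?a = "min 0 (x - 1)" and ?b = "max 0 (x+1)"
    have "((\<lambda>u. LBINT y=ereal 0..u. f y) has_vector_derivative f x) (at x within {?a..?b})"
      by (rule interval_integral_FTC2) (use assms continuous_on_subset in auto)
    then show ?thesis
      by (subst (asm) at_within_interior) (auto simp: has_real_derivative_iff_has_vector_derivative zero_ereal_def)
  qed
  then show ?thesis using that by blast
qed

subsection \<open>Smooth functions and test functions of several variables\<close>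

primrec ndiffN :: "nat \<Rightarrow> (real^'n::finite \<Rightarrow> real) \<Rightarrow> bool" where
  "ndiffN 0 f \<longleftrightarrow> True"
| "ndiffN (Suc n) f \<longleftrightarrow> (\<forall>x. f differentiable at x) \<and> (\<forall>i. ndiffN n (pdiff i f))"

text \<open>\<open>C_inf\<close> quantifies over lists of directions. Since \<open>fold\<close>
  applies the head first, splitting off the head turns it into a recursion on the order, the form in
  which product and chain rules become inductions.\<close>

lemma C_inf_iff_ndiffN: "C_inf f \<longleftrightarrow> (\<forall>n. ndiffN n f)"
proof -
  have *: "ndiffN n f \<longleftrightarrow> (\<forall>is::'n list. length is < n \<longrightarrow> (\<forall>x. (fold pdiff is f) differentiable (at x)))"
    for n and f :: "real^'n \<Rightarrow> real"
  proof (induction n arbitrary: f)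
    case (Suc n)
    have "(\<forall>is::'n list. length is < Suc n \<longrightarrow> (\<forall>x. (fold pdiff is f) differentiable (at x))) \<longleftrightarrow>
      (\<forall>x. f differentiable at x) \<and> (\<forall>i. \<forall>is::'n list. length is < n \<longrightarrow> (\<forall>x. (fold pdiff is (pdiff i f)) differentiable (at x)))" (is "?L \<longleftrightarrow> ?R")
    proof
      assume L: ?L
      show ?R
      proof (intro conjI allI impI)
        show "f differentiable at x" for x using L[rule_format, of "[]"] by auto
        show "(fold pdiff is (pdiff i f)) differentiable (at x)" if "length is < n" for i "is" x
          using L[rule_format, of "i # is"] that by auto
      qed
    next
      assume R: ?R
      show ?L
      proof (intro allI impI)
        show "fold pdiff is f differentiable at x" if "length is < Suc n" for "is" :: "'n list" and x
          using R that by (cases "is") auto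
      qed
    qed
    then show ?case by (simp add: Suc.IH)
  qed auto
  show ?thesis unfolding * C_inf_def by (meson lessI)
qed

lemma pdiff_eqI: "(f has_derivative f') (at x) \<Longrightarrow> pdiff i f x = f' (axis i 1)"
  unfolding pdiff_def by (metis frechet_derivative_at)

lemma ndiffN_SucD: "ndiffN (Suc n) f \<Longrightarrow> ndiffN n f"
  by (induction n arbitrary: f) auto

lemma ndiffN_SucI:
  assumes "\<And>x. (f has_derivative f' x) (at x)" "\<And>i. ndiffN n (\<lambda>x. f' x (axis i 1))"
  shows "ndiffN (Suc n) f"
proof -
  have "pdiff i f = (\<lambda>x. f' x (axis i 1))" for i using pdiff_eqI[OF assms(1)] by auto
  then show ?thesis using assms by (auto simp: differentiable_def)
qed

lemma differentiable_has_frechet: "f differentiable at x \<Longrightarrow> (f has_derivative frechet_derivative f (at x)) (at x)"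
  by (simp add: frechet_derivative_works)

lemma ndiffN_const: "ndiffN n (\<lambda>x. c)"
  by (induction n arbitrary: c) (auto simp del: ndiffN.simps(2) intro!: ndiffN_SucI[where f'="\<lambda>x y. 0"])

lemma ndiffN_component: "ndiffN n (\<lambda>x. x $ i)"
  by (cases n) (auto simp del: ndiffN.simps(2) intro!: ndiffN_SucI[where f'="\<lambda>x y. y $ i"] ndiffN_const
      bounded_linear_imp_has_derivative)

lemma ndiffN_add: "ndiffN n f \<Longrightarrow> ndiffN n g \<Longrightarrow> ndiffN n (\<lambda>x. f x + g x)"
proof (induction n arbitrary: f g)
  case (Suc n)
  show ?case
    by (rule ndiffN_SucI[where f'="\<lambda>x y. frechet_derivative f (at x) y + frechet_derivative g (at x) y"])
      (use Suc in \<open>auto intro!: has_derivative_add differentiable_has_frechet simp: pdiff_def[abs_def]\<close>)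
qed auto

lemma ndiffN_mult: "ndiffN n f \<Longrightarrow> ndiffN n g \<Longrightarrow> ndiffN n (\<lambda>x. f x * g x)"
proof (induction n arbitrary: f g)
  case (Suc n)
  show ?case
  proof (rule ndiffN_SucI[where f'="\<lambda>x y. f x * frechet_derivative g (at x) y + frechet_derivative f (at x) y * g x"])
    show "((\<lambda>x. f x * g x) has_derivative (\<lambda>y. f x * frechet_derivative g (at x) y + frechet_derivative f (at x) y * g x)) (at x)" for x
      by (rule has_derivative_mult) (use Suc in \<open>auto intro!: differentiable_has_frechet\<close>)
    show "ndiffN n (\<lambda>x. f x * frechet_derivative g (at x) (axis i 1) + frechet_derivative f (at x) (axis i 1) * g x)" for i
      using Suc.prems Suc.prems[THEN ndiffN_SucD] unfolding pdiff_def[symmetric] by (intro ndiffN_add Suc.IH) auto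
  qed
qed auto

lemma ndiffN_compose: "ndiff n UNIV h \<Longrightarrow> ndiffN n g \<Longrightarrow> ndiffN n (\<lambda>x. h (g x))"
proof (induction n arbitrary: h)
  case (Suc n)
  show ?case
  proof (rule ndiffN_SucI[where f'="\<lambda>x y. deriv h (g x) * frechet_derivative g (at x) y"])
    show "((\<lambda>x. h (g x)) has_derivative (\<lambda>y. deriv h (g x) * frechet_derivative g (at x) y)) (at x)" for x
    proof -
      have "(h has_derivative (\<lambda>y. deriv h (g x) * y)) (at (g x))"
        using ndiff_deriv[OF Suc.prems(1), of "g x"] by (simp add: has_field_derivative_def)
      from has_derivative_compose[OF differentiable_has_frechet[of g x] this] Suc.prems(2) show ?thesis by auto
    qed
    show "ndiffN n (\<lambda>x. deriv h (g x) * frechet_derivative g (at x) (axis i 1))" for i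
      using Suc.prems Suc.IH[of "deriv h"] Suc.prems(2)[THEN ndiffN_SucD] unfolding pdiff_def[symmetric]
      by (intro ndiffN_mult) auto
  qed
qed auto

lemma C_inf_const: "C_inf (\<lambda>x. c)"
  and C_inf_component: "C_inf (\<lambda>x. x $ i)"
  and C_inf_add: "C_inf f \<Longrightarrow> C_inf g \<Longrightarrow> C_inf (\<lambda>x. f x + g x)"
  and C_inf_mult: "C_inf f \<Longrightarrow> C_inf g \<Longrightarrow> C_inf (\<lambda>x. f x * g x)"
  and C_inf_compose: "smooth UNIV h \<Longrightarrow> C_inf g \<Longrightarrow> C_inf (\<lambda>x. h (g x))"
  using ndiffN_const ndiffN_component ndiffN_add ndiffN_mult ndiffN_compose
  unfolding C_inf_iff_ndiffN smooth_def by blast+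

lemma C_inf_sum: "finite I \<Longrightarrow> (\<And>i. i \<in> I \<Longrightarrow> C_inf (f i)) \<Longrightarrow> C_inf (\<lambda>x. \<Sum>i\<in>I. f i x)"
  by (induction I rule: finite_induct) (auto intro: C_inf_const C_inf_add)

lemma C_inf_prod: "finite I \<Longrightarrow> (\<And>i. i \<in> I \<Longrightarrow> C_inf (f i)) \<Longrightarrow> C_inf (\<lambda>x. \<Prod>i\<in>I. f i x)"
  by (induction I rule: finite_induct) (auto intro: C_inf_const C_inf_mult)

lemma norm_sq_eq_sum: "(norm (x::real^'n::finite))\<^sup>2 = (\<Sum>i\<in>UNIV. x $ i * x $ i)"
  by (simp add: power2_norm_eq_inner inner_vec_def)

lemma C_inf_norm_sq: "C_inf (\<lambda>x::real^'n::finite. (norm x)\<^sup>2)"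
  unfolding norm_sq_eq_sum by (intro C_inf_sum C_inf_mult C_inf_component) auto

lemma C_inf_scaleR: "C_inf f \<Longrightarrow> C_inf (\<lambda>x. f (c *\<^sub>R x))"
proof -
  have "ndiffN n (\<lambda>x. f (c *\<^sub>R x))" if "ndiffN n f" for n and f :: "real^'a \<Rightarrow> real"
    using that
  proof (induction n arbitrary: f)
    case (Suc n)
    show ?case
    proof (rule ndiffN_SucI[where f'="\<lambda>x y. frechet_derivative f (at (c *\<^sub>R x)) (c *\<^sub>R y)"])
      show D: "((\<lambda>x. f (c *\<^sub>R x)) has_derivative (\<lambda>y. frechet_derivative f (at (c *\<^sub>R x)) (c *\<^sub>R y))) (at x)" for x
        by (rule has_derivative_compose[of "\<lambda>x. c *\<^sub>R x"])
          (use Suc.prems in \<open>auto intro!: derivative_eq_intros differentiable_has_frechet\<close>)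
      have lin: "frechet_derivative f (at (c *\<^sub>R x)) (c *\<^sub>R axis i 1) = c * pdiff i f (c *\<^sub>R x)" for x i
        using Suc.prems linear_frechet_derivative[of f "at (c *\<^sub>R x)"] 
        by (auto simp: pdiff_def linear_cmul)
      show "ndiffN n (\<lambda>x. frechet_derivative f (at (c *\<^sub>R x)) (c *\<^sub>R axis i 1))" for i
        unfolding lin using Suc.prems by (intro ndiffN_mult ndiffN_const Suc.IH) auto
    qed
  qed auto
  then show "C_inf f \<Longrightarrow> ?thesis" by (simp add: C_inf_iff_ndiffN)
qed

lemma C_inf_pdiff: "C_inf f \<Longrightarrow> C_inf (pdiff i f)"
  unfolding C_inf_iff_ndiffN by (metis ndiffN.simps(2))

lemma C_inf_has_derivative: "C_inf f \<Longrightarrow> (f has_derivative frechet_derivative f (at x)) (at x)"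
  unfolding C_inf_iff_ndiffN by (metis ndiffN.simps(2) frechet_derivative_works)

lemma C_inf_continuous_on: "C_inf f \<Longrightarrow> continuous_on S f"
  by (intro continuous_at_imp_continuous_on ballI has_derivative_continuous[OF C_inf_has_derivative])

lemma C_inf_pdiff_line: 
  assumes "C_inf f"
  shows "((\<lambda>t. f (x + t *\<^sub>R axis i 1)) has_real_derivative pdiff i f (x + t *\<^sub>R axis i 1)) (at t)"
proof -
  have "((\<lambda>t. f (x + t *\<^sub>R axis i 1)) has_derivative (\<lambda>s. frechet_derivative f (at (x + t *\<^sub>R axis i 1)) (s *\<^sub>R axis i 1))) (at t)"
    by (rule has_derivative_compose[OF _ C_inf_has_derivative[OF assms]]) (auto intro!: derivative_eq_intros)
  moreover have "linear (frechet_derivative f (at (x + t *\<^sub>R axis i 1)))"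
    using C_inf_has_derivative[OF assms] has_derivative_linear by blast
  moreover from this have "(\<lambda>s. frechet_derivative f (at (x + t *\<^sub>R axis i 1)) (s *\<^sub>R axis i 1)) =
      (*) (frechet_derivative f (at (x + t *\<^sub>R axis i 1)) (axis i 1))"
    by (auto simp: linear_cmul)
  ultimately show ?thesis
    by (simp add: has_field_derivative_def pdiff_def)
qed

lemma pdiff_mult: "C_inf f \<Longrightarrow> C_inf g \<Longrightarrow> pdiff i (\<lambda>x. f x * g x) x = pdiff i f x * g x + f x * pdiff i g x"
  by (subst pdiff_eqI[OF has_derivative_mult[OF C_inf_has_derivative C_inf_has_derivative]]) (auto simp: pdiff_def)

lemma pdiff_component: "pdiff i (\<lambda>x. x $ j) x = (if i = j then 1 else 0)"
  by (subst pdiff_eqI[where f'="\<lambda>y. y $ j"])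
    (auto intro!: bounded_linear_imp_has_derivative simp: axis_def)

lemma pdiff_compose:
  assumes "smooth UNIV h" "C_inf g"
  shows "pdiff i (\<lambda>x. h (g x)) x = deriv h (g x) * pdiff i g x"
proof -
  have "(h has_derivative (\<lambda>y. deriv h (g x) * y)) (at (g x))"
    using smooth_DERIV[OF assms(1), of "g x"] by (simp add: has_field_derivative_def)
  from has_derivative_compose[OF C_inf_has_derivative[OF assms(2)] this, THEN pdiff_eqI]
  show ?thesis by (simp add: pdiff_def)
qed

lemma pdiff_norm_sq: "pdiff i (\<lambda>x::real^'n::finite. (norm x)\<^sup>2) x = 2 * x $ i"
proof -
  have "((\<lambda>x::real^'n. (norm x)\<^sup>2) has_derivative (\<lambda>y. 2 * (x \<bullet> y))) (at x)"
    unfolding power2_norm_eq_inner by (auto intro!: derivative_eq_intros simp: inner_commute)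
  from pdiff_eqI[OF this] show ?thesis by (simp add: inner_axis)
qed

lemma pdiff_scaleR:
  assumes "C_inf f" shows "pdiff i (\<lambda>x. f (c *\<^sub>R x)) x = c * pdiff i f (c *\<^sub>R x)"
proof -
  have "((\<lambda>x. f (c *\<^sub>R x)) has_derivative (\<lambda>y. frechet_derivative f (at (c *\<^sub>R x)) (c *\<^sub>R y))) (at x)"
    by (rule has_derivative_compose[of "\<lambda>x. c *\<^sub>R x"])
      (use C_inf_has_derivative[OF assms] in \<open>auto intro!: derivative_eq_intros\<close>)
  moreover have "linear (frechet_derivative f (at (c *\<^sub>R x)))"
    using C_inf_has_derivative[OF assms] has_derivative_linear by blast
  ultimately show ?thesis
    by (subst pdiff_eqI) (auto simp: pdiff_def linear_cmul)
qed

lemma test_funI: "C_inf f \<Longrightarrow> (\<And>x. norm x > R \<Longrightarrow> f x = 0) \<Longrightarrow> test_fun f"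
proof -
  assume *: "C_inf f" "\<And>x. norm x > R \<Longrightarrow> f x = 0"
  have "{x. f x \<noteq> 0} \<subseteq> cball 0 R" using *(2) by (force simp: not_less)
  then have "bounded {x. f x \<noteq> 0}" using bounded_subset bounded_cball by blast
  then show ?thesis using * by (auto simp: test_fun_def compact_closure)
qed

lemma test_fun_C_inf: "test_fun f \<Longrightarrow> C_inf f" by (simp add: test_fun_def)

lemma test_funE:
  assumes "test_fun f"
  obtains R where "R > 0" "\<And>x. norm x > R \<Longrightarrow> f x = 0"
proof -
  have "bounded {x. f x \<noteq> 0}"
    using assms by (auto simp: test_fun_def compact_closure)
  then obtain R where "R > 0" "\<forall>x\<in>{x. f x \<noteq> 0}. norm x \<le> R" using bounded_pos by blast
  then show ?thesis using that[of R] by force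
qed

lemma test_fun_mult: "test_fun f \<Longrightarrow> C_inf g \<Longrightarrow> test_fun (\<lambda>x. f x * g x)"
  by (rule test_funE[of f], assumption, rule test_funI) (auto intro: C_inf_mult test_fun_C_inf)

lemma test_fun_pdiff: assumes "test_fun f" shows "test_fun (pdiff i f)"
proof -
  obtain R where R: "R > 0" "\<And>x. norm x > R \<Longrightarrow> f x = 0" using test_funE[OF assms] by blast
  have "pdiff i f x = 0" if "norm x > R" for x
  proof -
    have "((\<lambda>x. 0) has_derivative (\<lambda>y. 0)) (at x)" by simp
    then have "(f has_derivative (\<lambda>y. 0)) (at x)"
      by (rule has_derivative_transform_within_open[of _ _ _ _ "- cball 0 R"]) (use that R in auto)
    from pdiff_eqI[OF this] show ?thesis .
  qed
  with C_inf_pdiff[OF test_fun_C_inf[OF assms]] show ?thesis by (rule test_funI)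
qed

lemma test_fun_scaleR: assumes "test_fun f" "c > 0" shows "test_fun (\<lambda>x. f (c *\<^sub>R x))"
proof -
  obtain R where R: "R > 0" "\<And>x. norm x > R \<Longrightarrow> f x = 0" using test_funE[OF assms(1)] by blast
  show ?thesis
    by (rule test_funI[of _ "R / c"]) (use assms C_inf_scaleR[OF test_fun_C_inf[OF assms(1)]] in \<open>auto intro!: R(2) simp: field_simps\<close>)
qed

lemma test_fun_bound:
  assumes "test_fun f"
  obtains B R where "R > 0" "B > 0" "\<And>x. \<bar>f x\<bar> \<le> B * indicator (cball 0 R) x"
proof -
  obtain R where R: "R > 0" "\<And>x. norm x > R \<Longrightarrow> f x = 0" using test_funE[OF assms(1)] by blast
  have "compact (f ` cball 0 R)"
    by (intro compact_continuous_image C_inf_continuous_on test_fun_C_inf assms) auto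
  from compact_imp_bounded[OF this] obtain B where B: "B > 0" "\<forall>x\<in>f ` cball 0 R. norm x \<le> B"
    unfolding bounded_pos by (elim exE conjE)
  show ?thesis
    by (rule that[OF R(1) B(1)]) (use B R in \<open>force simp: indicator_def\<close>)
qed

lemma C_inf_borel [measurable (raw)]: "C_inf f \<Longrightarrow> f \<in> borel_measurable borel"
  by (simp add: C_inf_continuous_on borel_measurable_continuous_onI)

lemma test_fun_borel: "test_fun f \<Longrightarrow> f \<in> borel_measurable borel"
  by (simp add: test_fun_def C_inf_borel)

text \<open>These products stand in for indicators of boxes, so that test functions determine all
  box integrals.\<close>

lemma test_fun_prod_bump: "test_fun (\<lambda>x::real^'n::finite. \<Prod>i\<in>UNIV. bump (a$i) (b$i) n (x$i))"
proof (rule test_funI[of _ "norm a + norm b + norm (b - a) + 1"])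
  show "C_inf (\<lambda>x::real^'n::finite. \<Prod>i\<in>UNIV. bump (a$i) (b$i) n (x$i))"
    by (intro C_inf_prod C_inf_compose[OF smooth_bump C_inf_component]) auto
next
  fix x :: "real^'n" assume x: "norm x > norm a + norm b + norm (b-a) + 1"
  have "\<not> (\<forall>i. x$i \<in> {a$i<..<b$i})"
  proof
    assume "\<forall>i. x$i \<in> {a$i<..<b$i}"
    then have "norm (x - a) \<le> norm (b - a)"
    proof (intro norm_le_componentwise_cart)
      fix i assume *: "\<forall>i. x$i \<in> {a$i<..<b$i}"
      show "norm ((x - a) $ i) \<le> norm ((b - a) $ i)" using *[rule_format, of i] by simp
    qed
    then show False using x norm_triangle_ineq[of "x - a" a] norm_ge_zero[of b] by simp
  qed
  then obtain i where "x$i \<notin> {a$i<..<b$i}" by blast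
  then have "\<exists>i\<in>UNIV. bump (a$i) (b$i) n (x$i) = 0" using bump_eq_0 by blast
  then show "(\<Prod>i\<in>UNIV. bump (a$i) (b$i) n (x$i)) = 0" by (intro prod_zero) auto
qed

lemma test_fun_radial:
  assumes "smooth UNIV h" "\<And>t. t > R \<Longrightarrow> h t = 0"
  shows "test_fun (\<lambda>x::real^'n::finite. h ((norm x)\<^sup>2))"
\<comment> \<open>Outside the unit ball |x| <= |x|^2, so |x| > \<open>max 1 R\<close> suffices
  although h is evaluated at |x|^2.\<close>
proof (rule test_funI[of _ "max 1 R"])
  show "C_inf (\<lambda>x::real^'n. h ((norm x)\<^sup>2))" by (rule C_inf_compose[OF assms(1) C_inf_norm_sq])
  fix x :: "real^'n" assume "max 1 R < norm x"
  moreover from this have "norm x \<le> (norm x)\<^sup>2" by (intro self_le_power) auto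
  ultimately show "h ((norm x)\<^sup>2) = 0" by (intro assms) auto
qed

lemma pdiff_radial: "smooth UNIV h \<Longrightarrow> pdiff i (\<lambda>x::real^'n::finite. h ((norm x)\<^sup>2)) x = 2 * x $ i * deriv h ((norm x)\<^sup>2)"
  by (subst pdiff_compose[where g="\<lambda>x. (norm x)\<^sup>2"]) (auto simp: C_inf_norm_sq pdiff_norm_sq)

subsection \<open>Vanishing criteria and the du Bois-Reymond lemma\<close>

text \<open>Boxes generate the Borel sets and are stable under intersection, so induction over
  complements and disjoint unions carries the vanishing of the integral to all Borel sets, and a
  density with this property is zero.\<close>

lemma AE_zero_if_box_integrals_zero:
  fixes f :: "'a::euclidean_space \<Rightarrow> real"
  assumes f: "integrable lborel f"
    and z: "\<And>a b. (\<integral>x. indicator (box a b) x * f x \<partial>lborel) = 0"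
  shows "AE x in lborel. f x = 0"
proof (rule sigma_finite_measure.density_zero[OF sigma_finite_lborel f])
  let ?G = "range (\<lambda>(a,b). box a b :: 'a set)"
  \<comment> \<open>The complement step of the induction needs the integral over the whole space, a
    limit over growing centred cubes.\<close>
  have UNIV0: "(\<integral>x. f x \<partial>lborel) = 0"
  proof -
    have "(\<lambda>n. \<integral>x. indicator (box (- (real n *\<^sub>R One)) (real n *\<^sub>R One)) x * f x \<partial>lborel) \<longlonglongrightarrow> (\<integral>x. f x \<partial>lborel)"
    proof (rule integral_dominated_convergence[where w="\<lambda>x. norm (f x)"])
      show "AE x in lborel. (\<lambda>n. indicator (box (- (real n *\<^sub>R One)) (real n *\<^sub>R One)) x * f x) \<longlonglongrightarrow> f x"
      proof (rule AE_I2)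
        fix x :: 'a
        obtain n0 where n0: "norm x < real n0" using reals_Archimedean2 by blast
        have "indicator (box (- (real n *\<^sub>R One)) (real n *\<^sub>R One)) x * f x = f x" if "n \<ge> n0" for n
        proof -
          have "\<bar>x \<bullet> b\<bar> < real n" if "b \<in> Basis" for b
            using Basis_le_norm[OF that, of x] n0 \<open>n \<ge> n0\<close> by linarith
          then have "x \<in> box (- (real n *\<^sub>R One)) (real n *\<^sub>R One)"
            by (auto simp: mem_box abs_less_iff inner_minus_left) (smt (verit, best))
          then show ?thesis by simp
        qed
        then have "eventually (\<lambda>n. indicator (box (- (real n *\<^sub>R One)) (real n *\<^sub>R One)) x * f x = f x) sequentially"
          by (auto simp: eventually_sequentially)
        then show "(\<lambda>n. indicator (box (- (real n *\<^sub>R One)) (real n *\<^sub>R One)) x * f x) \<longlonglongrightarrow> f x"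
          by (rule tendsto_eventually)
      qed
    qed (use f in \<open>auto simp: indicator_def\<close>)
    then show ?thesis unfolding z by (simp add: LIMSEQ_const_iff)
  qed
  fix A :: "'a set" assume "A \<in> sets lborel"
  then have A: "A \<in> sigma_sets UNIV ?G" by (simp add: borel_eq_box)
  have I: "Int_stable ?G" by (auto simp: Int_stable_def box_Int_box)
  have meas: "A \<in> sets borel" if "A \<in> sigma_sets UNIV ?G" for A
    using that by (simp add: borel_eq_box)
  have int: "integrable lborel (\<lambda>x. indicator A x *\<^sub>R f x)" if "A \<in> sets borel" for A
    using that f by (intro integrable_mult_indicator) auto
  show "set_lebesgue_integral lborel A f = 0"
    using A
  proof (induction rule: sigma_sets_induct_disjoint[OF I _ A, consumes 0, case_names sub basic empty compl union])
    case (basic A)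
    then show ?case using z by (auto simp: set_lebesgue_integral_def)
  next
    case (compl A)
    have "set_lebesgue_integral lborel (UNIV - A) f = (\<integral>x. f x - indicator A x *\<^sub>R f x \<partial>lborel)"
      unfolding set_lebesgue_integral_def by (intro Bochner_Integration.integral_cong) (auto simp: indicator_def)
    also have "\<dots> = 0"
      using compl UNIV0 f int[OF meas[OF compl(1)]] by (simp add: set_lebesgue_integral_def)
    finally show ?case .
  next
    case (union A)
    have A: "A i \<in> sets borel" for i using union meas by auto
    then have "set_integrable lborel (\<Union>i. A i) f" unfolding set_integrable_def by (intro int) auto
    from lebesgue_integral_countable_add[OF _ _ this]
    have "set_lebesgue_integral lborel (\<Union>i. A i) f = (\<Sum>i. set_lebesgue_integral lborel (A i) f)"
      using union(1) A by (simp add: disjoint_family_on_def)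
    moreover have "set_lebesgue_integral lborel (A i) f = 0" for i
      using union by auto
    ultimately show ?case by simp
  qed (auto simp: set_lebesgue_integral_def)
qed

lemma Cauchy_Schwarz_integral:
  fixes f g :: "'a \<Rightarrow> real"
  assumes [measurable]: "f \<in> borel_measurable M" "g \<in> borel_measurable M"
    and f: "integrable M (\<lambda>x. (f x)\<^sup>2)" and g: "integrable M (\<lambda>x. (g x)\<^sup>2)"
  shows "integrable M (\<lambda>x. f x * g x)"
    and "(\<integral>x. \<bar>f x * g x\<bar> \<partial>M)\<^sup>2 \<le> (\<integral>x. (f x)\<^sup>2 \<partial>M) * (\<integral>x. (g x)\<^sup>2 \<partial>M)"
    and "(\<integral>x. f x * g x \<partial>M)\<^sup>2 \<le> (\<integral>x. (f x)\<^sup>2 \<partial>M) * (\<integral>x. (g x)\<^sup>2 \<partial>M)"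
proof -
  show i: "integrable M (\<lambda>x. f x * g x)"
  proof (rule Bochner_Integration.integrable_bound)
    show "integrable M (\<lambda>x. (f x)\<^sup>2 + (g x)\<^sup>2)" using f g by simp
    show "AE x in M. norm (f x * g x) \<le> norm ((f x)\<^sup>2 + (g x)\<^sup>2)"
    proof (rule AE_I2)
      fix x have "2 * (\<bar>f x\<bar> * \<bar>g x\<bar>) \<le> (f x)\<^sup>2 + (g x)\<^sup>2"
        using sum_squares_bound[of "\<bar>f x\<bar>" "\<bar>g x\<bar>"] by (simp add: mult.assoc)
      moreover have "0 \<le> \<bar>f x\<bar> * \<bar>g x\<bar>" by simp
      ultimately show "norm (f x * g x) \<le> norm ((f x)\<^sup>2 + (g x)\<^sup>2)"
        unfolding real_norm_def abs_mult by linarith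
    qed
  qed auto
  have "ennreal ((\<integral>x. \<bar>f x * g x\<bar> \<partial>M)\<^sup>2) = (\<integral>\<^sup>+x. ennreal \<bar>f x * g x\<bar> \<partial>M)\<^sup>2"
    using i by (subst nn_integral_eq_integral) (auto simp: ennreal_power)
  also have "\<dots> = (\<integral>\<^sup>+x. ennreal \<bar>f x\<bar> * ennreal \<bar>g x\<bar> \<partial>M)\<^sup>2"
    by (simp add: abs_mult ennreal_mult)
  also have "\<dots> \<le> (\<integral>\<^sup>+x. (ennreal \<bar>f x\<bar>)\<^sup>2 \<partial>M) * (\<integral>\<^sup>+x. (ennreal \<bar>g x\<bar>)\<^sup>2 \<partial>M)"
    by (rule Cauchy_Schwarz_nn_integral) auto
  also have "\<dots> = ennreal (\<integral>x. (f x)\<^sup>2 \<partial>M) * ennreal (\<integral>x. (g x)\<^sup>2 \<partial>M)"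
    using f g by (simp add: ennreal_power nn_integral_eq_integral)
  also have "\<dots> = ennreal ((\<integral>x. (f x)\<^sup>2 \<partial>M) * (\<integral>x. (g x)\<^sup>2 \<partial>M))"
    by (simp add: ennreal_mult)
  finally show *: "(\<integral>x. \<bar>f x * g x\<bar> \<partial>M)\<^sup>2 \<le> (\<integral>x. (f x)\<^sup>2 \<partial>M) * (\<integral>x. (g x)\<^sup>2 \<partial>M)"
    by (subst (asm) ennreal_le_iff) auto
  have "\<bar>\<integral>x. f x * g x \<partial>M\<bar> \<le> (\<integral>x. \<bar>f x * g x\<bar> \<partial>M)" by (rule integral_abs_bound)
  then have "(\<integral>x. f x * g x \<partial>M)\<^sup>2 \<le> (\<integral>x. \<bar>f x * g x\<bar> \<partial>M)\<^sup>2"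
    by (metis abs_ge_zero power2_abs power_mono)
  with * show "(\<integral>x. f x * g x \<partial>M)\<^sup>2 \<le> (\<integral>x. (f x)\<^sup>2 \<partial>M) * (\<integral>x. (g x)\<^sup>2 \<partial>M)" by linarith
qed

lemma prod_bump_bounds: 
  fixes x :: "real^'n::finite"
  shows "0 \<le> (\<Prod>i\<in>UNIV. bump (a$i) (b$i) n (x$i))"
    and "(\<Prod>i\<in>UNIV. bump (a$i) (b$i) n (x$i)) \<le> indicator (box a b) x"
    and "(\<lambda>n. \<Prod>i\<in>UNIV. bump (a$i) (b$i) n (x$i)) \<longlonglongrightarrow> indicator (box a b) x"
proof -
  have ind: "indicator (box a b) x = (\<Prod>i\<in>UNIV. indicator {a$i<..<b$i} (x$i) :: real)"
  proof (cases "x \<in> box a b")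
    case False
    then obtain i where "x$i \<notin> {a$i<..<b$i}" by (auto simp: mem_box_cart)
    then have "(\<Prod>i\<in>UNIV. indicator {a$i<..<b$i} (x$i) :: real) = 0"
      by (intro prod_zero bexI[of _ i]) (auto simp: indicator_def)
    then show ?thesis using False by simp
  qed (auto simp: mem_box_cart)
  show "0 \<le> (\<Prod>i\<in>UNIV. bump (a$i) (b$i) n (x$i))" by (intro prod_nonneg) (auto simp: bump_nonneg)
  show "(\<Prod>i\<in>UNIV. bump (a$i) (b$i) n (x$i)) \<le> indicator (box a b) x"
    unfolding ind by (intro prod_mono) (auto simp: bump_nonneg bump_le_indicator)
  show "(\<lambda>n. \<Prod>i\<in>UNIV. bump (a$i) (b$i) n (x$i)) \<longlonglongrightarrow> indicator (box a b) x"
    unfolding ind by (intro tendsto_prod bump_tendsto_indicator)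
qed

text \<open>Bumps tend to indicators of open boxes, so dominated convergence leads back to box
  integrals. Only products of one-variable bumps are tested, the form that
  \<open>dirichlet_pos\<close> can supply. The Lebesgue measurable \<open>d\<close> is exchanged for
  a Borel representative, and cubes localise because \<open>d\<close> is only locally
  integrable.\<close>

lemma AE_zero_if_prod_bump_integrals_zero:
  fixes d :: "real^'n::finite \<Rightarrow> real"
  assumes m: "d \<in> borel_measurable lebesgue"
    and li: "\<And>R. integrable lebesgue (\<lambda>x. indicator (cball 0 R) x * d x)"
    and z: "\<And>a b n. (\<integral>x. d x * (\<Prod>i\<in>UNIV. bump (a$i) (b$i) n (x$i)) \<partial>lebesgue) = 0"
  shows "AE x in lebesgue. d x = 0"
proof -
  obtain d' where [measurable]: "d' \<in> borel_measurable borel" and d': "AE x in lborel. d x = d' x"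
    using completion_ex_borel_measurable_real[OF m] by auto
  have d'': "AE x in lebesgue. d x = d' x" using d' by (simp add: AE_completion_iff)
  have [measurable]: "d' \<in> borel_measurable lebesgue" by (simp add: measurable_completion)
  note m[measurable]
  have box0: "(\<integral>x. indicator (box a b) x * d x \<partial>lebesgue) = 0" for a b :: "real^'n"
  proof -
    obtain R where R: "box a b \<subseteq> cball 0 R" using bounded_box[of a b]
      by (meson bounded_subset_ballD ball_subset_cball order_trans)
    let ?\<phi> = "\<lambda>n x. \<Prod>i\<in>UNIV. bump (a$i) (b$i) n (x$i)"
    have [measurable]: "box a b \<in> sets lebesgue" "cball 0 R \<in> sets lebesgue" by auto
    have [measurable]: "?\<phi> n \<in> borel_measurable lebesgue" for n
      by (intro measurable_completion) (simp add: test_fun_borel[OF test_fun_prod_bump])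
    have "(\<lambda>n. \<integral>x. d x * ?\<phi> n x \<partial>lebesgue) \<longlonglongrightarrow> (\<integral>x. d x * indicator (box a b) x \<partial>lebesgue)"
    proof (rule integral_dominated_convergence[where w="\<lambda>x. norm (indicator (cball 0 R) x * d x)"])
      show "AE x in lebesgue. (\<lambda>n. d x * ?\<phi> n x) \<longlonglongrightarrow> d x * indicator (box a b) x"
        by (intro AE_I2 tendsto_mult tendsto_const prod_bump_bounds)
      show "AE x in lebesgue. norm (d x * ?\<phi> n x) \<le> norm (indicator (cball 0 R) x * d x)" for n
      proof (rule AE_I2)
        fix x
        have "?\<phi> n x \<le> indicator (cball 0 R) x"
          using prod_bump_bounds(2)[of a b n x] R by (auto split: split_indicator split_indicator_asm)
        then show "norm (d x * ?\<phi> n x) \<le> norm (indicator (cball 0 R) x * d x)"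
          using prod_bump_bounds(1)[of a b n x]
          by (auto simp: abs_mult mult.commute intro!: mult_left_mono)
      qed
    qed (use li in auto)
    then show ?thesis using z by (simp add: LIMSEQ_const_iff mult.commute)
  qed
  have "AE x in lborel. indicator (box (- (real k *\<^sub>R One)) (real k *\<^sub>R One)) x * d' x = 0" for k
  proof (rule AE_zero_if_box_integrals_zero)
    let ?B = "box (- (real k *\<^sub>R One)) (real k *\<^sub>R One) :: (real^'n) set"
    obtain R where R: "?B \<subseteq> cball 0 R" using bounded_box[of "- (real k *\<^sub>R One) :: real^'n" "real k *\<^sub>R One"]
      by (meson bounded_subset_ballD ball_subset_cball order_trans)
    have "integrable lebesgue (\<lambda>x. indicator ?B x *\<^sub>R (indicator (cball 0 R) x * d x))"
      by (rule integrable_mult_indicator[OF _ li]) auto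
    then have "integrable lebesgue (\<lambda>x. indicator ?B x * d' x)"
    proof (rule integrable_cong_AE_imp)
      have [measurable]: "?B \<in> sets lebesgue" by auto
      show "(\<lambda>x. indicator ?B x * d' x) \<in> borel_measurable lebesgue" by measurable
      show "AE x in lebesgue. indicator ?B x *\<^sub>R (indicator (cball 0 R) x * d x) = indicator ?B x * d' x"
        using d'' by eventually_elim (use R in \<open>auto split: split_indicator\<close>)
    qed
    then show "integrable lborel (\<lambda>x. indicator ?B x * d' x)"
      by (simp add: integrable_completion)
    fix a b :: "real^'n"
    obtain a' b' where ab: "box a b \<inter> ?B = box a' b'" by (auto simp: box_Int_box)
    have [measurable]: "box a' b' \<in> sets lebesgue" by auto
    have "(\<integral>x. indicator (box a b) x * (indicator ?B x * d' x) \<partial>lborel) = (\<integral>x. indicator (box a' b') x * d' x \<partial>lborel)"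
      by (intro Bochner_Integration.integral_cong) (auto simp: ab[symmetric] indicator_def)
    also have "\<dots> = (\<integral>x. indicator (box a' b') x * d' x \<partial>lebesgue)" by (simp add: integral_completion)
    also have "\<dots> = (\<integral>x. indicator (box a' b') x * d x \<partial>lebesgue)"
      by (rule integral_cong_AE) (use d'' in auto)
    finally show "(\<integral>x. indicator (box a b) x * (indicator ?B x * d' x) \<partial>lborel) = 0"
      using box0 by simp
  qed
  then have "AE x in lborel. \<forall>k. indicator (box (- (real k *\<^sub>R One)) (real k *\<^sub>R One)) x * d' x = 0"
    unfolding AE_all_countable by blast
  then have "AE x in lborel. d x = 0"
    using d'
  proof eventually_elim
    case (elim x)
    have "x \<in> (\<Union>k::nat. box (- (real k *\<^sub>R One)) (real k *\<^sub>R One))"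
      unfolding UN_box_eq_UNIV by simp
    then obtain k :: nat where "x \<in> box (- (real k *\<^sub>R One)) (real k *\<^sub>R One)" by (rule UN_E)
    then show ?case using elim(1)[rule_format, of k] elim(2) by simp
  qed
  then show ?thesis by (simp add: AE_completion_iff)
qed

lemma AE_zero_if_test_integrals_zero:
  fixes d :: "real^'n::finite \<Rightarrow> real"
  assumes m: "d \<in> borel_measurable lebesgue"
    and li: "\<And>R. integrable lebesgue (\<lambda>x. indicator (cball 0 R) x * d x)"
    and z: "\<And>\<phi>. test_fun \<phi> \<Longrightarrow> (\<integral>x. d x * \<phi> x \<partial>lebesgue) = 0"
  shows "AE x in lebesgue. d x = 0"
  by (rule AE_zero_if_prod_bump_integrals_zero[OF m li z[OF test_fun_prod_bump]])

lemma test_fun_lebesgue: "test_fun \<phi> \<Longrightarrow> \<phi> \<in> borel_measurable lebesgue"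
  by (simp add: measurable_completion test_fun_borel)

lemma integrable_mult_test_fun:
  assumes m: "d \<in> borel_measurable lebesgue"
    and li: "\<And>R. integrable lebesgue (\<lambda>x. indicator (cball 0 R) x * d x)" and t: "test_fun \<phi>"
  shows "integrable lebesgue (\<lambda>x. d x * \<phi> x)"
proof -
  obtain B R where BR: "R > 0" "B > 0" "\<And>x. \<bar>\<phi> x\<bar> \<le> B * indicator (cball 0 R) x"
    using test_fun_bound[OF t] by blast
  note m[measurable] test_fun_lebesgue[OF t, measurable]
  show ?thesis
  proof (rule Bochner_Integration.integrable_bound)
    show "integrable lebesgue (\<lambda>x. B * (indicator (cball 0 R) x * d x))" using li by simp
    show "AE x in lebesgue. norm (d x * \<phi> x) \<le> norm (B * (indicator (cball 0 R) x * d x))"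
    proof (rule AE_I2)
      fix x
      have "\<bar>d x\<bar> * \<bar>\<phi> x\<bar> \<le> \<bar>d x\<bar> * (B * indicator (cball 0 R) x)" by (intro mult_left_mono BR) auto
      then show "norm (d x * \<phi> x) \<le> norm (B * (indicator (cball 0 R) x * d x))"
        using BR by (simp add: abs_mult mult_ac)
    qed
  qed auto
qed

lemma integrable_cball_L2:
  fixes d :: "real^'n::finite \<Rightarrow> real"
  assumes [measurable]: "d \<in> borel_measurable lebesgue" and "integrable lebesgue (\<lambda>x. (d x)\<^sup>2)"
  shows "integrable lebesgue (\<lambda>x. indicator (cball 0 R) x * d x)"
proof (rule Cauchy_Schwarz_integral)
  have [measurable]: "cball 0 R \<in> sets (lebesgue :: (real^'n) measure)" by simp
  show "(indicator (cball 0 R) :: real^'n \<Rightarrow> real) \<in> borel_measurable lebesgue" by (rule borel_measurable_indicator) simp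
  have "integrable lebesgue (indicator (cball 0 R :: (real^'n) set) :: _ \<Rightarrow> real)"
    by (rule integrable_real_indicator) (use emeasure_bounded_finite[of "cball (0::real^'n) R"] in auto)
  then show "integrable lebesgue (\<lambda>x. (indicator (cball 0 R :: (real^'n) set) x :: real)\<^sup>2)"
    by (simp add: power2_eq_square indicator_inter_arith[symmetric] del: indicator_simps)
qed (use assms in auto)

section \<open>Uniqueness of the weak gradient\<close>

lemma L2grad_component:
  assumes "L2grad u g"
  shows "(\<lambda>x. g x $ i) \<in> borel_measurable lebesgue" "integrable lebesgue (\<lambda>x. (g x $ i)\<^sup>2)"
proof -
  show m: "(\<lambda>x. g x $ i) \<in> borel_measurable lebesgue"
    using assms unfolding L2grad_def
    by (intro measurable_compose[OF _ borel_measurable_continuous_onI[of "\<lambda>v. v$i"]] continuous_on_component continuous_on_id) auto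
  show "integrable lebesgue (\<lambda>x. (g x $ i)\<^sup>2)"
  proof (rule Bochner_Integration.integrable_bound)
    show "integrable lebesgue (\<lambda>x. (norm (g x))\<^sup>2)" using assms by (simp add: L2grad_def)
    show "AE x in lebesgue. norm ((g x $ i)\<^sup>2) \<le> norm ((norm (g x))\<^sup>2)"
      using component_le_norm_cart by (auto simp: abs_le_square_iff[symmetric])
  qed (use m in measurable)
qed

text \<open>\<open>wgrad\<close> is a choice, so every computation with a concrete gradient passes
  through this uniqueness. Each component of the difference annihilates all test functions.\<close>

lemma L2grad_unique:
  fixes g :: "real^'n::finite \<Rightarrow> real^'n"
  assumes g: "L2grad u g" and g': "L2grad u g'"
  shows "AE x in lebesgue. g x = g' x"
proof -
  have "AE x in lebesgue. g x $ i - g' x $ i = 0" for i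
  proof (rule AE_zero_if_test_integrals_zero)
    note [measurable] = L2grad_component(1)[OF g, of i] L2grad_component(1)[OF g', of i]
    show "(\<lambda>x. g x $ i - g' x $ i) \<in> borel_measurable lebesgue" by simp
    show "integrable lebesgue (\<lambda>x. indicator (cball 0 R) x * (g x $ i - g' x $ i))" for R
      using integrable_cball_L2[OF L2grad_component[OF g, of i], of R]
        integrable_cball_L2[OF L2grad_component[OF g', of i], of R]
      by (simp add: right_diff_distrib)
    show "(\<integral>x. (g x $ i - g' x $ i) * \<phi> x \<partial>lebesgue) = 0" if "test_fun \<phi>" for \<phi>
      using g g' that by (auto simp: L2grad_def weak_grad_def left_diff_distrib)
  qed
  then have "AE x in lebesgue. \<forall>i. g x $ i - g' x $ i = 0" by (simp add: AE_all_countable)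
  then show ?thesis by eventually_elim (auto simp: vec_eq_iff)
qed

lemma L2grad_wgrad: "L2grad u g \<Longrightarrow> L2grad u (wgrad u)"
  unfolding wgrad_def by (rule someI[of "L2grad u"])

lemma H1_L2grad: "H1 u \<Longrightarrow> L2grad u (wgrad u)"
  unfolding H1_def using L2grad_wgrad by blast

lemma dirichlet_eq:
  assumes "L2grad u g" shows "dirichlet u = (\<integral>x. (norm (g x))\<^sup>2 \<partial>lebesgue)"
  unfolding dirichlet_def
proof (rule integral_cong_AE)
  show "AE x in lebesgue. (norm (wgrad u x))\<^sup>2 = (norm (g x))\<^sup>2"
    using L2grad_unique[OF L2grad_wgrad[OF assms] assms] by eventually_elim simp
qed (use assms L2grad_wgrad[OF assms] in \<open>auto simp: L2grad_def\<close>)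

lemma dirichlet_nonneg: "dirichlet u \<ge> 0"
  by (simp add: dirichlet_def)

text \<open>A bump minus the right multiple of a fixed reference bump has mean zero, so its
  antiderivative, suitably normalised, has compact support in the open half line and may be tested.
  Hence f minus a constant annihilates all bumps, and these determine it almost everywhere.\<close>

lemma AE_const_if_weak_deriv_zero:
  fixes f :: "real \<Rightarrow> real"
  assumes m [measurable]: "f \<in> borel_measurable borel"
    and li: "\<And>a b. 0 < a \<Longrightarrow> integrable lborel (\<lambda>r. indicator {a..b} r * f r)"
    and z: "\<And>q a b. 0 < a \<Longrightarrow> a < b \<Longrightarrow> smooth UNIV q \<Longrightarrow> (\<And>r. r \<notin> {a..b} \<Longrightarrow> q r = 0) \<Longrightarrow>
        (\<integral>r. f r * deriv q r \<partial>lborel) = 0"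
  shows "\<exists>c. AE r in lborel. r > 0 \<longrightarrow> f r = c"
proof -
  have [measurable]: "bump a b n \<in> borel_measurable borel" for a b n
    using smooth_continuous_on[OF smooth_bump] by (rule borel_measurable_continuous_onI)
  have ib: "integrable lborel (bump a b n)" for a b n
    by (rule Bochner_Integration.integrable_bound[where f="indicator {a<..<b} :: real \<Rightarrow> real"])
      (use emeasure_bounded_finite[of "{a<..<b}"] in \<open>auto simp: bump_nonneg bump_le_indicator intro!: integrable_real_indicator\<close>)
  have ifb: "integrable lborel (\<lambda>r. f r * bump a b n r)" if "0 < a" for a b n
  proof (rule Bochner_Integration.integrable_bound[OF li[OF that, of b]])
    have "bump a b n r \<le> indicator {a..b} r" for r
      using bump_le_indicator[of a b n r] by (auto split: split_indicator split_indicator_asm)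
    then show "AE r in lborel. norm (f r * bump a b n r) \<le> norm (indicator {a..b} r * f r)"
      by (auto simp: abs_mult bump_nonneg mult.commute intro!: mult_left_mono)
  qed auto
  \<comment> \<open>The reference bump lives on the interval from 1 to 2; E is its integral, and c
    below is the mean of f with respect to it.\<close>
  define E where "E = (\<integral>r. bump 1 2 0 r \<partial>lborel)"
  have E: "E \<noteq> 0"
  proof
    assume "E = 0"
    then have "AE r in lborel. bump 1 2 0 r = 0"
      using integral_nonneg_eq_0_iff_AE[OF ib[of 1 2 0]] by (auto simp: E_def bump_nonneg)
    then have "AE r in lborel. (r::real) \<notin> {1<..<2}"
      by eventually_elim (metis bump_pos less_irrefl)
    then have "{1<..<2::real} \<in> null_sets lborel"
      by (subst (asm) AE_iff_null_sets[symmetric]) auto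
    then show False by (auto simp: null_sets_def)
  qed
  define c where "c = (\<integral>r. f r * bump 1 2 0 r \<partial>lborel) / E"
  have key: "(\<integral>r. f r * bump a b n r \<partial>lborel) = c * (\<integral>r. bump a b n r \<partial>lborel)" if ab: "0 < a" "a < b" for a b n
  proof -
    define k where "k = (\<integral>r. bump a b n r \<partial>lborel) / E"
    define g where "g r = bump a b n r - k * bump 1 2 0 r" for r
    have sg: "smooth UNIV g" unfolding g_def[abs_def]
      by (intro smooth_diff smooth_mult smooth_bump smooth_const) auto
    obtain G where G: "\<And>x. (G has_real_derivative g x) (at x)"
      using antiderivative_exists[OF smooth_continuous_on[OF sg]] by blast
    \<comment> \<open>The interval from l to M contains the supports of both bumps and stays away
      from 0.\<close>
    define l where "l = min a 1" define M where "M = max b 2"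
    have lM: "0 < l" "l < M" using ab by (auto simp: l_def M_def)
    have g0: "g r = 0" if "r \<notin> {l<..<M}" for r
      using that unfolding g_def l_def M_def by (subst (1 2) bump_eq_0) auto
    have Gl: "G r = G l" if "r \<le> l" for r
    proof (cases "r = l")
      case False
      show ?thesis
      proof (rule DERIV_isconst2[of r l G l, symmetric])
        show "r < l" using that False by simp
        show "continuous_on {r..l} G" using G by (intro continuous_at_imp_continuous_on ballI DERIV_isCont)
        show "DERIV G x :> 0" if "r < x" "x < l" for x using G[of x] g0[of x] that by auto
      qed (use that in auto)
    qed simp
    have ig: "integrable lborel g" unfolding g_def[abs_def] using ib by auto
    have "(\<integral>r. g r * indicator {l..M} r \<partial>lborel) = G M - G l"
      by (rule integral_FTC_Icc_real)
        (use lM G smooth_isCont[OF sg] in auto)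
    moreover have "(\<integral>r. g r * indicator {l..M} r \<partial>lborel) = (\<integral>r. g r \<partial>lborel)"
    proof (intro Bochner_Integration.integral_cong refl)
      show "g r * indicator {l..M} r = g r" for r using g0[of r] by (cases "r \<in> {l<..<M}") auto
    qed
    moreover have "(\<integral>r. g r \<partial>lborel) = 0"
      using ib E by (simp add: g_def[abs_def] k_def E_def[symmetric])
    ultimately have GM: "G M = G l" by simp
    have GM': "G r = G l" if "r \<ge> M" for r
    proof (cases "r = M")
      case False
      have "G r = G M"
      proof (rule DERIV_isconst2[of M r G r])
        show "M < r" using that False by simp
        show "continuous_on {M..r} G" using G by (intro continuous_at_imp_continuous_on ballI DERIV_isCont)
        show "DERIV G x :> 0" if "M < x" "x < r" for x using G[of x] g0[of x] that by auto
      qed (use that in auto)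
      then show ?thesis using GM by simp
    qed (simp add: GM)
    have D: "((\<lambda>r. G r - G l) has_real_derivative g r) (at r)" for r
      using G[of r] by (auto intro!: derivative_eq_intros)
    have dq: "deriv (\<lambda>r. G r - G l) = g" using DERIV_imp_deriv[OF D] by auto
    have "(\<integral>r. f r * deriv (\<lambda>r. G r - G l) r \<partial>lborel) = 0"
    proof (rule z[OF lM])
      show "smooth UNIV (\<lambda>r. G r - G l)" by (rule smoothI_DERIV[OF _ D sg]) auto
      show "G r - G l = 0" if "r \<notin> {l..M}" for r using that Gl[of r] GM'[of r] by auto
    qed
    then have "(\<integral>r. f r * bump a b n r - k * (f r * bump 1 2 0 r) \<partial>lborel) = 0"
      unfolding dq g_def by (simp add: right_diff_distrib mult_ac)
    then show ?thesis using ifb[of a b n] ifb[of 1 2 0] ab E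
      by (simp add: c_def k_def)
  qed
  have lim: "(\<integral>r. indicator {a<..<b} r * (f r - c) \<partial>lborel) = 0" if a: "0 < a" for a b
  proof (cases "a < b")
    case True
    have ili: "integrable lborel (\<lambda>r. indicator {a..b} r * f r)" by (rule li[OF a])
    have iic: "integrable lborel (\<lambda>r. indicator {a..b} r * c)"
      by (intro integrable_mult_left integrable_real_indicator) (auto simp: emeasure_lborel_Icc_eq)
    have fc: "integrable lborel (\<lambda>r. indicator {a..b} r * (f r - c))"
      using Bochner_Integration.integrable_diff[OF ili iic] by (simp add: right_diff_distrib)
    have "(\<lambda>n. \<integral>r. bump a b n r * (f r - c) \<partial>lborel) \<longlonglongrightarrow> (\<integral>r. indicator {a<..<b} r * (f r - c) \<partial>lborel)"
    proof (rule integral_dominated_convergence[where w="\<lambda>r. norm (indicator {a..b} r * (f r - c))"])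
      show "AE x in lborel. (\<lambda>n. bump a b n x * (f x - c)) \<longlonglongrightarrow> indicator {a<..<b} x * (f x - c)"
        by (intro AE_I2 tendsto_mult tendsto_const bump_tendsto_indicator)
      have "bump a b n r \<le> indicator {a..b} r" for r n
        using bump_le_indicator[of a b n r] by (auto split: split_indicator split_indicator_asm)
      then show "AE x in lborel. norm (bump a b n x * (f x - c)) \<le> norm (indicator {a..b} x * (f x - c))" for n
        by (auto simp: abs_mult bump_nonneg intro!: mult_right_mono)
    qed (use fc in auto)
    moreover have "(\<integral>r. bump a b n r * (f r - c) \<partial>lborel) = 0" for n
    proof -
      have "(\<integral>r. bump a b n r * (f r - c) \<partial>lborel) = (\<integral>r. f r * bump a b n r - c * bump a b n r \<partial>lborel)"
        by (simp add: algebra_simps)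
      also have "\<dots> = 0" using ifb[OF a, of b n] ib[of a b n] key[OF a True, of n] by simp
      finally show ?thesis .
    qed
    ultimately show ?thesis by (simp add: LIMSEQ_const_iff)
  qed auto
  have "AE r in lborel. indicator {1/real (Suc k)<..<real (Suc k)} r * (f r - c) = 0" for k
  proof (rule AE_zero_if_box_integrals_zero)
    let ?k = "real (Suc k)"
    have ili: "integrable lborel (\<lambda>r. indicator {1/?k..?k} r * f r)" by (rule li) simp
    have iic: "integrable lborel (\<lambda>r. indicator {1/?k..?k} r * c)"
      by (intro integrable_mult_left integrable_real_indicator) (auto simp: emeasure_lborel_Icc_eq)
    have "integrable lborel (\<lambda>r. indicator {1/?k<..<?k} r *\<^sub>R (indicator {1/?k..?k} r * (f r - c)))"
      using Bochner_Integration.integrable_diff[OF ili iic]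
      by (intro integrable_mult_indicator) (auto simp: right_diff_distrib)
    then show "integrable lborel (\<lambda>r. indicator {1/?k<..<?k} r * (f r - c))"
      by (rule Bochner_Integration.integrable_cong[THEN iffD1, rotated 2]) (auto simp: indicator_def)
    fix a b :: real
    have "(\<integral>r. indicator (box a b) r * (indicator {1/?k<..<?k} r * (f r - c)) \<partial>lborel) =
      (\<integral>r. indicator {max a (1/?k)<..<min b ?k} r * (f r - c) \<partial>lborel)"
      by (intro Bochner_Integration.integral_cong) (auto simp: box_real indicator_def)
    also have "\<dots> = 0" by (rule lim) (simp add: less_max_iff_disj)
    finally show "(\<integral>r. indicator (box a b) r * (indicator {1/?k<..<?k} r * (f r - c)) \<partial>lborel) = 0" .
  qed
  then have "AE r in lborel. \<forall>k. indicator {1/real (Suc k)<..<real (Suc k)} r * (f r - c) = 0"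
    unfolding AE_all_countable by blast
  then have "AE r in lborel. r > 0 \<longrightarrow> f r = c"
  proof eventually_elim
    case (elim r)
    show ?case
    proof
      assume r: "r > 0"
      obtain k where k: "max r (1/r) < real k" using reals_Archimedean2 by blast
      then have "1 / real (Suc k) < r" using r by (simp add: field_simps)
      then have "r \<in> {1/real (Suc k)<..<real (Suc k)}" using k by auto
      then show "f r = c" using elim[rule_format, of k] by (simp only: indicator_simps mult_1 right_minus_eq)
    qed
  qed
  then show ?thesis by blast
qed

subsection \<open>Integration of radial functions\<close>

text \<open>The surface area of the unit sphere: the derivative at radius 1 of the volume of a
  ball.\<close>

definition sph_area :: "'n::finite itself \<Rightarrow> real" where
  "sph_area _ = real CARD('n) * unit_ball_vol (real CARD('n))"

lemma sph_area_pos [simp]: "sph_area TYPE('n::finite) > 0"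
  by (simp add: sph_area_def)

lemma sph_area_neq_0 [simp]: "sph_area TYPE('n::finite) \<noteq> 0"
  using sph_area_pos[where 'n='n] by linarith

lemma sph_area_nonneg [simp]: "0 \<le> sph_area TYPE('n::finite)"
  using sph_area_pos[where 'n='n] by linarith

text \<open>Polar coordinates for radial integrands. On a half line below a both measures give the
  volume of the ball of radius a, on the right because r^(N-1) has primitive r^N / N; half lines
  generate the Borel sets and are stable under intersection.\<close>

lemma distr_norm_lborel:
  "distr (lborel::(real^'n::finite) measure) borel norm =
   density lborel (\<lambda>r. ennreal (indicator {0..} r * (sph_area TYPE('n) * r ^ (CARD('n) - 1))))"
proof (rule measure_eqI_generator_eq[where E="range (\<lambda>a::real. {..<a})" and \<Omega>=UNIV and A="\<lambda>i. {..<real i}"])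
  have 1: "emeasure (distr (lborel::(real^'n) measure) borel norm) {..<a} =
      ennreal (unit_ball_vol (real CARD('n)) * (max 0 a) ^ CARD('n))" for a :: real
  proof -
    have "norm -` {..<a} = ball (0::real^'n) a" by auto
    then show ?thesis by (cases "a > 0") (auto simp: emeasure_distr emeasure_ball zero_power not_less ball_empty)
  qed
  have 2: "emeasure (density lborel (\<lambda>r. ennreal (indicator {0..} r * (sph_area TYPE('n) * r ^ (CARD('n) - 1))))) {..<a} =
      ennreal (unit_ball_vol (real CARD('n)) * (max 0 a) ^ CARD('n))" for a :: real
  proof (cases "a \<ge> 0")
    case True
    have "emeasure (density lborel (\<lambda>r. ennreal (indicator {0..} r * (sph_area TYPE('n) * r ^ (CARD('n) - 1))))) {..<a} =
      (\<integral>\<^sup>+r. ennreal (indicator {0..} r * (sph_area TYPE('n) * r ^ (CARD('n) - 1))) * indicator {..<a} r \<partial>lborel)"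
      by (subst emeasure_density) auto
    also have "\<dots> = (\<integral>\<^sup>+r. ennreal (sph_area TYPE('n) * r ^ (CARD('n) - 1)) * indicator {0..a} r \<partial>lborel)"
      by (rule nn_integral_cong_AE, rule AE_mp[OF AE_lborel_singleton[of a]]) (auto simp: indicator_def)
    also have "\<dots> = ennreal (unit_ball_vol (real CARD('n)) * a ^ CARD('n) - unit_ball_vol (real CARD('n)) * 0 ^ CARD('n))"
      by (rule nn_integral_FTC_Icc[OF _ _ _ True])
        (use less_imp_le[OF sph_area_pos[where 'n='n]] in \<open>auto simp: sph_area_def intro!: derivative_eq_intros\<close>)
    finally show ?thesis using True by simp
  next
    case False
    then have "ennreal (indicator {0..} r * (sph_area TYPE('n) * r ^ (CARD('n) - 1))) * indicator {..<a} r = 0" for r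
      by (auto split: split_indicator)
    then have "(\<integral>\<^sup>+r. ennreal (indicator {0..} r * (sph_area TYPE('n) * r ^ (CARD('n) - 1))) * indicator {..<a} r \<partial>lborel) =
      (\<integral>\<^sup>+r. 0 \<partial>(lborel::real measure))" by (simp only:)
    then show ?thesis using False by (subst emeasure_density) (simp_all add: zero_power)
  qed
  show "emeasure (distr (lborel::(real^'n) measure) borel norm) X =
     emeasure (density lborel (\<lambda>r. ennreal (indicator {0..} r * (sph_area TYPE('n) * r ^ (CARD('n) - 1))))) X"
    if "X \<in> range (\<lambda>a::real. {..<a})" for X using that 1 2 by auto
  show "emeasure (distr (lborel::(real^'n) measure) borel norm) {..<real i} \<noteq> \<infinity>" for i
    unfolding 1 by simp
  show "(\<Union>i. {..<real i}) = UNIV" using reals_Archimedean2 by auto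
  show "Int_stable (range (\<lambda>a::real. {..<a}))"
  proof -
    have "{..<a} \<inter> {..<b} = {..<min a b}" for a b :: real by auto
    then show ?thesis unfolding Int_stable_def by fastforce
  qed
  show "sets (distr (lborel::(real^'n) measure) borel norm) = sigma_sets UNIV (range (\<lambda>a::real. {..<a}))"
    by (simp add: borel_Iio)
  show "sets (density lborel (\<lambda>r. ennreal (indicator {0..} r * (sph_area TYPE('n) * r ^ (CARD('n) - 1))))) = sigma_sets UNIV (range (\<lambda>a::real. {..<a}))"
    by (simp add: borel_Iio)
qed auto

lemma radial_density_nonneg: "0 \<le> indicator {0..} r * (sph_area TYPE('n::finite) * r ^ (CARD('n) - 1))"
  by (auto simp: indicator_def)

lemma integrable_radial_iff:
  assumes [measurable]: "h \<in> borel_measurable borel"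
  shows "integrable lborel (\<lambda>x::real^'n::finite. h (norm x) :: real) \<longleftrightarrow>
    integrable lborel (\<lambda>r. indicator {0..} r * (sph_area TYPE('n) * r ^ (CARD('n) - 1)) * h r)"
proof -
  have "integrable lborel (\<lambda>x::real^'n. h (norm x)) \<longleftrightarrow> integrable (distr (lborel::(real^'n) measure) borel norm) h"
    by (rule integrable_distr_eq[symmetric]) auto
  also have "\<dots> \<longleftrightarrow> integrable lborel (\<lambda>r. indicator {0..} r * (sph_area TYPE('n) * r ^ (CARD('n) - 1)) * h r)"
    unfolding distr_norm_lborel using radial_density_nonneg by (subst integrable_real_density) auto
  finally show ?thesis .
qed

lemma integral_radial:
  assumes [measurable]: "h \<in> borel_measurable borel"
  shows "(\<integral>x. h (norm (x::real^'n::finite)) \<partial>lborel) =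
    (\<integral>r. indicator {0..} r * (sph_area TYPE('n) * r ^ (CARD('n) - 1)) * (h r :: real) \<partial>lborel)"
proof -
  have "(\<integral>x. h (norm (x::real^'n)) \<partial>lborel) = (\<integral>r. h r \<partial>(distr (lborel::(real^'n) measure) borel norm))"
    by (rule integral_distr[symmetric]) auto
  also have "\<dots> = (\<integral>r. indicator {0..} r * (sph_area TYPE('n) * r ^ (CARD('n) - 1)) * h r \<partial>lborel)"
    unfolding distr_norm_lborel using radial_density_nonneg by (subst integral_real_density) auto
  finally show ?thesis .
qed

lemma AE_norm:
  assumes "AE r in lborel. P r"
  shows "AE x::real^'n::finite in lborel. P (norm x)"
proof -
  have "AE r in distr (lborel::(real^'n) measure) borel norm. P r"
    unfolding distr_norm_lborel using assms by (subst AE_density) auto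
  from AE_distrD[OF _ this] show ?thesis by simp
qed

text \<open>Only positive radii carry information, since the density of the distribution of |x|
  vanishes for negative r.\<close>

lemma AE_normD:
  assumes "AE x::real^'n::finite in lborel. P (norm x)" and [measurable]: "Measurable.pred borel P"
  shows "AE r in lborel. r > 0 \<longrightarrow> P r"
proof -
  have "AE r in distr (lborel::(real^'n) measure) borel norm. P r"
    using assms by (subst AE_distr_iff) auto
  then have "AE r in lborel. 0 < ennreal (indicator {0..} r * (sph_area TYPE('n) * r ^ (CARD('n) - 1))) \<longrightarrow> P r"
    unfolding distr_norm_lborel by (subst (asm) AE_density) auto
  then show ?thesis by eventually_elim (auto simp: ennreal_less_zero_iff indicator_def)
qed

text \<open>The preimage and its complement are both countable unions of compact sets up to null
  sets, and norms of compact sets form compact sets. A positive radius in neither image lies in Z,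
  whose preimage is covered by the two null sets; by polar coordinates Z is null, so A is Borel up
  to a null set.\<close>

lemma lebesgue_set_of_norm_vimage:
  fixes A :: "real set"
  assumes A: "A \<subseteq> {0..}" and S: "norm -` A \<in> sets (lebesgue :: (real^'n::finite) measure)"
  shows "A \<in> sets lebesgue"
proof -
  have sig: "norm ` C \<in> sets borel" if "fsigma C" for C :: "(real^'n) set"
  proof -
    have "\<exists>F::nat \<Rightarrow> (real^'n) set. range F \<subseteq> Collect compact \<and> C = \<Union>(F ` UNIV)"
      using that unfolding fsigma_Union_compact .
    then obtain F :: "nat \<Rightarrow> (real^'n) set" where F: "range F \<subseteq> Collect compact" "C = \<Union>(F ` UNIV)"
      by (elim exE conjE)
    have "norm ` C = (\<Union>n. norm ` F n)" unfolding F(2) by (simp add: image_UN)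
    moreover have "norm ` F n \<in> sets borel" for n
      using F by (intro borel_compact compact_continuous_image) (auto intro: continuous_intros)
    ultimately show ?thesis by auto
  qed
  obtain C T where C: "fsigma C" "T \<in> null_sets lebesgue" "C \<union> T = (norm -` A :: (real^'n) set)" "disjnt C T"
    by (rule lebesgue_set_almost_fsigma[OF S])
  have "- norm -` A \<in> sets (lebesgue :: (real^'n) measure)"
    using sets.compl_sets[OF S] by (simp add: Compl_eq_Diff_UNIV)
  then obtain C' T' where C': "fsigma C'" "T' \<in> null_sets lebesgue" "C' \<union> T' = - (norm -` A :: (real^'n) set)" "disjnt C' T'"
    by (rule lebesgue_set_almost_fsigma)
  define Z where "Z = {0<..} - norm ` C - norm ` C'"
  have [measurable]: "Z \<in> sets borel" using sig[OF C(1)] sig[OF C'(1)] by (auto simp: Z_def)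
  have "norm -` Z \<subseteq> T \<union> T'"
  proof
    fix x :: "real^'n" assume x: "x \<in> norm -` Z"
    have "x \<in> (C \<union> T) \<union> (C' \<union> T')" unfolding C(3) C'(3) by simp
    then show "x \<in> T \<union> T'" using x by (auto simp: Z_def)
  qed
  moreover have "T \<union> T' \<in> null_sets lebesgue" using C C' by auto
  ultimately have "(norm -` Z :: (real^'n) set) \<in> null_sets lebesgue"
    using null_sets_completion_subset by blast
  from AE_not_in[OF this] have "AE x::real^'n in lebesgue. norm x \<notin> Z" by eventually_elim simp
  then have "AE x::real^'n in lborel. norm x \<notin> Z" by (simp add: AE_completion_iff)
  then have "AE r in lborel. r > 0 \<longrightarrow> r \<notin> Z" by (rule AE_normD) auto
  then have "AE r in lborel. r \<notin> Z" by eventually_elim (auto simp: Z_def)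
  then have "Z \<in> null_sets lborel" by (subst AE_iff_null_sets) auto
  then have Z: "Z \<in> null_sets lebesgue" by (simp add: null_sets_completionI)
  have "A = (norm ` C) \<union> (A \<inter> (Z \<union> {0}))"
  proof
    show "A \<subseteq> norm ` C \<union> (A \<inter> (Z \<union> {0}))"
    proof
      fix r assume r: "r \<in> A"
      have "r \<notin> norm ` C'" using C'(3) r by auto
      then show "r \<in> norm ` C \<union> (A \<inter> (Z \<union> {0}))" using r A by (auto simp: Z_def)
    qed
    show "norm ` C \<union> (A \<inter> (Z \<union> {0})) \<subseteq> A" using C(3) by auto
  qed
  moreover have "{0::real} \<in> null_sets lebesgue" by (intro null_sets_completionI) auto
  then have "A \<inter> (Z \<union> {0}) \<in> null_sets lebesgue"
    using Z by (intro null_sets_completion_subset[of "A \<inter> (Z \<union> {0})" "Z \<union> {0}"]) auto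
  ultimately show ?thesis
    using sig[OF C(1)] by (metis null_setsD2 sets.Un sets_completionI_sets sets_lborel)
qed

lemma radial_borel_profile:
  fixes u :: "real^'n::finite \<Rightarrow> real"
  assumes u: "u \<in> borel_measurable lebesgue" and r: "radial u"
  obtains F where "F \<in> borel_measurable borel" "AE x in lebesgue. u x = F (norm x)"
proof -
  \<comment> \<open>The profile is read off along one ray; any unit vector would do.\<close>
  define F0 where "F0 t = (if t \<ge> 0 then u (t *\<^sub>R axis undefined 1) else 0)" for t
  have uF: "u x = F0 (norm x)" for x
    using r[unfolded radial_def, rule_format, of x "norm x *\<^sub>R axis undefined 1"] by (simp add: F0_def)
  have "F0 \<in> borel_measurable lebesgue"
    unfolding borel_measurable_iff_greater
  proof
    fix c
    let ?A = "{t. t \<ge> 0 \<and> F0 t > c}"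
    have "norm -` ?A = {x. u x > c}" using uF by auto
    moreover have "{x. u x > c} \<in> sets lebesgue" using u by (auto simp: borel_measurable_iff_greater)
    ultimately have "?A \<in> sets lebesgue" using lebesgue_set_of_norm_vimage[of ?A, where 'n='n] by auto
    moreover have "{t \<in> space lebesgue. c < F0 t} = ?A \<union> (if c < 0 then {..<0} else {})"
      by (auto simp: F0_def)
    ultimately show "{t \<in> space lebesgue. c < F0 t} \<in> sets lebesgue" by auto
  qed
  from completion_ex_borel_measurable_real[OF this] obtain F where F: "F \<in> borel_measurable borel" "AE t in lborel. F0 t = F t"
    by auto
  from AE_norm[OF F(2), where 'n='n] have "AE x::real^'n in lebesgue. u x = F (norm x)"
    using uF by (simp add: AE_completion_iff)
  with F(1) show ?thesis by (rule that)
qed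

text \<open>Difference quotients in direction e integrate to 0 by translation invariance, and the
  mean value theorem provides a majorant for the limit. One continuous directional derivative is
  enough, which matters because it is applied to functions that are only C1.\<close>

lemma integral_directional_deriv_zero:
  fixes z z' :: "'a::euclidean_space \<Rightarrow> real"
  assumes d: "\<And>x t. ((\<lambda>t. z (x + t *\<^sub>R e)) has_real_derivative z' (x + t *\<^sub>R e)) (at t)"
    and c: "continuous_on UNIV z" "continuous_on UNIV z'"
    and s: "\<And>x. norm x > R \<Longrightarrow> z x = 0" "\<And>x. norm x > R \<Longrightarrow> z' x = 0"
  shows "(\<integral>x. z' x \<partial>lborel) = 0"
proof -
  have [measurable]: "z \<in> borel_measurable borel" "z' \<in> borel_measurable borel"
    using c by (auto intro: borel_measurable_continuous_onI)
  have bdd: "\<exists>B>0. \<forall>x. \<bar>w x\<bar> \<le> B * indicator (cball 0 R) x" if "continuous_on UNIV w" "\<And>x. norm x > R \<Longrightarrow> w x = 0" for w :: "'a \<Rightarrow> real"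
  proof -
    have "compact (w ` cball 0 R)" by (intro compact_continuous_image continuous_on_subset[OF that(1)]) auto
    from compact_imp_bounded[OF this] obtain B where B: "B > 0" "\<forall>x\<in>w ` cball 0 R. norm x \<le> B"
      unfolding bounded_pos by (elim exE conjE)
    then show ?thesis using that(2) by (intro exI[of _ B]) (force simp: indicator_def)
  qed
  obtain B where B: "B > 0" "\<And>x. \<bar>z' x\<bar> \<le> B * indicator (cball 0 R) x" using bdd[OF c(2) s(2)] by blast
  obtain B0 where B0: "B0 > 0" "\<And>x. \<bar>z x\<bar> \<le> B0 * indicator (cball 0 R) x" using bdd[OF c(1) s(1)] by blast
  have iz: "integrable lborel z"
    by (rule Bochner_Integration.integrable_bound[where f="\<lambda>x. B0 * indicator (cball 0 R) x"])
      (use B0 emeasure_bounded_finite[of "cball (0::'a) R"] in \<open>auto intro!: integrable_mult_right integrable_real_indicator intro: order_trans[OF _ abs_ge_self]\<close>)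
  have tr: "integrable lborel (\<lambda>x. z (x + v)) \<and> (\<integral>x. z (x + v) \<partial>lborel) = (\<integral>x. z x \<partial>lborel)" for v
  proof -
    have "integrable (distr lborel borel ((+) v)) z" "(\<integral>x. z x \<partial>distr lborel borel ((+) v)) = (\<integral>x. z x \<partial>lborel)"
      using iz by (simp_all add: lborel_distr_plus)
    then show ?thesis by (simp add: integrable_distr_eq integral_distr add.commute)
  qed
  let ?s = "\<lambda>n. 1 / real (Suc n)"
  let ?q = "\<lambda>n x. (z (x + ?s n *\<^sub>R e) - z x) / ?s n"
  have "(\<lambda>n. \<integral>x. ?q n x \<partial>lborel) \<longlonglongrightarrow> (\<integral>x. z' x \<partial>lborel)"
  proof (rule integral_dominated_convergence[where w="\<lambda>x. B * indicator (cball 0 (R + norm e)) x"])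
    show "integrable lborel (\<lambda>x::'a. B * indicator (cball 0 (R + norm e)) x)"
      using emeasure_bounded_finite[of "cball (0::'a) (R + norm e)"] by (auto intro!: integrable_mult_right integrable_real_indicator)
    show "AE x in lborel. (\<lambda>n. ?q n x) \<longlonglongrightarrow> z' x"
    proof (rule AE_I2)
      fix x
      have "((\<lambda>h. (z (x + h *\<^sub>R e) - z x) / h) \<longlongrightarrow> z' x) (at 0)"
        using d[of x 0] by (simp add: DERIV_def)
      moreover have "filterlim ?s (at 0) sequentially"
        unfolding filterlim_at using LIMSEQ_inverse_real_of_nat by (auto simp: inverse_eq_divide)
      ultimately show "(\<lambda>n. ?q n x) \<longlonglongrightarrow> z' x" by (rule filterlim_compose)
    qed
    show "AE x in lborel. norm (?q n x) \<le> B * indicator (cball 0 (R + norm e)) x" for n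
    proof (rule AE_I2)
      fix x
      have sn: "0 < ?s n" "?s n \<le> 1" by auto
      obtain t where t: "0 < t" "t < ?s n" "z (x + ?s n *\<^sub>R e) - z (x + 0 *\<^sub>R e) = (?s n - 0) * z' (x + t *\<^sub>R e)"
        using MVT2[OF sn(1), of "\<lambda>t. z (x + t *\<^sub>R e)" "\<lambda>t. z' (x + t *\<^sub>R e)"] d by blast
      have "?q n x = z' (x + t *\<^sub>R e)" using t(3) sn by (simp add: field_simps)
      moreover have "\<bar>z' (x + t *\<^sub>R e)\<bar> \<le> B * indicator (cball 0 (R + norm e)) x"
      proof (cases "norm (x + t *\<^sub>R e) \<le> R")
        case True
        have "t \<le> 1" using t sn by linarith
        then have "norm (t *\<^sub>R e) \<le> norm e" using t by (simp add: mult_left_le_one_le)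
        then have "norm x \<le> R + norm e" using True norm_triangle_sub[of x "x + t *\<^sub>R e"] by (simp add: norm_minus_commute)
        then show ?thesis using B(2)[of "x + t *\<^sub>R e"] True by simp
      qed (use s B in auto)
      ultimately show "norm (?q n x) \<le> B * indicator (cball 0 (R + norm e)) x" by simp
    qed
  qed auto
  moreover have "(\<integral>x. ?q n x \<partial>lborel) = 0" for n
    using tr[of "?s n *\<^sub>R e"] iz by simp
  ultimately show ?thesis by (simp add: LIMSEQ_const_iff)
qed

subsection \<open>Radial functions in the Sobolev space\<close>

text \<open>Radial test functions have the form h(|x|^2), smooth at the origin because |x|^2 is a
  polynomial. Dividing q by r^k prepares for the Jacobian of polar coordinates; the applications
  take k = N.\<close>

lemma radial_test_profile:
  assumes q: "smooth UNIV q" and ab: "0 < a" "a < b" and s: "\<And>r. r \<notin> {a..b} \<Longrightarrow> q r = 0"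
  obtains h where "smooth UNIV h" "\<And>t. t < a\<^sup>2 \<Longrightarrow> h t = 0" "\<And>t. t > b\<^sup>2 \<Longrightarrow> h t = 0"
    "\<And>r. r > 0 \<Longrightarrow> h (r\<^sup>2) = q r / r ^ k"
    "\<And>r. r > 0 \<Longrightarrow> 2 * r * deriv h (r\<^sup>2) = deriv q r / r ^ k - real k * q r / r ^ (k + 1)"
proof -
  define h where "h t = (if t > 0 then t powr (- real k / 2) * q (t powr (1/2)) else 0)" for t
  have h1: "h t = 0" if "t < a\<^sup>2" for t
  proof (cases "t > 0")
    case True
    have "t powr (1/2) < a" using that True ab by (simp add: powr_half_sqrt real_less_lsqrt)
    then show ?thesis by (simp add: h_def s)
  qed (simp add: h_def)
  have h2: "h t = 0" if "t > b\<^sup>2" for t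
  proof -
    have "b < sqrt t" using that ab by (intro real_less_rsqrt) auto
    moreover have "t > 0" using that ab by (meson less_trans zero_less_power order_less_trans)
    ultimately show ?thesis by (simp add: h_def s powr_half_sqrt)
  qed
  have sh: "smooth UNIV h"
  proof -
    have "smooth {0<..} (\<lambda>t. t powr (- real k / 2) * q (t powr (1/2)))"
      by (intro smooth_mult smooth_powr smooth_compose[OF _ open_UNIV _ q]) auto
    then have 1: "smooth {0<..} h" by (rule smooth_cong[rotated 2]) (auto simp: h_def)
    have 2: "smooth {..<a\<^sup>2} h" by (rule smooth_cong[OF _ _ smooth_const[of _ 0]]) (auto simp: h1)
    have "0 < a\<^sup>2" using ab by simp
    then have "x \<in> {0<..} \<union> {..<a\<^sup>2}" for x using order_le_less_trans[of x 0 "a\<^sup>2"] by (cases "x > 0") (auto simp del: zero_less_power2)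
    then have "{0<..} \<union> {..<a\<^sup>2} = UNIV" by blast
    then show ?thesis using smooth_Un[OF 1 2] by simp
  qed
  have hr: "h (r\<^sup>2) = q r / r ^ k" if "r > 0" for r
  proof -
    have "r\<^sup>2 powr (- real k / 2) = (r powr 2) powr (- real k / 2)"
      using that by (simp add: powr_numeral)
    also have "\<dots> = r powr (- real k)" by (simp add: powr_powr)
    also have "\<dots> = 1 / r ^ k" using that by (simp add: powr_minus_divide powr_realpow)
    finally show ?thesis using that by (simp add: h_def powr_half_sqrt)
  qed
  have "2 * r * deriv h (r\<^sup>2) = deriv q r / r ^ k - real k * q r / r ^ (k + 1)" if r: "r > 0" for r
  proof -
    have "((\<lambda>r. h (r\<^sup>2)) has_real_derivative deriv h (r\<^sup>2) * (2 * r)) (at r)"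
      by (rule DERIV_chain2[where f=h]) (auto intro!: derivative_eq_intros smooth_DERIV[OF sh])
    moreover have "((\<lambda>r. h (r\<^sup>2)) has_real_derivative deriv q r / r ^ k - real k * q r / r ^ (k + 1)) (at r)"
    proof (rule has_field_derivative_transform_within_open[of "\<lambda>r. q r / r ^ k" _ _ "{0<..}"])
      have "((\<lambda>r. q r / r ^ k) has_real_derivative (deriv q r * r ^ k - q r * (real k * r ^ (k - 1))) / (r ^ k * r ^ k)) (at r)"
        using r by (auto intro!: derivative_eq_intros smooth_DERIV[OF q])
      moreover have "(deriv q r * r ^ k - q r * (real k * r ^ (k - 1))) / (r ^ k * r ^ k) = deriv q r / r ^ k - real k * q r / r ^ (k + 1)"
        using r by (cases k) (auto simp: field_simps)
      ultimately show "((\<lambda>r. q r / r ^ k) has_real_derivative deriv q r / r ^ k - real k * q r / r ^ (k + 1)) (at r)" by simp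
    qed (use r hr in auto)
    ultimately have "deriv h (r\<^sup>2) * (2 * r) = deriv q r / r ^ k - real k * q r / r ^ (k + 1)" by (rule DERIV_unique)
    then show ?thesis by (simp only: mult_ac)
  qed
  with that[OF sh h1 h2 hr] show ?thesis by blast
qed

text \<open>The first upper bound is proportional to s - r and yields Hoelder continuity; the second
  does not depend on s and yields a bound of order r^(2-N) for squares when s tends to
  infinity.\<close>

lemma power_integral_bounds:
  fixes r s :: real and N :: nat
  assumes r: "0 < r" "r \<le> s" and N: "N \<ge> 3"
  defines "J \<equiv> \<integral>t. indicator {r..<s} t / t ^ (N - 1) \<partial>lborel"
  shows "integrable lborel (\<lambda>t. indicator {r..<s} t / t ^ (N - 1))"
    and "0 \<le> J" "J \<le> (s - r) / r ^ (N - 1)" "J \<le> 1 / ((real N - 2) * r ^ (N - 2))"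
proof -
  have b: "indicator {r..<s} t / t ^ (N - 1) \<le> indicator {r..<s} t / r ^ (N - 1)" for t
    using r by (auto simp: indicator_def intro!: divide_left_mono power_mono)
  have i2: "integrable lborel (\<lambda>t. indicator {r..<s} t / r ^ (N - 1))"
    using emeasure_bounded_finite[of "{r..<s}"] by auto
  show i1: "integrable lborel (\<lambda>t. indicator {r..<s} t / t ^ (N - 1))"
    by (rule Bochner_Integration.integrable_bound[OF i2]) (use b r in \<open>auto simp: indicator_def intro!: divide_left_mono power_mono\<close>)
  show "0 \<le> J" unfolding J_def using r by (intro integral_nonneg_AE) (auto simp: indicator_def)
  have "J \<le> (\<integral>t. indicator {r..<s} t / r ^ (N - 1) \<partial>lborel)"
    unfolding J_def by (rule integral_mono[OF i1 i2 b])
  also have "\<dots> = (s - r) / r ^ (N - 1)" using r by simp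
  finally show "J \<le> (s - r) / r ^ (N - 1)" .
  let ?P = "\<lambda>t::real. - 1 / ((real N - 2) * t ^ (N - 2))"
  have D: "(?P has_real_derivative 1 / t ^ (N - 1)) (at t)" if "t > 0" for t
  proof -
    obtain m where m: "N = Suc (Suc (Suc m))" using N by (metis add_2_eq_Suc' le_Suc_ex numeral_3_eq_3 add_Suc)
    have "((\<lambda>t. - inverse (t ^ Suc m) / (real m + 1)) has_real_derivative
        inverse (t ^ Suc m) * ((real m + 1) * t ^ m) * inverse (t ^ Suc m) / (real m + 1)) (at t)"
    proof -
      have "((\<lambda>t. t ^ Suc m) has_real_derivative (real m + 1) * t ^ m) (at t)"
        using DERIV_pow[of "Suc m" t] by (simp add: add.commute)
      then show ?thesis
        by (rule DERIV_cong[OF DERIV_cdivide[OF DERIV_minus[OF DERIV_inverse']]]) (use that in simp_all)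
    qed
    moreover have "inverse (t ^ Suc m) * ((real m + 1) * t ^ m) * inverse (t ^ Suc m) / (real m + 1) = 1 / t ^ (N - 1)"
      using that unfolding m by (simp add: divide_simps)
    moreover have "?P = (\<lambda>t. - inverse (t ^ Suc m) / (real m + 1))"
      unfolding m by (auto simp: divide_simps algebra_simps)
    ultimately show ?thesis by simp
  qed
  have "J = (\<integral>t. 1 / t ^ (N - 1) * indicator {r..s} t \<partial>lborel)"
    unfolding J_def
    by (rule integral_cong_AE) (use AE_lborel_singleton[of s] in \<open>auto elim!: eventually_mono simp: indicator_def\<close>)
  also have "\<dots> = ?P s - ?P r"
    by (rule integral_FTC_Icc_real[OF r(2)])
      (use r D in \<open>auto intro!: continuous_intros\<close>)
  also have "\<dots> \<le> 1 / ((real N - 2) * r ^ (N - 2))" using r N by simp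
  finally show "J \<le> 1 / ((real N - 2) * r ^ (N - 2))" .
qed

lemma open_AE_imp_all:
  fixes S :: "real set"
  assumes "open S" "AE r in lborel. r \<notin> S" shows "S = {}"
proof (rule ccontr)
  assume "S \<noteq> {}"
  then have "\<not> negligible S" using open_not_negligible assms by blast
  moreover have "S \<in> null_sets lborel" using assms by (subst AE_iff_null_sets) auto
  ultimately show False by (simp add: negligible_iff_null_sets null_sets_completionI)
qed

lemma continuous_AE_eq:
  fixes f g :: "real \<Rightarrow> real"
  assumes f: "continuous_on {0<..} f" and g: "continuous_on {0<..} g"
    and AE: "AE r in lborel. r > 0 \<longrightarrow> f r = g r" and r: "r > 0"
  shows "f r = g r"
proof -
  have "open ({0<..} \<inter> (\<lambda>r. f r - g r) -` (- {0}))"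
    by (rule continuous_open_preimage) (auto intro: continuous_on_diff f g)
  moreover have "AE r in lborel. r \<notin> {0<..} \<inter> (\<lambda>r. f r - g r) -` (- {0})"
    using AE by eventually_elim auto
  ultimately have "{0<..} \<inter> (\<lambda>r. f r - g r) -` (- {0}) = {}" by (rule open_AE_imp_all)
  then show ?thesis using r by auto
qed

section \<open>Profiles of radial functions\<close>

text \<open>The value 0 at nonpositive arguments is a normalisation: it turns continuity on the open
  half line into Borel measurability on the whole line.\<close>

definition profile :: "(real^'n::finite \<Rightarrow> real) \<Rightarrow> (real \<Rightarrow> real) \<Rightarrow> bool" where
  "profile u F \<longleftrightarrow> continuous_on {0<..} F \<and> (\<forall>r\<le>0. F r = 0) \<and> (AE x in lebesgue. u x = F (norm x))"

lemma borel_measurable_pos_continuous: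
  assumes "continuous_on {0<..} (F::real \<Rightarrow> real)" "\<And>r. r \<le> 0 \<Longrightarrow> F r = 0"
  shows "F \<in> borel_measurable borel"
proof -
  have "(\<lambda>r. indicator {0<..} r *\<^sub>R F r) \<in> borel_measurable borel"
    by (rule borel_measurable_continuous_on_indicator) (use assms in auto)
  moreover have "(\<lambda>r. indicator {0<..} r *\<^sub>R F r) = F" using assms by (intro ext) (auto simp: indicator_def not_less)
  ultimately show ?thesis by simp
qed

lemma profile_borel: "profile u F \<Longrightarrow> F \<in> borel_measurable borel"
  unfolding profile_def by (intro borel_measurable_pos_continuous) auto

lemma AE_norm_pos: "AE x::real^'n::finite in lborel. norm x > 0"
  using AE_lborel_singleton[of "0::real^'n"] by eventually_elim simp

lemma integrable_radial_lebesgue: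
  fixes w :: "real^'n::finite \<Rightarrow> real"
  assumes h: "h \<in> borel_measurable borel" and AE: "AE x in lebesgue. w x = h (norm x)" and w: "w \<in> borel_measurable lebesgue"
  shows "integrable lebesgue w \<longleftrightarrow> integrable lborel (\<lambda>r. indicator {0..} r * (sph_area TYPE('n) * r ^ (CARD('n) - 1)) * h r)"
    and "(\<integral>x. w x \<partial>lebesgue) = (\<integral>r. indicator {0..} r * (sph_area TYPE('n) * r ^ (CARD('n) - 1)) * h r \<partial>lborel)"
proof -
  note [measurable] = h w
  have m: "(\<lambda>x::real^'n. h (norm x)) \<in> borel_measurable borel" by simp
  have "integrable lebesgue w \<longleftrightarrow> integrable lebesgue (\<lambda>x::real^'n. h (norm x))"
    by (rule integrable_cong_AE[OF w _ AE]) (simp add: measurable_completion)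
  also have "\<dots> \<longleftrightarrow> integrable lborel (\<lambda>x::real^'n. h (norm x))" by (simp add: integrable_completion)
  finally show "integrable lebesgue w \<longleftrightarrow> integrable lborel (\<lambda>r. indicator {0..} r * (sph_area TYPE('n) * r ^ (CARD('n) - 1)) * h r)"
    using integrable_radial_iff[OF h, where 'n='n] by simp
  have "(\<integral>x. w x \<partial>lebesgue) = (\<integral>x. h (norm x) \<partial>(lebesgue :: (real^'n) measure))"
    by (rule integral_cong_AE[OF w _ AE]) (simp add: measurable_completion)
  also have "\<dots> = (\<integral>x. h (norm x) \<partial>(lborel :: (real^'n) measure))" by (simp add: integral_completion)
  finally show "(\<integral>x. w x \<partial>lebesgue) = (\<integral>r. indicator {0..} r * (sph_area TYPE('n) * r ^ (CARD('n) - 1)) * h r \<partial>lborel)"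
    using integral_radial[OF h, where 'n='n] by simp
qed

text \<open>Test the i-th weak derivative with h(|x|^2) x_i, where h(r^2) = q(r) / r^N, and sum over
  i. The divergence of this field is q'(r) / r^(N-1), and its product with g is the radial component
  of g times q / r^(N-1).\<close>

lemma radial_weak_derivative:
  fixes u :: "real^'n::finite \<Rightarrow> real"
  assumes g: "L2grad u g" and q: "smooth UNIV q" "0 < a" "a < b" "\<And>r. r \<notin> {a..b} \<Longrightarrow> q r = 0"
  shows "(\<integral>x. u x * (deriv q (norm x) / norm x ^ (CARD('n) - 1)) \<partial>lebesgue) =
     - (\<integral>x. (g x \<bullet> x) / norm x ^ CARD('n) * q (norm x) \<partial>lebesgue)" (is ?eq)
    and "integrable lebesgue (\<lambda>x. (g x \<bullet> x) / norm x ^ CARD('n) * q (norm x))"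
proof -
  obtain h where h: "smooth UNIV h" "\<And>t. t < a\<^sup>2 \<Longrightarrow> h t = 0" "\<And>t. t > b\<^sup>2 \<Longrightarrow> h t = 0"
    "\<And>r. r > 0 \<Longrightarrow> h (r\<^sup>2) = q r / r ^ CARD('n)"
    "\<And>r. r > 0 \<Longrightarrow> 2 * r * deriv h (r\<^sup>2) = deriv q r / r ^ CARD('n) - real CARD('n) * q r / r ^ (CARD('n) + 1)"
    using radial_test_profile[OF q, of "CARD('n)"] by blast
  have t0: "test_fun (\<lambda>x::real^'n. h ((norm x)\<^sup>2))" by (rule test_fun_radial[OF h(1,3)])
  define \<phi> where "\<phi> i x = h ((norm x)\<^sup>2) * x $ i" for i and x :: "real^'n"
  have t: "test_fun (\<phi> i)" for i unfolding \<phi>_def[abs_def] by (rule test_fun_mult[OF t0 C_inf_component])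
  have pd: "pdiff i (\<phi> i) x = 2 * deriv h ((norm x)\<^sup>2) * (x $ i * x $ i) + h ((norm x)\<^sup>2)" for i x
    unfolding \<phi>_def[abs_def]
    by (subst pdiff_mult[OF test_fun_C_inf[OF t0] C_inf_component])
      (simp add: pdiff_radial[OF h(1)] pdiff_component)
  have wg: "integrable lebesgue (\<lambda>x. u x * pdiff i (\<phi> i) x)" "integrable lebesgue (\<lambda>x. g x $ i * \<phi> i x)"
    "(\<integral>x. u x * pdiff i (\<phi> i) x \<partial>lebesgue) = - (\<integral>x. g x $ i * \<phi> i x \<partial>lebesgue)" for i
    using g t[of i] by (auto simp: L2grad_def weak_grad_def)
  have comp: "(\<Sum>i\<in>UNIV. g x $ i * \<phi> i x) = (g x \<bullet> x) / norm x ^ CARD('n) * q (norm x)" for x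
  proof (cases "x = 0")
    case False
    then show ?thesis using h(4)[of "norm x"]
      by (simp add: \<phi>_def inner_vec_def sum_distrib_left sum_distrib_right sum_divide_distrib mult_ac)
  qed (simp add: \<phi>_def)
  have "u x * (deriv q (norm x) / norm x ^ (CARD('n) - 1)) = (\<Sum>i\<in>UNIV. u x * pdiff i (\<phi> i) x)" for x
  proof (cases "x = 0")
    case True
    have "deriv q 0 = 0" by (rule deriv_eq_0_if_locally_zero[of "{..<a}"]) (use q in auto)
    moreover have "pdiff i (\<phi> i) x = 0" for i using True pd[of i x] h(2)[of 0] q by simp
    ultimately show ?thesis using True by simp
  next
    case False
    let ?r = "norm x" obtain m where m: "CARD('n) = Suc m" using not0_implies_Suc[of "CARD('n)"] by auto
    have "(\<Sum>i\<in>UNIV. pdiff i (\<phi> i) x) = 2 * deriv h (?r\<^sup>2) * (\<Sum>i\<in>UNIV. x $ i * x $ i) + real CARD('n) * h (?r\<^sup>2)"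
      unfolding pd by (simp add: sum.distrib sum_distrib_left)
    also have "\<dots> = ?r * (2 * ?r * deriv h (?r\<^sup>2)) + real CARD('n) * h (?r\<^sup>2)"
      unfolding norm_sq_eq_sum[symmetric] by (simp add: power2_eq_square)
    also have "\<dots> = deriv q ?r / ?r ^ (CARD('n) - 1)"
      using False unfolding h(4,5)[OF False[folded zero_less_norm_iff]] m
      by (simp add: field_simps)
    finally show ?thesis by (simp add: sum_distrib_left[symmetric])
  qed
  then have "(\<integral>x. u x * (deriv q (norm x) / norm x ^ (CARD('n) - 1)) \<partial>lebesgue) = (\<Sum>i\<in>UNIV. \<integral>x. u x * pdiff i (\<phi> i) x \<partial>lebesgue)"
    using wg by simp
  also have "\<dots> = - (\<integral>x. (\<Sum>i\<in>UNIV. g x $ i * \<phi> i x) \<partial>lebesgue)"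
    using wg by (simp add: sum_negf)
  also have "(\<integral>x. (\<Sum>i\<in>UNIV. g x $ i * \<phi> i x) \<partial>lebesgue) = (\<integral>x. (g x \<bullet> x) / norm x ^ CARD('n) * q (norm x) \<partial>lebesgue)"
    by (simp only: comp)
  finally show ?eq .
  have "integrable lebesgue (\<lambda>x. \<Sum>i\<in>UNIV. g x $ i * \<phi> i x)" using wg by simp
  then show "integrable lebesgue (\<lambda>x. (g x \<bullet> x) / norm x ^ CARD('n) * q (norm x))" by (simp only: comp)
qed

text \<open>Cauchy-Schwarz for |g| against the weight |x|^(1-N) on the annulus; in polar coordinates
  the square of this weight leaves t^(1-N).\<close>

lemma radial_gradient_annulus:
  fixes g :: "real^'n::finite \<Rightarrow> real^'n"
  assumes N: "CARD('n) \<ge> 3" and g: "L2grad u g" and r: "0 < r" "r \<le> s"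
  shows "integrable lebesgue (\<lambda>x. indicator {r..<s} (norm x) * ((g x \<bullet> x) / norm x ^ CARD('n)))"
    and "(\<integral>x. indicator {r..<s} (norm x) * ((g x \<bullet> x) / norm x ^ CARD('n)) \<partial>lebesgue)\<^sup>2
      \<le> dirichlet u * (sph_area TYPE('n) * (\<integral>t. indicator {r..<s} t / t ^ (CARD('n) - 1) \<partial>lborel))"
proof -
  let ?N = "CARD('n)" let ?J = "\<integral>t. indicator {r..<s} t / t ^ (?N - 1) \<partial>lborel"
  have gm [measurable]: "g \<in> borel_measurable lebesgue" using g by (simp add: L2grad_def)
  have [measurable]: "norm \<in> borel_measurable (lebesgue :: (real^'n) measure)" "(\<lambda>x. x) \<in> lebesgue \<rightarrow>\<^sub>M (borel :: (real^'n) measure)"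
    by (simp_all add: measurable_completion)
  have [measurable]: "(\<lambda>x. indicator {r..<s} (norm x) / norm x ^ (?N - 1) :: real) \<in> borel_measurable (lebesgue :: (real^'n) measure)"
    by (intro measurable_completion) simp
  let ?h = "\<lambda>x::real^'n. indicator {r..<s} (norm x) / norm x ^ (?N - 1) :: real"
  let ?k = "\<lambda>t. (indicator {r..<s} t / t ^ (?N - 1) :: real)\<^sup>2"
  have eq: "indicator {0..} t * (sph_area TYPE('n) * t ^ (?N - 1)) * ?k t = sph_area TYPE('n) * (indicator {r..<s} t / t ^ (?N - 1))" for t
    using r by (auto simp: indicator_def power2_eq_square)
  have "integrable lebesgue (\<lambda>x. (?h x)\<^sup>2) \<longleftrightarrow> integrable lborel (\<lambda>t. sph_area TYPE('n) * (indicator {r..<s} t / t ^ (?N - 1)))"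
    unfolding eq[symmetric] by (rule integrable_radial_lebesgue(1)) auto
  moreover have "(\<integral>x. (?h x)\<^sup>2 \<partial>lebesgue) = (\<integral>t. sph_area TYPE('n) * (indicator {r..<s} t / t ^ (?N - 1)) \<partial>lborel)"
    unfolding eq[symmetric] by (rule integrable_radial_lebesgue(2)) auto
  ultimately have ih: "integrable lebesgue (\<lambda>x. (?h x)\<^sup>2)" "(\<integral>x. (?h x)\<^sup>2 \<partial>lebesgue) = sph_area TYPE('n) * ?J"
    using power_integral_bounds(1)[OF r N] by (simp_all del: times_divide_eq_right)
  have ig: "integrable lebesgue (\<lambda>x. (norm (g x))\<^sup>2)" using g by (simp add: L2grad_def)
  have CS: "integrable lebesgue (\<lambda>x. norm (g x) * ?h x)"
    "(\<integral>x. \<bar>norm (g x) * ?h x\<bar> \<partial>lebesgue)\<^sup>2 \<le> (\<integral>x. (norm (g x))\<^sup>2 \<partial>lebesgue) * (\<integral>x. (?h x)\<^sup>2 \<partial>lebesgue)"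
    using Cauchy_Schwarz_integral(1,2)[OF _ _ ig ih(1)] by auto
  have le: "\<bar>indicator {r..<s} (norm x) * ((g x \<bullet> x) / norm x ^ ?N)\<bar> \<le> norm (g x) * ?h x" for x
  proof (cases "norm x \<in> {r..<s}")
    case True
    then have "r \<le> norm x" by simp
    then have "norm x > 0" using r(1) by linarith
    obtain m where m: "?N = Suc m" using not0_implies_Suc[of ?N] by auto
    have "\<bar>g x \<bullet> x\<bar> / norm x ^ ?N \<le> norm (g x) * norm x / norm x ^ ?N"
      by (intro divide_right_mono Cauchy_Schwarz_ineq2) auto
    also have "\<dots> = norm (g x) / norm x ^ (?N - 1)" using \<open>norm x > 0\<close> unfolding m by (simp add: field_simps)
    finally show ?thesis using True by (simp add: abs_mult)
  qed simp
  show i: "integrable lebesgue (\<lambda>x. indicator {r..<s} (norm x) * ((g x \<bullet> x) / norm x ^ ?N))"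
    by (rule Bochner_Integration.integrable_bound[OF CS(1)]) (use le in \<open>auto intro: order_trans[OF _ abs_ge_self]\<close>)
  have "\<bar>\<integral>x. indicator {r..<s} (norm x) * ((g x \<bullet> x) / norm x ^ ?N) \<partial>lebesgue\<bar>
      \<le> (\<integral>x. \<bar>indicator {r..<s} (norm x) * ((g x \<bullet> x) / norm x ^ ?N)\<bar> \<partial>lebesgue)" by (rule integral_abs_bound)
  also have "\<dots> \<le> (\<integral>x. \<bar>norm (g x) * ?h x\<bar> \<partial>lebesgue)"
    by (rule integral_mono[OF integrable_abs[OF i] integrable_abs[OF CS(1)] order_trans[OF le abs_ge_self]])
  finally have ab: "\<bar>\<integral>x. indicator {r..<s} (norm x) * ((g x \<bullet> x) / norm x ^ ?N) \<partial>lebesgue\<bar> \<le> (\<integral>x. \<bar>norm (g x) * ?h x\<bar> \<partial>lebesgue)" .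
  have "(\<integral>x. indicator {r..<s} (norm x) * ((g x \<bullet> x) / norm x ^ ?N) \<partial>lebesgue)\<^sup>2 \<le> (\<integral>x. \<bar>norm (g x) * ?h x\<bar> \<partial>lebesgue)\<^sup>2"
    using power_mono[OF ab abs_ge_zero, of 2] by (simp only: power2_abs)
  also note CS(2)
  finally show "(\<integral>x. indicator {r..<s} (norm x) * ((g x \<bullet> x) / norm x ^ ?N) \<partial>lebesgue)\<^sup>2
      \<le> dirichlet u * (sph_area TYPE('n) * ?J)"
    unfolding ih(2) dirichlet_eq[OF g] .
qed

text \<open>Away from 0 the weight r^(N-1) is bounded below and may be removed from the integral
  over the annulus.\<close>

lemma integrable_annulus_profile:
  fixes u :: "real^'n::finite \<Rightarrow> real"
  assumes u: "u \<in> borel_measurable lebesgue" "integrable lebesgue (\<lambda>x. (u x)\<^sup>2)"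
    and F: "F \<in> borel_measurable borel" "AE x in lebesgue. u x = F (norm x)" and a: "0 < a"
  shows "integrable lborel (\<lambda>r. indicator {a..b} r * F r)"
proof -
  let ?N = "CARD('n)" let ?S = "{x::real^'n. norm x \<in> {a..b}}"
  note [measurable] = u(1) F(1)
  have S [measurable]: "?S \<in> sets lebesgue"
    by (rule sets_completionI_sets) simp
  have "integrable lebesgue (\<lambda>x. indicator ?S x *\<^sub>R (indicator (cball 0 b) x * u x))"
    by (rule integrable_mult_indicator[OF S integrable_cball_L2[OF u]])
  moreover have "(\<lambda>x. indicator ?S x *\<^sub>R (indicator (cball 0 b) x * u x)) = (\<lambda>x. indicator ?S x * u x)"
    by (auto split: split_indicator)
  ultimately have iu: "integrable lebesgue (\<lambda>x. indicator ?S x * u x)" by simp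
  have AE: "AE x in lebesgue. indicator ?S x * u x = indicator {a..b} (norm x) * F (norm x)"
    using F(2) by eventually_elim (auto split: split_indicator)
  have i: "integrable lborel (\<lambda>r. indicator {0..} r * (sph_area TYPE('n) * r ^ (?N - 1)) * (indicator {a..b} r * F r))"
    using iu by (subst (asm) integrable_radial_lebesgue(1)[OF _ AE borel_measurable_integrable[OF iu]]) auto
  show ?thesis
  proof (rule Bochner_Integration.integrable_bound[OF integrable_mult_right[OF i, of "1 / (sph_area TYPE('n) * a ^ (?N - 1))"]])
    show "AE r in lborel. norm (indicator {a..b} r * F r) \<le> norm (1 / (sph_area TYPE('n) * a ^ (?N - 1)) * (indicator {0..} r * (sph_area TYPE('n) * r ^ (?N - 1)) * (indicator {a..b} r * F r)))"
    proof (rule AE_I2)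
      fix r
      show "norm (indicator {a..b} r * F r) \<le> norm (1 / (sph_area TYPE('n) * a ^ (?N - 1)) * (indicator {0..} r * (sph_area TYPE('n) * r ^ (?N - 1)) * (indicator {a..b} r * F r)))"
      proof (cases "r \<in> {a..b}")
        case True
        have c: "sph_area TYPE('n) > 0" by simp
        have "a ^ (?N - 1) \<le> r ^ (?N - 1)" using True a by (intro power_mono) auto
        then have "1 \<le> r ^ (?N - 1) / a ^ (?N - 1)" using a by simp
        then have "\<bar>F r\<bar> * 1 \<le> \<bar>F r\<bar> * (r ^ (?N - 1) / a ^ (?N - 1))" by (intro mult_left_mono) auto
        also have "\<dots> = norm (1 / (sph_area TYPE('n) * a ^ (?N - 1)) * (indicator {0..} r * (sph_area TYPE('n) * r ^ (?N - 1)) * (indicator {a..b} r * F r)))"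
          using True a c by (simp add: abs_mult)
        finally show ?thesis using True by simp
      qed simp
    qed
  qed simp
qed

lemma holder_continuous_on_pos:
  fixes A :: "real \<Rightarrow> real"
  assumes H: "\<And>r s. 0 < r \<Longrightarrow> r \<le> s \<Longrightarrow> (A s - A r)\<^sup>2 \<le> K * ((s - r) / r ^ k)" and K: "K \<ge> 0"
  shows "continuous_on {0<..} A"
proof (rule continuous_at_imp_continuous_on, rule ballI)
  fix r :: real assume "r \<in> {0<..}" then have r: "r > 0" by simp
  \<comment> \<open>On s > r/2 this constant serves whichever of r and s is the smaller one.\<close>
  define L where "L = K / (r/2) ^ k"
  have b: "\<bar>A s - A r\<bar> \<le> sqrt (L * \<bar>s - r\<bar>)" if "s > r/2" for s
  proof -
    let ?l = "min r s" let ?m = "max r s"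
    have lm: "0 < ?l" "?l \<le> ?m" using that r by auto
    have "(A s - A r)\<^sup>2 = (A ?m - A ?l)\<^sup>2" by (auto simp: max_def min_def power2_commute)
    also have "\<dots> \<le> K * ((?m - ?l) / ?l ^ k)" by (rule H[OF lm])
    also have "\<dots> \<le> K * ((?m - ?l) / (r/2) ^ k)"
      using that r K by (intro mult_left_mono divide_left_mono power_mono mult_pos_pos zero_less_power) auto
    also have "\<dots> = L * \<bar>s - r\<bar>" by (auto simp: L_def max_def min_def)
    finally show ?thesis by (metis real_sqrt_abs real_sqrt_le_iff)
  qed
  have lim0: "((\<lambda>s. sqrt (L * \<bar>s - r\<bar>)) \<longlongrightarrow> 0) (at r)"
    by (rule tendsto_eq_intros refl | simp)+
  have "((\<lambda>s. A s - A r) \<longlongrightarrow> 0) (at r)"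
  proof (rule Lim_null_comparison[OF _ lim0])
    have "eventually (\<lambda>s. s \<in> {r/2<..}) (at r)" by (rule eventually_at_in_open') (use r in auto)
    then show "\<forall>\<^sub>F s in at r. norm (A s - A r) \<le> sqrt (L * \<bar>s - r\<bar>)"
      by eventually_elim (use b in auto)
  qed
  then show "isCont A r" by (simp add: isCont_def LIM_zero_iff)
qed

lemma holder_limit_continuous:
  fixes A :: "real \<Rightarrow> real"
  assumes H: "\<And>n r s. 0 < r \<Longrightarrow> r \<le> s \<Longrightarrow> (F n s - F n r)\<^sup>2 \<le> K * ((s - r) / r ^ k)" and K: "K \<ge> 0"
    and lim: "\<And>r. r > 0 \<Longrightarrow> (\<lambda>n. F n r) \<longlonglongrightarrow> A r"
  shows "continuous_on {0<..} A"
proof (rule holder_continuous_on_pos[OF _ K])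
  fix r s :: real assume rs: "0 < r" "r \<le> s"
  have "(\<lambda>n. (F n s - F n r)\<^sup>2) \<longlonglongrightarrow> (A s - A r)\<^sup>2" using rs by (intro tendsto_intros lim) auto
  then show "(A s - A r)\<^sup>2 \<le> K * ((s - r) / r ^ k)"
    by (rule LIMSEQ_le_const2) (use H[OF rs] in auto)
qed

text \<open>Integrals of the radial derivative over annuli define a Hoelder continuous function A.
  By Fubini, \<open>sph_area\<close> times the measurable profile minus A has weak derivative zero,
  so the profile is, up to that factor, A plus a constant and inherits its modulus of
  continuity.\<close>

lemma radial_H1_fundamental:
  fixes u :: "real^'n::finite \<Rightarrow> real"
  assumes N: "CARD('n) \<ge> 3" and u: "H1 u" and rad: "radial u"
  obtains F where "profile u F"
    "\<And>r s. 0 < r \<Longrightarrow> r \<le> s \<Longrightarrow> (F s - F r)\<^sup>2 \<le>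
        dirichlet u / sph_area TYPE('n) * (\<integral>t. indicator {r..<s} t / t ^ (CARD('n) - 1) \<partial>lborel)"
proof -
  let ?N = "CARD('n)" let ?c = "sph_area TYPE('n)"
  define g where "g = wgrad u"
  have g: "L2grad u g" using H1_L2grad[OF u] by (simp add: g_def)
  have um: "u \<in> borel_measurable lebesgue" and u2: "integrable lebesgue (\<lambda>x. (u x)\<^sup>2)" using u by (auto simp: H1_def)
  obtain F0 where F0m: "F0 \<in> borel_measurable borel" and F0: "AE x in lebesgue. u x = F0 (norm x)"
    using radial_borel_profile[OF um rad] by blast
  define G where "G x = (g x \<bullet> x) / norm x ^ ?N" for x
  \<comment> \<open>A signed integral over the annulus between radii 1 and t, so that differences of
    A are integrals over annuli. Starting at radius 1 avoids the singularity at 0.\<close>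
  define A where "A t = (if t > 0 then (\<integral>x. (indicator {1..<t} (norm x) - indicator {t..<1} (norm x)) * G x \<partial>lebesgue) else 0)" for t
  have iG: "integrable lebesgue (\<lambda>x. indicator {r..<s} (norm x) * G x)" if "0 < r" for r s
  proof (cases "r \<le> s")
    case True show ?thesis unfolding G_def by (rule radial_gradient_annulus[OF N g that True])
  qed simp
  have Adiff: "A s - A r = (\<integral>x. indicator {r..<s} (norm x) * G x \<partial>lebesgue)" if "0 < r" "r \<le> s" for r s
  proof -
    have i: "integrable lebesgue (\<lambda>x. (indicator {1..<t} (norm x) - indicator {t..<1} (norm x)) * G x)" if "t > 0" for t
      using iG[of 1 t] iG[of t 1] that by (simp add: left_diff_distrib)
    have "A s - A r = (\<integral>x. (indicator {1..<s} (norm x) - indicator {s..<1} (norm x)) * G x - (indicator {1..<r} (norm x) - indicator {r..<1} (norm x)) * G x \<partial>lebesgue)"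
      using that i[of s] i[of r] by (simp add: A_def)
    also have "\<dots> = (\<integral>x. indicator {r..<s} (norm x) * G x \<partial>lebesgue)"
      by (intro Bochner_Integration.integral_cong) (use that in \<open>auto split: split_indicator\<close>)
    finally show ?thesis .
  qed
  let ?J = "\<lambda>r s. \<integral>t. indicator {r..<s} t / t ^ (?N - 1) \<partial>lborel"
  have Ahold: "(A s - A r)\<^sup>2 \<le> dirichlet u * (?c * ?J r s)" if "0 < r" "r \<le> s" for r s
    unfolding Adiff[OF that] G_def by (rule radial_gradient_annulus(2)[OF N g that])
  have Acont: "continuous_on {0<..} A"
  proof (rule holder_continuous_on_pos)
    fix r s :: real assume rs: "0 < r" "r \<le> s"
    have "dirichlet u * (?c * ?J r s) \<le> dirichlet u * (?c * ((s - r) / r ^ (?N - 1)))"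
      using power_integral_bounds(3)[OF rs N] by (intro mult_left_mono) (auto simp: dirichlet_nonneg less_imp_le)
    with Ahold[OF rs] show "(A s - A r)\<^sup>2 \<le> (dirichlet u * ?c) * ((s - r) / r ^ (?N - 1))" by (simp add: mult.assoc)
  qed (simp add: dirichlet_nonneg)
  have Am [measurable]: "A \<in> borel_measurable borel"
    by (rule borel_measurable_pos_continuous[OF Acont]) (simp add: A_def)
  note [measurable] = F0m um
  have Aint: "integrable lborel (\<lambda>r. indicator {a..b} r * A r)" if "0 < a" for a b
    using borel_integrable_compact[of "{a..b}" A] continuous_on_subset[OF Acont, of "{a..b}"] that by (auto simp: subset_eq)
  have key: "(\<integral>r. (?c * F0 r - A r) * deriv q r \<partial>lborel) = 0"
    if q: "0 < a" "a < b" "smooth UNIV q" "\<And>r. r \<notin> {a..b} \<Longrightarrow> q r = 0" for q a b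
  proof -
    have dq0: "deriv q r = 0" if "r \<notin> {a..b}" for r
      by (rule deriv_eq_0_if_locally_zero[of "- {a..b}"]) (use q that in auto)
    have dqc: "continuous_on UNIV (deriv q)" by (rule smooth_continuous_on[OF smooth_deriv[OF q(3)]])
    have [measurable]: "deriv q \<in> borel_measurable borel" "q \<in> borel_measurable borel"
      using dqc smooth_continuous_on[OF q(3)] by (auto intro: borel_measurable_continuous_onI)
    have FTC: "(\<integral>t. deriv q t * indicator {0..r} t \<partial>lborel) = q r" if "0 \<le> r" for r
      using integral_FTC_Icc_real[OF that, of q "deriv q"] smooth_DERIV[OF q(3)] smooth_isCont[OF smooth_deriv[OF q(3)]] q(1) q(4)[of 0]
      by auto
    have idq: "integrable lborel (deriv q)"
    proof -
      have "integrable lborel (\<lambda>x. indicator {a..b} x *\<^sub>R deriv q x)"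
        by (rule borel_integrable_compact) (use continuous_on_subset[OF dqc] in auto)
      moreover have "(\<lambda>x. indicator {a..b} x *\<^sub>R deriv q x) = deriv q" using dq0 by (auto split: split_indicator)
      ultimately show ?thesis by simp
    qed
    have int_dq: "(\<integral>t. deriv q t \<partial>lborel) = 0"
    proof -
      have "(\<integral>t. deriv q t \<partial>lborel) = (\<integral>t. deriv q t * indicator {0..b+1} t \<partial>lborel)"
        by (intro Bochner_Integration.integral_cong) (use q dq0 in \<open>auto split: split_indicator\<close>)
      also have "\<dots> = 0" using FTC[of "b+1"] q by simp
      finally show ?thesis .
    qed
    \<comment> \<open>With the larger radius the half-open annulus contains the closed support of
      q.\<close>
    let ?b = "b + 1"
    let ?E = "\<lambda>x. indicator {a..<?b} (norm x) * G x"
    \<comment> \<open>Fubini is applied on the Borel product space, hence to a Borel representative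
      of the truncated integrand.\<close>
    obtain B where Bm [measurable]: "B \<in> borel_measurable borel" and B: "AE x in lborel. ?E x = B x"
      using completion_ex_borel_measurable_real[OF borel_measurable_integrable[OF iG[OF q(1), of ?b]]] by auto
    have B': "AE x in lebesgue. ?E x = B x" using B by (simp add: AE_completion_iff)
    have iB: "integrable lborel B"
    proof -
      have "integrable lebesgue B"
        by (rule integrable_cong_AE_imp[OF iG[OF q(1), of ?b]]) (use B' Bm in \<open>auto simp: measurable_completion\<close>)
      then show ?thesis by (simp add: integrable_completion)
    qed
    have P: "pair_sigma_finite (lborel :: (real^'n) measure) (lborel :: real measure)"
      by unfold_locales
    let ?f = "\<lambda>(x::real^'n, t::real). B x * (deriv q t * indicator {0..norm x} t)"
    have i0: "integrable (lborel \<Otimes>\<^sub>M lborel) (\<lambda>(x::real^'n, t::real). B x * deriv q t)"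
    proof (rule pair_sigma_finite.Fubini_integrable[OF P])
      show "integrable lborel (\<lambda>x. \<integral>t. norm (case (x, t) of (x, t) \<Rightarrow> B x * deriv q t) \<partial>lborel)"
        using iB by (simp add: abs_mult)
    qed (use idq in auto)
    have "(\<lambda>(x::real^'n, t::real). indicator {0..norm x} t :: real) =
        (\<lambda>p. if 0 \<le> snd p \<and> snd p \<le> norm (fst p) then 1 else 0)"
      by (auto split: split_indicator)
    then have [measurable]: "(\<lambda>(x::real^'n, t::real). indicator {0..norm x} t :: real) \<in> borel_measurable (lborel \<Otimes>\<^sub>M lborel)"
      by simp
    have "(\<lambda>(x::real^'n, t::real). B x * deriv q t * (case (x, t) of (x, t) \<Rightarrow> indicator {0..norm x} t)) \<in> borel_measurable (lborel \<Otimes>\<^sub>M lborel)"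
      by measurable
    then have [measurable]: "?f \<in> borel_measurable (lborel \<Otimes>\<^sub>M lborel)" by (simp add: case_prod_beta mult.assoc)
    have ifi: "integrable (lborel \<Otimes>\<^sub>M lborel) ?f"
      by (rule Bochner_Integration.integrable_bound[OF i0]) (auto simp: abs_mult split: split_indicator)
    have "(\<integral>x. G x * q (norm x) \<partial>lebesgue) = (\<integral>x. B x * q (norm x) \<partial>lebesgue)"
    proof (rule integral_cong_AE)
      have eq: "G x * q (norm x) = ?E x * q (norm x)" for x using q(4) by (auto split: split_indicator)
      show "AE x in lebesgue. G x * q (norm x) = B x * q (norm x)"
        using B' by eventually_elim (simp add: eq)
      have "(\<lambda>x. ?E x * q (norm x)) \<in> borel_measurable lebesgue"
        by (intro borel_measurable_times borel_measurable_integrable[OF iG[OF q(1)]] measurable_completion) simp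
      then show "(\<lambda>x. G x * q (norm x)) \<in> borel_measurable lebesgue" by (simp only: eq)
    qed (auto intro: measurable_completion)
    also have "\<dots> = (\<integral>x. B x * q (norm x) \<partial>lborel)" by (rule integral_completion) simp
    \<comment> \<open>q(|x|) is the integral of q' from 0 to |x|. After exchanging the order, each t
      sees the integral of G over the annulus outside radius t.\<close>
    also have "\<dots> = (\<integral>x. (\<integral>t. ?f (x, t) \<partial>lborel) \<partial>lborel)" using FTC by simp
    also have "\<dots> = (\<integral>t. (\<integral>x. ?f (x, t) \<partial>lborel) \<partial>lborel)" using pair_sigma_finite.Fubini_integral[OF P ifi] by simp
    also have "\<dots> = (\<integral>t. deriv q t * (A ?b - indicator {a..b} t * A t) \<partial>lborel)"
    proof (rule Bochner_Integration.integral_cong)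
      fix t :: real
      show "(\<integral>x. ?f (x, t) \<partial>lborel) = deriv q t * (A ?b - indicator {a..b} t * A t)"
      proof (cases "t \<in> {a..b}")
        case True
        then have t: "0 < t" "t \<le> ?b" using q by auto
        have "(\<integral>x. ?f (x, t) \<partial>lborel) = deriv q t * (\<integral>x. B x * indicator {0..norm x} t \<partial>lborel)"
          by (subst integral_mult_right_zero[symmetric]) (simp add: mult.left_commute)
        also have "(\<integral>x. B x * indicator {0..norm x} t \<partial>lborel) = (\<integral>x. B x * indicator {0..norm x} t \<partial>lebesgue)"
          by (rule integral_completion[symmetric]) simp
        also have "\<dots> = (\<integral>x. indicator {t..<?b} (norm x) * G x \<partial>lebesgue)"
        proof (rule integral_cong_AE)
          show "(\<lambda>x. B x * indicator {0..norm x} t) \<in> borel_measurable lebesgue" by (intro measurable_completion) simp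
          show "(\<lambda>x. indicator {t..<?b} (norm x) * G x) \<in> borel_measurable lebesgue" by (rule borel_measurable_integrable[OF iG[OF t(1)]])
          show "AE x in lebesgue. B x * indicator {0..norm x} t = indicator {t..<?b} (norm x) * G x"
            using B'
          proof eventually_elim
            case (elim x)
            have "?E x * indicator {0..norm x} t = indicator {t..<?b} (norm x) * G x"
              using True q by (auto split: split_indicator)
            then show ?case by (simp only: elim)
          qed
        qed
        also have "\<dots> = A ?b - A t" by (rule Adiff[OF t, symmetric])
        finally show ?thesis using True by simp
      next
        case False
        then show ?thesis using dq0[OF False] by (simp add: case_prod_beta)
      qed
    qed simp
    also have "\<dots> = - (\<integral>t. deriv q t * A t \<partial>lborel)"
    proof -
      have eq: "deriv q t * (indicator {a..b} t * A t) = deriv q t * A t" for t using dq0 by (auto split: split_indicator)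
      have iqA: "integrable lborel (\<lambda>t. deriv q t * (indicator {a..b} t * A t))"
      proof -
        have "integrable lborel (\<lambda>t. indicator {a..b} t *\<^sub>R (deriv q t * A t))"
          by (rule borel_integrable_compact)
            (use q(1) in \<open>auto intro!: continuous_on_mult continuous_on_subset[OF dqc] continuous_on_subset[OF Acont]\<close>)
        then show ?thesis by (simp add: mult_ac)
      qed
      show ?thesis using iqA idq int_dq by (simp add: right_diff_distrib eq)
    qed
    finally have GA: "(\<integral>x. G x * q (norm x) \<partial>lebesgue) = - (\<integral>t. deriv q t * A t \<partial>lborel)" .
    have "(\<integral>x. u x * (deriv q (norm x) / norm x ^ (?N - 1)) \<partial>lebesgue) =
      (\<integral>r. indicator {0..} r * (?c * r ^ (?N - 1)) * (F0 r * (deriv q r / r ^ (?N - 1))) \<partial>lborel)"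
    proof (rule integrable_radial_lebesgue(2))
      show "AE x in lebesgue. u x * (deriv q (norm x) / norm x ^ (?N - 1)) = F0 (norm x) * (deriv q (norm x) / norm x ^ (?N - 1))"
        using F0 by eventually_elim simp
      show "(\<lambda>x. u x * (deriv q (norm x) / norm x ^ (?N - 1))) \<in> borel_measurable lebesgue"
        by (intro borel_measurable_times um measurable_completion) simp
    qed simp
    also have "\<dots> = (\<integral>r. ?c * F0 r * deriv q r \<partial>lborel)"
      by (intro Bochner_Integration.integral_cong) (use dq0 q in \<open>auto split: split_indicator\<close>)
    finally have "(\<integral>r. ?c * F0 r * deriv q r \<partial>lborel) = (\<integral>t. deriv q t * A t \<partial>lborel)"
      using radial_weak_derivative(1)[OF g q(3,1,2,4)] GA by (simp add: G_def)
    moreover have "integrable lborel (\<lambda>r. ?c * F0 r * deriv q r)"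
    proof -
      obtain M where M: "\<forall>r\<in>{a..b}. \<bar>deriv q r\<bar> \<le> M"
        using compact_imp_bounded[OF compact_continuous_image[OF continuous_on_subset[OF dqc], of "{a..b}"]]
        by (auto simp: bounded_iff)
      have "integrable lborel (\<lambda>r. (?c * M) * (indicator {a..b} r * F0 r))"
        by (intro integrable_mult_right integrable_annulus_profile[OF um u2 F0m F0 q(1)])
      then show ?thesis
      proof (rule Bochner_Integration.integrable_bound)
        have c: "?c > 0" by simp
        show "AE r in lborel. norm (?c * F0 r * deriv q r) \<le> norm ((?c * M) * (indicator {a..b} r * F0 r))"
        proof (rule AE_I2)
          fix r show "norm (?c * F0 r * deriv q r) \<le> norm ((?c * M) * (indicator {a..b} r * F0 r))"
          proof (cases "r \<in> {a..b}")
            case True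
            have "?c * \<bar>F0 r\<bar> * \<bar>deriv q r\<bar> \<le> ?c * \<bar>F0 r\<bar> * \<bar>M\<bar>"
              using M[rule_format, OF True] c by (intro mult_left_mono) auto
            then show ?thesis using True c by (simp add: abs_mult mult_ac)
          qed (simp add: dq0)
        qed
      qed simp
    qed
    moreover have "integrable lborel (\<lambda>r. A r * deriv q r)"
    proof -
      have "integrable lborel (\<lambda>t. indicator {a..b} t *\<^sub>R (A t * deriv q t))"
        by (rule borel_integrable_compact)
          (use q(1) in \<open>auto intro!: continuous_on_mult continuous_on_subset[OF dqc] continuous_on_subset[OF Acont]\<close>)
      moreover have "(\<lambda>t. indicator {a..b} t *\<^sub>R (A t * deriv q t)) = (\<lambda>t. A t * deriv q t)"
        using dq0 by (auto split: split_indicator)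
      ultimately show ?thesis by simp
    qed
    moreover have "(\<integral>t. deriv q t * A t \<partial>lborel) = (\<integral>t. A t * deriv q t \<partial>lborel)" by (simp add: mult.commute)
    ultimately show ?thesis by (simp add: left_diff_distrib)
  qed
  have "\<exists>k. AE r in lborel. r > 0 \<longrightarrow> ?c * F0 r - A r = k"
  proof (rule AE_const_if_weak_deriv_zero)
    show "integrable lborel (\<lambda>r. indicator {a..b} r * (?c * F0 r - A r))" if "0 < a" for a b
      using integrable_mult_right[OF integrable_annulus_profile[OF um u2 F0m F0 that, of b], of ?c] Aint[OF that, of b]
      by (simp add: right_diff_distrib mult.left_commute)
  qed (use key in auto)
  then obtain k where k: "AE r in lborel. r > 0 \<longrightarrow> ?c * F0 r - A r = k" by blast
  define F where "F r = (if r > 0 then (A r + k) / ?c else 0)" for r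
  have c: "?c > 0" by simp
  show ?thesis
  proof (rule that[of F])
    have "continuous_on {0<..} (\<lambda>r. (A r + k) / ?c)" by (intro continuous_intros Acont) (use c in auto)
    then have cF: "continuous_on {0<..} F" by (rule continuous_on_eq) (auto simp: F_def)
    have "AE x::real^'n in lborel. norm x > 0 \<longrightarrow> ?c * F0 (norm x) - A (norm x) = k" by (rule AE_norm[OF k])
    then have "AE x::real^'n in lborel. F0 (norm x) = F (norm x)"
      using AE_norm_pos by eventually_elim (use c in \<open>auto simp: F_def field_simps\<close>)
    then have "AE x::real^'n in lebesgue. F0 (norm x) = F (norm x)" by (simp add: AE_completion_iff)
    then have "AE x in lebesgue. u x = F (norm x)" using F0 by eventually_elim simp
    then show "profile u F" using cF by (auto simp: profile_def F_def)
    fix r s :: real assume rs: "0 < r" "r \<le> s"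
    have "(F s - F r)\<^sup>2 = (A s - A r)\<^sup>2 / ?c\<^sup>2" using rs by (simp add: F_def power_divide flip: diff_divide_distrib)
    also have "\<dots> \<le> dirichlet u * (?c * ?J r s) / ?c\<^sup>2" by (intro divide_right_mono Ahold rs) auto
    also have "\<dots> = dirichlet u / ?c * ?J r s" using c by (simp add: power2_eq_square)
    finally show "(F s - F r)\<^sup>2 \<le> dirichlet u / ?c * ?J r s" .
  qed
qed

text \<open>Three uses of one estimate for F(s) - F(r). Keeping s - r gives the Hoelder bound;
  averaging over s between r and r + 1 gives the decay at infinity through the full norm; s to
  infinity gives a bound by the Dirichlet energy alone, which controls the singularity at 0.\<close>

lemma radial_H1_profile:
  fixes u :: "real^'n::finite \<Rightarrow> real"
  assumes N: "CARD('n) \<ge> 3" and u: "H1 u" and rad: "radial u"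
  obtains F where "profile u F"
    "\<And>r s. 0 < r \<Longrightarrow> r \<le> s \<Longrightarrow> (F s - F r)\<^sup>2 \<le> dirichlet u / sph_area TYPE('n) * ((s - r) / r ^ (CARD('n) - 1))"
    "\<And>r. 0 < r \<Longrightarrow> (F r)\<^sup>2 * r ^ (CARD('n) - 1) \<le> 2 / sph_area TYPE('n) * ((\<integral>x. (u x)\<^sup>2 \<partial>lebesgue) + dirichlet u)"
    "\<And>r. 0 < r \<Longrightarrow> (F r)\<^sup>2 * r ^ (CARD('n) - 2) \<le> dirichlet u / (sph_area TYPE('n) * (real CARD('n) - 2))"
proof -
  let ?N = "CARD('n)" let ?c = "sph_area TYPE('n)" let ?D = "dirichlet u" let ?m = "\<integral>x. (u x)\<^sup>2 \<partial>lebesgue"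
  have c: "?c > 0" by simp
  obtain F where P: "profile u F" and H: "\<And>r s. 0 < r \<Longrightarrow> r \<le> s \<Longrightarrow> (F s - F r)\<^sup>2 \<le>
        ?D / ?c * (\<integral>t. indicator {r..<s} t / t ^ (?N - 1) \<partial>lborel)"
    using radial_H1_fundamental[OF N u rad] by blast
  have Fm [measurable]: "F \<in> borel_measurable borel" by (rule profile_borel[OF P])
  have H1: "(F s - F r)\<^sup>2 \<le> ?D / ?c * ((s - r) / r ^ (?N - 1))" if "0 < r" "r \<le> s" for r s
    by (rule order_trans[OF H[OF that] mult_left_mono[OF power_integral_bounds(3)[OF that N]]])
      (auto simp: dirichlet_nonneg less_imp_le)
  have H2: "(F s - F r)\<^sup>2 \<le> ?D / ?c * (1 / ((real ?N - 2) * r ^ (?N - 2)))" if "0 < r" "r \<le> s" for r s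
    by (rule order_trans[OF H[OF that] mult_left_mono[OF power_integral_bounds(4)[OF that N]]])
      (auto simp: dirichlet_nonneg less_imp_le)
  have um: "u \<in> borel_measurable lebesgue" and u2: "integrable lebesgue (\<lambda>x. (u x)\<^sup>2)" using u by (auto simp: H1_def)
  have AE2: "AE x in lebesgue. (u x)\<^sup>2 = (F (norm x))\<^sup>2" using P unfolding profile_def by (auto elim: eventually_mono)
  have iF: "integrable lborel (\<lambda>r. indicator {0..} r * (?c * r ^ (?N - 1)) * (F r)\<^sup>2)"
    and eF: "?m = (\<integral>r. indicator {0..} r * (?c * r ^ (?N - 1)) * (F r)\<^sup>2 \<partial>lborel)"
    using integrable_radial_lebesgue[where h="\<lambda>r. (F r)\<^sup>2", OF _ AE2] um u2 by auto
  have B1: "(F r)\<^sup>2 * r ^ (?N - 1) \<le> 2 / ?c * (?m + ?D)" if r: "0 < r" for r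
  proof -
    have pt: "indicator {r..r+1} s * ((F r)\<^sup>2 * r ^ (?N - 1)) \<le>
        2 / ?c * (indicator {0..} s * (?c * s ^ (?N - 1)) * (F s)\<^sup>2) + indicator {r..r+1} s * (2 * ?D / ?c)" for s
    proof (cases "s \<in> {r..r+1}")
      case True
      have "(F r)\<^sup>2 \<le> 2 * (F s)\<^sup>2 + 2 * (F s - F r)\<^sup>2"
        using zero_le_power2[of "2 * F s - F r"] by (simp add: power2_eq_square algebra_simps)
      also have "\<dots> \<le> 2 * (F s)\<^sup>2 + 2 * (?D / ?c * ((s - r) / r ^ (?N - 1)))"
        using H1[OF r, of s] True by simp
      also have "\<dots> \<le> 2 * (F s)\<^sup>2 + 2 * (?D / ?c * (1 / r ^ (?N - 1)))"
        using True r by (intro add_left_mono mult_left_mono divide_right_mono) (auto simp: dirichlet_nonneg less_imp_le)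
      finally have "(F r)\<^sup>2 * r ^ (?N - 1) \<le> (2 * (F s)\<^sup>2 + 2 * (?D / ?c * (1 / r ^ (?N - 1)))) * r ^ (?N - 1)"
        using r by (intro mult_right_mono) auto
      also have "\<dots> = 2 * ((F s)\<^sup>2 * r ^ (?N - 1)) + 2 * ?D / ?c" using r by (simp add: distrib_right)
      also have "\<dots> \<le> 2 * ((F s)\<^sup>2 * s ^ (?N - 1)) + 2 * ?D / ?c"
        using r True by (intro add_right_mono mult_left_mono power_mono) auto
      finally show ?thesis using True r by (simp add: mult_ac)
    next
      case False
      then show ?thesis using less_imp_le[OF c] by (auto split: split_indicator)
    qed
    have i1: "integrable lborel (\<lambda>s. indicator {r..r+1} s * k :: real)" for k
      by (intro integrable_mult_left integrable_real_indicator) (auto simp: emeasure_lborel_Icc_eq)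
    have m1: "measure lborel {r..r+1} = 1" by simp
    have "(\<integral>s. indicator {r..r+1} s * ((F r)\<^sup>2 * r ^ (?N - 1)) \<partial>lborel) \<le>
       (\<integral>s. 2 / ?c * (indicator {0..} s * (?c * s ^ (?N - 1)) * (F s)\<^sup>2) + indicator {r..r+1} s * (2 * ?D / ?c) \<partial>lborel)"
      by (rule integral_mono[OF i1 Bochner_Integration.integrable_add[OF integrable_mult_right[OF iF] i1] pt])
    also have "\<dots> = (\<integral>s. 2 / ?c * (indicator {0..} s * (?c * s ^ (?N - 1)) * (F s)\<^sup>2) \<partial>lborel) +
        (\<integral>s. indicator {r..r+1} s * (2 * ?D / ?c) \<partial>lborel)"
      by (rule Bochner_Integration.integral_add[OF integrable_mult_right[OF iF] i1])
    also have "\<dots> = 2 / ?c * ?m + 2 * ?D / ?c"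
      unfolding eF integral_mult_right_zero using m1 by simp
    finally show ?thesis using m1 by (simp add: distrib_left)
  qed
  have B2: "(F r)\<^sup>2 * r ^ (?N - 2) \<le> ?D / (?c * (real ?N - 2))" if r: "0 < r" for r
  proof -
    define K where "K = ?D / ?c * (1 / ((real ?N - 2) * r ^ (?N - 2)))"
    have K: "K \<ge> 0" using r N by (auto simp: K_def dirichlet_nonneg less_imp_le)
    let ?C = "2 / ?c * (?m + ?D)"
    \<comment> \<open>The bound through the full norm already forces F to vanish at infinity, so
      F(r) is controlled by the increment from r to infinity.\<close>
    have "((\<lambda>s. sqrt (?C * inverse s)) \<longlongrightarrow> sqrt (?C * 0)) at_top"
      by (intro tendsto_real_sqrt tendsto_mult tendsto_const tendsto_inverse_0_at_top filterlim_ident)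
    then have l0: "((\<lambda>s. sqrt (?C * inverse s)) \<longlongrightarrow> 0) at_top" by simp
    have "(F \<longlongrightarrow> 0) at_top"
    proof (rule Lim_null_comparison[OF _ l0])
      show "\<forall>\<^sub>F s in at_top. norm (F s) \<le> sqrt (?C * inverse s)"
        using eventually_ge_at_top[of 1]
      proof eventually_elim
        case (elim s)
        have "s ^ 1 \<le> s ^ (?N - 1)" using elim N by (intro power_increasing) auto
        then have "(F s)\<^sup>2 * s \<le> (F s)\<^sup>2 * s ^ (?N - 1)" by (intro mult_left_mono) auto
        also have "\<dots> \<le> ?C" using B1 elim by simp
        finally have "(F s)\<^sup>2 \<le> ?C * inverse s" using elim by (simp add: field_simps)
        then show ?case using real_le_rsqrt by (simp add: real_sqrt_le_mono flip: real_sqrt_abs)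
      qed
    qed
    then have "((\<lambda>s. \<bar>F s\<bar> + sqrt K) \<longlongrightarrow> \<bar>0\<bar> + sqrt K) at_top" by (intro tendsto_intros)
    moreover have "\<forall>\<^sub>F s in at_top. \<bar>F r\<bar> \<le> \<bar>F s\<bar> + sqrt K"
      using eventually_ge_at_top[of r]
    proof eventually_elim
      case (elim s)
      have "\<bar>F s - F r\<bar> \<le> sqrt K" using H2[OF r elim] unfolding K_def[symmetric] by (simp add: real_le_rsqrt)
      then show ?case by linarith
    qed
    ultimately have "\<bar>F r\<bar> \<le> \<bar>0\<bar> + sqrt K" by (intro tendsto_lowerbound[of _ "\<bar>0\<bar> + sqrt K"]) auto
    then have "(F r)\<^sup>2 \<le> K" using K by (simp add: sqrt_ge_absD)
    then have "(F r)\<^sup>2 * r ^ (?N - 2) \<le> K * r ^ (?N - 2)" using r by (intro mult_right_mono) auto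
    also have "\<dots> = ?D / (?c * (real ?N - 2))" using r by (simp add: K_def)
    finally show ?thesis .
  qed
  show ?thesis by (rule that[OF P H1 B1 B2])
qed

subsection \<open>Calculus on the half line\<close>

text \<open>The substitution r = exp t transfers the problem to the whole line.\<close>

lemma antiderivative_exists_pos:
  assumes "continuous_on {0<..} (e::real \<Rightarrow> real)"
  obtains E where "\<And>r. r > 0 \<Longrightarrow> (E has_real_derivative e r) (at r)"
proof -
  have "continuous_on UNIV (\<lambda>t. e (exp t) * exp t)"
    by (intro continuous_on_mult continuous_on_compose2[OF assms] continuous_intros) auto
  then obtain H where H: "\<And>t. (H has_real_derivative e (exp t) * exp t) (at t)"
    using antiderivative_exists by blast
  have "((\<lambda>r. H (ln r)) has_real_derivative e r) (at r)" if "r > 0" for r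
  proof -
    have "((\<lambda>r. H (ln r)) has_real_derivative (e (exp (ln r)) * exp (ln r)) * (1 / r)) (at r)"
      by (rule DERIV_chain2[OF H]) (use that in \<open>auto intro!: derivative_eq_intros simp: inverse_eq_divide\<close>)
    then show ?thesis using that by simp
  qed
  then show ?thesis by (rule that)
qed

lemma integrable_powr_Icc:
  fixes p R :: real
  assumes "p > -1" "R \<ge> 0"
  shows "integrable lborel (\<lambda>t. indicator {0..R} t * t powr p)"
    and "(\<integral>t. indicator {0..R} t * t powr p \<partial>lborel) = R powr (p + 1) / (p + 1)"
proof -
  note h = has_integral_powr_from_0[OF assms]
  have "(\<lambda>t. t powr p) absolutely_integrable_on {0..R}"
    using h by (intro nonnegative_absolutely_integrable_1) auto
  then have "integrable lebesgue (\<lambda>t. indicator {0..R} t * t powr p)" by (simp add: set_integrable_def)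
  then show i: "integrable lborel (\<lambda>t. indicator {0..R} t * t powr p)"
    by (subst (asm) integrable_completion) auto
  have "set_integrable lborel {0..R} (\<lambda>t. t powr p)" using i by (simp add: set_integrable_def)
  from set_borel_integral_eq_integral(2)[OF this] h
  show "(\<integral>t. indicator {0..R} t * t powr p \<partial>lborel) = R powr (p + 1) / (p + 1)"
    by (simp add: set_lebesgue_integral_def integral_unique)
qed

text \<open>The integrand may be singular at 0, so the fundamental theorem is used on [r/2, r+1] and
  the integral up to r/2 enters as a constant.\<close>

lemma DERIV_integral_from_0:
  fixes w :: "real \<Rightarrow> real"
  assumes w: "continuous_on {0<..} w" and i: "\<And>R. integrable lborel (\<lambda>s. indicator {0..R} s * w s)" and r: "r > 0"
  shows "((\<lambda>r. \<integral>s. indicator {0..r} s * w s \<partial>lborel) has_real_derivative w r) (at r)"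
proof -
  let ?d = "r/2" let ?W = "\<lambda>r. \<integral>s. indicator {0..r} s * w s \<partial>lborel"
  have cw: "continuous_on {?d..r+1} w" by (rule continuous_on_subset[OF w]) (use r in auto)
  have "((\<lambda>x. integral {?d..x} w) has_real_derivative w r) (at r within {?d..r+1})"
    by (rule integral_has_real_derivative[OF cw]) (use r in auto)
  moreover have "at r within {?d..r+1} = at r" using r by (intro at_within_interior) auto
  ultimately have "((\<lambda>x. integral {?d..x} w) has_real_derivative w r) (at r)" by simp
  then have D: "((\<lambda>x. ?W ?d + integral {?d..x} w) has_real_derivative w r) (at r)"
    by (auto intro!: derivative_eq_intros)
  show ?thesis
  proof (rule has_field_derivative_transform_within_open[OF D, of "{?d<..<r+1}"])
    fix x assume x: "x \<in> {?d<..<r+1}"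
    have s: "set_integrable lborel {?d..x} w" unfolding set_integrable_def
      by (rule borel_integrable_compact[OF _ continuous_on_subset[OF w]]) (use x r in auto)
    have "?W x = (\<integral>s. indicator {0..?d} s * w s + indicator {?d..x} s * w s \<partial>lborel)"
    proof (rule integral_cong_AE)
      show "AE s in lborel. indicator {0..x} s * w s = indicator {0..?d} s * w s + indicator {?d..x} s * w s"
        using AE_lborel_singleton[of ?d] by eventually_elim (use x r in \<open>auto split: split_indicator\<close>)
    qed (use i[of x] i[of ?d] s in \<open>auto simp: set_integrable_def dest: borel_measurable_integrable\<close>)
    also have "\<dots> = ?W ?d + integral {?d..x} w"
      using i[of ?d] s set_borel_integral_eq_integral(2)[OF s] by (simp add: set_integrable_def set_lebesgue_integral_def)
    finally show "?W ?d + integral {?d..x} w = ?W x" by simp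
  qed (use r in auto)
qed

lemma integral_by_FTC:
  fixes Q q :: "real \<Rightarrow> real"
  assumes "0 < a" "a \<le> b" and "\<And>r. r > 0 \<Longrightarrow> (Q has_real_derivative q r) (at r)" and "continuous_on {0<..} q"
  shows "integrable lborel (\<lambda>r. indicator {a..b} r * q r)" "(\<integral>r. indicator {a..b} r * q r \<partial>lborel) = Q b - Q a"
proof -
  have "integrable lborel (\<lambda>r. indicator {a..b} r *\<^sub>R q r)"
    by (rule borel_integrable_compact[OF _ continuous_on_subset[OF assms(4)]]) (use assms in auto)
  then show "integrable lborel (\<lambda>r. indicator {a..b} r * q r)" by simp
  have "(\<integral>r. q r * indicator {a..b} r \<partial>lborel) = Q b - Q a"
    by (rule integral_FTC_Icc_real[OF assms(2)])
      (use assms continuous_on_eq_continuous_at[of "{0<..}" q] in auto)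
  then show "(\<integral>r. indicator {a..b} r * q r \<partial>lborel) = Q b - Q a" by (simp add: mult.commute)
qed


subsection \<open>The radial equation\<close>

text \<open>The singularity at 0 is that of the critical nonlinearity \<open>u\<close> to the power \<open>2* - 1\<close> for \<open>u\<close> below the Strauss bound, and it is still integrable in dimension \<open>N\<close>.\<close>

definition dom0 :: "'n::finite itself \<Rightarrow> real \<Rightarrow> real" where
  "dom0 _ r = 1 + r powr (- (real CARD('n) + 2) / 2)"

lemma dom0_pos: "dom0 TYPE('n::finite) r > 0"
  by (simp add: dom0_def add_pos_nonneg)

lemma dom0_borel [measurable]: "dom0 TYPE('n::finite) \<in> borel_measurable borel"
  unfolding dom0_def[abs_def] by simp

lemma power_mult_dom0:
  assumes "r > 0"
  shows "r ^ (CARD('n::finite) - 1) * dom0 TYPE('n) r = r powr (real CARD('n) - 1) + r powr ((real CARD('n) - 4) / 2)"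
proof -
  have "r ^ (CARD('n) - 1) = r powr (real CARD('n) - 1)"
    using assms by (simp add: powr_realpow[symmetric] of_nat_diff Suc_le_eq)
  moreover have "(real CARD('n) - 1) + (- (real CARD('n) + 2) / 2) = (real CARD('n) - 4) / 2"
  proof -
    have "(n - 1) + (- (n + 2) / 2) = (n - 4) / 2" for n :: real by (simp add: field_simps)
    then show ?thesis .
  qed
  ultimately show ?thesis by (simp only: dom0_def distrib_left mult_1_right powr_add[symmetric])
qed

lemma integrable_dom0:
  assumes N: "CARD('n::finite) \<ge> 3" and R: "R \<ge> 0"
  shows "integrable lborel (\<lambda>r. indicator {0..R} r * (r ^ (CARD('n) - 1) * dom0 TYPE('n) r))"
    and "(\<integral>r. indicator {0..R} r * (r ^ (CARD('n) - 1) * dom0 TYPE('n) r) \<partial>lborel) =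
       R powr real CARD('n) / real CARD('n) + R powr ((real CARD('n) - 2) / 2) / ((real CARD('n) - 2) / 2)"
proof -
  let ?N = "real CARD('n)"
  have N': "?N \<ge> 3" using N by simp
  have e: "(?N - 4) / 2 + 1 = (?N - 2) / 2" by (simp add: diff_divide_distrib)
  have i: "integrable lborel (\<lambda>r. indicator {0..R} r * r powr (?N - 1) + indicator {0..R} r * r powr ((?N - 4) / 2))"
    by (intro Bochner_Integration.integrable_add integrable_powr_Icc) (use N' R in auto)
  have AE: "AE r in lborel. indicator {0..R} r * r powr (?N - 1) + indicator {0..R} r * r powr ((?N - 4) / 2) =
      indicator {0..R} r * (r ^ (CARD('n) - 1) * dom0 TYPE('n) r)"
    using AE_lborel_singleton[of "0::real"]
    by eventually_elim (use power_mult_dom0[where 'n='n] in \<open>auto split: split_indicator\<close>)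
  show "integrable lborel (\<lambda>r. indicator {0..R} r * (r ^ (CARD('n) - 1) * dom0 TYPE('n) r))"
    by (rule integrable_cong_AE_imp[OF i]) (use AE in auto)
  have "(\<integral>r. indicator {0..R} r * (r ^ (CARD('n) - 1) * dom0 TYPE('n) r) \<partial>lborel) =
     (\<integral>r. indicator {0..R} r * r powr (?N - 1) + indicator {0..R} r * r powr ((?N - 4) / 2) \<partial>lborel)"
    by (rule integral_cong_AE) (use AE in \<open>auto elim: eventually_mono\<close>)
  also have "\<dots> = R powr ?N / ?N + R powr ((?N - 2) / 2) / ((?N - 2) / 2)"
    using integrable_powr_Icc[of "?N - 1" R] integrable_powr_Icc[of "(?N - 4) / 2" R] N' R by (simp add: e)
  finally show "(\<integral>r. indicator {0..R} r * (r ^ (CARD('n) - 1) * dom0 TYPE('n) r) \<partial>lborel) =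
       R powr ?N / ?N + R powr ((?N - 2) / 2) / ((?N - 2) / 2)" .
qed

lemma integrable_dom0_cball:
  assumes N: "CARD('n::finite) \<ge> 3"
  shows "integrable lebesgue (\<lambda>x::real^'n. indicator (cball 0 R) x * dom0 TYPE('n) (norm x))"
proof -
  have eq: "indicator {0..} r * (sph_area TYPE('n) * r ^ (CARD('n) - 1)) * (indicator {0..R} r * dom0 TYPE('n) r) =
     sph_area TYPE('n) * (indicator {0..R} r * (r ^ (CARD('n) - 1) * dom0 TYPE('n) r))" for r
    by (auto split: split_indicator)
  have [measurable]: "(\<lambda>x::real^'n. indicator (cball 0 R) x * dom0 TYPE('n) (norm x)) \<in> borel_measurable lebesgue"
    by (intro measurable_completion borel_measurable_times borel_measurable_indicator
        measurable_compose[OF borel_measurable_norm dom0_borel]) auto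
  show ?thesis
  proof (cases "R \<ge> 0")
    case True
    have "integrable lborel (\<lambda>r. indicator {0..} r * (sph_area TYPE('n) * r ^ (CARD('n) - 1)) * (indicator {0..R} r * dom0 TYPE('n) r))"
      unfolding eq by (rule integrable_mult_right[OF integrable_dom0(1)[OF N True]])
    then show ?thesis
      by (subst integrable_radial_lebesgue(1)[where h="\<lambda>r. indicator {0..R} r * dom0 TYPE('n) r"])
        (auto intro!: AE_I2 split: split_indicator)
  next
    case False
    then have "indicator (cball 0 R) x = (0::real)" for x :: "real^'n"
      by (auto simp: indicator_def intro: order_trans[OF norm_ge_zero])
    then show ?thesis by simp
  qed
qed

text \<open>Up to the factor \<open>sph_area\<close>, the integral of w over the ball of radius r.
  For a radial solution of -\<Delta>u = w the divergence theorem identifies it with -r^(N-1)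
  u'(r).\<close>

definition flux :: "'n::finite itself \<Rightarrow> (real \<Rightarrow> real) \<Rightarrow> real \<Rightarrow> real" where
  "flux _ w r = (\<integral>s. indicator {0..r} s * (s ^ (CARD('n) - 1) * w s) \<partial>lborel)"

context
  fixes w :: "real \<Rightarrow> real" and C :: real
  assumes wc: "continuous_on {0<..} w"
    and wm: "w \<in> borel_measurable borel"
begin

lemma integrable_flux:
  assumes N: "CARD('n::finite) \<ge> 3" and wC: "\<And>r. r > 0 \<Longrightarrow> \<bar>w r\<bar> \<le> C * dom0 TYPE('n) r"
  shows "integrable lborel (\<lambda>s. indicator {0..r} s * (s ^ (CARD('n) - 1) * w s))"
proof (cases "r \<ge> 0")
  case True
  note wm[measurable]
  show ?thesis
  proof (rule Bochner_Integration.integrable_bound[OF integrable_mult_right[OF integrable_dom0(1)[OF N True], of C]])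
    show "AE s in lborel. norm (indicator {0..r} s * (s ^ (CARD('n) - 1) * w s)) \<le>
        norm (C * (indicator {0..r} s * (s ^ (CARD('n) - 1) * dom0 TYPE('n) s)))"
      using AE_lborel_singleton[of "0::real"]
    proof eventually_elim
      case (elim s)
      show ?case
      proof (cases "s \<in> {0..r}")
        case True
        then have "s > 0" using elim by auto
        have "s ^ (CARD('n) - 1) * \<bar>w s\<bar> \<le> s ^ (CARD('n) - 1) * (C * dom0 TYPE('n) s)"
          using wC[OF \<open>s > 0\<close>] \<open>s > 0\<close> by (intro mult_left_mono) auto
        also have "\<dots> \<le> \<bar>C * (s ^ (CARD('n) - 1) * dom0 TYPE('n) s)\<bar>" by (simp add: mult_ac)
        finally show ?thesis using True \<open>s > 0\<close> by (simp add: abs_mult)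
      qed simp
    qed
  qed simp
qed simp

lemma flux_DERIV:
  assumes N: "CARD('n::finite) \<ge> 3" and wC: "\<And>r. r > 0 \<Longrightarrow> \<bar>w r\<bar> \<le> C * dom0 TYPE('n) r" and r: "r > 0"
  shows "(flux TYPE('n) w has_real_derivative r ^ (CARD('n) - 1) * w r) (at r)"
proof -
  have "continuous_on {0<..} (\<lambda>s. s ^ (CARD('n) - 1) * w s)" by (intro continuous_intros wc)
  from DERIV_integral_from_0[OF this integrable_flux[OF N wC] r] show ?thesis
    unfolding flux_def[abs_def] by simp
qed

text \<open>\<open>dom0\<close> is integrated in closed form. The bound depends on w only through C,
  hence is uniform along a sequence, and its rate r^(-N/2) at 0 is milder than that of
  \<open>dom0\<close>, so derivatives will be dominated as well.\<close>

lemma flux_bound: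
  assumes N: "CARD('n::finite) \<ge> 3" and wC: "\<And>r. r > 0 \<Longrightarrow> \<bar>w r\<bar> \<le> C * dom0 TYPE('n) r" and r: "r > 0"
  shows "\<bar>flux TYPE('n) w r\<bar> / r ^ (CARD('n) - 1) \<le> C * (r / real CARD('n) + r powr (- real CARD('n) / 2) / ((real CARD('n) - 2) / 2))"
proof -
  let ?N = "real CARD('n)"
  have r0: "r \<ge> 0" using r by simp
  have "\<bar>flux TYPE('n) w r\<bar> \<le> (\<integral>s. \<bar>indicator {0..r} s * (s ^ (CARD('n) - 1) * w s)\<bar> \<partial>lborel)"
    unfolding flux_def by (rule integral_abs_bound)
  also have "\<dots> \<le> (\<integral>s. C * (indicator {0..r} s * (s ^ (CARD('n) - 1) * dom0 TYPE('n) s)) \<partial>lborel)"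
  proof (rule integral_mono_AE)
    show "integrable lborel (\<lambda>s. \<bar>indicator {0..r} s * (s ^ (CARD('n) - 1) * w s)\<bar>)"
      by (rule integrable_abs[OF integrable_flux[OF N wC]])
    show "integrable lborel (\<lambda>s. C * (indicator {0..r} s * (s ^ (CARD('n) - 1) * dom0 TYPE('n) s)))"
      by (rule integrable_mult_right[OF integrable_dom0(1)[OF N r0]])
    show "AE s in lborel. \<bar>indicator {0..r} s * (s ^ (CARD('n) - 1) * w s)\<bar> \<le> C * (indicator {0..r} s * (s ^ (CARD('n) - 1) * dom0 TYPE('n) s))"
      using AE_lborel_singleton[of "0::real"]
    proof eventually_elim
      case (elim s)
      show ?case
      proof (cases "s \<in> {0..r}")
        case True
        then have "s > 0" using elim by auto
        have "s ^ (CARD('n) - 1) * \<bar>w s\<bar> \<le> s ^ (CARD('n) - 1) * (C * dom0 TYPE('n) s)"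
          using wC[OF \<open>s > 0\<close>] \<open>s > 0\<close> by (intro mult_left_mono) auto
        then show ?thesis using True \<open>s > 0\<close> by (simp add: abs_mult mult_ac)
      qed simp
    qed
  qed
  also have "\<dots> = C * (r powr ?N / ?N + r powr ((?N - 2) / 2) / ((?N - 2) / 2))"
    unfolding integral_mult_right_zero integrable_dom0(2)[OF N r0] ..
  finally have "\<bar>flux TYPE('n) w r\<bar> / r ^ (CARD('n) - 1) \<le> C * (r powr ?N / ?N + r powr ((?N - 2) / 2) / ((?N - 2) / 2)) / r ^ (CARD('n) - 1)"
    using r by (intro divide_right_mono) auto
  also have "\<dots> = C * (r powr ?N / r ^ (CARD('n) - 1) / ?N + r powr ((?N - 2) / 2) / r ^ (CARD('n) - 1) / ((?N - 2) / 2))"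
  proof -
    have "C * (X / m + Y / k) / p = C * (X / p / m + Y / p / k)" for X Y m k p :: real
      by (simp add: add_divide_distrib distrib_left mult_ac)
    then show ?thesis .
  qed
  also have "r ^ (CARD('n) - 1) = r powr (?N - 1)"
    using r by (simp add: powr_realpow[symmetric] of_nat_diff Suc_le_eq)
  also have "r powr ?N / r powr (?N - 1) = r" using r by (simp add: powr_diff[symmetric])
  also have "r powr ((?N - 2) / 2) / r powr (?N - 1) = r powr (- ?N / 2)" by (simp add: powr_diff[symmetric] field_simps)
  finally show ?thesis
    using r by (simp add: powr_realpow[symmetric] of_nat_diff Suc_le_eq)
qed

end

text \<open>The test functions are \<open>H (|x|\<^sup>2)\<close> with \<open>H\<close> constant near 0 and zero far out; varying \<open>H\<close> and applying du Bois-Reymond yields the equation integrated once.\<close>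

lemma weak_sol_profile_ode:
  fixes u f :: "real^'n::finite \<Rightarrow> real"
  assumes N: "CARD('n) \<ge> 3" and u: "H1 u" and P: "profile u F"
    and fr: "f \<in> borel_measurable lebesgue" "AE x in lebesgue. f x = fr (norm x)" "continuous_on {0<..} fr" "fr \<in> borel_measurable borel"
    and C: "\<And>r. r > 0 \<Longrightarrow> \<bar>fr r - lam * F r\<bar> \<le> C * dom0 TYPE('n) r"
    and ws: "weak_sol lam u f" and r: "r > 0"
  shows "(F has_real_derivative - flux TYPE('n) (\<lambda>r. fr r - lam * F r) r / r ^ (CARD('n) - 1)) (at r)"
proof -
  let ?N = "CARD('n)" let ?c = "sph_area TYPE('n)"
  define w where "w r = fr r - lam * F r" for r
  let ?W = "flux TYPE('n) w"
  have Fm [measurable]: "F \<in> borel_measurable borel" by (rule profile_borel[OF P])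
  note fr(4)[measurable]
  have Fc: "continuous_on {0<..} F" and uF: "AE x in lebesgue. u x = F (norm x)" using P by (auto simp: profile_def)
  have wc: "continuous_on {0<..} w" unfolding w_def by (intro continuous_intros fr Fc)
  have wm [measurable]: "w \<in> borel_measurable borel" unfolding w_def by simp
  have wC: "\<And>r. r > 0 \<Longrightarrow> \<bar>w r\<bar> \<le> C * dom0 TYPE('n) r" using C by (simp add: w_def)
  have iW: "integrable lborel (\<lambda>s. indicator {0..r} s * (s ^ (?N - 1) * w s))" for r
    by (rule integrable_flux[OF wc wm N]) (rule wC)
  have WD: "(?W has_real_derivative r ^ (?N - 1) * w r) (at r)" if "r > 0" for r
    by (rule flux_DERIV[OF wc wm N _ that]) (rule wC)
  have Wc: "continuous_on {0<..} ?W"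
    by (intro continuous_at_imp_continuous_on ballI) (use WD DERIV_isCont in auto)
  have ec: "continuous_on {0<..} (\<lambda>r. ?W r / r ^ (?N - 1))" by (intro continuous_intros Wc) auto
  \<comment> \<open>E is an antiderivative of what the equation predicts for -F', so the goal
    becomes that F + E is constant.\<close>
  obtain E where E: "\<And>r. r > 0 \<Longrightarrow> (E has_real_derivative ?W r / r ^ (?N - 1)) (at r)"
    using antiderivative_exists_pos[OF ec] by blast
  have Ec: "continuous_on {0<..} E"
    by (intro continuous_at_imp_continuous_on ballI) (use E DERIV_isCont in auto)
  define E0 where "E0 r = (if r > 0 then E r else 0)" for r
  have E0c: "continuous_on {0<..} E0" by (rule continuous_on_eq[OF Ec]) (auto simp: E0_def)
  have E0m [measurable]: "E0 \<in> borel_measurable borel" by (rule borel_measurable_pos_continuous[OF E0c]) (simp add: E0_def)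
  have um: "u \<in> borel_measurable lebesgue" and u2: "integrable lebesgue (\<lambda>x. (u x)\<^sup>2)" using u by (auto simp: H1_def)
  note g = H1_L2grad[OF u]
  have cnt: "continuous_on {0<..} (\<lambda>r. F r + E0 r)" by (intro continuous_intros Fc E0c)
  have "(\<integral>r. (F r + E0 r) * deriv q r \<partial>lborel) = 0"
    if ab: "0 < a" "a < b" and sq: "smooth UNIV q" and q0: "\<And>r. r \<notin> {a..b} \<Longrightarrow> q r = 0" for q a b
  proof -
    \<comment> \<open>The normalisation h(r^2) = q(r) / r^N makes the gradient term twice the
      integrand of \<open>radial_weak_derivative\<close>.\<close>
    obtain h where h: "smooth UNIV h" "\<And>t. t < a\<^sup>2 \<Longrightarrow> h t = 0" "\<And>t. t > b\<^sup>2 \<Longrightarrow> h t = 0"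
      "\<And>r. r > 0 \<Longrightarrow> h (r\<^sup>2) = q r / r ^ ?N"
      "\<And>r. r > 0 \<Longrightarrow> 2 * r * deriv h (r\<^sup>2) = deriv q r / r ^ ?N - real ?N * q r / r ^ (?N + 1)"
      using radial_test_profile[OF sq ab q0, of ?N] by blast
    have hc: "continuous_on UNIV h" by (rule smooth_continuous_on[OF h(1)])
    obtain H0 where H0: "\<And>t. (H0 has_real_derivative h t) (at t)" using antiderivative_exists[OF hc] by blast
    define B where "B = b + 1"
    have B: "b < B" "0 < B" "b\<^sup>2 < B\<^sup>2" using ab by (auto simp: B_def power_strict_mono)
    \<comment> \<open>Subtracting the value at \<open>B\<^sup>2\<close> makes H vanish beyond
      \<open>b\<^sup>2\<close>, where its derivative h is zero.\<close>
    define H where "H t = H0 t - H0 (B\<^sup>2)" for t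
    have HD: "(H has_real_derivative h t) (at t)" for t unfolding H_def[abs_def] using H0[of t] by (auto intro!: derivative_eq_intros)
    have Hc: "continuous_on S H" for S by (intro continuous_at_imp_continuous_on ballI DERIV_isCont[OF HD])
    have sH: "smooth UNIV H" by (rule smoothI_DERIV[OF _ HD h(1)]) simp
    have dH: "deriv H = h" using DERIV_imp_deriv[OF HD] by auto
    have H_right: "H t = 0" if "t > b\<^sup>2" for t
    proof -
      have "H y = H x" if "b\<^sup>2 < x" "x < y" for x y
      proof (rule DERIV_isconst2[of x y H y])
        show "DERIV H z :> 0" if "x < z" "z < y" for z
          using HD[of z] h(3)[of z] that \<open>b\<^sup>2 < x\<close> by simp
      qed (use that in \<open>auto intro: Hc\<close>)
      moreover have "H (B\<^sup>2) = 0" by (simp add: H_def)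
      ultimately show ?thesis using that B(3) by (cases t "B\<^sup>2" rule: linorder_cases) auto
    qed
    have H_left: "H t = H 0" if "0 \<le> t" "t < a\<^sup>2" for t
    proof (cases "t = 0")
      case False
      show ?thesis
      proof (rule DERIV_isconst2[of 0 t H t])
        show "DERIV H z :> 0" if "0 < z" "z < t" for z
          using HD[of z] h(2)[of z] that \<open>t < a\<^sup>2\<close> by simp
      qed (use that False in \<open>auto intro: Hc\<close>)
    qed simp
    define \<phi> where "\<phi> x = H ((norm x)\<^sup>2)" for x :: "real^'n"
    have t\<phi>: "test_fun \<phi>" unfolding \<phi>_def[abs_def] by (rule test_fun_radial[OF sH H_right])
    have cg: "wgrad u x \<bullet> cgrad \<phi> x = 2 * ((wgrad u x \<bullet> x) / norm x ^ ?N * q (norm x))" for x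
    proof -
      have "cgrad \<phi> x = (2 * h ((norm x)\<^sup>2)) *\<^sub>R x"
        unfolding cgrad_def \<phi>_def[abs_def] by (auto simp: vec_eq_iff pdiff_radial[OF sH] dH)
      then show ?thesis using h(4)[of "norm x"] by (cases "x = 0") auto
    qed
    note rw = radial_weak_derivative[OF g sq ab q0]
    have irw: "integrable lebesgue (\<lambda>x. 2 * ((wgrad u x \<bullet> x) / norm x ^ ?N * q (norm x)))"
      by (rule integrable_mult_right) (rule rw(2))
    have iu: "integrable lebesgue (\<lambda>x. u x * \<phi> x)"
      by (rule integrable_mult_test_fun[OF um integrable_cball_L2[OF um u2] t\<phi>])
    have AEw: "AE x in lebesgue. (f x - lam * u x) = w (norm x)"
      using fr(2) uF by eventually_elim (simp add: w_def)
    have fm: "(\<lambda>x. f x - lam * u x) \<in> borel_measurable lebesgue" using fr(1) um by simp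
    have iw: "integrable lebesgue (\<lambda>x. (f x - lam * u x) * \<phi> x)"
    proof (rule integrable_mult_test_fun[OF fm _ t\<phi>])
      fix R
      show "integrable lebesgue (\<lambda>x. indicator (cball 0 R) x * (f x - lam * u x))"
      proof (rule Bochner_Integration.integrable_bound[OF integrable_mult_right[OF integrable_dom0_cball[OF N], of C]])
        have "AE x::real^'n in lebesgue. norm x > 0" using AE_norm_pos by (simp add: AE_completion_iff)
        then show "AE x in lebesgue. norm (indicator (cball 0 R) x * (f x - lam * u x)) \<le> norm (C * (indicator (cball 0 R) x * dom0 TYPE('n) (norm x)))"
          using AEw
        proof eventually_elim
          case (elim x)
          have "\<bar>w (norm x)\<bar> \<le> \<bar>C * dom0 TYPE('n) (norm x)\<bar>" using wC[OF elim(1)] by linarith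
          then show ?case using elim by (simp add: abs_mult split: split_indicator)
        qed
        have [measurable]: "cball 0 R \<in> sets (lebesgue :: (real^'n) measure)" by simp
        show "(\<lambda>x. indicator (cball 0 R) x * (f x - lam * u x)) \<in> borel_measurable lebesgue" using fm by measurable
      qed
    qed
    have "(\<integral>x. wgrad u x \<bullet> cgrad \<phi> x + lam * u x * \<phi> x \<partial>lebesgue) = (\<integral>x. f x * \<phi> x \<partial>lebesgue)"
      using ws t\<phi> by (simp add: weak_sol_def)
    also have "(\<integral>x. f x * \<phi> x \<partial>lebesgue) = (\<integral>x. (f x - lam * u x) * \<phi> x + lam * (u x * \<phi> x) \<partial>lebesgue)"
      by (simp add: algebra_simps)
    also have "\<dots> = (\<integral>x. (f x - lam * u x) * \<phi> x \<partial>lebesgue) + lam * (\<integral>x. u x * \<phi> x \<partial>lebesgue)"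
      using iw iu by simp
    also have "(\<integral>x. wgrad u x \<bullet> cgrad \<phi> x + lam * u x * \<phi> x \<partial>lebesgue) =
      2 * (\<integral>x. (wgrad u x \<bullet> x) / norm x ^ ?N * q (norm x) \<partial>lebesgue) + lam * (\<integral>x. u x * \<phi> x \<partial>lebesgue)"
      unfolding cg using Bochner_Integration.integral_add[OF irw integrable_mult_right[OF iu, of lam]]
      by (simp only: mult.assoc integral_mult_right_zero)
    finally have eq1: "2 * (\<integral>x. (wgrad u x \<bullet> x) / norm x ^ ?N * q (norm x) \<partial>lebesgue) = (\<integral>x. (f x - lam * u x) * \<phi> x \<partial>lebesgue)"
      by simp
    have dqc: "continuous_on UNIV (deriv q)" by (rule smooth_continuous_on[OF smooth_deriv[OF sq]])
    have qc: "continuous_on UNIV q" by (rule smooth_continuous_on[OF sq])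
    have [measurable]: "deriv q \<in> borel_measurable borel" "q \<in> borel_measurable borel" "H \<in> borel_measurable borel" "h \<in> borel_measurable borel"
      using dqc qc Hc hc by (auto intro: borel_measurable_continuous_onI)
    have dq0: "deriv q r = 0" if "r \<notin> {a..b}" for r
      by (rule deriv_eq_0_if_locally_zero[of "- {a..b}"]) (use q0 that in auto)
    have lhs: "(\<integral>x. u x * (deriv q (norm x) / norm x ^ (?N - 1)) \<partial>lebesgue) = ?c * (\<integral>r. F r * deriv q r \<partial>lborel)"
    proof -
      have "(\<integral>x. u x * (deriv q (norm x) / norm x ^ (?N - 1)) \<partial>lebesgue) =
        (\<integral>r. indicator {0..} r * (?c * r ^ (?N - 1)) * (F r * (deriv q r / r ^ (?N - 1))) \<partial>lborel)"
      proof (rule integrable_radial_lebesgue(2))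
        show "AE x in lebesgue. u x * (deriv q (norm x) / norm x ^ (?N - 1)) = F (norm x) * (deriv q (norm x) / norm x ^ (?N - 1))"
          using uF by eventually_elim simp
        show "(\<lambda>x. u x * (deriv q (norm x) / norm x ^ (?N - 1))) \<in> borel_measurable lebesgue"
          by (intro borel_measurable_times um measurable_completion) simp
      qed simp
      also have "\<dots> = (\<integral>r. ?c * (F r * deriv q r) \<partial>lborel)"
        by (intro Bochner_Integration.integral_cong) (use dq0 ab in \<open>auto split: split_indicator\<close>)
      finally show ?thesis by simp
    qed
    have rhs: "(\<integral>x. (f x - lam * u x) * \<phi> x \<partial>lebesgue) = ?c * (\<integral>r. indicator {0..B} r * (r ^ (?N - 1) * w r) * H (r\<^sup>2) \<partial>lborel)"
    proof -
      have "(\<integral>x. (f x - lam * u x) * \<phi> x \<partial>lebesgue) = (\<integral>r. indicator {0..} r * (?c * r ^ (?N - 1)) * (w r * H (r\<^sup>2)) \<partial>lborel)"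
        by (rule integrable_radial_lebesgue(2))
          (use AEw in \<open>auto simp: \<phi>_def elim: eventually_mono intro!: borel_measurable_integrable[OF iw, unfolded \<phi>_def]\<close>)
      also have "\<dots> = (\<integral>r. ?c * (indicator {0..B} r * (r ^ (?N - 1) * w r) * H (r\<^sup>2)) \<partial>lborel)"
      proof (intro Bochner_Integration.integral_cong refl)
        fix r
        show "indicator {0..} r * (?c * r ^ (?N - 1)) * (w r * H (r\<^sup>2)) = ?c * (indicator {0..B} r * (r ^ (?N - 1) * w r) * H (r\<^sup>2))"
        proof (cases "r \<le> B")
          case False
          then have "b\<^sup>2 < r\<^sup>2" using B ab by (intro power_strict_mono) auto
          then show ?thesis using False H_right by simp
        qed (auto split: split_indicator)
      qed
      finally show ?thesis by simp
    qed
    \<comment> \<open>For r <= l the factor H(r^2) is the constant H(0), so the part of the integral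
      that touches the origin is H(0) times the flux at l. It cancels against the boundary term at l
      in the integration by parts.\<close>
    define l where "l = a / 2"
    have l: "0 < l" "l < a" "l < B" "l\<^sup>2 < a\<^sup>2" using ab B by (auto simp: l_def power_strict_mono)
    have Q1: "((\<lambda>r. ?W r * H (r\<^sup>2)) has_real_derivative (r ^ (?N - 1) * w r) * H (r\<^sup>2) + h (r\<^sup>2) * (2 * r) * ?W r) (at r)" if "r > 0" for r
      by (rule DERIV_mult[OF WD[OF that] DERIV_chain2[OF HD]]) (auto intro!: derivative_eq_intros)
    have c1: "continuous_on {0<..} (\<lambda>r. (r ^ (?N - 1) * w r) * H (r\<^sup>2))"
      by (intro continuous_on_mult wc continuous_on_compose2[OF Hc[of UNIV]] continuous_intros) auto
    have c2: "continuous_on {0<..} (\<lambda>r. h (r\<^sup>2) * (2 * r) * ?W r)"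
      by (intro continuous_on_mult Wc continuous_on_compose2[OF hc] continuous_intros) auto
    have ci: "integrable lborel (\<lambda>r. indicator {l..B} r * k r)" if "continuous_on {0<..} k" for k :: "real \<Rightarrow> real"
    proof -
      have "integrable lborel (\<lambda>r. indicator {l..B} r *\<^sub>R k r)"
        by (rule borel_integrable_compact[OF _ continuous_on_subset[OF that]]) (use l in auto)
      then show ?thesis by simp
    qed
    have "(\<integral>r. indicator {l..B} r * ((r ^ (?N - 1) * w r) * H (r\<^sup>2) + h (r\<^sup>2) * (2 * r) * ?W r) \<partial>lborel) = ?W B * H (B\<^sup>2) - ?W l * H (l\<^sup>2)"
      by (rule integral_by_FTC(2)[OF l(1) less_imp_le[OF l(3)] Q1 continuous_on_add[OF c1 c2]])
    also have "\<dots> = - H 0 * ?W l" using H_right[OF B(3)] H_left[of "l\<^sup>2"] l by simp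
    also have "?W l = (\<integral>r. indicator {0..l} r * (r ^ (?N - 1) * w r) \<partial>lborel)" by (simp add: flux_def)
    finally have ibp: "(\<integral>r. indicator {l..B} r * ((r ^ (?N - 1) * w r) * H (r\<^sup>2)) \<partial>lborel) + (\<integral>r. indicator {l..B} r * (h (r\<^sup>2) * (2 * r) * ?W r) \<partial>lborel) =
       - H 0 * (\<integral>r. indicator {0..l} r * (r ^ (?N - 1) * w r) \<partial>lborel)"
      using ci[OF c1] ci[OF c2] by (simp add: distrib_left)
    have "(\<integral>r. indicator {0..B} r * (r ^ (?N - 1) * w r) * H (r\<^sup>2) \<partial>lborel) =
      (\<integral>r. H 0 * (indicator {0..l} r * (r ^ (?N - 1) * w r)) + indicator {l..B} r * ((r ^ (?N - 1) * w r) * H (r\<^sup>2)) \<partial>lborel)"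
    proof (rule integral_cong_AE)
      show "AE r in lborel. indicator {0..B} r * (r ^ (?N - 1) * w r) * H (r\<^sup>2) =
         H 0 * (indicator {0..l} r * (r ^ (?N - 1) * w r)) + indicator {l..B} r * ((r ^ (?N - 1) * w r) * H (r\<^sup>2))"
        using AE_lborel_singleton[of l]
      proof eventually_elim
        case (elim r)
        show ?case
        proof (cases "r \<in> {0..l}")
          case True
          then have "r\<^sup>2 \<le> l\<^sup>2" by (intro power_mono) auto
          then have "H (r\<^sup>2) = H 0" using l by (intro H_left) auto
          then show ?thesis using True elim l by (auto split: split_indicator)
        qed (use l in \<open>auto split: split_indicator\<close>)
      qed
    qed auto
    also have "\<dots> = H 0 * (\<integral>r. indicator {0..l} r * (r ^ (?N - 1) * w r) \<partial>lborel) + (\<integral>r. indicator {l..B} r * ((r ^ (?N - 1) * w r) * H (r\<^sup>2)) \<partial>lborel)"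
      using iW[of l] ci[OF c1] by simp
    finally have eq2: "(\<integral>r. indicator {0..B} r * (r ^ (?N - 1) * w r) * H (r\<^sup>2) \<partial>lborel) = - (\<integral>r. indicator {l..B} r * (h (r\<^sup>2) * (2 * r) * ?W r) \<partial>lborel)"
      using ibp by simp
    have c3: "continuous_on {0<..} (\<lambda>r. ?W r / r ^ (?N - 1) * q r)"
      by (intro continuous_on_mult ec continuous_on_subset[OF qc]) auto
    have c4: "continuous_on {0<..} (\<lambda>r. deriv q r * E r)"
      by (intro continuous_on_mult Ec continuous_on_subset[OF dqc]) auto
    have "(\<integral>r. indicator {l..B} r * (h (r\<^sup>2) * (2 * r) * ?W r) \<partial>lborel) = 2 * (\<integral>r. indicator {l..B} r * (?W r / r ^ (?N - 1) * q r) \<partial>lborel)"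
    proof -
      obtain m where m: "?N = Suc m" using not0_implies_Suc[of ?N] by auto
      have "indicator {l..B} r * (h (r\<^sup>2) * (2 * r) * ?W r) = 2 * (indicator {l..B} r * (?W r / r ^ (?N - 1) * q r))" for r
      proof (cases "r \<in> {l..B}")
        case True
        then have "r > 0" using l by auto
        then show ?thesis unfolding h(4)[OF \<open>r > 0\<close>] m by (simp add: field_simps)
      qed simp
      then show ?thesis by (simp only: integral_mult_right_zero)
    qed
    moreover have "(\<integral>r. indicator {l..B} r * (?W r / r ^ (?N - 1) * q r + deriv q r * E r) \<partial>lborel) = E B * q B - E l * q l"
      by (rule integral_by_FTC(2)[OF l(1) less_imp_le[OF l(3)] DERIV_mult[OF E smooth_DERIV[OF sq]] continuous_on_add[OF c3 c4]]) auto
    then have "(\<integral>r. indicator {l..B} r * (?W r / r ^ (?N - 1) * q r) \<partial>lborel) + (\<integral>r. indicator {l..B} r * (deriv q r * E r) \<partial>lborel) = 0"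
      using ci[OF c3] ci[OF c4] q0[of B] q0[of l] l B by (simp add: distrib_left)
    moreover have "(\<integral>r. indicator {l..B} r * (deriv q r * E r) \<partial>lborel) = (\<integral>r. E0 r * deriv q r \<partial>lborel)"
      by (intro Bochner_Integration.integral_cong) (use dq0 l B in \<open>auto simp: E0_def split: split_indicator\<close>)
    ultimately have Y: "(\<integral>r. indicator {0..B} r * (r ^ (?N - 1) * w r) * H (r\<^sup>2) \<partial>lborel) = 2 * (\<integral>r. E0 r * deriv q r \<partial>lborel)"
      using eq2 by linarith
    have "2 * (?c * (\<integral>r. F r * deriv q r \<partial>lborel)) = - (?c * (\<integral>r. indicator {0..B} r * (r ^ (?N - 1) * w r) * H (r\<^sup>2) \<partial>lborel))"
      using rw(1) eq1 lhs rhs by linarith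
    then have "?c * ((\<integral>r. F r * deriv q r \<partial>lborel) + (\<integral>r. E0 r * deriv q r \<partial>lborel)) = 0"
      unfolding Y distrib_left by linarith
    then have "(\<integral>r. F r * deriv q r \<partial>lborel) + (\<integral>r. E0 r * deriv q r \<partial>lborel) = 0"
      by (simp only: mult_eq_0_iff sph_area_neq_0 simp_thms)
    moreover have "integrable lborel (\<lambda>r. k r * deriv q r)" if "continuous_on {0<..} k" for k
    proof -
      have "integrable lborel (\<lambda>r. indicator {l..B} r * (k r * deriv q r))"
        by (intro ci continuous_on_mult that continuous_on_subset[OF dqc]) auto
      moreover have "indicator {l..B} r * (k r * deriv q r) = k r * deriv q r" for r
        using dq0[of r] l B by (cases "r \<in> {a..b}") auto
      ultimately show ?thesis by simp
    qed
    ultimately show ?thesis using Fc E0c by (simp add: distrib_right)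
  qed
  then have "\<exists>k. AE r in lborel. r > 0 \<longrightarrow> F r + E0 r = k"
  proof (intro AE_const_if_weak_deriv_zero)
    show "integrable lborel (\<lambda>r. indicator {a..b} r * (F r + E0 r))" if "0 < a" for a b
    proof -
      have "integrable lborel (\<lambda>r. indicator {a..b} r *\<^sub>R (F r + E0 r))"
        by (rule borel_integrable_compact[OF _ continuous_on_subset[OF cnt]]) (use that in auto)
      then show ?thesis by simp
    qed
  qed auto
  then obtain k where k: "AE r in lborel. r > 0 \<longrightarrow> F r + E0 r = k" by blast
  \<comment> \<open>Both sides are continuous, so the identity holds at every positive radius and
    can be differentiated.\<close>
  have FE: "F r = k - E r" if "r > 0" for r
    using continuous_AE_eq[OF cnt _ k that] that by (simp add: E0_def)
  have "((\<lambda>r. k - E r) has_real_derivative - (?W r / r ^ (?N - 1))) (at r)"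
    using E[OF r] by (auto intro!: derivative_eq_intros)
  then have "(F has_real_derivative - (?W r / r ^ (?N - 1))) (at r)"
    by (rule has_field_derivative_transform_within_open[of _ _ _ "{0<..}"]) (use r FE in auto)
  then show ?thesis by (simp add: w_def[abs_def])
qed

section \<open>The gradient of a radial function with differentiable profile\<close>

text \<open>The equation determines only the derivative of the profile; the full weak gradient needs
  arbitrary test functions. A cutoff removes the origin, and F(|x|) times this cutoff is C1 on the
  whole space, so it can be integrated by parts directly and compared with the weak
  gradient.\<close>

lemma profile_gradient:
  fixes u :: "real^'n::finite \<Rightarrow> real"
  assumes g: "L2grad u g" and um: "u \<in> borel_measurable lebesgue" and P: "profile u F"
    and F': "\<And>r. r > 0 \<Longrightarrow> (F has_real_derivative F' r) (at r)" and F'c: "continuous_on {0<..} F'"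
  shows "AE x in lebesgue. g x = (F' (norm x) / norm x) *\<^sub>R x"
proof -
  define G where "G r = (if r > 0 then F' r else 0)" for r
  have Gc: "continuous_on {0<..} G" by (rule continuous_on_eq[OF F'c]) (auto simp: G_def)
  have Gm [measurable]: "G \<in> borel_measurable borel" by (rule borel_measurable_pos_continuous[OF Gc]) (simp add: G_def)
  have Fm [measurable]: "F \<in> borel_measurable borel" by (rule profile_borel[OF P])
  have uF: "AE x in lebesgue. u x = F (norm x)" using P by (auto simp: profile_def)
  \<comment> \<open>Cutoffs in the variable t = |x|^2, positive for 1/(k+1) < t < k+1, so that every
    nonzero x is seen by some k.\<close>
  define \<eta> where "\<eta> k = bump (1 / real (Suc k)) (real (Suc k)) 0" for k
  define \<psi> where "\<psi> k x = \<eta> k ((norm x)\<^sup>2)" for k and x :: "real^'n"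
  have s\<eta>: "smooth UNIV (\<eta> k)" for k unfolding \<eta>_def by (rule smooth_bump)
  have t\<psi>: "test_fun (\<psi> k)" for k unfolding \<psi>_def[abs_def]
    by (rule test_fun_radial[OF s\<eta>, of "real (Suc k)"]) (simp add: \<eta>_def bump_eq_0)
  have main: "AE x in lebesgue. (g x $ i - G (norm x) / norm x * x $ i) * \<psi> k x = 0" for i k
  proof (rule AE_zero_if_test_integrals_zero)
    let ?a = "1 / real (Suc k)"
    have a: "?a > 0" by simp
    have \<eta>0: "\<eta> k t = 0" if "t \<le> ?a" for t unfolding \<eta>_def by (rule bump_eq_0) (use that in auto)
    \<comment> \<open>Q(|x|^2) is F(|x|) times the cutoff; passing to t = |x|^2 keeps the chain rule
      polynomial in x.\<close>
    define Q where "Q t = (if t > 0 then F (sqrt t) * \<eta> k t else 0)" for t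
    define Q' where "Q' t = (if t > 0 then F' (sqrt t) * (1 / (2 * sqrt t)) * \<eta> k t + F (sqrt t) * deriv (\<eta> k) t else 0)" for t
    have d\<eta>0: "deriv (\<eta> k) t = 0" if "t < ?a" for t
      by (rule deriv_eq_0_if_locally_zero[of "{..<?a}"]) (use \<eta>0 that in auto)
    have Q0: "Q t = 0" "Q' t = 0" if "t < ?a" for t using that \<eta>0[of t] d\<eta>0[of t] by (auto simp: Q_def Q'_def)
    have QD: "(Q has_real_derivative Q' t) (at t)" for t
    proof (cases "t < ?a")
      case True
      have "((\<lambda>_. 0) has_real_derivative Q' t) (at t)" using Q0[OF True] by simp
      then show ?thesis
        by (rule has_field_derivative_transform_within_open[of _ _ _ "{..<?a}"]) (use True Q0 in auto)
    next
      case False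
      then have t: "t > 0" using a by linarith
      have "((\<lambda>t. F (sqrt t)) has_real_derivative F' (sqrt t) * (1 / (2 * sqrt t))) (at t)"
        by (rule DERIV_chain2[OF F']) (use t in \<open>auto intro!: derivative_eq_intros simp: field_simps\<close>)
      from DERIV_mult[OF this smooth_DERIV[OF s\<eta>[of k] UNIV_I]]
      have "((\<lambda>t. F (sqrt t) * \<eta> k t) has_real_derivative Q' t) (at t)"
        using t by (simp add: Q'_def mult_ac)
      then show ?thesis
        by (rule has_field_derivative_transform_within_open[of _ _ _ "{0<..}"]) (use t in \<open>auto simp: Q_def\<close>)
    qed
    have Qc: "continuous_on UNIV Q" by (intro continuous_at_imp_continuous_on ballI DERIV_isCont[OF QD])
    have Q'c: "continuous_on UNIV Q'"
    proof -
      have Fc: "continuous_on {0<..} F"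
        by (intro continuous_at_imp_continuous_on ballI) (use F' DERIV_isCont in auto)
      have "continuous_on {0<..} (\<lambda>t. F' (sqrt t) * (1 / (2 * sqrt t)) * \<eta> k t + F (sqrt t) * deriv (\<eta> k) t)"
        by (intro continuous_intros continuous_on_compose2[OF F'c] continuous_on_compose2[OF Fc]
            continuous_on_subset[OF smooth_continuous_on[OF s\<eta>]] continuous_on_subset[OF smooth_continuous_on[OF smooth_deriv[OF s\<eta>]]]) auto
      then have "continuous_on {0<..} Q'" by (rule continuous_on_eq) (auto simp: Q'_def)
      moreover have "continuous_on {..<?a} Q'"
        by (rule continuous_on_eq[OF continuous_on_const[of _ 0]]) (use Q0 in auto)
      ultimately have "continuous_on ({0<..} \<union> {..<?a}) Q'" by (intro continuous_on_open_Un) auto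
      moreover have "{0<..} \<union> {..<?a} = UNIV" using a by (auto simp: not_less simp del: of_nat_Suc intro: order_le_less_trans)
      ultimately show ?thesis by simp
    qed
    have gm: "(\<lambda>x. g x $ i) \<in> borel_measurable lebesgue" by (rule L2grad_component[OF g])
    have \<psi>m: "\<psi> k \<in> borel_measurable lebesgue" by (rule test_fun_lebesgue[OF t\<psi>])
    have G1m: "(\<lambda>x::real^'n. G (norm x) / norm x * x $ i) \<in> borel_measurable lebesgue"
      by (intro measurable_completion) simp
    let ?Z = "\<lambda>x::real^'n. G (norm x) / norm x * x $ i * \<psi> k x"
    \<comment> \<open>The part of 2 Q' in which the derivative falls on F and not on the cutoff;
      Z(|x|^2) x_i is the expected i-th derivative times the cutoff.\<close>
    define Z where "Z t = 2 * (Q' t - (if t > 0 then F (sqrt t) else 0) * deriv (\<eta> k) t)" for t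
    have Zeq: "?Z x = Z ((norm x)\<^sup>2) * x $ i" for x
    proof (cases "x = 0")
      case False
      then show ?thesis by (simp add: Z_def Q'_def G_def \<psi>_def)
    qed (simp add: G_def)
    have Zc: "continuous_on UNIV Z"
    proof -
      define Q2 where "Q2 t = (if t > 0 then F (sqrt t) else 0) * deriv (\<eta> k) t" for t
      have Fc: "continuous_on {0<..} F"
        by (intro continuous_at_imp_continuous_on ballI) (use F' DERIV_isCont in auto)
      have "continuous_on {0<..} (\<lambda>t. F (sqrt t) * deriv (\<eta> k) t)"
        by (intro continuous_intros continuous_on_compose2[OF Fc]
            continuous_on_subset[OF smooth_continuous_on[OF smooth_deriv[OF s\<eta>]]]) auto
      then have "continuous_on {0<..} Q2" by (rule continuous_on_eq) (auto simp: Q2_def)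
      moreover have "continuous_on {..<?a} Q2"
        by (rule continuous_on_eq[OF continuous_on_const[of _ 0]]) (use d\<eta>0 in \<open>auto simp: Q2_def\<close>)
      ultimately have "continuous_on ({0<..} \<union> {..<?a}) Q2" by (intro continuous_on_open_Un) auto
      moreover have "{0<..} \<union> {..<?a} = UNIV" using a by (auto simp: not_less simp del: of_nat_Suc intro: order_le_less_trans)
      ultimately have "continuous_on UNIV Q2" by simp
      then show ?thesis unfolding Z_def Q2_def[symmetric] by (intro continuous_intros Q'c)
    qed
    have Zi: "continuous_on UNIV ?Z" unfolding Zeq
      by (intro continuous_intros continuous_on_compose2[OF Zc]) auto
    have iZ: "integrable lebesgue (\<lambda>x. indicator (cball 0 R) x * ?Z x)" for R
    proof -
      have "integrable lborel (\<lambda>x. indicator (cball 0 R) x *\<^sub>R ?Z x)"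
        by (rule borel_integrable_compact) (use continuous_on_subset[OF Zi] in auto)
      then have "integrable lborel (\<lambda>x. indicator (cball 0 R) x * ?Z x)" by simp
      then show ?thesis by (subst integrable_completion) (auto dest: borel_measurable_integrable)
    qed
    have ig\<phi>: "integrable lebesgue (\<lambda>x. g x $ i * \<phi> x)" if "test_fun \<phi>" for \<phi>
      by (rule integrable_mult_test_fun[OF gm integrable_cball_L2[OF L2grad_component[OF g]] that])
    have igc: "integrable lebesgue (\<lambda>x. indicator (cball 0 R) x * (g x $ i * \<psi> k x))" for R
    proof -
      have "integrable lebesgue (\<lambda>x. indicator (cball 0 R) x *\<^sub>R (g x $ i * \<psi> k x))"
        by (rule integrable_mult_indicator[OF _ ig\<phi>[OF t\<psi>]]) simp
      then show ?thesis by simp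
    qed
    have split: "(g x $ i - G (norm x) / norm x * x $ i) * \<psi> k x = g x $ i * \<psi> k x - ?Z x" for x
      by (simp add: left_diff_distrib)
    show "(\<lambda>x. (g x $ i - G (norm x) / norm x * x $ i) * \<psi> k x) \<in> borel_measurable lebesgue"
      using gm \<psi>m G1m by simp
    show "integrable lebesgue (\<lambda>x. indicator (cball 0 R) x * ((g x $ i - G (norm x) / norm x * x $ i) * \<psi> k x))" for R
      unfolding split using Bochner_Integration.integrable_diff[OF igc iZ, of R R] by (simp only: right_diff_distrib)
    fix \<phi> :: "real^'n \<Rightarrow> real" assume t: "test_fun \<phi>"
    have t2: "test_fun (\<lambda>x. \<psi> k x * \<phi> x)" by (rule test_fun_mult[OF t\<psi> test_fun_C_inf[OF t]])
    obtain R where R: "R > 0" "\<And>x. norm x > R \<Longrightarrow> \<phi> x = 0" using test_funE[OF t] by blast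
    have R': "pdiff i \<phi> x = 0" if "norm x > R" for x
    proof -
      have "(\<phi> has_derivative (\<lambda>y. 0)) (at x)"
        by (rule has_derivative_transform_within_open[of "\<lambda>_. 0" _ _ _ "- cball 0 R"]) (use that R in auto)
      from pdiff_eqI[OF this] show ?thesis .
    qed
    let ?z' = "\<lambda>x::real^'n. Q' ((norm x)\<^sup>2) * (2 * x $ i) * \<phi> x + pdiff i \<phi> x * Q ((norm x)\<^sup>2)"
    have pc: "continuous_on UNIV \<phi>" "continuous_on UNIV (pdiff i \<phi>)"
      using C_inf_continuous_on test_fun_C_inf[OF t] C_inf_pdiff by blast+
    have z0: "(\<integral>x. ?z' x \<partial>lborel) = 0"
    proof (rule integral_directional_deriv_zero[where z="\<lambda>x. Q ((norm x)\<^sup>2) * \<phi> x" and R=R and e="axis i 1"])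
      fix x :: "real^'n" and t :: real
      let ?y = "x + t *\<^sub>R axis i 1"
      have "((\<lambda>t. (norm (x + t *\<^sub>R axis i 1))\<^sup>2) has_real_derivative pdiff i (\<lambda>x. (norm x)\<^sup>2) ?y) (at t)"
        by (rule C_inf_pdiff_line[OF C_inf_norm_sq])
      then have "((\<lambda>t. (norm (x + t *\<^sub>R axis i 1))\<^sup>2) has_real_derivative 2 * ?y $ i) (at t)"
        unfolding pdiff_norm_sq .
      from DERIV_mult[OF DERIV_chain2[OF QD this] C_inf_pdiff_line[OF test_fun_C_inf[OF \<open>test_fun \<phi>\<close>]]]
      show "((\<lambda>t. Q ((norm (x + t *\<^sub>R axis i 1))\<^sup>2) * \<phi> (x + t *\<^sub>R axis i 1)) has_real_derivative ?z' ?y) (at t)" .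
    qed (use R R' in \<open>auto intro!: continuous_intros continuous_on_compose2[OF Qc] continuous_on_compose2[OF Q'c] pc\<close>)
    have z'eq: "?z' x = ?Z x * \<phi> x + F (norm x) * pdiff i (\<lambda>x. \<psi> k x * \<phi> x) x" if "x \<noteq> 0" for x
    proof -
      have "pdiff i (\<psi> k) x = 2 * x $ i * deriv (\<eta> k) ((norm x)\<^sup>2)"
        unfolding \<psi>_def[abs_def] by (rule pdiff_radial[OF s\<eta>])
      then have "pdiff i (\<lambda>x. \<psi> k x * \<phi> x) x = 2 * x $ i * deriv (\<eta> k) ((norm x)\<^sup>2) * \<phi> x + \<eta> k ((norm x)\<^sup>2) * pdiff i \<phi> x"
        unfolding pdiff_mult[OF test_fun_C_inf[OF t\<psi>] test_fun_C_inf[OF t]] by (simp add: \<psi>_def)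
      then show ?thesis using that
        by (simp add: Q'_def Q_def G_def \<psi>_def algebra_simps)
    qed
    have iu: "integrable lebesgue (\<lambda>x. u x * pdiff i (\<lambda>x. \<psi> k x * \<phi> x) x)"
      and eu: "(\<integral>x. u x * pdiff i (\<lambda>x. \<psi> k x * \<phi> x) x \<partial>lebesgue) = - (\<integral>x. g x $ i * (\<psi> k x * \<phi> x) \<partial>lebesgue)"
      using g t2 by (auto simp: L2grad_def weak_grad_def)
    have iZ\<phi>: "integrable lebesgue (\<lambda>x. ?Z x * \<phi> x)"
      by (rule integrable_mult_test_fun[OF borel_measurable_times[OF G1m \<psi>m] iZ t])
    have "(\<integral>x. ?Z x * \<phi> x + u x * pdiff i (\<lambda>x. \<psi> k x * \<phi> x) x \<partial>lebesgue) = (\<integral>x. ?z' x \<partial>lebesgue)"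
    proof (rule integral_cong_AE)
      have "AE x::real^'n in lebesgue. norm x > 0" using AE_norm_pos by (simp add: AE_completion_iff)
      then show "AE x in lebesgue. ?Z x * \<phi> x + u x * pdiff i (\<lambda>x. \<psi> k x * \<phi> x) x = ?z' x"
        using uF by eventually_elim (use z'eq in simp)
      show "(\<lambda>x. ?Z x * \<phi> x + u x * pdiff i (\<lambda>x. \<psi> k x * \<phi> x) x) \<in> borel_measurable lebesgue"
        using iZ\<phi> iu by (intro borel_measurable_add borel_measurable_integrable)
      have "continuous_on UNIV ?z'"
        by (auto intro!: continuous_intros continuous_on_compose2[OF Qc] continuous_on_compose2[OF Q'c] pc)
      then show "?z' \<in> borel_measurable lebesgue"
        by (intro measurable_completion) (simp add: borel_measurable_continuous_onI)
    qed
    also have "\<dots> = 0"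
    proof -
      have "continuous_on UNIV ?z'"
        by (auto intro!: continuous_intros continuous_on_compose2[OF Qc] continuous_on_compose2[OF Q'c] pc)
      then have "?z' \<in> borel_measurable borel" by (rule borel_measurable_continuous_onI)
      then show ?thesis using z0 by (subst integral_completion) auto
    qed
    finally have "(\<integral>x. ?Z x * \<phi> x \<partial>lebesgue) = (\<integral>x. g x $ i * (\<psi> k x * \<phi> x) \<partial>lebesgue)"
      using iZ\<phi> iu eu by simp
    moreover have "(\<integral>x. (g x $ i - G (norm x) / norm x * x $ i) * \<psi> k x * \<phi> x \<partial>lebesgue) = (\<integral>x. g x $ i * (\<psi> k x * \<phi> x) - ?Z x * \<phi> x \<partial>lebesgue)"
      unfolding split by (simp add: left_diff_distrib mult.assoc)
    ultimately show "(\<integral>x. (g x $ i - G (norm x) / norm x * x $ i) * \<psi> k x * \<phi> x \<partial>lebesgue) = 0"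
      using iZ\<phi> ig\<phi>[OF t2] by simp
  qed
  have "AE x in lebesgue. \<forall>i k. (g x $ i - G (norm x) / norm x * x $ i) * \<psi> k x = 0"
    unfolding AE_all_countable using main by blast
  moreover have "AE x::real^'n in lebesgue. norm x > 0" using AE_norm_pos by (simp add: AE_completion_iff)
  ultimately show ?thesis
  proof eventually_elim
    case (elim x)
    obtain k where k: "max ((norm x)\<^sup>2) (1 / (norm x)\<^sup>2) < real k" using reals_Archimedean2 by blast
    have p: "(norm x)\<^sup>2 > 0" using elim by simp
    have "1 < real k * (norm x)\<^sup>2" using k p by (simp add: divide_less_eq)
    then have "1 < real k * (norm x)\<^sup>2 + (norm x)\<^sup>2" using p by linarith
    then have "1 / real (Suc k) < (norm x)\<^sup>2" by (simp add: divide_less_eq algebra_simps)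
    then have "\<psi> k x \<noteq> 0" unfolding \<psi>_def \<eta>_def using k by (intro less_imp_neq[symmetric] bump_pos) auto
    then have "g x $ i = G (norm x) / norm x * x $ i" for i using elim(1)[rule_format, of i k] by simp
    then show ?case using elim(2) by (simp add: vec_eq_iff G_def)
  qed
qed

subsection \<open>Hardy's inequality and the energy identity\<close>

text \<open>Otherwise |Q|/r >= d/r beyond R, and the integral of d/r diverges
  logarithmically.\<close>

lemma small_value_at_infinity:
  fixes Q :: "real \<Rightarrow> real"
  assumes i: "integrable lborel (\<lambda>r. indicator {0<..} r * (Q r / r))" and d: "d > 0" and R: "R > 0"
  shows "\<exists>r\<ge>R. \<bar>Q r\<bar> < d"
proof (rule ccontr)
  assume "\<not> ?thesis"
  then have Q: "\<bar>Q r\<bar> \<ge> d" if "r \<ge> R" for r using that by force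
  define M where "M = (\<integral>r. \<bar>indicator {0<..} r * (Q r / r)\<bar> \<partial>lborel)"
  have "d * T \<le> M" if "T > 0" for T
  proof -
    let ?S = "R * exp T"
    have RS: "R \<le> ?S" using R that by simp
    have D: "((\<lambda>r. d * ln r) has_real_derivative d * (1 / r)) (at r)" if "r > 0" for r
      using that by (auto intro!: derivative_eq_intros)
    have c: "continuous_on {0<..} (\<lambda>r::real. d * (1 / r))" by (intro continuous_intros) auto
    have "d * T = d * ln ?S - d * ln R" using R by (simp add: ln_mult algebra_simps)
    also have "\<dots> = (\<integral>r. indicator {R..?S} r * (d * (1 / r)) \<partial>lborel)"
      by (rule integral_by_FTC(2)[OF R RS D c, symmetric])
    also have "\<dots> \<le> M" unfolding M_def
    proof (rule integral_mono[OF integral_by_FTC(1)[OF R RS D c] integrable_abs[OF i]])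
      fix r
      show "indicator {R..?S} r * (d * (1 / r)) \<le> \<bar>indicator {0<..} r * (Q r / r)\<bar>"
        using Q[of r] R by (auto split: split_indicator simp: abs_div intro!: divide_right_mono)
    qed
    finally show ?thesis .
  qed
  from this[of "(\<bar>M\<bar> + 1) / d"] d have "\<bar>M\<bar> + 1 \<le> M" by (simp add: add_nonneg_pos)
  then show False by linarith
qed

text \<open>The same logarithmic divergence, now at 0.\<close>

lemma small_value_at_zero:
  fixes Q :: "real \<Rightarrow> real"
  assumes i: "integrable lborel (\<lambda>r. indicator {0<..} r * (Q r / r))" and d: "d > 0" and R: "R > 0"
  shows "\<exists>r. 0 < r \<and> r \<le> R \<and> \<bar>Q r\<bar> < d"
proof (rule ccontr)
  assume "\<not> ?thesis"
  then have Q: "\<bar>Q r\<bar> \<ge> d" if "0 < r" "r \<le> R" for r using that by force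
  define M where "M = (\<integral>r. \<bar>indicator {0<..} r * (Q r / r)\<bar> \<partial>lborel)"
  have "d * T \<le> M" if "T > 0" for T
  proof -
    let ?S = "R * exp (- T)"
    have S: "0 < ?S" "?S \<le> R" using R that by auto
    have D: "((\<lambda>r. d * ln r) has_real_derivative d * (1 / r)) (at r)" if "r > 0" for r
      using that by (auto intro!: derivative_eq_intros)
    have c: "continuous_on {0<..} (\<lambda>r::real. d * (1 / r))" by (intro continuous_intros) auto
    have "d * T = d * ln R - d * ln ?S" using R by (simp add: ln_mult algebra_simps)
    also have "\<dots> = (\<integral>r. indicator {?S..R} r * (d * (1 / r)) \<partial>lborel)"
      by (rule integral_by_FTC(2)[OF S D c, symmetric])
    also have "\<dots> \<le> M" unfolding M_def
    proof (rule integral_mono[OF integral_by_FTC(1)[OF S D c] integrable_abs[OF i]])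
      fix r
      show "indicator {?S..R} r * (d * (1 / r)) \<le> \<bar>indicator {0<..} r * (Q r / r)\<bar>"
      proof (cases "r \<in> {?S..R}")
        case True
        then have "0 < r" using S by auto
        then show ?thesis using Q[of r] True by (auto simp: abs_div intro!: divide_right_mono)
      qed auto
    qed
    finally show ?thesis .
  qed
  from this[of "(\<bar>M\<bar> + 1) / d"] d have "\<bar>M\<bar> + 1 \<le> M" by (simp add: add_nonneg_pos)
  then show False by linarith
qed

lemma inverse_Suc_le_pos: "1 / real (Suc n) \<le> r \<Longrightarrow> 0 < r"
  by (rule less_le_trans[of _ "1 / real (Suc n)"]) simp_all

lemma exhaustion_tendsto:
  fixes q :: "real \<Rightarrow> real"
  assumes i: "integrable lborel (\<lambda>r. indicator {0<..} r * q r)"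
  shows "(\<lambda>n. \<integral>r. indicator {1 / real (Suc n)..real (Suc n)} r * q r \<partial>lborel) \<longlonglongrightarrow> (\<integral>r. indicator {0<..} r * q r \<partial>lborel)"
proof -
  have eq: "indicator {1 / real (Suc n)..real (Suc n)} r * q r = indicator {1 / real (Suc n)..real (Suc n)} r * (indicator {0<..} r * q r)" for n r
    by (auto split: split_indicator dest: inverse_Suc_le_pos simp del: of_nat_Suc)
  have [measurable]: "(\<lambda>r. indicator {0<..} r * q r) \<in> borel_measurable lborel" using i by (rule borel_measurable_integrable)
  show ?thesis
    unfolding eq
  proof (rule integral_dominated_convergence[where w="\<lambda>r. \<bar>indicator {0<..} r * q r\<bar>"])
    show "AE r in lborel. (\<lambda>n. indicator {1 / real (Suc n)..real (Suc n)} r * (indicator {0<..} r * q r)) \<longlonglongrightarrow> indicator {0<..} r * q r"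
    proof (rule AE_I2)
      fix r :: real
      show "(\<lambda>n. indicator {1 / real (Suc n)..real (Suc n)} r * (indicator {0<..} r * q r)) \<longlonglongrightarrow> indicator {0<..} r * q r"
      proof (cases "r > 0")
        case True
        obtain k where k: "max r (1/r) < real k" using reals_Archimedean2 by blast
        have "r \<in> {1 / real (Suc n)..real (Suc n)}" if "n \<ge> k" for n
        proof -
          have "1 / r < real (Suc n)" "r < real (Suc n)" using k that by auto
          then show ?thesis using True by (auto simp: field_simps)
        qed
        then have "\<forall>\<^sub>F n in sequentially. indicator {1 / real (Suc n)..real (Suc n)} r * (indicator {0<..} r * q r) = indicator {0<..} r * q r"
          by (intro eventually_sequentiallyI[of k]) (simp only: indicator_simps mult_1)
        then show ?thesis by (rule tendsto_eventually)
      qed simp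
    qed
    show "AE r in lborel. norm (indicator {1 / real (Suc n)..real (Suc n)} r * (indicator {0<..} r * q r)) \<le> \<bar>indicator {0<..} r * q r\<bar>" for n
      by (rule AE_I2) (auto split: split_indicator)
  qed (use i in auto)
qed

text \<open>No pointwise decay of Q is known. Integrability of Q/r supplies, arbitrarily far out and
  arbitrarily close to 0, single radii at which Q is small, and the fundamental theorem between two
  such radii suffices.\<close>

lemma integral_deriv_zero_halfline:
  fixes Q q :: "real \<Rightarrow> real"
  assumes Q: "\<And>r. r > 0 \<Longrightarrow> (Q has_real_derivative q r) (at r)" and qc: "continuous_on {0<..} q"
    and iq: "integrable lborel (\<lambda>r. indicator {0<..} r * q r)"
    and iQ: "integrable lborel (\<lambda>r. indicator {0<..} r * (Q r / r))"
  shows "(\<integral>r. indicator {0<..} r * q r \<partial>lborel) = 0"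
proof (rule ccontr)
  define I where "I = (\<integral>r. indicator {0<..} r * q r \<partial>lborel)"
  assume "(\<integral>r. indicator {0<..} r * q r \<partial>lborel) \<noteq> 0"
  then have "\<bar>I\<bar> > 0" by (simp add: I_def)
  \<comment> \<open>One third for each of the two boundary values and one third for the tails of the
    integral.\<close>
  define d where "d = \<bar>I\<bar> / 3"
  have d: "d > 0" using \<open>\<bar>I\<bar> > 0\<close> by (simp add: d_def)
  have iq': "integrable lborel (\<lambda>r. indicator {0<..} r * \<bar>q r\<bar>)"
    using integrable_abs[OF iq] by (simp add: abs_mult)
  obtain n where n: "\<bar>(\<integral>r. indicator {1 / real (Suc n)..real (Suc n)} r * \<bar>q r\<bar> \<partial>lborel) - (\<integral>r. indicator {0<..} r * \<bar>q r\<bar> \<partial>lborel)\<bar> < d"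
    using LIMSEQ_D[OF exhaustion_tendsto[OF iq'] d] by (metis order_refl real_norm_def)
  have np: "0 < 1 / real (Suc n)" "1 / real (Suc n) \<le> real (Suc n)" by (simp_all add: field_simps)
  obtain b where b: "b \<ge> real (Suc n)" "\<bar>Q b\<bar> < d" using small_value_at_infinity[OF iQ d, of "real (Suc n)"] by auto
  obtain a where a: "0 < a" "a \<le> 1 / real (Suc n)" "\<bar>Q a\<bar> < d" using small_value_at_zero[OF iQ d np(1)] by auto
  have ab: "a \<le> b" using a b np by linarith
  note FTC = integral_by_FTC[OF a(1) ab Q qc]
  have qca: "continuous_on {0<..} (\<lambda>r. \<bar>q r\<bar>)" by (intro continuous_intros qc)
  have in1: "integrable lborel (\<lambda>r. indicator {1 / real (Suc n)..real (Suc n)} r * \<bar>q r\<bar>)"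
  proof -
    have "integrable lborel (\<lambda>r. indicator {1 / real (Suc n)..real (Suc n)} r *\<^sub>R \<bar>q r\<bar>)"
      by (rule borel_integrable_compact[OF _ continuous_on_subset[OF qca]]) (auto dest: inverse_Suc_le_pos simp del: of_nat_Suc)
    then show ?thesis by simp
  qed
  have "\<bar>I - (\<integral>r. indicator {a..b} r * q r \<partial>lborel)\<bar> = \<bar>\<integral>r. indicator {0<..} r * q r - indicator {a..b} r * q r \<partial>lborel\<bar>"
    unfolding I_def using iq FTC(1) by simp
  also have "\<dots> \<le> (\<integral>r. \<bar>indicator {0<..} r * q r - indicator {a..b} r * q r\<bar> \<partial>lborel)" by (rule integral_abs_bound)
  also have "\<dots> \<le> (\<integral>r. indicator {0<..} r * \<bar>q r\<bar> - indicator {1 / real (Suc n)..real (Suc n)} r * \<bar>q r\<bar> \<partial>lborel)"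
  proof (rule integral_mono)
    show "integrable lborel (\<lambda>r. \<bar>indicator {0<..} r * q r - indicator {a..b} r * q r\<bar>)" using iq FTC(1) by simp
    show "integrable lborel (\<lambda>r. indicator {0<..} r * \<bar>q r\<bar> - indicator {1 / real (Suc n)..real (Suc n)} r * \<bar>q r\<bar>)"
      using iq' in1 by simp
    fix r
    show "\<bar>indicator {0<..} r * q r - indicator {a..b} r * q r\<bar> \<le> indicator {0<..} r * \<bar>q r\<bar> - indicator {1 / real (Suc n)..real (Suc n)} r * \<bar>q r\<bar>"
    proof (cases "r \<in> {1 / real (Suc n)..real (Suc n)}")
      case True
      then have "r \<in> {a..b}" "r \<in> {0<..}" using a b np unfolding atLeastAtMost_iff greaterThan_iff by linarith+
      then show ?thesis using True by (simp only: indicator_simps)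
    next
      case False
      have "r \<in> {a..b} \<Longrightarrow> r \<in> {0<..}" using a by auto
      then show ?thesis using False by (cases "r \<in> {a..b}"; cases "r \<in> {0<..}") (simp_all only: indicator_simps, auto)
    qed
  qed
  also have "\<dots> < d" using n iq' in1 by simp
  finally have "\<bar>I - (Q b - Q a)\<bar> < d" using FTC(2) by simp
  then have "\<bar>I\<bar> < 3 * d" using a(3) b(2) by linarith
  then show False by (simp add: d_def)
qed

text \<open>Integrate the derivative of r^(N-2) F^2 over a compact interval: the upper boundary
  value is at most K, the lower one has a favourable sign, and the mixed term is absorbed by a
  square. Monotone convergence then yields integrability instead of presupposing it.\<close>

lemma hardy_radial:
  fixes F F' :: "real \<Rightarrow> real" and N :: nat
  assumes N: "N \<ge> 3" and F: "\<And>r. r > 0 \<Longrightarrow> (F has_real_derivative F' r) (at r)" and F'c: "continuous_on {0<..} F'"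
    and K: "\<And>r. r > 0 \<Longrightarrow> (F r)\<^sup>2 * r ^ (N - 2) \<le> K"
    and iA: "integrable lborel (\<lambda>r. indicator {0<..} r * (r ^ (N - 1) * (F' r)\<^sup>2))"
  shows "integrable lborel (\<lambda>r. indicator {0<..} r * (r ^ (N - 3) * (F r)\<^sup>2))" (is ?int)
    and "(real N - 2) / 2 * (\<integral>r. indicator {0<..} r * (r ^ (N - 3) * (F r)\<^sup>2) \<partial>lborel) \<le>
      K + 2 / (real N - 2) * (\<integral>r. indicator {0<..} r * (r ^ (N - 1) * (F' r)\<^sup>2) \<partial>lborel)"
proof -
  obtain m where m: "N = m + 3" using N le_Suc_ex by (metis add.commute)
  define k where "k = real m + 1"
  have k: "k > 0" "real N - 2 = k" by (auto simp: k_def m)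
  have Fc: "continuous_on {0<..} F"
    by (intro continuous_at_imp_continuous_on ballI) (use F DERIV_isCont in auto)
  define A where "A = (\<integral>r. indicator {0<..} r * (r ^ (N - 1) * (F' r)\<^sup>2) \<partial>lborel)"
  define h where "h r = r ^ m * (F r)\<^sup>2" for r
  define q where "q r = k * h r + 2 * (r ^ Suc m * (F r * F' r))" for r
  have hc: "continuous_on {0<..} h" unfolding h_def by (intro continuous_intros Fc)
  have qc: "continuous_on {0<..} q" unfolding q_def by (intro continuous_intros Fc F'c hc)
  have D: "((\<lambda>r. r ^ Suc m * (F r)\<^sup>2) has_real_derivative q r) (at r)" if "r > 0" for r
  proof -
    have "((\<lambda>r. (F r)\<^sup>2) has_real_derivative 2 * F r * F' r) (at r)"
      using F[OF that] by (auto intro!: derivative_eq_intros)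
    from DERIV_mult[OF DERIV_pow[of "Suc m" r UNIV] this] show ?thesis
      by (simp add: q_def h_def k_def algebra_simps)
  qed
  define J where "J n = (\<integral>r. indicator {1 / real (Suc n)..real (Suc n)} r * h r \<partial>lborel)" for n
  have np: "0 < 1 / real (Suc n)" "1 / real (Suc n) \<le> real (Suc n)" for n by (simp_all add: field_simps)
  have ci: "integrable lborel (\<lambda>r. indicator {1 / real (Suc n)..real (Suc n)} r * f r)" if "continuous_on {0<..} f" for f :: "real \<Rightarrow> real" and n
  proof -
    have "integrable lborel (\<lambda>r. indicator {1 / real (Suc n)..real (Suc n)} r *\<^sub>R f r)"
      by (rule borel_integrable_compact[OF _ continuous_on_subset[OF that]]) (auto dest: inverse_Suc_le_pos simp del: of_nat_Suc)
    then show ?thesis by simp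
  qed
  have J: "k / 2 * J n \<le> K + 2 / k * A" for n
  proof -
    let ?I = "\<lambda>r. indicator {1 / real (Suc n)..real (Suc n)} r :: real"
    have e: "(\<integral>r. ?I r * q r \<partial>lborel) = real (Suc n) ^ Suc m * (F (real (Suc n)))\<^sup>2 - (1 / real (Suc n)) ^ Suc m * (F (1 / real (Suc n)))\<^sup>2"
      by (rule integral_by_FTC(2)[OF np D qc])
    have "real (Suc n) ^ Suc m * (F (real (Suc n)))\<^sup>2 \<le> K" using K[of "real (Suc n)"] by (simp add: m mult.commute)
    moreover have "0 \<le> (1 / real (Suc n)) ^ Suc m * (F (1 / real (Suc n)))\<^sup>2" by simp
    ultimately have e1: "(\<integral>r. ?I r * q r \<partial>lborel) \<le> K" unfolding e by linarith
    have pt: "k / 2 * (?I r * h r) \<le> ?I r * q r + 2 / k * (indicator {0<..} r * (r ^ (N - 1) * (F' r)\<^sup>2))" for r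
    proof (cases "r \<in> {1 / real (Suc n)..real (Suc n)}")
      case True
      then have r: "r > 0" using np(1)[of n] unfolding atLeastAtMost_iff by linarith
      \<comment> \<open>Half of the Hardy term pays for the mixed term 2 r^(N-2) F F'; the price is
        the factor 2/(N-2) in front of the Dirichlet integral.\<close>
      have "0 \<le> r ^ m * (k / 2 * (F r + 2 / k * (r * F' r))\<^sup>2)" using k r by simp
      also have "\<dots> = k / 2 * h r + 2 * (r ^ Suc m * (F r * F' r)) + 2 / k * (r ^ (N - 1) * (F' r)\<^sup>2)"
        using k by (simp add: h_def m power2_eq_square field_simps)
      finally show ?thesis using True r by (simp add: q_def)
    next
      case False
      have "r > 0 \<Longrightarrow> 0 \<le> 2 / k * (r ^ (N - 1) * (F' r)\<^sup>2)" using k by simp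
      then show ?thesis using False by (cases "r > 0") (simp_all only: indicator_simps, auto)
    qed
    have "k / 2 * J n = (\<integral>r. k / 2 * (?I r * h r) \<partial>lborel)" by (simp add: J_def)
    also have "\<dots> \<le> (\<integral>r. ?I r * q r + 2 / k * (indicator {0<..} r * (r ^ (N - 1) * (F' r)\<^sup>2)) \<partial>lborel)"
      by (rule integral_mono[OF integrable_mult_right[OF ci[OF hc]] Bochner_Integration.integrable_add[OF ci[OF qc] integrable_mult_right[OF iA]] pt])
    also have "\<dots> = (\<integral>r. ?I r * q r \<partial>lborel) + 2 / k * A"
      unfolding A_def using Bochner_Integration.integral_add[OF ci[OF qc] integrable_mult_right[OF iA, of "2/k"], of n]
      by (simp only: integral_mult_right_zero)
    finally show ?thesis using e1 by linarith
  qed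
  have inc: "{1 / real (Suc n)..real (Suc n)} \<subseteq> {1 / real (Suc n')..real (Suc n')}" if "n \<le> n'" for n n'
    using that by (auto simp: field_simps intro: order_trans)
  have mI: "indicator {1 / real (Suc n)..real (Suc n)} r * h r \<le> indicator {1 / real (Suc n')..real (Suc n')} r * h r" if "n \<le> n'" for n n' r
  proof (cases "r \<in> {1 / real (Suc n)..real (Suc n)}")
    case True
    then show ?thesis using inc[OF that] by (simp only: indicator_simps subsetD)
  next
    case False
    then show ?thesis unfolding h_def
      by (cases "r \<in> {1 / real (Suc n')..real (Suc n')}")
        (simp_all only: indicator_simps, auto dest!: inverse_Suc_le_pos simp del: of_nat_Suc)
  qed
  have Jmono: "incseq J" unfolding incseq_def J_def
    by (intro allI impI integral_mono ci hc mI)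
  have Jbd: "J n \<le> (K + 2 / k * A) / (k / 2)" for n
    using J[of n] k by (simp add: field_simps)
  then obtain L where L: "J \<longlonglongrightarrow> L" using incseq_convergent[OF Jmono] by (metis Jbd)
  have L': "L \<le> (K + 2 / k * A) / (k / 2)" by (rule LIMSEQ_le_const2[OF L]) (use Jbd in auto)
  have lim: "(\<lambda>n. indicator {1 / real (Suc n)..real (Suc n)} r * h r) \<longlonglongrightarrow> indicator {0<..} r * h r" for r
  proof (cases "r > 0")
    case True
    obtain j where j: "max r (1/r) < real j" using reals_Archimedean2 by blast
    have "r \<in> {1 / real (Suc n)..real (Suc n)}" if "n \<ge> j" for n
    proof -
      have "1 / r < real (Suc n)" "r < real (Suc n)" using j that by auto
      then show ?thesis using True by (auto simp: field_simps)
    qed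
    then have "\<forall>\<^sub>F n in sequentially. indicator {1 / real (Suc n)..real (Suc n)} r * h r = indicator {0<..} r * h r"
      by (intro eventually_sequentiallyI[of j]) (use True in \<open>simp only: indicator_simps greaterThan_iff\<close>)
    then show ?thesis by (rule tendsto_eventually)
  next
    case False
    then have eq: "indicator {1 / real (Suc n)..real (Suc n)} r * h r = indicator {0<..} r * h r" for n
      by (auto split: split_indicator dest: inverse_Suc_le_pos simp del: of_nat_Suc)
    show ?thesis by (simp only: eq tendsto_const)
  qed
  have hm: "(\<lambda>r. indicator {0<..} r * h r) \<in> borel_measurable lborel"
    using borel_measurable_continuous_on_indicator[OF _ hc] by simp
  have mono': "AE r in lborel. mono (\<lambda>n. indicator {1 / real (Suc n)..real (Suc n)} r * h r)"
    by (intro AE_I2 monoI mI)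
  have *: "integrable lborel (\<lambda>r. indicator {0<..} r * h r)" "(\<integral>r. indicator {0<..} r * h r \<partial>lborel) = L"
    using integrable_monotone_convergence[OF ci[OF hc] mono' _ L[unfolded J_def] hm]
      integral_monotone_convergence[OF ci[OF hc] mono' _ L[unfolded J_def] hm] lim by auto
  show ?int using *(1) by (simp add: h_def m)
  show "(real N - 2) / 2 * (\<integral>r. indicator {0<..} r * (r ^ (N - 3) * (F r)\<^sup>2) \<partial>lborel) \<le>
      K + 2 / (real N - 2) * (\<integral>r. indicator {0<..} r * (r ^ (N - 1) * (F' r)\<^sup>2) \<partial>lborel)"
    using L' *(2) k unfolding k(2) A_def[symmetric] by (simp add: h_def m field_simps)
qed


lemma radial_integral:
  fixes w :: "real^'n::finite \<Rightarrow> real"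
  assumes h: "h \<in> borel_measurable borel" and AE: "AE x in lebesgue. w x = h (norm x)" and w: "w \<in> borel_measurable lebesgue"
  shows "integrable lebesgue w \<longleftrightarrow> integrable lborel (\<lambda>r. indicator {0<..} r * (r ^ (CARD('n) - 1) * h r))"
    and "(\<integral>x. w x \<partial>lebesgue) = sph_area TYPE('n) * (\<integral>r. indicator {0<..} r * (r ^ (CARD('n) - 1) * h r) \<partial>lborel)"
proof -
  note h[measurable]
  have AE': "AE r in lborel. indicator {0..} r * (sph_area TYPE('n) * r ^ (CARD('n) - 1)) * h r =
      sph_area TYPE('n) * (indicator {0<..} r * (r ^ (CARD('n) - 1) * h r))"
    using AE_lborel_singleton[of "0::real"] by eventually_elim (auto split: split_indicator)
  have "integrable lebesgue w \<longleftrightarrow> integrable lborel (\<lambda>r. sph_area TYPE('n) * (indicator {0<..} r * (r ^ (CARD('n) - 1) * h r)))"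
    unfolding integrable_radial_lebesgue(1)[OF assms] by (rule integrable_cong_AE[OF _ _ AE']) auto
  also have "\<dots> \<longleftrightarrow> integrable lborel (\<lambda>r. indicator {0<..} r * (r ^ (CARD('n) - 1) * h r))"
    by (subst integrable_mult_left_iff) simp
  finally show "integrable lebesgue w \<longleftrightarrow> integrable lborel (\<lambda>r. indicator {0<..} r * (r ^ (CARD('n) - 1) * h r))" .
  have "(\<integral>x. w x \<partial>lebesgue) = (\<integral>r. sph_area TYPE('n) * (indicator {0<..} r * (r ^ (CARD('n) - 1) * h r)) \<partial>lborel)"
    unfolding integrable_radial_lebesgue(2)[OF assms] by (rule integral_cong_AE[OF _ _ AE']) auto
  then show "(\<integral>x. w x \<partial>lebesgue) = sph_area TYPE('n) * (\<integral>r. indicator {0<..} r * (r ^ (CARD('n) - 1) * h r) \<partial>lborel)"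
    by (simp only: integral_mult_right_zero)
qed

text \<open>The equation multiplied by F: the derivative of flux times F is r^(N-1) (w F - F'^2).
  The boundary terms are disposed of by \<open>integral_deriv_zero_halfline\<close>, where flux
  times F / r is integrable because it is bounded by the Dirichlet and Hardy densities
  together.\<close>

lemma energy_identity:
  assumes N: "CARD('n::finite) \<ge> 3" and wc: "continuous_on {0<..} w" and wm: "w \<in> borel_measurable borel"
    and wC: "\<And>r. r > 0 \<Longrightarrow> \<bar>w r\<bar> \<le> C * dom0 TYPE('n) r"
    and F: "\<And>r. r > 0 \<Longrightarrow> (F has_real_derivative F' r) (at r)"
    and F': "\<And>r. r > 0 \<Longrightarrow> F' r = - flux TYPE('n) w r / r ^ (CARD('n) - 1)"
    and K: "\<And>r. r > 0 \<Longrightarrow> (F r)\<^sup>2 * r ^ (CARD('n) - 2) \<le> K"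
    and iA: "integrable lborel (\<lambda>r. indicator {0<..} r * (r ^ (CARD('n) - 1) * (F' r)\<^sup>2))"
    and iB: "integrable lborel (\<lambda>r. indicator {0<..} r * (r ^ (CARD('n) - 1) * (w r * F r)))"
  shows "(\<integral>r. indicator {0<..} r * (r ^ (CARD('n) - 1) * (F' r)\<^sup>2) \<partial>lborel) =
    (\<integral>r. indicator {0<..} r * (r ^ (CARD('n) - 1) * (w r * F r)) \<partial>lborel)"
proof -
  let ?N = "CARD('n)" let ?W = "flux TYPE('n) w"
  obtain m where m: "?N = m + 3" using N le_Suc_ex by (metis add.commute)
  have WD: "(?W has_real_derivative r ^ (?N - 1) * w r) (at r)" if "r > 0" for r
    by (rule flux_DERIV[OF wc wm N _ that]) (rule wC)
  have Wc: "continuous_on {0<..} ?W"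
    by (intro continuous_at_imp_continuous_on ballI) (use WD DERIV_isCont in auto)
  have Fc: "continuous_on {0<..} F"
    by (intro continuous_at_imp_continuous_on ballI) (use F DERIV_isCont in auto)
  have "continuous_on {0<..} (\<lambda>r. - ?W r / r ^ (?N - 1))" by (intro continuous_intros Wc) auto
  then have F'c: "continuous_on {0<..} F'" by (rule continuous_on_eq) (simp add: F')
  have WF: "?W r = - (r ^ (?N - 1) * F' r)" if "r > 0" for r using F'[OF that] that by simp
  define q where "q r = r ^ (?N - 1) * (w r * F r) - r ^ (?N - 1) * (F' r)\<^sup>2" for r
  have qc: "continuous_on {0<..} q" unfolding q_def by (intro continuous_intros wc Fc F'c)
  have D: "((\<lambda>r. ?W r * F r) has_real_derivative q r) (at r)" if "r > 0" for r
  proof -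
    have "((\<lambda>r. ?W r * F r) has_real_derivative r ^ (?N - 1) * w r * F r + F' r * ?W r) (at r)"
      by (rule DERIV_mult[OF WD[OF that] F[OF that]])
    then show ?thesis using WF[OF that] by (simp add: q_def power2_eq_square algebra_simps)
  qed
  have iq: "integrable lborel (\<lambda>r. indicator {0<..} r * q r)"
    using Bochner_Integration.integrable_diff[OF iB iA] by (simp only: q_def right_diff_distrib)
  note iH = hardy_radial(1)[OF N F F'c K iA]
  have iQ: "integrable lborel (\<lambda>r. indicator {0<..} r * (?W r * F r / r))"
  proof (rule Bochner_Integration.integrable_bound[OF Bochner_Integration.integrable_add[OF iA iH]])
    have "continuous_on {0<..} (\<lambda>r. ?W r * F r / r)" by (intro continuous_intros Wc Fc) auto
    then show "(\<lambda>r. indicator {0<..} r * (?W r * F r / r)) \<in> borel_measurable lborel"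
      using borel_measurable_continuous_on_indicator[of "{0<..}" "\<lambda>r. ?W r * F r / r"] by simp
    show "AE r in lborel. norm (indicator {0<..} r * (?W r * F r / r)) \<le>
        norm (indicator {0<..} r * (r ^ (?N - 1) * (F' r)\<^sup>2) + indicator {0<..} r * (r ^ (?N - 3) * (F r)\<^sup>2))"
    proof (rule AE_I2)
      fix r
      show "norm (indicator {0<..} r * (?W r * F r / r)) \<le>
        norm (indicator {0<..} r * (r ^ (?N - 1) * (F' r)\<^sup>2) + indicator {0<..} r * (r ^ (?N - 3) * (F r)\<^sup>2))"
      proof (cases "r > 0")
        case True
        let ?x = "\<bar>r * F' r\<bar>" let ?y = "\<bar>F r\<bar>"
        have "?W r * F r / r = - (r ^ m * ((r * F' r) * F r))" using True by (simp add: WF m)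
        then have "\<bar>?W r * F r / r\<bar> = r ^ m * (?x * ?y)" using True by (simp add: abs_mult)
        also have "\<dots> \<le> r ^ m * (?x\<^sup>2 + ?y\<^sup>2)"
        proof (rule mult_left_mono)
          have "2 * ?x * ?y \<le> ?x\<^sup>2 + ?y\<^sup>2" by (rule sum_squares_bound)
          moreover have "0 \<le> ?x * ?y" by simp
          ultimately show "?x * ?y \<le> ?x\<^sup>2 + ?y\<^sup>2" by linarith
        qed (use True in simp)
        also have "\<dots> = r ^ (?N - 1) * (F' r)\<^sup>2 + r ^ (?N - 3) * (F r)\<^sup>2"
          by (simp add: m power2_eq_square algebra_simps)
        finally show ?thesis using True by simp
      qed simp
    qed
  qed
  have "(\<integral>r. indicator {0<..} r * q r \<partial>lborel) = 0"
    by (rule integral_deriv_zero_halfline[OF D qc iq iQ])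
  then show ?thesis
    using Bochner_Integration.integral_diff[OF iB iA] by (simp only: q_def right_diff_distrib)
qed

subsection \<open>A dominating profile\<close>

text \<open>Strauss bound of a radial \<open>H\<^sup>1\<close> function: near 0 the Dirichlet energy alone gives the first rate, at infinity the full norm gives the second.\<close>

definition mu :: "'n::finite itself \<Rightarrow> real \<Rightarrow> real" where
  "mu _ r = (if r \<le> 1 then r powr (- ((real CARD('n) - 2) / 2)) else r powr (- ((real CARD('n) - 1) / 2)))"

lemma mu_borel [measurable]: "mu TYPE('n::finite) \<in> borel_measurable borel"
  unfolding mu_def[abs_def] by simp

lemma mu_pos: "r > 0 \<Longrightarrow> mu TYPE('n::finite) r > 0"
  by (simp add: mu_def)

lemma bound_mu:
  assumes N: "CARD('n::finite) \<ge> 3" and r: "r > 0" and M: "M \<ge> 0"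
    and 1: "x\<^sup>2 * r ^ (CARD('n) - 1) \<le> M\<^sup>2" and 2: "x\<^sup>2 * r ^ (CARD('n) - 2) \<le> M\<^sup>2"
  shows "\<bar>x\<bar> \<le> M * mu TYPE('n) r"
proof -
  have *: "\<bar>x\<bar> \<le> M * r powr (- (real k / 2))" if "x\<^sup>2 * r ^ k \<le> M\<^sup>2" for k
  proof -
    have "r powr (- (real k / 2)) * r powr (- (real k / 2)) = r powr (- real k)"
      by (simp add: powr_add[symmetric])
    then have e: "(r powr (- (real k / 2)))\<^sup>2 * r ^ k = 1"
      using r by (simp add: power2_eq_square powr_realpow[symmetric] powr_add[symmetric])
    have "x\<^sup>2 * r ^ k \<le> M\<^sup>2 * ((r powr (- (real k / 2)))\<^sup>2 * r ^ k)" using that e by simp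
    then have "x\<^sup>2 \<le> (M * r powr (- (real k / 2)))\<^sup>2"
      using r by (simp add: power_mult_distrib mult.assoc[symmetric])
    then show ?thesis using M by (simp add: abs_le_square_iff[symmetric] abs_mult)
  qed
  have "real (CARD('n) - 2) = real CARD('n) - 2" "real (CARD('n) - 1) = real CARD('n) - 1"
    using N by (auto simp: of_nat_diff)
  then show ?thesis using *[OF 1] *[OF 2] by (simp add: mu_def)
qed

lemma crit_gt_2: "CARD('n::finite) \<ge> 3 \<Longrightarrow> crit TYPE('n) > 2"
  by (simp add: crit_def field_simps)

text \<open>The extreme case e = \<open>crit\<close> - 1 fixes the exponent in \<open>dom0\<close>,
  since (N-2)/2 times (\<open>crit\<close> - 1) is (N+2)/2. Beyond radius 1 both sides are compared
  with 1.\<close>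

lemma mu_le_dom0:
  assumes N: "CARD('n::finite) \<ge> 3" and e: "0 \<le> e" "e \<le> crit TYPE('n) - 1" and r: "r > 0"
  shows "mu TYPE('n) r powr e \<le> dom0 TYPE('n) r"
proof (cases "r \<le> 1")
  case True
  have N': "real CARD('n) \<ge> 3" using N by simp
  have "(real CARD('n) - 2) / 2 * e \<le> (real CARD('n) - 2) / 2 * (crit TYPE('n) - 1)"
    using e N' by (intro mult_left_mono) auto
  also have "\<dots> = (real CARD('n) + 2) / 2" using N' by (simp add: crit_def field_simps)
  finally have "- (real CARD('n) + 2) / 2 \<le> - ((real CARD('n) - 2) / 2) * e" by simp
  then have "r powr (- ((real CARD('n) - 2) / 2) * e) \<le> r powr (- (real CARD('n) + 2) / 2)"
    using True r by (intro powr_mono') auto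
  then show ?thesis using True by (simp add: mu_def dom0_def powr_powr)
next
  case False
  have N': "real CARD('n) \<ge> 3" using N by simp
  have "r powr (- ((real CARD('n) - 1) / 2) * e) \<le> 1 powr (- ((real CARD('n) - 1) / 2) * e)"
    using False e N' by (intro powr_mono2') (auto simp: mult_nonneg_nonneg)
  then have "mu TYPE('n) r powr e \<le> 1" using False by (simp add: mu_def powr_powr)
  also have "\<dots> \<le> dom0 TYPE('n) r" by (simp add: dom0_def)
  finally show ?thesis .
qed

text \<open>At 0 the exponent N-1 - p(N-2)/2 exceeds -1 exactly for p < \<open>crit\<close>; at
  infinity N-1 - p(N-1)/2 is below -1 exactly for p > 2N/(N-1).\<close>

lemma integrable_mu:
  assumes N: "CARD('n::finite) \<ge> 3" and p: "2 * real CARD('n) / (real CARD('n) - 1) < p" "p < crit TYPE('n)"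
  shows "integrable lborel (\<lambda>r. indicator {0<..} r * (r ^ (CARD('n) - 1) * mu TYPE('n) r powr p))"
proof -
  let ?N = "real CARD('n)"
  have N': "?N \<ge> 3" using N by simp
  define e1 where "e1 = ?N - 1 - (?N - 2) / 2 * p"
  define e2 where "e2 = ?N - 1 - (?N - 1) / 2 * p"
  have e1: "e1 > -1"
  proof -
    have "p * (?N - 2) < 2 * ?N" using p(2) N' by (simp add: crit_def field_simps)
    then show ?thesis by (simp add: e1_def field_simps)
  qed
  have e2: "e2 < -1"
  proof -
    have "2 * ?N < p * (?N - 1)" using p(1) N' by (simp add: field_simps)
    then show ?thesis by (simp add: e2_def field_simps)
  qed
  have i1: "integrable lborel (\<lambda>r. indicator {0..1} r * r powr e1)" by (rule integrable_powr_Icc(1)[OF e1]) simp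
  have "(\<lambda>t::real. t powr e2) absolutely_integrable_on {1..}"
    using has_integral_powr_to_inf[OF e2, of 1] by (intro nonnegative_absolutely_integrable_1) auto
  then have "integrable lebesgue (\<lambda>t::real. indicator {1..} t * t powr e2)" by (simp add: set_integrable_def)
  then have i2: "integrable lborel (\<lambda>t::real. indicator {1..} t * t powr e2)"
    by (subst (asm) integrable_completion) auto
  have rN: "r ^ (CARD('n) - 1) = r powr (?N - 1)" if "r > 0" for r :: real
    using that by (simp add: powr_realpow[symmetric] of_nat_diff Suc_le_eq)
  show ?thesis
  proof (rule Bochner_Integration.integrable_bound[OF Bochner_Integration.integrable_add[OF i1 i2]])
    show "AE r in lborel. norm (indicator {0<..} r * (r ^ (CARD('n) - 1) * mu TYPE('n) r powr p)) \<le>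
       norm (indicator {0..1} r * r powr e1 + indicator {1..} r * r powr e2)"
    proof (rule AE_I2)
      fix r :: real
      show "norm (indicator {0<..} r * (r ^ (CARD('n) - 1) * mu TYPE('n) r powr p)) \<le>
       norm (indicator {0..1} r * r powr e1 + indicator {1..} r * r powr e2)"
      proof (cases "r > 0")
        case True
        then show ?thesis
          by (cases "r \<le> 1") (auto simp: rN[simplified One_nat_def] mu_def powr_powr powr_add[symmetric] e1_def e2_def split: split_indicator)
      qed simp
    qed
  qed simp
qed

text \<open>With k = N - 2 the power |F|^\<open>crit\<close> is F^2 times (F^2)^(2/k), and the
  Strauss bound makes the second factor at most K^(2/k) / r^2. What remains is the Hardy
  integral.\<close>

lemma crit_integral_bound:
  fixes F F' :: "real \<Rightarrow> real"
  assumes N: "CARD('n::finite) \<ge> 3" and F: "\<And>r. r > 0 \<Longrightarrow> (F has_real_derivative F' r) (at r)" and F'c: "continuous_on {0<..} F'"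
    and K: "\<And>r. r > 0 \<Longrightarrow> (F r)\<^sup>2 * r ^ (CARD('n) - 2) \<le> K" and Fm: "F \<in> borel_measurable borel"
    and iA: "integrable lborel (\<lambda>r. indicator {0<..} r * (r ^ (CARD('n) - 1) * (F' r)\<^sup>2))"
  shows "integrable lborel (\<lambda>r. indicator {0<..} r * (r ^ (CARD('n) - 1) * \<bar>F r\<bar> powr crit TYPE('n)))" (is ?int)
    and "(\<integral>r. indicator {0<..} r * (r ^ (CARD('n) - 1) * \<bar>F r\<bar> powr crit TYPE('n)) \<partial>lborel) \<le>
      K powr (2 / (real CARD('n) - 2)) * (2 / (real CARD('n) - 2) * (K + 2 / (real CARD('n) - 2) *
        (\<integral>r. indicator {0<..} r * (r ^ (CARD('n) - 1) * (F' r)\<^sup>2) \<partial>lborel)))"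
proof -
  let ?N = "CARD('n)" let ?k = "real ?N - 2"
  obtain m where m: "?N = m + 3" using N le_Suc_ex by (metis add.commute)
  have k: "?k = real m + 1" by (simp add: m)
  have kp: "?k > 0" unfolding k by simp
  note H = hardy_radial[OF N F F'c K iA]
  have c: "crit TYPE('n) = 2 + 2 * (2 / ?k)" using kp by (simp add: crit_def field_simps)
  have pt: "indicator {0<..} r * (r ^ (?N - 1) * \<bar>F r\<bar> powr crit TYPE('n)) \<le> K powr (2 / ?k) * (indicator {0<..} r * (r ^ (?N - 3) * (F r)\<^sup>2))" for r
  proof (cases "r > 0")
    case True
    have "\<bar>F r\<bar> powr crit TYPE('n) = (F r)\<^sup>2 * ((F r)\<^sup>2) powr (2 / ?k)"
    proof (cases "F r = 0")
      case False
      have "\<bar>F r\<bar> powr crit TYPE('n) = \<bar>F r\<bar> powr 2 * \<bar>F r\<bar> powr (2 * (2 / ?k))" unfolding c powr_add ..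
      also have "\<bar>F r\<bar> powr (2 * (2 / ?k)) = (\<bar>F r\<bar> powr 2) powr (2 / ?k)" by (simp only: powr_powr)
      also have "\<bar>F r\<bar> powr 2 = (F r)\<^sup>2" using False by (simp add: powr_numeral)
      finally show ?thesis .
    qed simp
    also have "\<dots> * r\<^sup>2 \<le> (F r)\<^sup>2 * K powr (2 / ?k)"
    proof -
      have "((F r)\<^sup>2) powr (2 / ?k) * r\<^sup>2 = ((F r)\<^sup>2 * r ^ (?N - 2)) powr (2 / ?k)"
      proof -
        have "?N - 2 = m + 1" "?k = real (m + 1)" by (simp_all add: m)
        then have "(r ^ (?N - 2)) powr (2 / ?k) = (r powr ?k) powr (2 / ?k)" using True by (simp only: powr_realpow)
        also have "\<dots> = r\<^sup>2"
        proof -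
          have "(r powr z) powr (2 / z) = r\<^sup>2" if "z > 0" for z
            using that True by (simp add: powr_powr powr_numeral)
          then show ?thesis using kp by blast
        qed
        finally show ?thesis using True by (simp add: powr_mult)
      qed
      also have "\<dots> \<le> K powr (2 / ?k)" using K[OF True] True kp by (intro powr_mono2) auto
      finally have "(F r)\<^sup>2 * (((F r)\<^sup>2) powr (2 / ?k) * r\<^sup>2) \<le> (F r)\<^sup>2 * K powr (2 / ?k)" by (intro mult_left_mono) auto
      then show ?thesis by (simp add: mult.assoc)
    qed
    finally have "r ^ m * (\<bar>F r\<bar> powr crit TYPE('n) * r\<^sup>2) \<le> r ^ m * ((F r)\<^sup>2 * K powr (2 / ?k))"
      using True by (intro mult_left_mono) auto
    then show ?thesis using True by (simp add: m power2_eq_square mult_ac)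
  qed simp
  have iH: "integrable lborel (\<lambda>r. K powr (2 / ?k) * (indicator {0<..} r * (r ^ (?N - 3) * (F r)\<^sup>2)))"
    by (rule integrable_mult_right[OF H(1)])
  show i: ?int
  proof (rule Bochner_Integration.integrable_bound[OF iH])
    show "(\<lambda>r. indicator {0<..} r * (r ^ (?N - 1) * \<bar>F r\<bar> powr crit TYPE('n))) \<in> borel_measurable lborel" using Fm by simp
    have nn: "0 \<le> indicator {0<..} r * (r ^ (?N - 1) * \<bar>F r\<bar> powr crit TYPE('n))" for r by (auto split: split_indicator)
    show "AE r in lborel. norm (indicator {0<..} r * (r ^ (?N - 1) * \<bar>F r\<bar> powr crit TYPE('n))) \<le> norm (K powr (2 / ?k) * (indicator {0<..} r * (r ^ (?N - 3) * (F r)\<^sup>2)))"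
      by (rule AE_I2) (use pt nn in \<open>simp only: real_norm_def abs_of_nonneg order_trans[OF _ abs_ge_self]\<close>)
  qed
  have "(\<integral>r. indicator {0<..} r * (r ^ (?N - 1) * \<bar>F r\<bar> powr crit TYPE('n)) \<partial>lborel) \<le>
      K powr (2 / ?k) * (\<integral>r. indicator {0<..} r * (r ^ (?N - 3) * (F r)\<^sup>2) \<partial>lborel)"
    unfolding integral_mult_right_zero[symmetric] by (rule integral_mono[OF i iH pt])
  also have "\<dots> \<le> K powr (2 / ?k) * (2 / ?k * (K + 2 / ?k * (\<integral>r. indicator {0<..} r * (r ^ (?N - 1) * (F' r)\<^sup>2) \<partial>lborel)))"
  proof (rule mult_left_mono)
    have "y \<le> 2 / z * x" if "z / 2 * y \<le> x" "z > 0" for x y z :: real using that by (simp add: field_simps)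
    then show "(\<integral>r. indicator {0<..} r * (r ^ (?N - 3) * (F r)\<^sup>2) \<partial>lborel) \<le>
        2 / ?k * (K + 2 / ?k * (\<integral>r. indicator {0<..} r * (r ^ (?N - 1) * (F' r)\<^sup>2) \<partial>lborel))"
      using H(2) kp by blast
  qed simp
  finally show "(\<integral>r. indicator {0<..} r * (r ^ (?N - 1) * \<bar>F r\<bar> powr crit TYPE('n)) \<partial>lborel) \<le>
      K powr (2 / ?k) * (2 / ?k * (K + 2 / ?k * (\<integral>r. indicator {0<..} r * (r ^ (?N - 1) * (F' r)\<^sup>2) \<partial>lborel)))" .
qed

subsection \<open>Dilations\<close>

lemma lebesgue_scaleR:
  fixes f :: "real^'n::finite \<Rightarrow> real"
  assumes c: "c > 0" and f: "f \<in> borel_measurable lebesgue"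
  shows "(\<lambda>x. f (c *\<^sub>R x)) \<in> borel_measurable lebesgue"
    and "integrable lebesgue (\<lambda>x. f (c *\<^sub>R x)) \<longleftrightarrow> integrable lebesgue f"
    and "(\<integral>x. f (c *\<^sub>R x) \<partial>lebesgue) = (\<integral>x. f x \<partial>lebesgue) / c ^ CARD('n)"
proof -
  let ?N = "CARD('n)"
  have Tm: "(\<lambda>x::real^'n. c *\<^sub>R x) \<in> lebesgue \<rightarrow>\<^sub>M lebesgue" by (rule lebesgue_measurable_scaling)
  have T: "(\<lambda>x::real^'n. 0 + (\<Sum>j\<in>Basis. (c * (x \<bullet> j)) *\<^sub>R j)) = (\<lambda>x. c *\<^sub>R x)"
    by (simp add: scaleR_scaleR[symmetric] scaleR_sum_right[symmetric] euclidean_representation del: scaleR_scaleR)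
  have L: "(lebesgue :: (real^'n) measure) = density (distr lebesgue lebesgue (\<lambda>x. c *\<^sub>R x)) (\<lambda>_. ennreal (c ^ ?N))"
    using lebesgue_affine_euclidean[of "\<lambda>_::real^'n. c" 0] c unfolding T by (simp add: prod_constant ennreal_power[symmetric] ennreal_mult)
  show m: "(\<lambda>x. f (c *\<^sub>R x)) \<in> borel_measurable lebesgue" by (rule measurable_compose[OF Tm f])
  have f': "f \<in> borel_measurable (distr lebesgue lebesgue (\<lambda>x. c *\<^sub>R x))" using f by simp
  have cN: "c ^ ?N > 0" using c by simp
  have "integrable lebesgue f \<longleftrightarrow> integrable (distr lebesgue lebesgue (\<lambda>x. c *\<^sub>R x)) (\<lambda>x. c ^ ?N * f x)"
    by (subst L, subst integrable_real_density) (use f' cN in auto)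
  also have "\<dots> \<longleftrightarrow> integrable (distr lebesgue lebesgue (\<lambda>x. c *\<^sub>R x)) f"
    using c by (subst integrable_mult_left_iff) auto
  also have "\<dots> \<longleftrightarrow> integrable lebesgue (\<lambda>x. f (c *\<^sub>R x))" by (rule integrable_distr_eq[OF Tm f])
  finally show "integrable lebesgue (\<lambda>x. f (c *\<^sub>R x)) \<longleftrightarrow> integrable lebesgue f" by simp
  have "(\<integral>x. f x \<partial>lebesgue) = (\<integral>x. c ^ ?N * f x \<partial>distr lebesgue lebesgue (\<lambda>x. c *\<^sub>R x))"
    by (subst L, subst integral_real_density) (use f' cN in auto)
  also have "\<dots> = c ^ ?N * (\<integral>x. f (c *\<^sub>R x) \<partial>lebesgue)" using integral_distr[OF Tm f] by simp
  finally show "(\<integral>x. f (c *\<^sub>R x) \<partial>lebesgue) = (\<integral>x. f x \<partial>lebesgue) / c ^ ?N" using c by simp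
qed

lemma exp_power_CARD: "exp s ^ CARD('n::finite) = exp (real CARD('n) * s)"
  by (simp add: exp_of_nat_mult)

lemma star_measurable:
  "u \<in> borel_measurable lebesgue \<Longrightarrow> star s u \<in> borel_measurable lebesgue"
  unfolding star_def[abs_def] by (intro borel_measurable_times borel_measurable_const lebesgue_scaleR) auto

lemma star_sq:
  fixes u :: "real^'n::finite \<Rightarrow> real"
  assumes "u \<in> borel_measurable lebesgue"
  shows "integrable lebesgue (\<lambda>x. (star s u x)\<^sup>2) \<longleftrightarrow> integrable lebesgue (\<lambda>x. (u x)\<^sup>2)"
    and "(\<integral>x. (star s u x)\<^sup>2 \<partial>lebesgue) = (\<integral>x. (u x)\<^sup>2 \<partial>lebesgue)"
proof -
  have m: "(\<lambda>x. (u x)\<^sup>2) \<in> borel_measurable lebesgue" using assms by simp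
  have e: "(star s u x)\<^sup>2 = exp (real CARD('n) * s) * (u (exp s *\<^sub>R x))\<^sup>2" for x
    by (simp add: star_def power_mult_distrib exp_double[symmetric])
  show "integrable lebesgue (\<lambda>x. (star s u x)\<^sup>2) \<longleftrightarrow> integrable lebesgue (\<lambda>x. (u x)\<^sup>2)"
    unfolding e using lebesgue_scaleR(2)[OF exp_gt_zero m] by (subst integrable_mult_left_iff) simp
  show "(\<integral>x. (star s u x)\<^sup>2 \<partial>lebesgue) = (\<integral>x. (u x)\<^sup>2 \<partial>lebesgue)"
    unfolding e using lebesgue_scaleR(3)[OF exp_gt_zero m, of s] by (simp add: exp_power_CARD)
qed

lemma coup_star:
  fixes u v :: "real^'n::finite \<Rightarrow> real"
  assumes u: "u \<in> borel_measurable lebesgue" and v: "v \<in> borel_measurable lebesgue"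
  shows "coup \<alpha> \<beta> (star s u) (star s v) = exp (gam TYPE('n) \<alpha> \<beta> * s) * coup \<alpha> \<beta> u v"
proof -
  have m: "(\<lambda>x. \<bar>u x\<bar> powr \<alpha> * \<bar>v x\<bar> powr \<beta>) \<in> borel_measurable lebesgue" using u v by simp
  have p: "exp a powr b = exp (a * b)" for a b :: real by (simp add: powr_def mult.commute)
  have e: "\<bar>star s u x\<bar> powr \<alpha> * \<bar>star s v x\<bar> powr \<beta> =
      exp (real CARD('n) * s / 2 * (\<alpha> + \<beta>)) * (\<bar>u (exp s *\<^sub>R x)\<bar> powr \<alpha> * \<bar>v (exp s *\<^sub>R x)\<bar> powr \<beta>)" for x
    by (simp add: star_def abs_mult powr_mult p distrib_left exp_add)
  have "coup \<alpha> \<beta> (star s u) (star s v) = exp (real CARD('n) * s / 2 * (\<alpha> + \<beta>)) * (coup \<alpha> \<beta> u v / exp (real CARD('n) * s))"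
    unfolding coup_def e using lebesgue_scaleR(3)[OF exp_gt_zero m, of s] by (simp add: exp_power_CARD)
  also have "\<dots> = exp (real CARD('n) * s / 2 * (\<alpha> + \<beta>) - real CARD('n) * s) * coup \<alpha> \<beta> u v" by (simp add: exp_diff)
  also have "real CARD('n) * s / 2 * (\<alpha> + \<beta>) - real CARD('n) * s = gam TYPE('n) \<alpha> \<beta> * s" by (simp add: gam_def field_simps)
  finally show ?thesis .
qed

lemma star_Lp_crit:
  fixes u :: "real^'n::finite \<Rightarrow> real"
  assumes N: "CARD('n) \<ge> 3" and u: "u \<in> borel_measurable lebesgue"
  shows "Lp_int (crit TYPE('n)) (star s u) = exp (crit TYPE('n) * s) * Lp_int (crit TYPE('n)) u"
proof -
  let ?p = "crit TYPE('n)"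
  have m: "(\<lambda>x. \<bar>u x\<bar> powr ?p) \<in> borel_measurable lebesgue" using u by simp
  have p: "exp a powr b = exp (a * b)" for a b :: real by (simp add: powr_def mult.commute)
  have e: "\<bar>star s u x\<bar> powr ?p = exp (real CARD('n) * s / 2 * ?p) * \<bar>u (exp s *\<^sub>R x)\<bar> powr ?p" for x
    by (simp add: star_def abs_mult powr_mult p)
  have "Lp_int ?p (star s u) = exp (real CARD('n) * s / 2 * ?p) * (Lp_int ?p u / exp (real CARD('n) * s))"
    unfolding Lp_int_def e using lebesgue_scaleR(3)[OF exp_gt_zero m, of s] by (simp add: exp_power_CARD)
  also have "\<dots> = exp (real CARD('n) * s / 2 * ?p - real CARD('n) * s) * Lp_int ?p u" by (simp add: exp_diff)
  also have "real CARD('n) * s / 2 * ?p - real CARD('n) * s = ?p * s"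
  proof -
    have "n * s / 2 * (2 * n / (n - 2)) - n * s = 2 * n / (n - 2) * s" if "n > 2" for n :: real
      using that by (simp add: field_simps)
    then show ?thesis using N by (simp add: crit_def)
  qed
  finally show ?thesis .
qed

text \<open>Testing the dilated function with \<phi> amounts to testing u with the inversely dilated
  \<phi>; the chain rule contributes the extra factor exp s.\<close>

lemma L2grad_star:
  fixes u :: "real^'n::finite \<Rightarrow> real" and s :: real
  assumes u: "u \<in> borel_measurable lebesgue" and g: "L2grad u g"
  defines "G \<equiv> \<lambda>x. (exp s * exp (real CARD('n) * s / 2)) *\<^sub>R g (exp s *\<^sub>R x)"
  shows "L2grad (star s u) G"
    and "(\<integral>x. (norm (G x))\<^sup>2 \<partial>lebesgue) = exp (2 * s) * (\<integral>x. (norm (g x))\<^sup>2 \<partial>lebesgue)"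
proof -
  let ?c = "exp s" let ?E = "exp (real CARD('n) * s / 2)"
  have gm: "g \<in> borel_measurable lebesgue" and g2: "integrable lebesgue (\<lambda>x. (norm (g x))\<^sup>2)" and wg: "weak_grad u g"
    using g by (auto simp: L2grad_def)
  have Gm: "G \<in> borel_measurable lebesgue" unfolding G_def
    using measurable_compose[OF lebesgue_measurable_scaling[of ?c] gm] by simp
  have nm: "(\<lambda>x. (norm (g x))\<^sup>2) \<in> borel_measurable lebesgue" using g2 by (rule borel_measurable_integrable)
  have e: "(norm (G x))\<^sup>2 = exp (2 * s) * exp (real CARD('n) * s) * (norm (g (?c *\<^sub>R x)))\<^sup>2" for x
    by (simp add: G_def power_mult_distrib exp_double[symmetric])
  have i: "integrable lebesgue (\<lambda>x. (norm (G x))\<^sup>2)"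
    unfolding e using lebesgue_scaleR(2)[OF exp_gt_zero nm, of s] g2 by (subst integrable_mult_left_iff) simp
  show "(\<integral>x. (norm (G x))\<^sup>2 \<partial>lebesgue) = exp (2 * s) * (\<integral>x. (norm (g x))\<^sup>2 \<partial>lebesgue)"
    unfolding e using lebesgue_scaleR(3)[OF exp_gt_zero nm, of s] by (simp add: exp_power_CARD)
  have "weak_grad (star s u) G"
    unfolding weak_grad_def
  proof (intro allI impI)
    fix \<phi> :: "real^'n \<Rightarrow> real" and i assume t: "test_fun \<phi>"
    define \<psi> where "\<psi> y = \<phi> (exp (- s) *\<^sub>R y)" for y
    have t\<psi>: "test_fun \<psi>" unfolding \<psi>_def[abs_def] by (rule test_fun_scaleR[OF t]) simp
    have p1: "pdiff i \<psi> y = exp (- s) * pdiff i \<phi> (exp (- s) *\<^sub>R y)" for y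
      unfolding \<psi>_def[abs_def] by (rule pdiff_scaleR[OF test_fun_C_inf[OF t]])
    have e1: "star s u x * pdiff i \<phi> x = (?E * ?c) * (u (?c *\<^sub>R x) * pdiff i \<psi> (?c *\<^sub>R x))" for x
      unfolding p1 by (simp add: star_def exp_minus)
    have e2: "G x $ i * \<phi> x = (?E * ?c) * (g (?c *\<^sub>R x) $ i * \<psi> (?c *\<^sub>R x))" for x
      by (simp add: G_def \<psi>_def exp_minus)
    have w: "integrable lebesgue (\<lambda>x. u x * pdiff i \<psi> x)" "integrable lebesgue (\<lambda>x. g x $ i * \<psi> x)"
      "(\<integral>x. u x * pdiff i \<psi> x \<partial>lebesgue) = - (\<integral>x. g x $ i * \<psi> x \<partial>lebesgue)"
      using wg t\<psi> by (auto simp: weak_grad_def)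
    note m1 = borel_measurable_integrable[OF w(1)] and m2 = borel_measurable_integrable[OF w(2)]
    have "integrable lebesgue (\<lambda>x. star s u x * pdiff i \<phi> x)"
      unfolding e1 using lebesgue_scaleR(2)[OF exp_gt_zero m1, of s] w by (subst integrable_mult_left_iff) simp
    moreover have "integrable lebesgue (\<lambda>x. G x $ i * \<phi> x)"
      unfolding e2 using lebesgue_scaleR(2)[OF exp_gt_zero m2, of s] w by (subst integrable_mult_left_iff) simp
    moreover have "(\<integral>x. star s u x * pdiff i \<phi> x \<partial>lebesgue) = - (\<integral>x. G x $ i * \<phi> x \<partial>lebesgue)"
      unfolding e1 e2 integral_mult_right_zero lebesgue_scaleR(3)[OF exp_gt_zero m1] lebesgue_scaleR(3)[OF exp_gt_zero m2] w(3)
      by simp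
    ultimately show "integrable lebesgue (\<lambda>x. star s u x * pdiff i \<phi> x) \<and> integrable lebesgue (\<lambda>x. G x $ i * \<phi> x) \<and>
        (\<integral>x. star s u x * pdiff i \<phi> x \<partial>lebesgue) = - (\<integral>x. G x $ i * \<phi> x \<partial>lebesgue)" by blast
  qed
  then show "L2grad (star s u) G" using Gm i by (simp add: L2grad_def)
qed

lemma H1_star: "H1 u \<Longrightarrow> H1 (star s u)"
  using L2grad_star(1)[of u "wgrad u" s] H1_L2grad[of u] star_sq(1)[of u s] star_measurable[of u s]
  by (auto simp: H1_def)

lemma dirichlet_star:
  assumes "H1 u" shows "dirichlet (star s u) = exp (2 * s) * dirichlet u"
proof -
  have u: "u \<in> borel_measurable lebesgue" using assms by (simp add: H1_def)
  note g = H1_L2grad[OF assms]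
  show ?thesis using dirichlet_eq[OF L2grad_star(1)[OF u g, of s]] L2grad_star(2)[OF u g, of s] dirichlet_eq[OF g] by simp
qed

lemma L2norm_star: "H1 u \<Longrightarrow> L2norm (star s u) = L2norm u"
  by (simp add: L2norm_def star_sq(2) H1_def)

lemma star_star: "star s (star t u) = star (s + t) u"
  by (simp add: star_def fun_eq_iff exp_add[symmetric] algebra_simps add_divide_distrib)

lemma radial_star: "radial u \<Longrightarrow> radial (star s u)"
  by (auto simp: radial_def star_def)

lemma star2_Tset: "(u, v) \<in> Tset a b \<Longrightarrow> (star s u, star s v) \<in> Tset a b"
  by (auto simp: Tset_def H1_star L2norm_star)

lemma weak_sol_star:
  fixes u :: "real^'n::finite \<Rightarrow> real"
  assumes u: "H1 u" and ws: "weak_sol lam u f" and f: "f \<in> borel_measurable lebesgue"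
  shows "weak_sol (exp (2 * s) * lam) (star s u) (\<lambda>x. exp (2 * s) * exp (real CARD('n) * s / 2) * f (exp s *\<^sub>R x))"
  unfolding weak_sol_def
proof (intro allI impI)
  let ?c = "exp s" let ?E = "exp (real CARD('n) * s / 2)"
  fix \<phi> :: "real^'n \<Rightarrow> real" assume t: "test_fun \<phi>"
  define \<psi> where "\<psi> y = \<phi> (exp (- s) *\<^sub>R y)" for y
  have t\<psi>: "test_fun \<psi>" unfolding \<psi>_def[abs_def] by (rule test_fun_scaleR[OF t]) simp
  have p1: "pdiff i \<psi> y = exp (- s) * pdiff i \<phi> (exp (- s) *\<^sub>R y)" for y i
    unfolding \<psi>_def[abs_def] by (rule pdiff_scaleR[OF test_fun_C_inf[OF t]])
  have cg: "cgrad \<phi> x = exp s *\<^sub>R cgrad \<psi> (?c *\<^sub>R x)" for x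
    by (simp add: vec_eq_iff cgrad_def p1 exp_minus)
  have um: "u \<in> borel_measurable lebesgue" using u by (simp add: H1_def)
  note g = H1_L2grad[OF u]
  note gs = L2grad_star(1)[OF um g, of s]
  have AE: "AE x in lebesgue. wgrad (star s u) x = (?c * ?E) *\<^sub>R wgrad u (?c *\<^sub>R x)"
    by (rule L2grad_unique[OF L2grad_wgrad[OF gs] gs])
  have cgm: "cgrad \<eta> \<in> borel_measurable lebesgue" if "test_fun \<eta>" for \<eta> :: "real^'n \<Rightarrow> real"
  proof -
    have "continuous_on UNIV (cgrad \<eta>)" unfolding cgrad_def[abs_def]
      by (intro continuous_on_vec_lambda C_inf_continuous_on C_inf_pdiff test_fun_C_inf[OF that])
    then show ?thesis by (intro measurable_completion) (simp add: borel_measurable_continuous_onI)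
  qed
  have sm: "star s u \<in> borel_measurable lebesgue" by (rule star_measurable[OF um])
  have gm: "wgrad u \<in> borel_measurable lebesgue" "wgrad (star s u) \<in> borel_measurable lebesgue"
    using g L2grad_wgrad[OF gs] by (auto simp: L2grad_def)
  have gm': "(\<lambda>x. wgrad u (?c *\<^sub>R x)) \<in> borel_measurable lebesgue"
    by (rule measurable_compose[OF lebesgue_measurable_scaling gm(1)])
  have cm: "cgrad \<phi> \<in> borel_measurable lebesgue" "cgrad \<psi> \<in> borel_measurable lebesgue"
    using cgm t t\<psi> by auto
  have pm: "\<phi> \<in> borel_measurable lebesgue" "\<psi> \<in> borel_measurable lebesgue" using test_fun_lebesgue t t\<psi> by auto
  define h where "h x = wgrad u x \<bullet> cgrad \<psi> x + lam * u x * \<psi> x" for x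
  have hm: "h \<in> borel_measurable lebesgue" unfolding h_def using gm cm um pm by simp
  have fm: "(\<lambda>x. f x * \<psi> x) \<in> borel_measurable lebesgue" using f pm by simp
  have pe: "\<psi> (?c *\<^sub>R x) = \<phi> x" for x by (simp add: \<psi>_def exp_minus)
  have "(\<integral>x. wgrad (star s u) x \<bullet> cgrad \<phi> x + exp (2 * s) * lam * star s u x * \<phi> x \<partial>lebesgue) =
      (\<integral>x. exp (2 * s) * ?E * h (?c *\<^sub>R x) \<partial>lebesgue)"
  proof (rule integral_cong_AE)
    show "AE x in lebesgue. wgrad (star s u) x \<bullet> cgrad \<phi> x + exp (2 * s) * lam * star s u x * \<phi> x = exp (2 * s) * ?E * h (?c *\<^sub>R x)"
      using AE
    proof eventually_elim
      case (elim x)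
      have "exp (2 * s) = ?c * ?c" by (simp add: exp_add[symmetric])
      then show ?case unfolding elim cg h_def pe by (simp add: star_def algebra_simps)
    qed
    show "(\<lambda>x. exp (2 * s) * ?E * h (?c *\<^sub>R x)) \<in> borel_measurable lebesgue"
      by (intro borel_measurable_times borel_measurable_const lebesgue_scaleR hm) auto
  qed (use gm cm sm pm in simp)
  also have "\<dots> = exp (2 * s) * ?E * ((\<integral>x. h x \<partial>lebesgue) / ?c ^ CARD('n))"
    using lebesgue_scaleR(3)[OF exp_gt_zero hm, of s] by simp
  also have "(\<integral>x. h x \<partial>lebesgue) = (\<integral>x. f x * \<psi> x \<partial>lebesgue)"
    using ws t\<psi> unfolding weak_sol_def h_def by blast
  also have "exp (2 * s) * ?E * ((\<integral>x. f x * \<psi> x \<partial>lebesgue) / ?c ^ CARD('n)) = (\<integral>x. exp (2 * s) * ?E * (f (?c *\<^sub>R x) * \<psi> (?c *\<^sub>R x)) \<partial>lebesgue)"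
    using lebesgue_scaleR(3)[OF exp_gt_zero fm, of s] by simp
  also have "\<dots> = (\<integral>x. exp (2 * s) * ?E * f (?c *\<^sub>R x) * \<phi> x \<partial>lebesgue)" by (simp add: pe mult.assoc)
  finally show "(\<integral>x. wgrad (star s u) x \<bullet> cgrad \<phi> x + exp (2 * s) * lam * star s u x * \<phi> x \<partial>lebesgue) =
      (\<integral>x. exp (2 * s) * ?E * f (?c *\<^sub>R x) * \<phi> x \<partial>lebesgue)" .
qed

subsection \<open>Functions with vanishing gradient\<close>

lemma pdiff_prod_other:
  assumes "finite J" "i \<notin> J" "\<And>j. smooth UNIV (h j)"
  shows "pdiff i (\<lambda>x. \<Prod>j\<in>J. h j (x $ j)) x = 0"
  using assms(1,2)
proof (induction J rule: finite_induct)
  case empty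
  have "((\<lambda>x::real^'a. 1::real) has_derivative (\<lambda>y. 0)) (at x)" by simp
  from pdiff_eqI[OF this] show ?case by simp
next
  case (insert j J)
  have 1: "C_inf (\<lambda>x. h j (x $ j))" by (rule C_inf_compose[OF assms(3) C_inf_component])
  have 2: "C_inf (\<lambda>x. \<Prod>j\<in>J. h j (x $ j))"
    by (intro C_inf_prod insert.hyps) (rule C_inf_compose[OF assms(3) C_inf_component])
  have "pdiff i (\<lambda>x. h j (x $ j)) x = 0"
    by (subst pdiff_compose[OF assms(3) C_inf_component]) (use insert.prems in \<open>simp add: pdiff_component\<close>)
  then show ?case using insert pdiff_mult[OF 1 2, of i x] by simp
qed

text \<open>If the weak gradient vanishes, w has the same integral against a bump and against each
  of its translates. Moving the bump to infinity in one coordinate direction, Cauchy-Schwarz on the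
  moving box makes this integral 0 because w is square integrable.\<close>

lemma dirichlet_pos:
  fixes w :: "real^'n::finite \<Rightarrow> real"
  assumes w: "H1 w" and pos: "(\<integral>x. (w x)\<^sup>2 \<partial>lebesgue) \<noteq> 0"
  shows "dirichlet w > 0"
proof (rule ccontr)
  assume "\<not> dirichlet w > 0"
  then have D0: "dirichlet w = 0" using dirichlet_nonneg[of w] by linarith
  note g = H1_L2grad[OF w]
  have wm: "w \<in> borel_measurable lebesgue" and w2: "integrable lebesgue (\<lambda>x. (w x)\<^sup>2)" using w by (auto simp: H1_def)
  have "AE x in lebesgue. (norm (wgrad w x))\<^sup>2 = 0"
    using D0 g unfolding dirichlet_def by (subst integral_nonneg_eq_0_iff_AE[symmetric]) (auto simp: L2grad_def)
  then have g0: "AE x in lebesgue. wgrad w x = 0" by eventually_elim simp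
  have zero: "(\<integral>x. w x * pdiff i \<phi> x \<partial>lebesgue) = 0" if "test_fun \<phi>" for i \<phi>
  proof -
    have "(\<integral>x. wgrad w x $ i * \<phi> x \<partial>lebesgue) = (\<integral>x. 0 \<partial>(lebesgue :: (real^'n) measure))"
      by (rule integral_cong_AE) (use g0 L2grad_component(1)[OF g] test_fun_lebesgue[OF that] in \<open>auto elim: eventually_mono\<close>)
    then show ?thesis using g that by (auto simp: L2grad_def weak_grad_def)
  qed
  have "AE x in lebesgue. w x = 0"
  proof (rule AE_zero_if_prod_bump_integrals_zero[OF wm integrable_cball_L2[OF wm w2]])
    fix a b :: "real^'n" and n
    define i :: 'n where "i = undefined"
    let ?h = "\<lambda>j. bump (a$j) (b$j) n"
    let ?\<psi> = "\<lambda>x::real^'n. \<Prod>j\<in>UNIV. ?h j (x$j)"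
    let ?R = "\<lambda>x::real^'n. \<Prod>j\<in>UNIV - {i}. ?h j (x$j)"
    have sh: "smooth UNIV (?h j)" for j by (rule smooth_bump)
    have split: "?\<psi> x = ?h i (x$i) * ?R x" for x by (rule prod.remove) auto
    obtain H where H: "\<And>t. (H has_real_derivative ?h i t) (at t)"
      using antiderivative_exists[OF smooth_continuous_on[OF sh[of i]]] by blast
    have sH: "smooth UNIV H" by (rule smoothI_DERIV[OF _ H sh]) simp
    have Hc: "continuous_on S H" for S by (intro continuous_at_imp_continuous_on ballI DERIV_isCont[OF H])
    have Hconst: "H y = H x" if "x < y" "y \<le> a$i \<or> b$i \<le> x" for x y
    proof (rule DERIV_isconst2[of x y H y])
      show "DERIV H z :> 0" if "x < z" "z < y" for z
        using H[of z] bump_eq_0[of z "a$i" "b$i" n] that \<open>y \<le> a$i \<or> b$i \<le> x\<close> by auto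
    qed (use that Hc in auto)
    define e :: "real^'n" where "e = axis i 1"
    have tr: "(\<integral>x. w x * ?\<psi> x \<partial>lebesgue) = (\<integral>x. w x * ?\<psi> (x + T *\<^sub>R e) \<partial>lebesgue)" if T: "T > 0" for T
    proof -
      \<comment> \<open>H is an antiderivative of one bump factor and is constant on either side of
        its support. So D has compact support, and its derivative is the translated bump minus the
        original one.\<close>
      define D where "D t = H (t + T) - H t" for t
      have sD: "smooth UNIV D" unfolding D_def[abs_def]
        by (intro smooth_diff smooth_compose[OF _ _ _ sH] smooth_add smooth_ident smooth_const sH) auto
      have dD: "deriv D t = ?h i (t + T) - ?h i t" for t
        unfolding D_def[abs_def]
        by (intro DERIV_imp_deriv DERIV_diff DERIV_chain2[OF H, where s=UNIV, THEN DERIV_cong] H)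
          (auto intro!: derivative_eq_intros)
      have CD: "C_inf (\<lambda>x::real^'n. D (x$i))" by (rule C_inf_compose[OF sD C_inf_component])
      have CR: "C_inf ?R" by (intro C_inf_prod C_inf_compose[OF sh C_inf_component]) auto
      have "test_fun (\<lambda>x. D (x$i) * ?R x)"
      proof (rule test_funI[OF C_inf_mult[OF CD CR], of "\<Sum>j\<in>UNIV. \<bar>a$j\<bar> + \<bar>b$j\<bar> + T"])
        fix x :: "real^'n" assume x: "(\<Sum>j\<in>UNIV. \<bar>a$j\<bar> + \<bar>b$j\<bar> + T) < norm x"
        have "norm x \<le> (\<Sum>j\<in>UNIV. \<bar>x$j\<bar>)" by (rule norm_le_l1_cart)
        then have "\<not> (\<forall>j. \<bar>x$j\<bar> \<le> \<bar>a$j\<bar> + \<bar>b$j\<bar> + T)"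
          using x sum_mono[of UNIV "\<lambda>j. \<bar>x$j\<bar>" "\<lambda>j. \<bar>a$j\<bar> + \<bar>b$j\<bar> + T"] by force
        then obtain j where j: "\<bar>x$j\<bar> > \<bar>a$j\<bar> + \<bar>b$j\<bar> + T" by (auto simp: not_le)
        show "D (x$i) * ?R x = 0"
        proof (cases "j = i")
          case True
          then have "x$i + T \<le> a$i \<or> b$i \<le> x$i" using j T by (auto simp: abs_if split: if_splits)
          then have "D (x$i) = 0" using Hconst[of "x$i" "x$i + T"] T by (simp add: D_def)
          then show ?thesis by simp
        next
          case False
          have "?h j (x$j) = 0" using j T by (intro bump_eq_0) (auto simp: abs_if split: if_splits)
          then have "?R x = 0" using False by (intro prod_zero bexI[of _ j]) auto
          then show ?thesis by simp
        qed
      qed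
      from zero[OF this, of i] have z: "(\<integral>x. w x * pdiff i (\<lambda>x. D (x$i) * ?R x) x \<partial>lebesgue) = 0" .
      have ei: "(x + T *\<^sub>R e) $ i = x $ i + T" "j \<noteq> i \<Longrightarrow> (x + T *\<^sub>R e) $ j = x $ j" for x j
        by (auto simp: e_def axis_def)
      have R_shift: "?R (x + T *\<^sub>R e) = ?R x" for x by (intro prod.cong) (auto simp: e_def axis_def)
      have pd: "pdiff i (\<lambda>x. D (x$i) * ?R x) x = ?\<psi> (x + T *\<^sub>R e) - ?\<psi> x" for x
      proof -
        have "pdiff i (\<lambda>x. D (x$i) * ?R x) x = pdiff i (\<lambda>x. D (x$i)) x * ?R x + D (x$i) * pdiff i ?R x"
          by (rule pdiff_mult[OF CD CR])
        also have "pdiff i ?R x = 0" by (rule pdiff_prod_other[OF _ _ sh]) auto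
        also have "pdiff i (\<lambda>x. D (x$i)) x = ?h i (x$i + T) - ?h i (x$i)"
          by (subst pdiff_compose[OF sD C_inf_component]) (simp add: dD pdiff_component)
        finally show ?thesis unfolding split[of x] split[of "x + T *\<^sub>R e"] R_shift ei(1) by (simp add: left_diff_distrib)
      qed
      have i1: "integrable lebesgue (\<lambda>x. w x * ?\<psi> x)"
        by (rule integrable_mult_test_fun[OF wm integrable_cball_L2[OF wm w2] test_fun_prod_bump])
      have bshift: "?\<psi> (x + T *\<^sub>R e) = (\<Prod>j\<in>UNIV. bump ((a - T *\<^sub>R e)$j) ((b - T *\<^sub>R e)$j) n (x$j))" for x
        by (intro prod.cong) (auto simp: bump_def algebra_simps)
      have i2: "integrable lebesgue (\<lambda>x. w x * ?\<psi> (x + T *\<^sub>R e))"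
        unfolding bshift by (rule integrable_mult_test_fun[OF wm integrable_cball_L2[OF wm w2] test_fun_prod_bump])
      show ?thesis using z i1 i2 unfolding pd by (simp add: right_diff_distrib)
    qed
    \<comment> \<open>The box supporting the bump translated by k + 1 units; its volume does not
      depend on k.\<close>
    let ?B = "\<lambda>k::nat. box (a - real (Suc k) *\<^sub>R e) (b - real (Suc k) *\<^sub>R e)"
    have Bm: "?B k \<in> sets lebesgue" for k by simp
    have bshift: "?\<psi> (x + real (Suc k) *\<^sub>R e) = (\<Prod>j\<in>UNIV. bump ((a - real (Suc k) *\<^sub>R e)$j) ((b - real (Suc k) *\<^sub>R e)$j) n (x$j))" for x k
      by (intro prod.cong) (auto simp: bump_def algebra_simps)
    have pt: "\<bar>w x * ?\<psi> (x + real (Suc k) *\<^sub>R e)\<bar> \<le> \<bar>(indicator (?B k) x * w x) * indicator (?B k) x\<bar>" for x k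
    proof -
      have *: "\<bar>w x * p\<bar> \<le> \<bar>(indicator (?B k) x * w x) * indicator (?B k) x\<bar>" if "0 \<le> p" "p \<le> indicator (?B k) x" for p :: real
        using that by (cases "x \<in> ?B k") (simp_all only: indicator_simps, auto simp: abs_mult mult_left_le)
      show ?thesis unfolding bshift by (rule *[OF prod_bump_bounds(1,2)])
    qed
    define V where "V = measure lebesgue (box a b)"
    have mB: "measure lebesgue (?B k) = V" for k
      unfolding V_def by (simp add: measure_lborel_box_eq inner_diff_left)
    have le: "(\<integral>x. w x * ?\<psi> x \<partial>lebesgue)\<^sup>2 \<le> (\<integral>x. indicator (?B k) x * (w x)\<^sup>2 \<partial>lebesgue) * V" for k
    proof -
      note Bm[measurable] wm[measurable]
      have fin: "emeasure lebesgue (?B k) < \<infinity>" using emeasure_bounded_finite[OF bounded_box, of "a - real (Suc k) *\<^sub>R e"] by simp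
      have sq: "(indicator (?B k) x * w x)\<^sup>2 = indicator (?B k) x * (w x)\<^sup>2" "(indicator (?B k) x :: real)\<^sup>2 = indicator (?B k) x" for x
        by (auto split: split_indicator)
      have i1: "integrable lebesgue (\<lambda>x. (indicator (?B k) x * w x)\<^sup>2)" unfolding sq
        using integrable_mult_indicator[OF Bm w2] by simp
      have i2: "integrable lebesgue (\<lambda>x. (indicator (?B k) x :: real)\<^sup>2)" unfolding sq
        using fin by (intro integrable_real_indicator) auto
      have CS: "integrable lebesgue (\<lambda>x. (indicator (?B k) x * w x) * indicator (?B k) x)"
        "(\<integral>x. \<bar>(indicator (?B k) x * w x) * indicator (?B k) x\<bar> \<partial>lebesgue)\<^sup>2 \<le> (\<integral>x. (indicator (?B k) x * w x)\<^sup>2 \<partial>lebesgue) * (\<integral>x. (indicator (?B k) x :: real)\<^sup>2 \<partial>lebesgue)"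
        by (rule Cauchy_Schwarz_integral(1,2)[OF _ _ i1 i2]; measurable)+
      have "(\<integral>x. w x * ?\<psi> x \<partial>lebesgue) = (\<integral>x. w x * ?\<psi> (x + real (Suc k) *\<^sub>R e) \<partial>lebesgue)" by (rule tr) simp
      also have "\<bar>\<dots>\<bar> \<le> (\<integral>x. \<bar>w x * ?\<psi> (x + real (Suc k) *\<^sub>R e)\<bar> \<partial>lebesgue)" by (rule integral_abs_bound)
      also have "\<dots> \<le> (\<integral>x. \<bar>(indicator (?B k) x * w x) * indicator (?B k) x\<bar> \<partial>lebesgue)"
      proof (rule integral_mono[OF _ integrable_abs[OF CS(1)] pt])
        show "integrable lebesgue (\<lambda>x. \<bar>w x * ?\<psi> (x + real (Suc k) *\<^sub>R e)\<bar>)"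
          unfolding bshift by (intro integrable_abs integrable_mult_test_fun[OF wm integrable_cball_L2[OF wm w2] test_fun_prod_bump])
      qed
      finally have "\<bar>\<integral>x. w x * ?\<psi> x \<partial>lebesgue\<bar> \<le> (\<integral>x. \<bar>(indicator (?B k) x * w x) * indicator (?B k) x\<bar> \<partial>lebesgue)" .
      from power_mono[OF this abs_ge_zero, of 2] CS(2)
      have "(\<integral>x. w x * ?\<psi> x \<partial>lebesgue)\<^sup>2 \<le> (\<integral>x. (indicator (?B k) x * w x)\<^sup>2 \<partial>lebesgue) * (\<integral>x. (indicator (?B k) x :: real)\<^sup>2 \<partial>lebesgue)"
        unfolding power2_abs by (rule order_trans)
      also have "(\<integral>x. (indicator (?B k) x :: real)\<^sup>2 \<partial>lebesgue) = V" unfolding sq using mB[of k] by simp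
      finally show ?thesis unfolding sq .
    qed
    \<comment> \<open>Every point is eventually outside the moving boxes, and the square of w is a
      majorant.\<close>
    have "(\<lambda>k. \<integral>x. indicator (?B k) x * (w x)\<^sup>2 \<partial>lebesgue) \<longlonglongrightarrow> (\<integral>x. 0 \<partial>(lebesgue :: (real^'n) measure))"
    proof (rule integral_dominated_convergence[where w="\<lambda>x. (w x)\<^sup>2"])
      show "AE x in lebesgue. (\<lambda>k. indicator (?B k) x * (w x)\<^sup>2) \<longlonglongrightarrow> 0"
      proof (rule AE_I2)
        fix x
        obtain k0 where k0: "b$i - x$i < real k0" using reals_Archimedean2 by blast
        have "indicator (?B k) x * (w x)\<^sup>2 = 0" if "k \<ge> k0" for k
        proof -
          have "\<not> x$i < (b - real (Suc k) *\<^sub>R e)$i" using k0 that by (simp add: e_def)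
          then have "x \<notin> ?B k" unfolding mem_box_cart by blast
          then show ?thesis by simp
        qed
        then show "(\<lambda>k. indicator (?B k) x * (w x)\<^sup>2) \<longlonglongrightarrow> 0"
          by (intro tendsto_eventually eventually_sequentiallyI[of k0])
      qed
      show "AE x in lebesgue. norm (indicator (?B k) x * (w x)\<^sup>2) \<le> (w x)\<^sup>2" for k
        by (rule AE_I2) (auto split: split_indicator)
      show "(\<lambda>x. indicator (?B k) x * (w x)\<^sup>2) \<in> borel_measurable lebesgue" for k
        using Bm[of k] wm by measurable
    qed (use w2 in auto)
    then have "(\<lambda>k. (\<integral>x. indicator (?B k) x * (w x)\<^sup>2 \<partial>lebesgue) * V) \<longlonglongrightarrow> 0 * V"
      by (intro tendsto_mult tendsto_const) simp
    then have "(\<integral>x. w x * ?\<psi> x \<partial>lebesgue)\<^sup>2 \<le> 0 * V"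
      by (rule LIMSEQ_le_const) (use le in auto)
    then show "(\<integral>x. w x * ?\<psi> x \<partial>lebesgue) = 0" by simp
  qed
  then have "(\<integral>x. (w x)\<^sup>2 \<partial>lebesgue) = (\<integral>x. 0 \<partial>(lebesgue :: (real^'n) measure))"
    by (intro integral_cong_AE) (use wm in \<open>auto elim: eventually_mono\<close>)
  then show False using pos by simp
qed

lemma L2grad_diff:
  assumes "L2grad u g" "L2grad v h"
  shows "L2grad (\<lambda>x. u x - v x) (\<lambda>x. g x - h x)"
proof -
  have m [measurable]: "g \<in> borel_measurable lebesgue" "h \<in> borel_measurable lebesgue" using assms by (auto simp: L2grad_def)
  have "integrable lebesgue (\<lambda>x. (norm (g x - h x))\<^sup>2)"
  proof (rule Bochner_Integration.integrable_bound)
    show "integrable lebesgue (\<lambda>x. 2 * (norm (g x))\<^sup>2 + 2 * (norm (h x))\<^sup>2)"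
      using assms by (auto simp: L2grad_def)
    show "AE x in lebesgue. norm ((norm (g x - h x))\<^sup>2) \<le> norm (2 * (norm (g x))\<^sup>2 + 2 * (norm (h x))\<^sup>2)"
    proof (rule AE_I2)
      fix x
      have "(norm (g x - h x))\<^sup>2 \<le> (norm (g x) + norm (h x))\<^sup>2" by (intro power_mono norm_triangle_ineq4) auto
      also have "\<dots> \<le> 2 * (norm (g x))\<^sup>2 + 2 * (norm (h x))\<^sup>2"
        using sum_squares_bound[of "norm (g x)" "norm (h x)"] by (simp add: power2_sum)
      finally show "norm ((norm (g x - h x))\<^sup>2) \<le> norm (2 * (norm (g x))\<^sup>2 + 2 * (norm (h x))\<^sup>2)" by simp
    qed
  qed simp
  moreover have "weak_grad (\<lambda>x. u x - v x) (\<lambda>x. g x - h x)"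
    using assms by (auto simp: L2grad_def weak_grad_def left_diff_distrib)
  ultimately show ?thesis using m by (auto simp: L2grad_def)
qed

subsection \<open>Fatou arguments\<close>

text \<open>The codomain is a Banach space so that one statement serves functions and their
  gradients.\<close>

lemma fatou_L2:
  fixes f :: "'a \<Rightarrow> 'b::{second_countable_topology, banach}"
  assumes m: "\<And>n. fn n \<in> borel_measurable M" "f \<in> borel_measurable M"
    and AE: "AE x in M. (\<lambda>n. fn n x) \<longlonglongrightarrow> f x" and i: "\<And>n. integrable M (\<lambda>x. (norm (fn n x))\<^sup>2)"
    and l: "(\<lambda>n. \<integral>x. (norm (fn n x))\<^sup>2 \<partial>M) \<longlonglongrightarrow> l"
  shows "integrable M (\<lambda>x. (norm (f x))\<^sup>2)" "(\<integral>x. (norm (f x))\<^sup>2 \<partial>M) \<le> l"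
proof -
  note m[measurable]
  have l0: "l \<ge> 0" by (rule LIMSEQ_le_const[OF l]) auto
  have "(\<integral>\<^sup>+x. ennreal ((norm (f x))\<^sup>2) \<partial>M) = (\<integral>\<^sup>+x. liminf (\<lambda>n. ennreal ((norm (fn n x))\<^sup>2)) \<partial>M)"
  proof (rule nn_integral_cong_AE)
    show "AE x in M. ennreal ((norm (f x))\<^sup>2) = liminf (\<lambda>n. ennreal ((norm (fn n x))\<^sup>2))"
      using AE
    proof eventually_elim
      case (elim x)
      have "(\<lambda>n. ennreal ((norm (fn n x))\<^sup>2)) \<longlonglongrightarrow> ennreal ((norm (f x))\<^sup>2)"
        by (intro tendsto_ennrealI tendsto_power tendsto_norm elim)
      then show ?case by (intro lim_imp_Liminf[symmetric]) simp_all
    qed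
  qed
  also have "\<dots> \<le> liminf (\<lambda>n. \<integral>\<^sup>+x. ennreal ((norm (fn n x))\<^sup>2) \<partial>M)" by (rule nn_integral_liminf) simp
  also have "(\<lambda>n. \<integral>\<^sup>+x. ennreal ((norm (fn n x))\<^sup>2) \<partial>M) = (\<lambda>n. ennreal (\<integral>x. (norm (fn n x))\<^sup>2 \<partial>M))"
    using i by (intro ext nn_integral_eq_integral) auto
  also have "liminf \<dots> = ennreal l" by (intro lim_imp_Liminf tendsto_ennrealI l) auto
  finally have le: "(\<integral>\<^sup>+x. ennreal ((norm (f x))\<^sup>2) \<partial>M) \<le> ennreal l" .
  show int: "integrable M (\<lambda>x. (norm (f x))\<^sup>2)"
    by (rule integrableI_bounded) (use le in \<open>auto intro: le_less_trans\<close>)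
  show "(\<integral>x. (norm (f x))\<^sup>2 \<partial>M) \<le> l"
    using le l0 by (simp add: nn_integral_eq_integral[OF int])
qed

text \<open>Fatou applied to 2|f_n|^2 + 2|f|^2 - |f_n - f|^2, which is nonnegative and tends to
  4|f|^2. Convergence of the norms takes the place of a majorant.\<close>

lemma scheffe_L2:
  fixes f :: "'a \<Rightarrow> 'b::{second_countable_topology, banach}"
  assumes m: "\<And>n. fn n \<in> borel_measurable M" "f \<in> borel_measurable M"
    and AE: "AE x in M. (\<lambda>n. fn n x) \<longlonglongrightarrow> f x" and i: "\<And>n. integrable M (\<lambda>x. (norm (fn n x))\<^sup>2)"
    and f: "integrable M (\<lambda>x. (norm (f x))\<^sup>2)"
    and l: "(\<lambda>n. \<integral>x. (norm (fn n x))\<^sup>2 \<partial>M) \<longlonglongrightarrow> (\<integral>x. (norm (f x))\<^sup>2 \<partial>M)"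
  shows "(\<lambda>n. \<integral>x. (norm (fn n x - f x))\<^sup>2 \<partial>M) \<longlonglongrightarrow> 0"
proof -
  note m[measurable]
  define I where "I = (\<integral>x. (norm (f x))\<^sup>2 \<partial>M)"
  define d where "d n = (\<integral>x. (norm (fn n x - f x))\<^sup>2 \<partial>M)" for n
  define c where "c n = 2 * (\<integral>x. (norm (fn n x))\<^sup>2 \<partial>M) + 2 * I" for n
  have pt: "(norm (fn n x - f x))\<^sup>2 \<le> 2 * (norm (fn n x))\<^sup>2 + 2 * (norm (f x))\<^sup>2" for n x
  proof -
    have "(norm (fn n x - f x))\<^sup>2 \<le> (norm (fn n x) + norm (f x))\<^sup>2" by (intro power_mono norm_triangle_ineq4) auto
    also have "\<dots> \<le> 2 * (norm (fn n x))\<^sup>2 + 2 * (norm (f x))\<^sup>2"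
      using sum_squares_bound[of "norm (fn n x)" "norm (f x)"] by (simp add: power2_sum)
    finally show ?thesis .
  qed
  have id: "integrable M (\<lambda>x. (norm (fn n x - f x))\<^sup>2)" for n
    by (rule Bochner_Integration.integrable_bound[where f="\<lambda>x. 2 * (norm (fn n x))\<^sup>2 + 2 * (norm (f x))\<^sup>2"])
      (use i f pt in auto)
  let ?h = "\<lambda>n x. 2 * (norm (fn n x))\<^sup>2 + 2 * (norm (f x))\<^sup>2 - (norm (fn n x - f x))\<^sup>2"
  have ih: "integrable M (?h n)" for n using i f id by simp
  have eh: "(\<integral>x. ?h n x \<partial>M) = c n - d n" for n using i f id by (simp add: c_def d_def I_def)
  have "ennreal (4 * I) = (\<integral>\<^sup>+x. ennreal (4 * (norm (f x))\<^sup>2) \<partial>M)"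
    using f by (subst nn_integral_eq_integral) (auto simp: I_def)
  also have "\<dots> = (\<integral>\<^sup>+x. liminf (\<lambda>n. ennreal (?h n x)) \<partial>M)"
  proof (rule nn_integral_cong_AE)
    show "AE x in M. ennreal (4 * (norm (f x))\<^sup>2) = liminf (\<lambda>n. ennreal (?h n x))"
      using AE
    proof eventually_elim
      case (elim x)
      have "(\<lambda>n. ennreal (?h n x)) \<longlonglongrightarrow> ennreal (2 * (norm (f x))\<^sup>2 + 2 * (norm (f x))\<^sup>2 - (norm (f x - f x))\<^sup>2)"
        by (intro tendsto_ennrealI tendsto_intros elim)
      then show ?case by (simp add: lim_imp_Liminf)
    qed
  qed
  also have "\<dots> \<le> liminf (\<lambda>n. \<integral>\<^sup>+x. ennreal (?h n x) \<partial>M)" by (rule nn_integral_liminf) simp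
  also have "(\<lambda>n. \<integral>\<^sup>+x. ennreal (?h n x) \<partial>M) = (\<lambda>n. ennreal (c n - d n))"
    unfolding eh[symmetric] using ih pt by (intro ext nn_integral_eq_integral) auto
  finally have le: "ennreal (4 * I) \<le> liminf (\<lambda>n. ennreal (c n - d n))" .
  have cl: "c \<longlonglongrightarrow> 4 * I"
  proof -
    have "c \<longlonglongrightarrow> 2 * I + 2 * I" unfolding c_def I_def by (intro tendsto_intros l)
    then show ?thesis by simp
  qed
  have I0: "I \<ge> 0" by (simp add: I_def)
  have d0: "d n \<ge> 0" for n by (simp add: d_def)
  show ?thesis unfolding d_def[symmetric]
  proof (rule LIMSEQ_I)
    fix e :: real assume e: "e > 0"
    have ev: "\<forall>\<^sub>F n in sequentially. 4 * I - e / 2 < c n - d n"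
    proof (cases "4 * I - e / 2 \<ge> 0")
      case True
      then have "ennreal (4 * I - e / 2) < ennreal (4 * I)" using e I0 by (simp add: ennreal_less_iff)
      then have "\<forall>\<^sub>F n in sequentially. ennreal (4 * I - e / 2) < ennreal (c n - d n)"
        using le by (simp add: le_Liminf_iff)
      then show ?thesis by eventually_elim (use True in \<open>simp add: ennreal_less_iff\<close>)
    next
      case False
      have "0 \<le> c n - d n" for n unfolding eh[symmetric] by (intro integral_nonneg_AE AE_I2) (use pt in simp)
      then show ?thesis using False by (intro always_eventually allI) (smt (verit))
    qed
    have "\<forall>\<^sub>F n in sequentially. c n < 4 * I + e / 2" using cl e by (intro order_tendstoD) auto
    with ev have "\<forall>\<^sub>F n in sequentially. norm (d n - 0) < e"
      by eventually_elim (use d0 in auto)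
    then show "\<exists>no. \<forall>n\<ge>no. norm (d n - 0) < e" by (simp add: eventually_sequentially)
  qed
qed

subsection \<open>Radial solutions\<close>

text \<open>The sign of u gives F = |F| only almost everywhere; continuity extends this to every
  positive radius.\<close>

lemma profile_nonneg:
  fixes u :: "real^'n::finite \<Rightarrow> real"
  assumes P: "profile u F" and u: "\<And>x. u x \<ge> 0" shows "F r \<ge> 0"
proof (cases "r > 0")
  case True
  have Fc: "continuous_on {0<..} F" and uF: "AE x in lebesgue. u x = F (norm x)" using P by (auto simp: profile_def)
  note profile_borel[OF P, measurable]
  have "AE x in lebesgue. F (norm (x::real^'n)) \<ge> 0" using uF by eventually_elim (metis u)
  then have "AE x::real^'n in lborel. F (norm x) \<ge> 0" by (simp add: AE_completion_iff)
  then have "AE r in lborel. r > 0 \<longrightarrow> F r \<ge> 0" by (rule AE_normD) simp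
  then have "AE r in lborel. r > 0 \<longrightarrow> F r = \<bar>F r\<bar>" by eventually_elim auto
  from continuous_AE_eq[OF Fc _ this True] have "F r = \<bar>F r\<bar>" using Fc by (auto intro: continuous_intros)
  then show ?thesis by linarith
next
  case False then show ?thesis using P by (simp add: profile_def)
qed

lemma norm_radial_gradient: "(norm ((a / norm x) *\<^sub>R (x::real^'n::finite)))\<^sup>2 = (if x = 0 then 0 else a\<^sup>2)"
  by (simp add: power_mult_distrib power_divide)

text \<open>Collects what the equation yields for one component. The energy identity is conditional
  because integrability of the nonlinearity times F involves the other component; it is supplied in
  \<open>system_solution\<close>.\<close>

lemma solution_profile:
  fixes u f :: "real^'n::finite \<Rightarrow> real" and F fr :: "real \<Rightarrow> real"
  assumes N: "CARD('n) \<ge> 3" and u: "H1 u" and P: "profile u F"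
    and K: "\<And>r. r > 0 \<Longrightarrow> (F r)\<^sup>2 * r ^ (CARD('n) - 2) \<le> K"
    and fr: "f \<in> borel_measurable lebesgue" "AE x in lebesgue. f x = fr (norm x)" "continuous_on {0<..} fr" "fr \<in> borel_measurable borel"
    and C: "\<And>r. r > 0 \<Longrightarrow> \<bar>fr r - lam * F r\<bar> \<le> C * dom0 TYPE('n) r"
    and ws: "weak_sol lam u f"
  defines "F' \<equiv> \<lambda>r. - flux TYPE('n) (\<lambda>r. fr r - lam * F r) r / r ^ (CARD('n) - 1)"
  shows "\<And>r. r > 0 \<Longrightarrow> (F has_real_derivative F' r) (at r)"
    and "continuous_on {0<..} F'"
    and "AE x in lebesgue. wgrad u x = (F' (norm x) / norm x) *\<^sub>R x"
    and "integrable lborel (\<lambda>r. indicator {0<..} r * (r ^ (CARD('n) - 1) * (F' r)\<^sup>2))"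
    and "dirichlet u = sph_area TYPE('n) * (\<integral>r. indicator {0<..} r * (r ^ (CARD('n) - 1) * (F' r)\<^sup>2) \<partial>lborel)"
    and "integrable lborel (\<lambda>r. indicator {0<..} r * (r ^ (CARD('n) - 1) * (fr r * F r))) \<Longrightarrow>
      dirichlet u + lam * (\<integral>x. (u x)\<^sup>2 \<partial>lebesgue) =
      sph_area TYPE('n) * (\<integral>r. indicator {0<..} r * (r ^ (CARD('n) - 1) * (fr r * F r)) \<partial>lborel)"
proof -
  let ?N = "CARD('n)" let ?c = "sph_area TYPE('n)"
  define w where "w r = fr r - lam * F r" for r
  have Fc: "continuous_on {0<..} F" and F0: "\<And>r. r \<le> 0 \<Longrightarrow> F r = 0" and uF: "AE x in lebesgue. u x = F (norm x)"
    using P by (auto simp: profile_def)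
  have Fm [measurable]: "F \<in> borel_measurable borel" by (rule profile_borel[OF P])
  note fr(4)[measurable]
  have um: "u \<in> borel_measurable lebesgue" and u2: "integrable lebesgue (\<lambda>x. (u x)\<^sup>2)" using u by (auto simp: H1_def)
  note g = H1_L2grad[OF u]
  have wc: "continuous_on {0<..} w" unfolding w_def by (intro continuous_intros fr Fc)
  have wm [measurable]: "w \<in> borel_measurable borel" unfolding w_def by simp
  have wC: "\<bar>w r\<bar> \<le> C * dom0 TYPE('n) r" if "r > 0" for r using C[OF that] by (simp add: w_def)
  have F'w: "F' r = - flux TYPE('n) w r / r ^ (?N - 1)" for r by (simp add: F'_def w_def[abs_def])
  show D: "(F has_real_derivative F' r) (at r)" if "r > 0" for r
    unfolding F'_def by (rule weak_sol_profile_ode[OF N u P fr C ws that])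
  have WD: "(flux TYPE('n) w has_real_derivative r ^ (?N - 1) * w r) (at r)" if "r > 0" for r
    by (rule flux_DERIV[OF wc wm N _ that]) (rule wC)
  have "continuous_on {0<..} (flux TYPE('n) w)"
    by (intro continuous_at_imp_continuous_on ballI) (use WD DERIV_isCont in auto)
  then show F'c: "continuous_on {0<..} F'" unfolding F'w by (intro continuous_intros) auto
  show gF: "AE x in lebesgue. wgrad u x = (F' (norm x) / norm x) *\<^sub>R x"
    by (rule profile_gradient[OF g um P D F'c])
  define G where "G r = (if r > 0 then F' r else 0)" for r
  have Gc: "continuous_on {0<..} G" by (rule continuous_on_eq[OF F'c]) (auto simp: G_def)
  have Gm [measurable]: "G \<in> borel_measurable borel" by (rule borel_measurable_pos_continuous[OF Gc]) (simp add: G_def)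
  have AE: "AE x in lebesgue. (norm (wgrad u x))\<^sup>2 = (G (norm x))\<^sup>2"
    using gF by eventually_elim (simp add: norm_radial_gradient G_def)
  have i2: "integrable lebesgue (\<lambda>x. (norm (wgrad u x))\<^sup>2)" using g by (simp add: L2grad_def)
  have eqG: "indicator {0<..} r * (r ^ (?N - 1) * (G r)\<^sup>2) = indicator {0<..} r * (r ^ (?N - 1) * (F' r)\<^sup>2)" for r
    by (auto simp: G_def split: split_indicator)
  have Gm2: "(\<lambda>r. (G r)\<^sup>2) \<in> borel_measurable borel" by simp
  note R = radial_integral[OF Gm2 AE borel_measurable_integrable[OF i2]]
  show iA: "integrable lborel (\<lambda>r. indicator {0<..} r * (r ^ (?N - 1) * (F' r)\<^sup>2))"
    using R(1) i2 unfolding eqG by blast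
  show DA: "dirichlet u = ?c * (\<integral>r. indicator {0<..} r * (r ^ (?N - 1) * (F' r)\<^sup>2) \<partial>lborel)"
    using R(2) unfolding dirichlet_def eqG .
  assume iB: "integrable lborel (\<lambda>r. indicator {0<..} r * (r ^ (?N - 1) * (fr r * F r)))"
  have AE2: "AE x in lebesgue. (u x)\<^sup>2 = (F (norm x))\<^sup>2" using uF by eventually_elim simp
  note R2 = radial_integral[where h="\<lambda>r. (F r)\<^sup>2", OF _ AE2 borel_measurable_integrable[OF u2]]
  have iM: "integrable lborel (\<lambda>r. indicator {0<..} r * (r ^ (?N - 1) * (F r)\<^sup>2))" using R2(1) u2 by simp
  have eM: "(\<integral>x. (u x)\<^sup>2 \<partial>lebesgue) = ?c * (\<integral>r. indicator {0<..} r * (r ^ (?N - 1) * (F r)\<^sup>2) \<partial>lborel)" using R2(2) by simp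
  have e: "indicator {0<..} r * (r ^ (?N - 1) * (w r * F r)) = indicator {0<..} r * (r ^ (?N - 1) * (fr r * F r)) - lam * (indicator {0<..} r * (r ^ (?N - 1) * (F r)\<^sup>2))" for r
    by (simp add: w_def algebra_simps power2_eq_square)
  have iwF: "integrable lborel (\<lambda>r. indicator {0<..} r * (r ^ (?N - 1) * (w r * F r)))"
    unfolding e by (rule Bochner_Integration.integrable_diff[OF iB integrable_mult_right[OF iM]])
  have "(\<integral>r. indicator {0<..} r * (r ^ (?N - 1) * (F' r)\<^sup>2) \<partial>lborel) = (\<integral>r. indicator {0<..} r * (r ^ (?N - 1) * (w r * F r)) \<partial>lborel)"
    by (rule energy_identity[OF N wc wm wC D F'w K iA iwF])
  also have "\<dots> = (\<integral>r. indicator {0<..} r * (r ^ (?N - 1) * (fr r * F r)) \<partial>lborel) - lam * (\<integral>r. indicator {0<..} r * (r ^ (?N - 1) * (F r)\<^sup>2) \<partial>lborel)"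
    unfolding e Bochner_Integration.integral_diff[OF iB integrable_mult_right[OF iM]] integral_mult_right_zero ..
  finally have E: "(\<integral>r. indicator {0<..} r * (r ^ (?N - 1) * (F' r)\<^sup>2) \<partial>lborel) =
      (\<integral>r. indicator {0<..} r * (r ^ (?N - 1) * (fr r * F r)) \<partial>lborel) - lam * (\<integral>r. indicator {0<..} r * (r ^ (?N - 1) * (F r)\<^sup>2) \<partial>lborel)" .
  show "dirichlet u + lam * (\<integral>x. (u x)\<^sup>2 \<partial>lebesgue) = ?c * (\<integral>r. indicator {0<..} r * (r ^ (?N - 1) * (fr r * F r)) \<partial>lborel)"
    unfolding DA eM E by (simp only: right_diff_distrib mult.left_commute[of lam] diff_add_cancel)
qed

text \<open>A nontrivial flux forces \<open>u \<ge> c r\<close> to the power \<open>2 - N\<close> at infinity, which is not square integrable exactly when \<open>N \<le> 4\<close>.\<close>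

lemma liouville_radial:
  assumes N: "CARD('n::finite) = 3 \<or> CARD('n) = 4"
    and F: "\<And>r. r > 0 \<Longrightarrow> (F has_real_derivative - flux TYPE('n) w r / r ^ (CARD('n) - 1)) (at r)"
    and wc: "continuous_on {0<..} w" and wm: "w \<in> borel_measurable borel"
    and wC: "\<And>r. r > 0 \<Longrightarrow> \<bar>w r\<bar> \<le> C * dom0 TYPE('n) r" and w0: "\<And>r. r > 0 \<Longrightarrow> w r \<ge> 0"
    and F0: "\<And>r. r > 0 \<Longrightarrow> F r \<ge> 0"
    and L2: "integrable lborel (\<lambda>r. indicator {0<..} r * (r ^ (CARD('n) - 1) * (F r)\<^sup>2))"
    and r: "r > 0"
  shows "w r = 0"
proof (rule ccontr)
  assume "w r \<noteq> 0"
  then have wr: "w r > 0" using w0[OF r] by simp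
  let ?N = "CARD('n)" let ?W = "flux TYPE('n) w"
  have N3: "?N \<ge> 3" using N by auto
  obtain m where m: "?N = m + 3" using N3 le_Suc_ex by (metis add.commute)
  have m1: "m = 0 \<or> m = 1" using N m by auto
  have WD: "(?W has_real_derivative s ^ (?N - 1) * w s) (at s)" if "s > 0" for s
    by (rule flux_DERIV[OF wc wm N3 _ that]) (rule wC)
  have W0: "?W s \<ge> 0" for s
    unfolding flux_def
  proof (rule integral_nonneg_AE, rule AE_mp[OF AE_lborel_singleton[of 0]], rule AE_I2, rule impI)
    fix x :: real assume "x \<noteq> 0"
    then show "0 \<le> indicator {0..s} x * (x ^ (?N - 1) * w x)" using w0[of x] by (auto split: split_indicator)
  qed
  have Wmono: "?W s \<le> ?W t" if "0 < s" "s \<le> t" for s t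
  proof (rule DERIV_nonneg_imp_nondecreasing[OF that(2)])
    fix x assume "s \<le> x" "x \<le> t"
    then show "\<exists>y. (?W has_real_derivative y) (at x) \<and> 0 \<le> y"
      using WD[of x] w0[of x] that by (intro exI[of _ "x ^ (?N - 1) * w x"]) auto
  qed
  \<comment> \<open>The flux just beyond a radius at which w is positive; since w >= 0 it bounds all
    later fluxes from below.\<close>
  define c where "c = ?W (r + 1)"
  have c: "c > 0"
  proof (rule ccontr)
    assume "\<not> c > 0"
    then have "?W s = 0" if "0 < s" "s < r + 1" for s using Wmono[of s "r+1"] W0[of s] that by (simp add: c_def)
    then have "((\<lambda>_. 0) has_real_derivative r ^ (?N - 1) * w r) (at r)"
      by (intro has_field_derivative_transform_within_open[OF WD[OF r], of "{0<..<r+1}"]) (use r in auto)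
    then have "r ^ (?N - 1) * w r = 0" using DERIV_unique[OF _ DERIV_const] by blast
    then show False using wr r by simp
  qed
  define k where "k = c / (real m + 1)"
  have k: "k > 0" using c by (simp add: k_def)
  have lower: "F s \<ge> k / s ^ (m + 1)" if s: "s \<ge> r + 1" for s
  proof -
    have sp: "s > 0" using s r by linarith
    \<comment> \<open>k t^(2-N) is the radial harmonic function with flux c. F minus this function
      is nonincreasing beyond r + 1 and asymptotically at least 0, hence it is nonnegative
      there.\<close>
    define Q where "Q t = F t - k / t ^ (m + 1)" for t
    have QD: "(Q has_real_derivative (- ?W t + c) / t ^ (?N - 1)) (at t)" if "t > 0" for t
    proof -
      have "((\<lambda>t. inverse (t ^ Suc m)) has_real_derivative - ((real m + 1) * t ^ m * inverse ((t ^ Suc m)\<^sup>2))) (at t)"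
        using DERIV_inverse'[OF DERIV_pow[of "Suc m" t UNIV]] that by (simp add: power2_eq_square add.commute mult_ac)
      from DERIV_diff[OF F[OF that] DERIV_cmult[OF this, of k]]
      have "(Q has_real_derivative - ?W t / t ^ (?N - 1) - k * - ((real m + 1) * t ^ m * inverse ((t ^ Suc m)\<^sup>2))) (at t)"
        by (simp add: Q_def[abs_def] divide_inverse)
      moreover have "k * ((real m + 1) * t ^ m * inverse ((t ^ Suc m)\<^sup>2)) = c / t ^ (?N - 1)"
        using that unfolding k_def m by (simp add: power2_eq_square divide_simps)
      ultimately show ?thesis by (simp add: diff_divide_distrib)
    qed
    have dec: "Q T \<le> Q s" if T: "T \<ge> s" for T
    proof (rule DERIV_nonpos_imp_nonincreasing[OF T])
      fix x assume x: "s \<le> x" "x \<le> T"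
      then have "c \<le> ?W x" unfolding c_def using s r by (intro Wmono) auto
      then show "\<exists>y. (Q has_real_derivative y) (at x) \<and> y \<le> 0"
        using QD[of x] x sp by (intro exI[of _ "(- ?W x + c) / x ^ (?N - 1)"]) (auto intro!: divide_nonpos_pos)
    qed
    have "((\<lambda>T. - (k * inverse T)) \<longlongrightarrow> - (k * 0)) at_top"
      by (intro tendsto_intros tendsto_inverse_0_at_top filterlim_ident)
    moreover have "\<forall>\<^sub>F T in at_top. - (k * inverse T) \<le> Q s"
      using eventually_ge_at_top[of "max s 1"]
    proof eventually_elim
      case (elim T)
      have "T ^ 1 \<le> T ^ (m + 1)" using elim by (intro power_increasing) auto
      then have "k / T ^ (m + 1) \<le> k * inverse T" using k elim by (simp add: divide_inverse[symmetric] divide_left_mono)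
      then have "- (k * inverse T) \<le> Q T" using F0[of T] elim sp by (simp add: Q_def)
      then show ?case using dec[of T] elim by linarith
    qed
    ultimately have "- (k * 0) \<le> Q s" by (rule tendsto_upperbound) simp
    then show ?thesis by (simp add: Q_def)
  qed
  define R where "R = r + 1"
  have R: "R > 0" "R \<ge> 1" using r by (auto simp: R_def)
  define M where "M = (\<integral>r. indicator {0<..} r * (r ^ (?N - 1) * (F r)\<^sup>2) \<partial>lborel)"
  have "k\<^sup>2 * T \<le> M" if "T > 0" for T
  proof -
    let ?S = "R * exp T"
    have RS: "R \<le> ?S" using R that by simp
    have D: "((\<lambda>r. k\<^sup>2 * ln r) has_real_derivative k\<^sup>2 * (1 / r)) (at r)" if "r > 0" for r
      using that by (auto intro!: derivative_eq_intros)
    have cn: "continuous_on {0<..} (\<lambda>r::real. k\<^sup>2 * (1 / r))" by (intro continuous_intros) auto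
    have "k\<^sup>2 * T = k\<^sup>2 * ln ?S - k\<^sup>2 * ln R" using R by (simp add: ln_mult algebra_simps)
    also have "\<dots> = (\<integral>r. indicator {R..?S} r * (k\<^sup>2 * (1 / r)) \<partial>lborel)"
      by (rule integral_by_FTC(2)[OF R(1) RS D cn, symmetric])
    also have "\<dots> \<le> M" unfolding M_def
    proof (rule integral_mono[OF integral_by_FTC(1)[OF R(1) RS D cn] L2])
      fix s
      show "indicator {R..?S} s * (k\<^sup>2 * (1 / s)) \<le> indicator {0<..} s * (s ^ (?N - 1) * (F s)\<^sup>2)"
      proof (cases "s \<in> {R..?S}")
        case True
        then have s: "s \<ge> r + 1" "s \<ge> 1" "s > 0" using R by (auto simp: R_def)
        have "(k / s ^ (m + 1))\<^sup>2 \<le> (F s)\<^sup>2" using lower[OF s(1)] k s by (intro power_mono) auto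
        then have "s ^ (?N - 1) * (k / s ^ (m + 1))\<^sup>2 \<le> s ^ (?N - 1) * (F s)\<^sup>2" using s by (intro mult_left_mono) auto
        moreover have "k\<^sup>2 * (1 / s) \<le> s ^ (?N - 1) * (k / s ^ (m + 1))\<^sup>2"
        proof -
          have e: "s ^ (?N - 1) * (k / s ^ (m + 1))\<^sup>2 = k\<^sup>2 * (s ^ (m + 2) / (s ^ (m + 1) * s ^ (m + 1)))"
            by (simp add: m power2_eq_square)
          \<comment> \<open>Here the dimension enters: the quotient is s^(-m) with m = N - 3 at most
            1, and s >= 1.\<close>
          have i: "1 / s \<le> s ^ (m + 2) / (s ^ (m + 1) * s ^ (m + 1))"
            using m1 s by (auto simp: field_simps power2_eq_square)
          show ?thesis unfolding e by (rule mult_left_mono[OF i]) simp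
        qed
        ultimately have "k\<^sup>2 * (1 / s) \<le> s ^ (?N - 1) * (F s)\<^sup>2" by linarith
        then show ?thesis using True s(3) by simp
      qed (auto split: split_indicator)
    qed
    finally show ?thesis .
  qed
  from this[of "(\<bar>M\<bar> + 1) / k\<^sup>2"] have "\<bar>M\<bar> + 1 \<le> M" using k by (simp add: add_nonneg_pos)
  then show False by linarith
qed

subsection \<open>Limits of radial solutions\<close>

text \<open>The majorant may depend on the ball, since \<phi> has compact support; for gradients the
  available constant does grow with the radius.\<close>

lemma dominated_test:
  fixes X :: "nat \<Rightarrow> real^'n::finite \<Rightarrow> real"
  assumes N: "CARD('n) \<ge> 3" and m: "\<And>n. X n \<in> borel_measurable lebesgue" "Y \<in> borel_measurable lebesgue"
    and lim: "AE x in lebesgue. (\<lambda>n. X n x) \<longlonglongrightarrow> Y x"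
    and dom: "\<And>R. \<exists>C. \<forall>n. AE x in lebesgue. norm x \<le> R \<longrightarrow> \<bar>X n x\<bar> \<le> C * dom0 TYPE('n) (norm x)"
    and t: "test_fun \<phi>"
  shows "integrable lebesgue (\<lambda>x. X n x * \<phi> x)" "integrable lebesgue (\<lambda>x. Y x * \<phi> x)"
    "(\<lambda>n. \<integral>x. X n x * \<phi> x \<partial>lebesgue) \<longlonglongrightarrow> (\<integral>x. Y x * \<phi> x \<partial>lebesgue)"
proof -
  obtain B R where BR: "R > 0" "B > 0" "\<And>x. \<bar>\<phi> x\<bar> \<le> B * indicator (cball 0 R) x"
    using test_fun_bound[OF t] by blast
  obtain C where C: "\<And>n. AE x in lebesgue. norm x \<le> R \<longrightarrow> \<bar>X n x\<bar> \<le> C * dom0 TYPE('n) (norm x)" using dom by blast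
  note m[measurable] test_fun_lebesgue[OF t, measurable]
  let ?w = "\<lambda>x::real^'n. (\<bar>C\<bar> * B) * (indicator (cball 0 R) x * dom0 TYPE('n) (norm x))"
  have iw: "integrable lebesgue ?w" by (rule integrable_mult_right[OF integrable_dom0_cball[OF N]])
  have b: "AE x in lebesgue. norm (X n x * \<phi> x) \<le> ?w x" for n
    using C[of n]
  proof eventually_elim
    case (elim x)
    show ?case
    proof (cases "norm x \<le> R")
      case True
      then have x: "x \<in> cball 0 R" by simp
      have "\<bar>X n x\<bar> \<le> \<bar>C\<bar> * dom0 TYPE('n) (norm x)"
        using elim True dom0_pos[where 'n='n, of "norm x"] by (intro order_trans[OF elim[rule_format, OF True]] mult_right_mono) auto
      moreover have "\<bar>\<phi> x\<bar> \<le> B" using BR(3)[of x] x by simp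
      ultimately have "\<bar>X n x\<bar> * \<bar>\<phi> x\<bar> \<le> (\<bar>C\<bar> * dom0 TYPE('n) (norm x)) * B" by (intro mult_mono) auto
      then show ?thesis using x by (simp add: abs_mult mult_ac)
    next
      case False
      then have "\<phi> x = 0" using BR(3)[of x] by simp
      then show ?thesis using False by simp
    qed
  qed
  have lim': "AE x in lebesgue. (\<lambda>n. X n x * \<phi> x) \<longlonglongrightarrow> Y x * \<phi> x"
    using lim by eventually_elim (intro tendsto_intros)
  have mm: "(\<lambda>x. Y x * \<phi> x) \<in> borel_measurable lebesgue" "\<And>n. (\<lambda>x. X n x * \<phi> x) \<in> borel_measurable lebesgue" by measurable
  show "integrable lebesgue (\<lambda>x. X n x * \<phi> x)" "integrable lebesgue (\<lambda>x. Y x * \<phi> x)"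
    "(\<lambda>n. \<integral>x. X n x * \<phi> x \<partial>lebesgue) \<longlonglongrightarrow> (\<integral>x. Y x * \<phi> x \<partial>lebesgue)"
    using integrable_dominated_convergence2[OF mm iw lim' b] integrable_dominated_convergence[OF mm iw lim' b]
      integral_dominated_convergence[OF mm iw lim' b] by auto
qed

lemma powr_le_dom0:
  assumes N: "CARD('n::finite) \<ge> 3" and r: "r > 0"
  shows "r powr (- real CARD('n) / 2) \<le> dom0 TYPE('n) r"
proof (cases "r \<le> 1")
  case True
  have "- (real CARD('n) + 2) / 2 \<le> - real CARD('n) / 2" by simp
  then have "r powr (- real CARD('n) / 2) \<le> r powr (- (real CARD('n) + 2) / 2)" using r True by (intro powr_mono') auto
  then show ?thesis by (simp add: dom0_def)
next
  case False
  have "r powr (- real CARD('n) / 2) \<le> 1 powr (- real CARD('n) / 2)" using False by (intro powr_mono2') auto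
  also have "\<dots> \<le> dom0 TYPE('n) r" by (simp add: dom0_def)
  finally show ?thesis .
qed

text \<open>One component of the sequence; the other one enters only through the right-hand sides
  \<open>fr n\<close> and their limit. Continuity of \<open>frl\<close> is assumed conditionally
  because continuity of \<open>Fl\<close> is itself derived, from the Hoelder bounds. The constants
  do not depend on n, and this uniformity carries the compactness.\<close>

locale radial_sequence =
  fixes U f :: "nat \<Rightarrow> real^'n::finite \<Rightarrow> real" and F fr :: "nat \<Rightarrow> real \<Rightarrow> real" and lam :: "nat \<Rightarrow> real"
    and Fl frl :: "real \<Rightarrow> real" and laml A d M C H Kb :: real
  assumes N: "CARD('n) \<ge> 3"
    and U: "\<And>n. H1 (U n)" and P: "\<And>n. profile (U n) (F n)"
    and K: "\<And>n r. r > 0 \<Longrightarrow> (F n r)\<^sup>2 * r ^ (CARD('n) - 2) \<le> Kb"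
    and fm: "\<And>n. f n \<in> borel_measurable lebesgue" and fr: "\<And>n. AE x in lebesgue. f n x = fr n (norm x)"
    and frc: "\<And>n. continuous_on {0<..} (fr n)" and frm: "\<And>n. fr n \<in> borel_measurable borel"
    and C: "\<And>n r. r > 0 \<Longrightarrow> \<bar>fr n r - lam n * F n r\<bar> \<le> C * dom0 TYPE('n) r"
    and Cf: "\<And>n r. r > 0 \<Longrightarrow> \<bar>fr n r\<bar> \<le> C * dom0 TYPE('n) r"
    and M: "\<And>n r. r > 0 \<Longrightarrow> \<bar>F n r\<bar> \<le> M * dom0 TYPE('n) r"
    and H0: "H \<ge> 0" and H: "\<And>n r s. 0 < r \<Longrightarrow> r \<le> s \<Longrightarrow> (F n s - F n r)\<^sup>2 \<le> H * ((s - r) / r ^ (CARD('n) - 1))"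
    and ws: "\<And>n. weak_sol (lam n) (U n) (f n)"
    and limF: "\<And>r. r > 0 \<Longrightarrow> (\<lambda>n. F n r) \<longlonglongrightarrow> Fl r" and limfr: "\<And>r. r > 0 \<Longrightarrow> (\<lambda>n. fr n r) \<longlonglongrightarrow> frl r"
    and limlam: "lam \<longlonglongrightarrow> laml" and Fl0: "\<And>r. r \<le> 0 \<Longrightarrow> Fl r = 0"
    and frlc: "continuous_on {0<..} Fl \<Longrightarrow> continuous_on {0<..} frl" and frlm: "frl \<in> borel_measurable borel"
    and mass: "\<And>n. (\<integral>x. (U n x)\<^sup>2 \<partial>lebesgue) = A"
    and dir: "(\<lambda>n. dirichlet (U n)) \<longlonglongrightarrow> d"
begin

definition "w n r = fr n r - lam n * F n r"
definition "wl r = frl r - laml * Fl r"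
definition "F' n r = - flux TYPE('n) (w n) r / r ^ (CARD('n) - 1)"
definition "Fl' r = - flux TYPE('n) wl r / r ^ (CARD('n) - 1)"
definition "ul x = Fl (norm (x::real^'n))"
definition "gl x = ((if norm x > 0 then Fl' (norm x) else 0) / norm x) *\<^sub>R (x::real^'n)"

lemma Flc: "continuous_on {0<..} Fl"
  by (rule holder_limit_continuous[OF H H0 limF])

lemma Flm [measurable]: "Fl \<in> borel_measurable borel"
  by (rule borel_measurable_pos_continuous[OF Flc Fl0])

lemma Fm [measurable]: "F n \<in> borel_measurable borel" by (rule profile_borel[OF P])

lemma wm [measurable]: "w n \<in> borel_measurable borel" "wl \<in> borel_measurable borel"
  unfolding w_def[abs_def] wl_def[abs_def] using frm frlm by simp_all

lemma wc: "continuous_on {0<..} wl"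
  unfolding wl_def[abs_def] by (intro continuous_intros frlc Flc)

lemma wnc: "continuous_on {0<..} (w n)"
  unfolding w_def[abs_def] using P[of n] by (intro continuous_intros frc) (simp add: profile_def)

lemma wC: "r > 0 \<Longrightarrow> \<bar>w n r\<bar> \<le> C * dom0 TYPE('n) r"
  using C by (simp add: w_def)

lemma limw: "r > 0 \<Longrightarrow> (\<lambda>n. w n r) \<longlonglongrightarrow> wl r"
  unfolding w_def wl_def by (intro tendsto_intros limF limfr limlam)

lemma wlC: "r > 0 \<Longrightarrow> \<bar>wl r\<bar> \<le> C * dom0 TYPE('n) r"
  by (rule LIMSEQ_le_const2[OF tendsto_rabs[OF limw]]) (use wC in auto)

lemma sol: 
  shows F'D: "r > 0 \<Longrightarrow> (F n has_real_derivative F' n r) (at r)"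
    and F'c: "continuous_on {0<..} (F' n)"
    and gF: "AE x in lebesgue. wgrad (U n) x = (F' n (norm x) / norm x) *\<^sub>R x"
proof -
  show "r > 0 \<Longrightarrow> (F n has_real_derivative F' n r) (at r)"
    unfolding F'_def w_def[abs_def]
    by (rule solution_profile(1)[OF N U P _ fm fr frc frm _ ws]) (use K C in auto)
  show "continuous_on {0<..} (F' n)"
    unfolding F'_def[abs_def] w_def[abs_def]
    by (rule solution_profile(2)[OF N U P _ fm fr frc frm _ ws]) (use K C in auto)
  show "AE x in lebesgue. wgrad (U n) x = (F' n (norm x) / norm x) *\<^sub>R x"
    unfolding F'_def w_def[abs_def]
    by (rule solution_profile(3)[OF N U P _ fm fr frc frm _ ws]) (use K C in auto)
qed

lemma F'bound:
  assumes r: "r > 0" 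
  shows "\<bar>F' n r\<bar> \<le> C * (r / real CARD('n) + r powr (- real CARD('n) / 2) / ((real CARD('n) - 2) / 2))"
  using flux_bound[OF wnc wm(1) N wC r, of n] r by (simp add: F'_def)

lemma limflux: assumes r: "r > 0" shows "(\<lambda>n. flux TYPE('n) (w n) r) \<longlonglongrightarrow> flux TYPE('n) wl r"
  unfolding flux_def
proof (rule integral_dominated_convergence[where w="\<lambda>s. C * (indicator {0..r} s * (s ^ (CARD('n) - 1) * dom0 TYPE('n) s))"])
  show "integrable lborel (\<lambda>s. C * (indicator {0..r} s * (s ^ (CARD('n) - 1) * dom0 TYPE('n) s)))"
    by (rule integrable_mult_right[OF integrable_dom0(1)[OF N]]) (use r in simp)
  show "AE s in lborel. (\<lambda>n. indicator {0..r} s * (s ^ (CARD('n) - 1) * w n s)) \<longlonglongrightarrow> indicator {0..r} s * (s ^ (CARD('n) - 1) * wl s)"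
    using AE_lborel_singleton[of "0::real"]
  proof eventually_elim
    case (elim s)
    show ?case
    proof (cases "s > 0")
      case True then show ?thesis by (intro tendsto_intros limw)
    next
      case False then show ?thesis using elim by simp
    qed
  qed
  show "AE s in lborel. norm (indicator {0..r} s * (s ^ (CARD('n) - 1) * w n s)) \<le> C * (indicator {0..r} s * (s ^ (CARD('n) - 1) * dom0 TYPE('n) s))" for n
    using AE_lborel_singleton[of "0::real"]
  proof eventually_elim
    case (elim s)
    show ?case
    proof (cases "s \<in> {0..r}")
      case True
      then have "s > 0" using elim by auto
      have "s ^ (CARD('n) - 1) * \<bar>w n s\<bar> \<le> s ^ (CARD('n) - 1) * (C * dom0 TYPE('n) s)"
        using wC[OF \<open>s > 0\<close>] \<open>s > 0\<close> by (intro mult_left_mono) auto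
      then show ?thesis using True \<open>s > 0\<close> by (simp add: abs_mult mult_ac)
    qed simp
  qed
qed auto

lemma limF': "r > 0 \<Longrightarrow> (\<lambda>n. F' n r) \<longlonglongrightarrow> Fl' r"
  unfolding F'_def Fl'_def by (intro tendsto_intros limflux) auto

lemma Fl'c: "continuous_on {0<..} Fl'"
proof -
  have "continuous_on {0<..} (flux TYPE('n) wl)"
    by (intro continuous_at_imp_continuous_on ballI DERIV_isCont[OF flux_DERIV[OF wc wm(2) N wlC]]) auto
  then show ?thesis unfolding Fl'_def[abs_def] by (intro continuous_intros) auto
qed

text \<open>Derivatives converge pointwise with a majorant on compact intervals, so the fundamental
  theorem for \<open>F n\<close> passes to the limit; the base point r/2 fixes the additive
  constant.\<close>

lemma FlD: assumes r: "r > 0" shows "(Fl has_real_derivative Fl' r) (at r)"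
proof -
  obtain E where E: "\<And>r. r > 0 \<Longrightarrow> (E has_real_derivative Fl' r) (at r)" using antiderivative_exists_pos[OF Fl'c] by blast
  define a where "a = r / 2"
  have a: "0 < a" "a < r" using r by (auto simp: a_def)
  have eq: "Fl x - Fl a = E x - E a" if x: "a \<le> x" for x
  proof -
    let ?b = "\<lambda>r. C * (r / real CARD('n) + r powr (- real CARD('n) / 2) / ((real CARD('n) - 2) / 2))"
    have bc: "continuous_on {a..x} ?b" by (intro continuous_intros) (use a N in auto)
    have Fl'm: "(\<lambda>r. indicator {a..x} r * Fl' r) \<in> borel_measurable lborel"
      using integral_by_FTC(1)[OF a(1) x E Fl'c] by (rule borel_measurable_integrable)
    have "(\<lambda>n. \<integral>r. indicator {a..x} r * F' n r \<partial>lborel) \<longlonglongrightarrow> (\<integral>r. indicator {a..x} r * Fl' r \<partial>lborel)"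
    proof (rule integral_dominated_convergence[where w="\<lambda>r. indicator {a..x} r *\<^sub>R ?b r", OF Fl'm])
      show "(\<lambda>r. indicator {a..x} r * F' n r) \<in> borel_measurable lborel" for n
        using integral_by_FTC(1)[OF a(1) x F'D F'c] by (rule borel_measurable_integrable)
      show "integrable lborel (\<lambda>r. indicator {a..x} r *\<^sub>R ?b r)" by (rule borel_integrable_compact[OF _ bc]) simp
      show "AE r in lborel. (\<lambda>n. indicator {a..x} r * F' n r) \<longlonglongrightarrow> indicator {a..x} r * Fl' r"
      proof (rule AE_I2)
        fix r show "(\<lambda>n. indicator {a..x} r * F' n r) \<longlonglongrightarrow> indicator {a..x} r * Fl' r"
          using a by (cases "r \<in> {a..x}") (auto intro!: limF')
      qed
      show "AE r in lborel. norm (indicator {a..x} r * F' n r) \<le> indicator {a..x} r *\<^sub>R ?b r" for n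
      proof (rule AE_I2)
        fix r show "norm (indicator {a..x} r * F' n r) \<le> indicator {a..x} r *\<^sub>R ?b r"
        proof (cases "r \<in> {a..x}")
          case True
          then have "r > 0" using a by auto
          then show ?thesis using True F'bound[of r n] by simp
        qed simp
      qed
    qed
    moreover have "(\<integral>r. indicator {a..x} r * F' n r \<partial>lborel) = F n x - F n a" for n
      by (rule integral_by_FTC(2)[OF a(1) x F'D F'c])
    moreover have "(\<integral>r. indicator {a..x} r * Fl' r \<partial>lborel) = E x - E a"
      by (rule integral_by_FTC(2)[OF a(1) x E Fl'c])
    ultimately have "(\<lambda>n. F n x - F n a) \<longlonglongrightarrow> E x - E a" by simp
    moreover have "(\<lambda>n. F n x - F n a) \<longlonglongrightarrow> Fl x - Fl a" using a x by (intro tendsto_intros limF) auto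
    ultimately show ?thesis by (rule LIMSEQ_unique[symmetric])
  qed
  have "((\<lambda>x. E x + (Fl a - E a)) has_real_derivative Fl' r) (at r)" using E[OF r] by (auto intro!: derivative_eq_intros)
  then show ?thesis
  proof (rule has_field_derivative_transform_within_open[of _ _ _ "{a<..}"])
    show "E x + (Fl a - E a) = Fl x" if "x \<in> {a<..}" for x using eq[of x] that by simp
  qed (use a in auto)
qed

lemma AE_pos: "AE x::real^'n in lebesgue. norm x > 0"
  using AE_norm_pos by (simp add: AE_completion_iff)

lemma ul_measurable: "ul \<in> borel_measurable lebesgue"
  unfolding ul_def[abs_def] by (intro measurable_completion) simp

lemma gl_measurable: "gl \<in> borel_measurable lebesgue"
proof -
  define G where "G r = (if r > 0 then Fl' r else 0)" for r
  have "continuous_on {0<..} G" by (rule continuous_on_eq[OF Fl'c]) (auto simp: G_def)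
  then have [measurable]: "G \<in> borel_measurable borel" by (rule borel_measurable_pos_continuous) (simp add: G_def)
  have "gl = (\<lambda>x. (G (norm x) / norm x) *\<^sub>R x)" by (auto simp: gl_def G_def)
  then show ?thesis by (intro measurable_completion) simp
qed

lemma limU: "AE x in lebesgue. (\<lambda>n. U n x) \<longlonglongrightarrow> ul x"
proof -
  have "AE x in lebesgue. \<forall>n. U n x = F n (norm x)"
    unfolding AE_all_countable using P by (simp add: profile_def)
  then show ?thesis using AE_pos
    by eventually_elim (use limF in \<open>simp add: ul_def\<close>)
qed

lemma limgrad: "AE x in lebesgue. (\<lambda>n. wgrad (U n) x) \<longlonglongrightarrow> gl x"
proof -
  have "AE x in lebesgue. \<forall>n. wgrad (U n) x = (F' n (norm x) / norm x) *\<^sub>R x"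
    unfolding AE_all_countable using gF by blast
  then show ?thesis using AE_pos
  proof eventually_elim
    case (elim x)
    have "(\<lambda>n. (F' n (norm x) / norm x) *\<^sub>R x) \<longlonglongrightarrow> (Fl' (norm x) / norm x) *\<^sub>R x"
      using elim by (intro tendsto_intros limF') auto
    then show ?case using elim by (simp add: gl_def)
  qed
qed

lemma Um: "U n \<in> borel_measurable lebesgue" and U2: "integrable lebesgue (\<lambda>x. (U n x)\<^sup>2)"
  using U[of n] by (auto simp: H1_def)

lemma gm: "wgrad (U n) \<in> borel_measurable lebesgue" and g2: "integrable lebesgue (\<lambda>x. (norm (wgrad (U n) x))\<^sup>2)"
  using H1_L2grad[OF U[of n]] by (auto simp: L2grad_def)

lemma ul2: "integrable lebesgue (\<lambda>x. (ul x)\<^sup>2)" "(\<integral>x. (ul x)\<^sup>2 \<partial>lebesgue) \<le> A"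
  using fatou_L2[of U lebesgue ul, OF Um ul_measurable limU, of A] U2 mass by simp_all

lemma gl2: "integrable lebesgue (\<lambda>x. (norm (gl x))\<^sup>2)" "(\<integral>x. (norm (gl x))\<^sup>2 \<partial>lebesgue) \<le> d"
  using fatou_L2[of "\<lambda>n. wgrad (U n)" lebesgue gl, OF gm gl_measurable limgrad g2, of d] dir
  by (simp_all add: dirichlet_def)

lemma domU: "\<exists>C. \<forall>n. AE x in lebesgue. norm x \<le> R \<longrightarrow> \<bar>U n x\<bar> \<le> C * dom0 TYPE('n) (norm x)"
proof (intro exI allI)
  fix n
  have "AE x in lebesgue. U n x = F n (norm x)" using P[of n] by (simp add: profile_def)
  then show "AE x in lebesgue. norm x \<le> R \<longrightarrow> \<bar>U n x\<bar> \<le> M * dom0 TYPE('n) (norm x)"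
    using AE_pos by eventually_elim (use M in simp)
qed

lemma domf: "\<exists>C. \<forall>n. AE x in lebesgue. norm x \<le> R \<longrightarrow> \<bar>f n x\<bar> \<le> C * dom0 TYPE('n) (norm x)"
proof (intro exI allI)
  fix n
  show "AE x in lebesgue. norm x \<le> R \<longrightarrow> \<bar>f n x\<bar> \<le> C * dom0 TYPE('n) (norm x)"
    using fr[of n] AE_pos by eventually_elim (use Cf in simp)
qed

lemma C_nonneg: "C \<ge> 0"
proof -
  have "0 \<le> \<bar>w 0 1\<bar>" by simp
  also have "\<dots> \<le> C * dom0 TYPE('n) 1" by (rule wC) simp
  finally show ?thesis using dom0_pos[where 'n='n, of 1] by (simp add: zero_le_mult_iff)
qed

text \<open>The linear growth of the flux bound makes the constant depend on the ball; its singular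
  part at 0 is absorbed by \<open>powr_le_dom0\<close>.\<close>

lemma domg: "\<exists>C. \<forall>n. AE x in lebesgue. norm x \<le> R \<longrightarrow> \<bar>wgrad (U n) x $ i\<bar> \<le> C * dom0 TYPE('n) (norm x)"
proof (intro exI allI)
  fix n
  let ?k = "(real CARD('n) - 2) / 2"
  have k: "?k > 0" using N by simp
  show "AE x in lebesgue. norm x \<le> R \<longrightarrow> \<bar>wgrad (U n) x $ i\<bar> \<le> (C * (\<bar>R\<bar> / real CARD('n) + 1 / ?k)) * dom0 TYPE('n) (norm x)"
    using gF[of n] AE_pos
  proof eventually_elim
    case (elim x)
    show ?case
    proof
      assume R: "norm x \<le> R"
      let ?r = "norm x"
      have "\<bar>wgrad (U n) x $ i\<bar> \<le> norm (wgrad (U n) x)" by (rule component_le_norm_cart)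
      also have "\<dots> = \<bar>F' n ?r\<bar>" using elim by simp
      also have "\<dots> \<le> C * (?r / real CARD('n) + ?r powr (- real CARD('n) / 2) / ?k)" by (rule F'bound) (use elim in simp)
      also have "\<dots> \<le> C * ((\<bar>R\<bar> / real CARD('n)) * dom0 TYPE('n) ?r + dom0 TYPE('n) ?r / ?k)"
      proof (intro mult_left_mono[OF _ C_nonneg] add_mono divide_right_mono powr_le_dom0 N)
        have "?r / real CARD('n) \<le> \<bar>R\<bar> / real CARD('n) * 1" using R by (simp add: divide_right_mono)
        also have "\<dots> \<le> \<bar>R\<bar> / real CARD('n) * dom0 TYPE('n) ?r" by (intro mult_left_mono) (auto simp: dom0_def)
        finally show "?r / real CARD('n) \<le> \<bar>R\<bar> / real CARD('n) * dom0 TYPE('n) ?r" .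
      qed (use k elim in auto)
      also have "\<dots> = (C * (\<bar>R\<bar> / real CARD('n) + 1 / ?k)) * dom0 TYPE('n) ?r" by (simp add: algebra_simps)
      finally show "\<bar>wgrad (U n) x $ i\<bar> \<le> (C * (\<bar>R\<bar> / real CARD('n) + 1 / ?k)) * dom0 TYPE('n) ?r" .
    qed
  qed
qed

lemma limg_i: "AE x in lebesgue. (\<lambda>n. wgrad (U n) x $ i) \<longlonglongrightarrow> gl x $ i"
  using limgrad by eventually_elim (intro tendsto_intros)

lemma gi_measurable: "(\<lambda>x. wgrad (U n) x $ i) \<in> borel_measurable lebesgue" "(\<lambda>x. gl x $ i) \<in> borel_measurable lebesgue"
  by (rule measurable_compose[OF gm borel_measurable_continuous_onI[OF continuous_on_component[OF continuous_on_id]]])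
    (rule measurable_compose[OF gl_measurable borel_measurable_continuous_onI[OF continuous_on_component[OF continuous_on_id]]])

text \<open>For each test function both sides of the defining identity converge by domination, so
  the pointwise limit of the gradients is the weak gradient of the limit.\<close>

lemma L2grad_ul: "L2grad ul gl"
proof -
  have "weak_grad ul gl"
    unfolding weak_grad_def
  proof (intro allI impI conjI)
    fix \<phi> :: "real^'n \<Rightarrow> real" and i assume t: "test_fun \<phi>"
    note 1 = dominated_test[OF N Um ul_measurable limU domU test_fun_pdiff[OF t, of i]]
    note 2 = dominated_test[OF N gi_measurable limg_i domg t, of i]
    show "integrable lebesgue (\<lambda>x. ul x * pdiff i \<phi> x)" "integrable lebesgue (\<lambda>x. gl x $ i * \<phi> x)"
      using 1(2) 2(2) by auto
    have "(\<integral>x. U n x * pdiff i \<phi> x \<partial>lebesgue) = - (\<integral>x. wgrad (U n) x $ i * \<phi> x \<partial>lebesgue)" for n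
      using H1_L2grad[OF U[of n]] t by (auto simp: L2grad_def weak_grad_def)
    then have "(\<lambda>n. \<integral>x. U n x * pdiff i \<phi> x \<partial>lebesgue) \<longlonglongrightarrow> - (\<integral>x. gl x $ i * \<phi> x \<partial>lebesgue)"
      using tendsto_minus[OF 2(3)] by simp
    with 1(3) show "(\<integral>x. ul x * pdiff i \<phi> x \<partial>lebesgue) = - (\<integral>x. gl x $ i * \<phi> x \<partial>lebesgue)"
      by (rule LIMSEQ_unique)
  qed
  then show ?thesis using gl_measurable gl2 by (simp add: L2grad_def)
qed

lemma H1_ul: "H1 ul"
  using ul_measurable ul2 L2grad_ul by (auto simp: H1_def)

lemma profile_ul: "profile ul Fl"
  using Flc Fl0 by (simp add: profile_def ul_def)

lemma dirichlet_ul: "dirichlet ul \<le> d"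
  unfolding dirichlet_eq[OF L2grad_ul] by (rule gl2)

lemma Kl: "r > 0 \<Longrightarrow> (Fl r)\<^sup>2 * r ^ (CARD('n) - 2) \<le> Kb"
  by (rule LIMSEQ_le_const2[OF tendsto_mult[OF tendsto_power[OF limF] tendsto_const]]) (use K in auto)

lemma weak_sol_ul: "weak_sol laml ul (\<lambda>x. frl (norm x))"
  unfolding weak_sol_def
proof (intro allI impI)
  fix \<phi> :: "real^'n \<Rightarrow> real" assume t: "test_fun \<phi>"
  have flm: "(\<lambda>x::real^'n. frl (norm x)) \<in> borel_measurable lebesgue"
    using frlm by (intro measurable_completion) simp
  have limf: "AE x in lebesgue. (\<lambda>n. f n x) \<longlonglongrightarrow> frl (norm x)"
  proof -
    have "AE x in lebesgue. \<forall>n. f n x = fr n (norm x)" unfolding AE_all_countable using fr by blast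
    then show ?thesis using AE_pos by eventually_elim (use limfr in simp)
  qed
  note 1 = dominated_test[OF N Um ul_measurable limU domU t]
  note 2 = dominated_test[OF N gi_measurable limg_i domg test_fun_pdiff[OF t]]
  note 3 = dominated_test[OF N fm flm limf domf t]
  have in_eq: "v \<bullet> cgrad \<phi> x = (\<Sum>i\<in>UNIV. v $ i * pdiff i \<phi> x)" for v x
    by (simp add: inner_vec_def cgrad_def)
  have e: "(\<integral>x. wgrad (U n) x \<bullet> cgrad \<phi> x + lam n * U n x * \<phi> x \<partial>lebesgue) =
     (\<Sum>i\<in>UNIV. \<integral>x. wgrad (U n) x $ i * pdiff i \<phi> x \<partial>lebesgue) + lam n * (\<integral>x. U n x * \<phi> x \<partial>lebesgue)" for n
    unfolding in_eq mult.assoc using 2(1) 1(1) by simp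
  have AEg: "AE x in lebesgue. wgrad ul x = gl x" by (rule L2grad_unique[OF L2grad_wgrad[OF L2grad_ul] L2grad_ul])
  have "(\<lambda>n. (\<Sum>i\<in>UNIV. \<integral>x. wgrad (U n) x $ i * pdiff i \<phi> x \<partial>lebesgue) + lam n * (\<integral>x. U n x * \<phi> x \<partial>lebesgue))
     \<longlonglongrightarrow> (\<Sum>i\<in>UNIV. \<integral>x. gl x $ i * pdiff i \<phi> x \<partial>lebesgue) + laml * (\<integral>x. ul x * \<phi> x \<partial>lebesgue)"
    by (intro tendsto_intros 2(3) 1(3) limlam)
  moreover have "(\<Sum>i\<in>UNIV. \<integral>x. wgrad (U n) x $ i * pdiff i \<phi> x \<partial>lebesgue) + lam n * (\<integral>x. U n x * \<phi> x \<partial>lebesgue) = (\<integral>x. f n x * \<phi> x \<partial>lebesgue)" for n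
    using ws[of n] t unfolding e[symmetric] by (simp add: weak_sol_def)
  ultimately have "(\<Sum>i\<in>UNIV. \<integral>x. gl x $ i * pdiff i \<phi> x \<partial>lebesgue) + laml * (\<integral>x. ul x * \<phi> x \<partial>lebesgue) = (\<integral>x. frl (norm x) * \<phi> x \<partial>lebesgue)"
    using LIMSEQ_unique[OF _ 3(3)] by simp
  moreover have "(\<integral>x. wgrad ul x \<bullet> cgrad \<phi> x + laml * ul x * \<phi> x \<partial>lebesgue) = (\<integral>x. (\<Sum>i\<in>UNIV. gl x $ i * pdiff i \<phi> x) + laml * (ul x * \<phi> x) \<partial>lebesgue)"
  proof (rule integral_cong_AE)
    show "AE x in lebesgue. wgrad ul x \<bullet> cgrad \<phi> x + laml * ul x * \<phi> x = (\<Sum>i\<in>UNIV. gl x $ i * pdiff i \<phi> x) + laml * (ul x * \<phi> x)"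
      using AEg by eventually_elim (simp add: in_eq mult.assoc)
    have "(\<lambda>x. wgrad ul x $ i) \<in> borel_measurable lebesgue" for i
      by (rule L2grad_component[OF L2grad_wgrad[OF L2grad_ul]])
    then show "(\<lambda>x. wgrad ul x \<bullet> cgrad \<phi> x + laml * ul x * \<phi> x) \<in> borel_measurable lebesgue"
      unfolding in_eq using ul_measurable test_fun_lebesgue[OF t] test_fun_lebesgue[OF test_fun_pdiff[OF t]] by simp
    show "(\<lambda>x. (\<Sum>i\<in>UNIV. gl x $ i * pdiff i \<phi> x) + laml * (ul x * \<phi> x)) \<in> borel_measurable lebesgue"
      using 2(2) 1(2) by (intro borel_measurable_integrable Bochner_Integration.integrable_add integrable_mult_right Bochner_Integration.integrable_sum) auto
  qed
  moreover have "\<dots> = (\<Sum>i\<in>UNIV. \<integral>x. gl x $ i * pdiff i \<phi> x \<partial>lebesgue) + laml * (\<integral>x. ul x * \<phi> x \<partial>lebesgue)"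
    using 2(2) 1(2) by simp
  ultimately show "(\<integral>x. wgrad ul x \<bullet> cgrad \<phi> x + laml * ul x * \<phi> x \<partial>lebesgue) = (\<integral>x. frl (norm x) * \<phi> x \<partial>lebesgue)" by simp
qed

text \<open>The two equalities are what \<open>scheffe_L2\<close> requires, once for the functions
  and once for the gradients.\<close>

lemma strong_convergence:
  assumes "(\<integral>x. (ul x)\<^sup>2 \<partial>lebesgue) = A" "dirichlet ul = d"
  shows "(\<lambda>n. (H1norm (\<lambda>x. U n x - ul x))\<^sup>2) \<longlonglongrightarrow> 0"
proof -
  have 1: "(\<lambda>n. \<integral>x. (norm (U n x - ul x))\<^sup>2 \<partial>lebesgue) \<longlonglongrightarrow> 0"
    by (rule scheffe_L2[OF Um ul_measurable limU]) (use U2 ul2 mass assms in simp_all)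
  have 2: "(\<lambda>n. \<integral>x. (norm (wgrad (U n) x - gl x))\<^sup>2 \<partial>lebesgue) \<longlonglongrightarrow> 0"
    by (rule scheffe_L2[OF gm gl_measurable limgrad g2 gl2(1)])
      (use dir assms dirichlet_eq[OF L2grad_ul] in \<open>simp add: dirichlet_def\<close>)
  have "(H1norm (\<lambda>x. U n x - ul x))\<^sup>2 = (\<integral>x. (norm (U n x - ul x))\<^sup>2 \<partial>lebesgue) + (\<integral>x. (norm (wgrad (U n) x - gl x))\<^sup>2 \<partial>lebesgue)" for n
    unfolding H1norm_def dirichlet_eq[OF L2grad_diff[OF H1_L2grad[OF U[of n]] L2grad_ul]] by simp
  then show ?thesis using tendsto_add[OF 1 2] by simp
qed

end

subsection \<open>The coupled system\<close>

text \<open>The right-hand side of the first rescaled equation, with coupling constant 1. Exchanging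
  \<alpha> with \<beta> and u with v gives the second equation, and \<epsilon> = 0 the limit
  system.\<close>

definition sys_rhs :: "real \<Rightarrow> real \<Rightarrow> real \<Rightarrow> (real^'n::finite \<Rightarrow> real) \<Rightarrow> (real^'n \<Rightarrow> real) \<Rightarrow> real^'n \<Rightarrow> real" where
  "sys_rhs \<epsilon> \<alpha> \<beta> u v x = \<epsilon> * (\<bar>u x\<bar> powr (crit TYPE('n) - 2) * u x) + \<alpha> * (\<bar>u x\<bar> powr (\<alpha> - 2) * \<bar>v x\<bar> powr \<beta> * u x)"

text \<open>The version for nonnegative profiles, with the factor u merged into the powers. This
  matters for \<alpha> < 2, where a separate exponent \<alpha> - 2 would be negative and continuity
  at zeros of F would be hidden.\<close>

definition profile_rhs :: "'n::finite itself \<Rightarrow> real \<Rightarrow> real \<Rightarrow> real \<Rightarrow> (real \<Rightarrow> real) \<Rightarrow> (real \<Rightarrow> real) \<Rightarrow> real \<Rightarrow> real" where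
  "profile_rhs _ \<epsilon> \<alpha> \<beta> F G r = \<epsilon> * F r powr (crit TYPE('n) - 1) + \<alpha> * (F r powr (\<alpha> - 1) * G r powr \<beta>)"

lemma powr_mult_self: "x \<ge> 0 \<Longrightarrow> x powr a * x = (x::real) powr (a + 1)"
  by (cases "x = 0") (auto simp: powr_add)

lemma sys_rhs_profile:
  assumes "u x = F r" "v x = G r" "F r \<ge> 0" "G r \<ge> 0"
  shows "sys_rhs \<epsilon> \<alpha> \<beta> u v (x::real^'n::finite) = profile_rhs TYPE('n) \<epsilon> \<alpha> \<beta> F G r"
proof -
  have "F r powr (crit TYPE('n) - 2) * F r = F r powr (crit TYPE('n) - 1)" "F r powr (\<alpha> - 2) * F r = F r powr (\<alpha> - 1)"
    using powr_mult_self[OF assms(3), of "crit TYPE('n) - 2"] powr_mult_self[OF assms(3), of "\<alpha> - 2"] by simp_all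
  then show ?thesis using assms by (simp add: sys_rhs_def profile_rhs_def mult.commute mult.left_commute)
qed

lemma sys_rhs_measurable:
  "u \<in> borel_measurable lebesgue \<Longrightarrow> v \<in> borel_measurable lebesgue \<Longrightarrow> sys_rhs \<epsilon> \<alpha> \<beta> u v \<in> borel_measurable lebesgue"
  unfolding sys_rhs_def[abs_def] by simp

lemma profile_rhs_borel:
  "F \<in> borel_measurable borel \<Longrightarrow> G \<in> borel_measurable borel \<Longrightarrow> profile_rhs TYPE('n::finite) \<epsilon> \<alpha> \<beta> F G \<in> borel_measurable borel"
  unfolding profile_rhs_def[abs_def] by simp

lemma profile_rhs_continuous:
  assumes N: "CARD('n::finite) \<ge> 3" and ab: "\<alpha> > 1" "\<beta> > 1"
    and F: "continuous_on {0<..} F" "\<And>r. F r \<ge> 0" and G: "continuous_on {0<..} G" "\<And>r. G r \<ge> 0"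
  shows "continuous_on {0<..} (profile_rhs TYPE('n) \<epsilon> \<alpha> \<beta> F G)"
  unfolding profile_rhs_def[abs_def]
  by (intro continuous_on_add continuous_on_mult continuous_on_const continuous_on_powr' F G)
    (use F G ab crit_gt_2[OF N] in auto)

lemma profile_rhs_tendsto:
  assumes N: "CARD('n::finite) \<ge> 3" and ab: "\<alpha> > 1" "\<beta> > 1"
    and F: "(\<lambda>n. F n r) \<longlonglongrightarrow> Fl r" "\<And>n. F n r \<ge> 0" and G: "(\<lambda>n. G n r) \<longlonglongrightarrow> Gl r" "\<And>n. G n r \<ge> 0"
    and e: "\<epsilon> \<longlonglongrightarrow> 0"
  shows "(\<lambda>n. profile_rhs TYPE('n) (\<epsilon> n) \<alpha> \<beta> (F n) (G n) r) \<longlonglongrightarrow> profile_rhs TYPE('n) 0 \<alpha> \<beta> Fl Gl r"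
  unfolding profile_rhs_def
  by (intro tendsto_add tendsto_mult tendsto_const tendsto_powr' F G e)
    (use F G ab crit_gt_2[OF N] in auto)

lemma powr_prod_le_mu:
  assumes F: "0 \<le> x" "x \<le> M * mu TYPE('n::finite) r" and G: "0 \<le> y" "y \<le> M * mu TYPE('n) r"
    and e: "a \<ge> 0" "b \<ge> 0" and M: "M \<ge> 0" and r: "r > 0"
  shows "x powr a * y powr b \<le> M powr (a + b) * mu TYPE('n) r powr (a + b)"
proof -
  have "x powr a * y powr b \<le> (M * mu TYPE('n) r) powr a * (M * mu TYPE('n) r) powr b"
    using F G e by (intro mult_mono powr_mono2) auto
  also have "\<dots> = (M * mu TYPE('n) r) powr (a + b)" by (simp add: powr_add)
  also have "\<dots> = M powr (a + b) * mu TYPE('n) r powr (a + b)" using M mu_pos[OF r, where 'n='n] by (simp add: powr_mult)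
  finally show ?thesis .
qed

lemma profile_rhs_bound:
  assumes N: "CARD('n::finite) \<ge> 3" and ab: "\<alpha> > 1" "\<beta> > 1" and sub: "\<alpha> + \<beta> < crit TYPE('n)"
    and F: "0 \<le> F r" "F r \<le> M * mu TYPE('n) r" and G: "0 \<le> G r" "G r \<le> M * mu TYPE('n) r"
    and M: "M \<ge> 0" and r: "r > 0" and e: "0 \<le> \<epsilon>" "\<epsilon> \<le> 1"
  shows "\<bar>profile_rhs TYPE('n) \<epsilon> \<alpha> \<beta> F G r\<bar> \<le> (M powr (crit TYPE('n) - 1) + \<alpha> * M powr (\<alpha> + \<beta> - 1)) * dom0 TYPE('n) r"
proof -
  note c = crit_gt_2[OF N]
  \<comment> \<open>The factor with exponent 0 lets the product bound serve a single power. At F r =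
    0 it is 0 and not 1, whence the case distinction that follows.\<close>
  have "F r powr (crit TYPE('n) - 1) * F r powr 0 \<le> M powr (crit TYPE('n) - 1 + 0) * mu TYPE('n) r powr (crit TYPE('n) - 1 + 0)"
    by (rule powr_prod_le_mu) (use F M r c in auto)
  also have "\<dots> \<le> M powr (crit TYPE('n) - 1) * dom0 TYPE('n) r"
    using mu_le_dom0[OF N _ _ r, of "crit TYPE('n) - 1"] c by (auto intro!: mult_left_mono)
  finally have 1: "F r powr (crit TYPE('n) - 1) \<le> M powr (crit TYPE('n) - 1) * dom0 TYPE('n) r"
    by (cases "F r = 0") (auto simp: less_imp_le[OF dom0_pos])
  have "F r powr (\<alpha> - 1) * G r powr \<beta> \<le> M powr (\<alpha> - 1 + \<beta>) * mu TYPE('n) r powr (\<alpha> - 1 + \<beta>)"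
    by (rule powr_prod_le_mu) (use F G M r ab in auto)
  also have "\<dots> \<le> M powr (\<alpha> - 1 + \<beta>) * dom0 TYPE('n) r"
    using mu_le_dom0[OF N _ _ r, of "\<alpha> - 1 + \<beta>"] sub ab by (auto intro!: mult_left_mono)
  finally have 2: "F r powr (\<alpha> - 1) * G r powr \<beta> \<le> M powr (\<alpha> + \<beta> - 1) * dom0 TYPE('n) r" by (simp add: algebra_simps)
  have "\<epsilon> * F r powr (crit TYPE('n) - 1) \<le> 1 * (M powr (crit TYPE('n) - 1) * dom0 TYPE('n) r)"
    using 1 e by (intro mult_mono) auto
  moreover have "\<alpha> * (F r powr (\<alpha> - 1) * G r powr \<beta>) \<le> \<alpha> * (M powr (\<alpha> + \<beta> - 1) * dom0 TYPE('n) r)"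
    using 2 ab by (intro mult_left_mono) auto
  moreover have "0 \<le> profile_rhs TYPE('n) \<epsilon> \<alpha> \<beta> F G r" using e ab by (simp add: profile_rhs_def)
  ultimately show ?thesis by (simp add: profile_rhs_def distrib_right)
qed

definition below_mu :: "'n::finite itself \<Rightarrow> real \<Rightarrow> (real \<Rightarrow> real) \<Rightarrow> bool" where
  "below_mu _ M F \<longleftrightarrow> M \<ge> 0 \<and> (\<forall>r. 0 \<le> F r) \<and> (\<forall>r>0. F r \<le> M * mu TYPE('n) r)"

lemma below_muD:
  assumes "below_mu TYPE('n::finite) M F"
  shows "M \<ge> 0" "0 \<le> F r" "r > 0 \<Longrightarrow> F r \<le> M * mu TYPE('n) r"
  using assms by (auto simp: below_mu_def)

text \<open>2N/(N-1) equals 2 + 2/(N-1), and 2/(N-1) <= 4/N in these dimensions. So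
  mass-supercriticality covers the decay that \<open>integrable_mu\<close> requires at
  infinity.\<close>

lemma exponent_range:
  assumes N: "CARD('n::finite) \<ge> 3" and p: "p > 2 + 4 / real CARD('n)"
  shows "2 * real CARD('n) / (real CARD('n) - 1) < p"
proof -
  define n where "n = real CARD('n)"
  have n: "n \<ge> 3" using N by (simp add: n_def)
  have "2 / (n - 1) \<le> 4 / n" using n by (simp add: divide_simps)
  moreover have "2 * n / (n - 1) = 2 + 2 / (n - 1)" using n by (simp add: divide_simps)
  ultimately show ?thesis using p unfolding n_def by linarith
qed

lemma coup_density_bound:
  assumes BF: "below_mu TYPE('n::finite) M F" and BG: "below_mu TYPE('n) M G" and ab: "\<alpha> > 1" "\<beta> > 1"
  shows "\<bar>indicator {0<..} r * (r ^ (CARD('n) - 1) * (F r powr \<alpha> * G r powr \<beta>))\<bar> \<le> M powr (\<alpha> + \<beta>) * (indicator {0<..} r * (r ^ (CARD('n) - 1) * mu TYPE('n) r powr (\<alpha> + \<beta>)))"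
proof (cases "r > 0")
  case True
  have "F r powr \<alpha> * G r powr \<beta> \<le> M powr (\<alpha> + \<beta>) * mu TYPE('n) r powr (\<alpha> + \<beta>)"
    by (rule powr_prod_le_mu) (use below_muD[OF BF] below_muD[OF BG] True ab in auto)
  then have "r ^ (CARD('n) - 1) * (F r powr \<alpha> * G r powr \<beta>) \<le> r ^ (CARD('n) - 1) * (M powr (\<alpha> + \<beta>) * mu TYPE('n) r powr (\<alpha> + \<beta>))"
    using True by (intro mult_left_mono) auto
  then show ?thesis using True by (simp add: mult_ac)
qed simp

lemma coup_profile:
  fixes u v :: "real^'n::finite \<Rightarrow> real"
  assumes N: "CARD('n) \<ge> 3" and ab: "\<alpha> > 1" "\<beta> > 1" and sub: "\<alpha> + \<beta> < crit TYPE('n)" and sup: "\<alpha> + \<beta> > 2 + 4 / real CARD('n)"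
    and u: "u \<in> borel_measurable lebesgue" and v: "v \<in> borel_measurable lebesgue" and P: "profile u F" "profile v G"
    and BF: "below_mu TYPE('n) M F" and BG: "below_mu TYPE('n) M G"
  shows "integrable lborel (\<lambda>r. indicator {0<..} r * (r ^ (CARD('n) - 1) * (F r powr \<alpha> * G r powr \<beta>)))"
    and "coup \<alpha> \<beta> u v = sph_area TYPE('n) * (\<integral>r. indicator {0<..} r * (r ^ (CARD('n) - 1) * (F r powr \<alpha> * G r powr \<beta>)) \<partial>lborel)"
    and "integrable lebesgue (\<lambda>x. \<bar>u x\<bar> powr \<alpha> * \<bar>v x\<bar> powr \<beta>)"
proof -
  note M = below_muD(1)[OF BF] and F = below_muD(2,3)[OF BF] and G = below_muD(2,3)[OF BG]
  have [measurable]: "F \<in> borel_measurable borel" "G \<in> borel_measurable borel" using P profile_borel by auto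
  show i: "integrable lborel (\<lambda>r. indicator {0<..} r * (r ^ (CARD('n) - 1) * (F r powr \<alpha> * G r powr \<beta>)))"
    by (rule Bochner_Integration.integrable_bound[OF integrable_mult_right[OF integrable_mu[OF N exponent_range[OF N sup] sub], of "M powr (\<alpha> + \<beta>)"]])
      (use coup_density_bound[OF BF BG ab] in \<open>auto intro: order_trans[OF _ abs_ge_self]\<close>)
  have m: "(\<lambda>x. \<bar>u x\<bar> powr \<alpha> * \<bar>v x\<bar> powr \<beta>) \<in> borel_measurable lebesgue" using u v by simp
  have AE: "AE x in lebesgue. \<bar>u x\<bar> powr \<alpha> * \<bar>v x\<bar> powr \<beta> = F (norm x) powr \<alpha> * G (norm x) powr \<beta>"
  proof -
    have "AE x in lebesgue. u x = F (norm x)" "AE x in lebesgue. v x = G (norm x)" using P by (auto simp: profile_def)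
    then show ?thesis by eventually_elim (use F G in simp)
  qed
  have hm: "(\<lambda>r. F r powr \<alpha> * G r powr \<beta>) \<in> borel_measurable borel" by simp
  show "coup \<alpha> \<beta> u v = sph_area TYPE('n) * (\<integral>r. indicator {0<..} r * (r ^ (CARD('n) - 1) * (F r powr \<alpha> * G r powr \<beta>)) \<partial>lborel)"
    unfolding coup_def by (rule radial_integral(2)[OF hm AE m])
  show "integrable lebesgue (\<lambda>x. \<bar>u x\<bar> powr \<alpha> * \<bar>v x\<bar> powr \<beta>)"
    unfolding radial_integral(1)[OF hm AE m] by (rule i)
qed

lemma coup_bound:
  fixes u v :: "real^'n::finite \<Rightarrow> real"
  assumes N: "CARD('n) \<ge> 3" and ab: "\<alpha> > 1" "\<beta> > 1" and sub: "\<alpha> + \<beta> < crit TYPE('n)" and sup: "\<alpha> + \<beta> > 2 + 4 / real CARD('n)"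
    and u: "u \<in> borel_measurable lebesgue" and v: "v \<in> borel_measurable lebesgue" and P: "profile u F" "profile v G"
    and BF: "below_mu TYPE('n) M F" and BG: "below_mu TYPE('n) M G"
  shows "coup \<alpha> \<beta> u v \<le> sph_area TYPE('n) * (M powr (\<alpha> + \<beta>) * (\<integral>r. indicator {0<..} r * (r ^ (CARD('n) - 1) * mu TYPE('n) r powr (\<alpha> + \<beta>)) \<partial>lborel))"
proof -
  note c = coup_profile[OF N ab sub sup u v P BF BG]
  have "(\<integral>r. indicator {0<..} r * (r ^ (CARD('n) - 1) * (F r powr \<alpha> * G r powr \<beta>)) \<partial>lborel) \<le>
      (\<integral>r. M powr (\<alpha> + \<beta>) * (indicator {0<..} r * (r ^ (CARD('n) - 1) * mu TYPE('n) r powr (\<alpha> + \<beta>))) \<partial>lborel)"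
    by (intro integral_mono c(1) integrable_mult_right integrable_mu[OF N exponent_range[OF N sup] sub] abs_le_D1[OF coup_density_bound[OF BF BG ab]])
  then show ?thesis unfolding c(2) by (intro mult_left_mono) auto
qed

text \<open>The common majorant is \<open>mu\<close> to the power \<alpha> + \<beta>, integrable at
  0 by subcriticality and at infinity by the lower bound on the exponent. This is the compactness of
  the coupling term.\<close>

lemma coup_tendsto:
  fixes U V :: "nat \<Rightarrow> real^'n::finite \<Rightarrow> real" and u v :: "real^'n \<Rightarrow> real"
  assumes N: "CARD('n) \<ge> 3" and ab: "\<alpha> > 1" "\<beta> > 1" and sub: "\<alpha> + \<beta> < crit TYPE('n)" and sup: "\<alpha> + \<beta> > 2 + 4 / real CARD('n)"
    and m: "\<And>n. U n \<in> borel_measurable lebesgue" "\<And>n. V n \<in> borel_measurable lebesgue" "u \<in> borel_measurable lebesgue" "v \<in> borel_measurable lebesgue"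
    and P: "\<And>n. profile (U n) (F n)" "\<And>n. profile (V n) (G n)" "profile u Fl" "profile v Gl"
    and BF: "\<And>n. below_mu TYPE('n) M (F n)" and BG: "\<And>n. below_mu TYPE('n) M (G n)" and BFl: "below_mu TYPE('n) M Fl" and BGl: "below_mu TYPE('n) M Gl"
    and lim: "\<And>r. r > 0 \<Longrightarrow> (\<lambda>n. F n r) \<longlonglongrightarrow> Fl r" "\<And>r. r > 0 \<Longrightarrow> (\<lambda>n. G n r) \<longlonglongrightarrow> Gl r"
  shows "(\<lambda>n. coup \<alpha> \<beta> (U n) (V n)) \<longlonglongrightarrow> coup \<alpha> \<beta> u v"
  unfolding coup_profile(2)[OF N ab sub sup m(1) m(2) P(1) P(2) BF BG] coup_profile(2)[OF N ab sub sup m(3,4) P(3,4) BFl BGl]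
proof (intro tendsto_mult tendsto_const)
  have [measurable]: "F n \<in> borel_measurable borel" "G n \<in> borel_measurable borel" "Fl \<in> borel_measurable borel" "Gl \<in> borel_measurable borel" for n
    using P profile_borel by auto
  show "(\<lambda>n. \<integral>r. indicator {0<..} r * (r ^ (CARD('n) - 1) * (F n r powr \<alpha> * G n r powr \<beta>)) \<partial>lborel) \<longlonglongrightarrow>
      (\<integral>r. indicator {0<..} r * (r ^ (CARD('n) - 1) * (Fl r powr \<alpha> * Gl r powr \<beta>)) \<partial>lborel)"
  proof (rule integral_dominated_convergence[where w="\<lambda>r. M powr (\<alpha> + \<beta>) * (indicator {0<..} r * (r ^ (CARD('n) - 1) * mu TYPE('n) r powr (\<alpha> + \<beta>)))"])
    show "integrable lborel (\<lambda>r. M powr (\<alpha> + \<beta>) * (indicator {0<..} r * (r ^ (CARD('n) - 1) * mu TYPE('n) r powr (\<alpha> + \<beta>))))"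
      by (rule integrable_mult_right[OF integrable_mu[OF N exponent_range[OF N sup] sub]])
    show "AE r in lborel. (\<lambda>n. indicator {0<..} r * (r ^ (CARD('n) - 1) * (F n r powr \<alpha> * G n r powr \<beta>))) \<longlonglongrightarrow> indicator {0<..} r * (r ^ (CARD('n) - 1) * (Fl r powr \<alpha> * Gl r powr \<beta>))"
    proof (rule AE_I2)
      fix r :: real
      show "(\<lambda>n. indicator {0<..} r * (r ^ (CARD('n) - 1) * (F n r powr \<alpha> * G n r powr \<beta>))) \<longlonglongrightarrow> indicator {0<..} r * (r ^ (CARD('n) - 1) * (Fl r powr \<alpha> * Gl r powr \<beta>))"
      proof (cases "r > 0")
        case True
        then show ?thesis using below_muD(2)[OF BF] below_muD(2)[OF BG] ab by (intro tendsto_mult tendsto_const tendsto_powr' lim) auto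
      qed simp
    qed
    show "AE r in lborel. norm (indicator {0<..} r * (r ^ (CARD('n) - 1) * (F n r powr \<alpha> * G n r powr \<beta>))) \<le> M powr (\<alpha> + \<beta>) * (indicator {0<..} r * (r ^ (CARD('n) - 1) * mu TYPE('n) r powr (\<alpha> + \<beta>)))" for n
      by (rule AE_I2) (use coup_density_bound[OF BF BG ab] in simp)
  qed auto
qed

lemma coup_commute: "coup \<alpha> \<beta> u v = coup \<beta> \<alpha> v u"
  by (simp add: coup_def mult.commute)

text \<open>The identity is the equation tested with u itself. The bound on the critical integral
  involves only K and the Dirichlet energy, neither \<epsilon> nor the multiplier, so a small
  \<epsilon> in front of it will make the critical term negligible.\<close>

lemma system_solution:
  fixes u v :: "real^'n::finite \<Rightarrow> real"
  assumes N: "CARD('n) \<ge> 3" and ab: "\<alpha> > 1" "\<beta> > 1" and sub: "\<alpha> + \<beta> < crit TYPE('n)" and sup: "\<alpha> + \<beta> > 2 + 4 / real CARD('n)"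
    and u: "H1 u" and v: "v \<in> borel_measurable lebesgue" and P: "profile u F" "profile v G"
    and BF: "below_mu TYPE('n) M F" and BG: "below_mu TYPE('n) M G"
    and K: "\<And>r. r > 0 \<Longrightarrow> (F r)\<^sup>2 * r ^ (CARD('n) - 2) \<le> K"
    and e: "0 \<le> \<epsilon>" "\<epsilon> \<le> 1" and ws: "weak_sol lam u (sys_rhs \<epsilon> \<alpha> \<beta> u v)"
  shows "dirichlet u + lam * (\<integral>x. (u x)\<^sup>2 \<partial>lebesgue) = \<epsilon> * Lp_int (crit TYPE('n)) u + \<alpha> * coup \<alpha> \<beta> u v"
    and "Lp_int (crit TYPE('n)) u \<le> sph_area TYPE('n) * (K powr (2 / (real CARD('n) - 2)) * (2 / (real CARD('n) - 2) * (K + 2 / (real CARD('n) - 2) * (dirichlet u / sph_area TYPE('n)))))"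
proof -
  note M = below_muD(1)[OF BF] and F = below_muD(2,3)[OF BF] and G = below_muD(2,3)[OF BG]
  let ?c = "sph_area TYPE('n)"
  have um: "u \<in> borel_measurable lebesgue" using u by (simp add: H1_def)
  have uF: "AE x in lebesgue. u x = F (norm x)" and vG: "AE x in lebesgue. v x = G (norm x)" using P by (auto simp: profile_def)
  have Fc: "continuous_on {0<..} F" and Gc: "continuous_on {0<..} G" using P by (auto simp: profile_def)
  have Fm [measurable]: "F \<in> borel_measurable borel" and Gm [measurable]: "G \<in> borel_measurable borel" using P profile_borel by auto
  let ?fr = "profile_rhs TYPE('n) \<epsilon> \<alpha> \<beta> F G"
  have fr: "AE x in lebesgue. sys_rhs \<epsilon> \<alpha> \<beta> u v x = ?fr (norm x)"
    using uF vG by eventually_elim (use F G in \<open>auto intro!: sys_rhs_profile\<close>)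
  have frc: "continuous_on {0<..} ?fr" by (rule profile_rhs_continuous[OF N ab Fc _ Gc]) (use F G in auto)
  define C where "C = (M powr (crit TYPE('n) - 1) + \<alpha> * M powr (\<alpha> + \<beta> - 1)) + \<bar>lam\<bar> * M"
  have C: "\<bar>?fr r - lam * F r\<bar> \<le> C * dom0 TYPE('n) r" if r: "r > 0" for r
  proof -
    have "mu TYPE('n) r powr 1 \<le> dom0 TYPE('n) r" using crit_gt_2[OF N] by (intro mu_le_dom0 N r) auto
    then have "F r \<le> M * dom0 TYPE('n) r" using F(2)[OF r] M mu_pos[OF r, where 'n='n] by (auto intro: order_trans mult_left_mono)
    then have "\<bar>lam * F r\<bar> \<le> \<bar>lam\<bar> * (M * dom0 TYPE('n) r)" using F(1)[of r] by (simp add: abs_mult mult_left_mono)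
    moreover have "\<bar>?fr r\<bar> \<le> (M powr (crit TYPE('n) - 1) + \<alpha> * M powr (\<alpha> + \<beta> - 1)) * dom0 TYPE('n) r"
      by (rule profile_rhs_bound[OF N ab sub]) (use F G M r e in auto)
    ultimately show ?thesis unfolding C_def by (simp add: distrib_right)
  qed
  define F' where "F' = (\<lambda>r. - flux TYPE('n) (\<lambda>r. ?fr r - lam * F r) r / r ^ (CARD('n) - 1))"
  note S = solution_profile[OF N u P(1) _ sys_rhs_measurable[OF um v] fr frc profile_rhs_borel[OF Fm Gm] _ ws]
  have D: "(F has_real_derivative F' r) (at r)" if "r > 0" for r unfolding F'_def by (rule S(1)) (use that K C in auto)
  have F'c: "continuous_on {0<..} F'" unfolding F'_def by (rule S(2)) (use K C in auto)
  have iA: "integrable lborel (\<lambda>r. indicator {0<..} r * (r ^ (CARD('n) - 1) * (F' r)\<^sup>2))" unfolding F'_def by (rule S(4)) (use K C in auto)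
  have DA: "dirichlet u = ?c * (\<integral>r. indicator {0<..} r * (r ^ (CARD('n) - 1) * (F' r)\<^sup>2) \<partial>lborel)" unfolding F'_def by (rule S(5)) (use K C in auto)
  have cr: "integrable lborel (\<lambda>r. indicator {0<..} r * (r ^ (CARD('n) - 1) * \<bar>F r\<bar> powr crit TYPE('n)))"
    "(\<integral>r. indicator {0<..} r * (r ^ (CARD('n) - 1) * \<bar>F r\<bar> powr crit TYPE('n)) \<partial>lborel) \<le>
      K powr (2 / (real CARD('n) - 2)) * (2 / (real CARD('n) - 2) * (K + 2 / (real CARD('n) - 2) *
        (\<integral>r. indicator {0<..} r * (r ^ (CARD('n) - 1) * (F' r)\<^sup>2) \<partial>lborel)))"
    by (rule crit_integral_bound[where 'n='n, OF N _ F'c _ Fm iA]; use D K in auto)+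
  note cp = coup_profile[OF N ab sub sup um v P BF BG]
  have AEp: "AE x in lebesgue. \<bar>u x\<bar> powr crit TYPE('n) = \<bar>F (norm x)\<bar> powr crit TYPE('n)"
    using uF by eventually_elim simp
  have Lp: "Lp_int (crit TYPE('n)) u = ?c * (\<integral>r. indicator {0<..} r * (r ^ (CARD('n) - 1) * \<bar>F r\<bar> powr crit TYPE('n)) \<partial>lborel)"
    unfolding Lp_int_def by (rule radial_integral(2)[OF _ AEp]) (use um in auto)
  \<comment> \<open>Multiplying by F raises each exponent of F by one; thanks to
    \<open>powr_mult_self\<close> this also holds where F is zero.\<close>
  have ident: "indicator {0<..} r * (r ^ (CARD('n) - 1) * (?fr r * F r)) =
     \<epsilon> * (indicator {0<..} r * (r ^ (CARD('n) - 1) * \<bar>F r\<bar> powr crit TYPE('n))) + \<alpha> * (indicator {0<..} r * (r ^ (CARD('n) - 1) * (F r powr \<alpha> * G r powr \<beta>)))" for r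
  proof -
    have 1: "F r powr (crit TYPE('n) - 1) * F r = \<bar>F r\<bar> powr crit TYPE('n)" "F r powr (\<alpha> - 1) * F r = F r powr \<alpha>"
      using powr_mult_self[OF F(1)[of r], of "crit TYPE('n) - 1"] powr_mult_self[OF F(1)[of r], of "\<alpha> - 1"] F(1)[of r] by simp_all
    have "?fr r * F r = \<epsilon> * (F r powr (crit TYPE('n) - 1) * F r) + \<alpha> * ((F r powr (\<alpha> - 1) * F r) * G r powr \<beta>)"
      by (simp add: profile_rhs_def algebra_simps)
    then have "?fr r * F r = \<epsilon> * \<bar>F r\<bar> powr crit TYPE('n) + \<alpha> * (F r powr \<alpha> * G r powr \<beta>)"
      unfolding 1 .
    then show ?thesis by (simp add: distrib_left mult_ac)
  qed
  have i1: "integrable lborel (\<lambda>r. \<epsilon> * (indicator {0<..} r * (r ^ (CARD('n) - 1) * \<bar>F r\<bar> powr crit TYPE('n))))"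
    by (rule integrable_mult_right) (rule cr(1))
  have i2: "integrable lborel (\<lambda>r. \<alpha> * (indicator {0<..} r * (r ^ (CARD('n) - 1) * (F r powr \<alpha> * G r powr \<beta>))))"
    by (rule integrable_mult_right) (rule cp(1))
  have iB: "integrable lborel (\<lambda>r. indicator {0<..} r * (r ^ (CARD('n) - 1) * (?fr r * F r)))"
    unfolding ident by (rule Bochner_Integration.integrable_add[OF i1 i2])
  have "dirichlet u + lam * (\<integral>x. (u x)\<^sup>2 \<partial>lebesgue) = ?c * (\<integral>r. indicator {0<..} r * (r ^ (CARD('n) - 1) * (?fr r * F r)) \<partial>lborel)"
    by (rule S(6)) (use iB K C in auto)
  also have "\<dots> = \<epsilon> * Lp_int (crit TYPE('n)) u + \<alpha> * coup \<alpha> \<beta> u v"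
    unfolding ident Bochner_Integration.integral_add[OF i1 i2] integral_mult_right_zero Lp cp(2)
    by (simp only: distrib_left mult.left_commute[of ?c])
  finally show "dirichlet u + lam * (\<integral>x. (u x)\<^sup>2 \<partial>lebesgue) = \<epsilon> * Lp_int (crit TYPE('n)) u + \<alpha> * coup \<alpha> \<beta> u v" .
  show "Lp_int (crit TYPE('n)) u \<le> ?c * (K powr (2 / (real CARD('n) - 2)) * (2 / (real CARD('n) - 2) * (K + 2 / (real CARD('n) - 2) * (dirichlet u / ?c))))"
    unfolding Lp DA using cr(2) by (intro mult_left_mono) auto
qed

text \<open>The two Strauss constants of \<open>radial_H1_profile\<close>, added under the root so
  that one constant serves both regimes of \<open>mu\<close>.\<close>

definition profM :: "'n::finite itself \<Rightarrow> real \<Rightarrow> real \<Rightarrow> real" where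
  "profM _ A D = sqrt (2 / sph_area TYPE('n) * (A + D) + D / (sph_area TYPE('n) * (real CARD('n) - 2)))"

lemma radial_profile_uniform:
  fixes u :: "real^'n::finite \<Rightarrow> real"
  assumes N: "CARD('n) \<ge> 3" and u: "H1 u" and rad: "radial u" and pos: "\<And>x. u x > 0"
    and A: "(\<integral>x. (u x)\<^sup>2 \<partial>lebesgue) \<le> A" and D: "dirichlet u \<le> D"
  obtains F where "profile u F" "below_mu TYPE('n) (profM TYPE('n) A D) F"
    "\<And>r s. 0 < r \<Longrightarrow> r \<le> s \<Longrightarrow> (F s - F r)\<^sup>2 \<le> D / sph_area TYPE('n) * ((s - r) / r ^ (CARD('n) - 1))"
    "\<And>r. r > 0 \<Longrightarrow> (F r)\<^sup>2 * r ^ (CARD('n) - 2) \<le> D / (sph_area TYPE('n) * (real CARD('n) - 2))"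
proof -
  let ?c = "sph_area TYPE('n)" let ?M = "profM TYPE('n) A D"
  obtain F where F: "profile u F"
    "\<And>r s. 0 < r \<Longrightarrow> r \<le> s \<Longrightarrow> (F s - F r)\<^sup>2 \<le> dirichlet u / ?c * ((s - r) / r ^ (CARD('n) - 1))"
    "\<And>r. 0 < r \<Longrightarrow> (F r)\<^sup>2 * r ^ (CARD('n) - 1) \<le> 2 / ?c * ((\<integral>x. (u x)\<^sup>2 \<partial>lebesgue) + dirichlet u)"
    "\<And>r. 0 < r \<Longrightarrow> (F r)\<^sup>2 * r ^ (CARD('n) - 2) \<le> dirichlet u / (?c * (real CARD('n) - 2))"
    using radial_H1_profile[OF N u rad] by metis
  have c: "?c > 0" by simp
  have n2: "real CARD('n) - 2 > 0" using N by simp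
  have F0: "0 \<le> F r" for r by (rule profile_nonneg[OF F(1)]) (use pos less_imp_le in blast)
  have D0: "D \<ge> 0" using D dirichlet_nonneg[of u] by linarith
  have A0: "A \<ge> 0" using A by (rule order_trans[rotated]) simp
  have t2: "0 \<le> D / (?c * (real CARD('n) - 2))" using D0 c n2 by simp
  have t1: "0 \<le> 2 / ?c * (A + D)" using D0 A0 c by simp
  have M2: "?M\<^sup>2 = 2 / ?c * (A + D) + D / (?c * (real CARD('n) - 2))" unfolding profM_def using t1 t2 by simp
  have M0: "?M \<ge> 0" unfolding profM_def using t1 t2 by simp
  have b2: "(F r)\<^sup>2 * r ^ (CARD('n) - 2) \<le> D / (?c * (real CARD('n) - 2))" if "r > 0" for r
    by (rule order_trans[OF F(4)[OF that] divide_right_mono[OF D]]) (use n2 c in simp)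
  have b1: "(F r)\<^sup>2 * r ^ (CARD('n) - 1) \<le> 2 / ?c * (A + D)" if "r > 0" for r
    by (rule order_trans[OF F(3)[OF that] mult_left_mono]) (use A D c in auto)
  have "F r \<le> ?M * mu TYPE('n) r" if r: "r > 0" for r
  proof -
    have "\<bar>F r\<bar> \<le> ?M * mu TYPE('n) r"
    proof (rule bound_mu[OF N r M0])
      show "(F r)\<^sup>2 * r ^ (CARD('n) - 1) \<le> ?M\<^sup>2" unfolding M2 using b1[OF r] t2 by linarith
      show "(F r)\<^sup>2 * r ^ (CARD('n) - 2) \<le> ?M\<^sup>2" unfolding M2 using b2[OF r] t1 by linarith
    qed
    then show ?thesis by simp
  qed
  then have "below_mu TYPE('n) ?M F" using M0 F0 by (simp add: below_mu_def)
  moreover have "(F s - F r)\<^sup>2 \<le> D / ?c * ((s - r) / r ^ (CARD('n) - 1))" if "0 < r" "r \<le> s" for r s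
    by (rule order_trans[OF F(2)[OF that] mult_right_mono[OF divide_right_mono[OF D]]]) (use that c in auto)
  ultimately show ?thesis using that[OF F(1) _ _ b2] by blast
qed

text \<open>Equicontinuity: r is replaced by a nearby rational at a cost of e/3 that does not depend
  on n.\<close>

lemma convergent_from_rationals:
  fixes F :: "nat \<Rightarrow> real \<Rightarrow> real"
  assumes H: "\<And>n r s. 0 < r \<Longrightarrow> r \<le> s \<Longrightarrow> (F n s - F n r)\<^sup>2 \<le> H * ((s - r) / r ^ k)" and H0: "H \<ge> 0"
    and c: "\<And>q. q \<in> \<rat> \<Longrightarrow> q > 0 \<Longrightarrow> convergent (\<lambda>n. F n q)" and r: "r > 0"
  shows "convergent (\<lambda>n. F n r)"
proof (rule Cauchy_convergent, rule metric_CauchyI)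
  fix e :: real assume e: "e > 0"
  \<comment> \<open>The Hoelder bound over a distance \<delta> is then at most (e/3)^2; H + 1 avoids
    a division by 0.\<close>
  define \<delta> where "\<delta> = (e / 3)\<^sup>2 * r ^ k / (H + 1)"
  have \<delta>: "\<delta> > 0" using e r H0 by (simp add: \<delta>_def)
  obtain q where q: "q \<in> \<rat>" "r < q" "q < r + \<delta>" using Rats_dense_in_real[of r "r + \<delta>"] \<delta> by auto
  have close: "\<bar>F n q - F n r\<bar> \<le> e / 3" for n
  proof -
    have "(F n q - F n r)\<^sup>2 \<le> H * ((q - r) / r ^ k)" using H[OF r, of q n] q by simp
    also have "\<dots> \<le> (H + 1) * (\<delta> / r ^ k)" using q r H0 by (intro mult_mono divide_right_mono) auto
    also have "\<dots> = (e / 3)\<^sup>2" using H0 r by (simp add: \<delta>_def)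
    finally show ?thesis using e by (simp add: abs_le_square_iff[symmetric])
  qed
  have "Cauchy (\<lambda>n. F n q)" using c[of q] q r by (simp add: convergent_Cauchy)
  then obtain n0 where n0: "\<And>m n. m \<ge> n0 \<Longrightarrow> n \<ge> n0 \<Longrightarrow> dist (F m q) (F n q) < e / 3"
    using e by (metis metric_CauchyD zero_less_divide_iff zero_less_numeral)
  show "\<exists>M. \<forall>m\<ge>M. \<forall>n\<ge>M. dist (F m r) (F n r) < e"
  proof (intro exI allI impI)
    fix m n assume "n0 \<le> m" "n0 \<le> n"
    then have "\<bar>F m q - F n q\<bar> < e / 3" using n0 by (simp add: dist_real_def)
    then show "dist (F m r) (F n r) < e" using close[of m] close[of n] unfolding dist_real_def by linarith
  qed
qed

subsection \<open>Compactness of radial solutions\<close>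

lemma radial_subsequence:
  fixes F G :: "nat \<Rightarrow> real \<Rightarrow> real" and c :: "nat \<Rightarrow> nat \<Rightarrow> real"
  assumes HF: "\<And>n r s. 0 < r \<Longrightarrow> r \<le> s \<Longrightarrow> (F n s - F n r)\<^sup>2 \<le> H * ((s - r) / r ^ k)"
    and HG: "\<And>n r s. 0 < r \<Longrightarrow> r \<le> s \<Longrightarrow> (G n s - G n r)\<^sup>2 \<le> H * ((s - r) / r ^ k)" and H0: "H \<ge> 0"
    and BF: "\<And>n r. r > 0 \<Longrightarrow> \<bar>F n r\<bar> \<le> m r" and BG: "\<And>n r. r > 0 \<Longrightarrow> \<bar>G n r\<bar> \<le> m r"
    and c: "\<And>n j. \<bar>c n j\<bar> \<le> B"
  obtains \<phi> Fl Gl cl where "strict_mono (\<phi> :: nat \<Rightarrow> nat)"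
    "\<And>r. r > 0 \<Longrightarrow> (\<lambda>n. F (\<phi> n) r) \<longlonglongrightarrow> Fl r" "\<And>r. r > 0 \<Longrightarrow> (\<lambda>n. G (\<phi> n) r) \<longlonglongrightarrow> Gl r"
    "\<And>r. r \<le> 0 \<Longrightarrow> Fl r = 0" "\<And>r. r \<le> 0 \<Longrightarrow> Gl r = 0" "\<And>j. (\<lambda>n. c (\<phi> n) j) \<longlonglongrightarrow> cl j"
proof -
  \<comment> \<open>Two sequences of functions and countably many sequences of numbers are coded
    into one bounded family over a countable index set: second coordinate 0 stands for F, 1 for G,
    and j + 2 for the j-th number. Dividing by m + 1 makes the bound uniform; numbers ignore the
    first coordinate, which is later taken to be 1.\<close>
  define X where "X n p = (if snd p = 0 then F n (fst p) / (m (fst p) + 1) else if snd p = 1 then G n (fst p) / (m (fst p) + 1) else c n (snd p - 2))" for n :: nat and p :: "real \<times> nat"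
  let ?S = "(\<rat> \<inter> {0<..}) \<times> (UNIV :: nat set)"
  have m0: "m r \<ge> 0" if "r > 0" for r using BF[OF that, of 0] by (rule order_trans[rotated]) simp
  have q: "\<bar>x / (m r + 1)\<bar> \<le> 1" if "\<bar>x\<bar> \<le> m r" "r > 0" for x r
    using that m0[of r] by (simp add: abs_divide divide_le_eq)
  obtain \<phi> where \<phi>: "strict_mono \<phi>" "\<And>p. p \<in> ?S \<Longrightarrow> \<exists>l. (\<lambda>n. X (\<phi> n) p) \<longlonglongrightarrow> l"
  proof (rule function_convergent_subsequence[of ?S X "1 + \<bar>B\<bar>"])
    show "countable ?S" using countable_rat by (intro countable_SIGMA countable_Int1) auto
    show "norm (X n p) \<le> 1 + \<bar>B\<bar>" if "p \<in> ?S" for n p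
    proof -
      have p: "fst p > 0" using that by auto
      have "\<bar>X n p\<bar> \<le> 1 \<or> \<bar>X n p\<bar> \<le> B" unfolding X_def using q[OF BF p] q[OF BG p] p c by auto
      then show ?thesis by auto
    qed
  qed auto
  have cF: "convergent (\<lambda>n. F (\<phi> n) r)" if r: "r > 0" for r
  proof (rule convergent_from_rationals[of "\<lambda>n. F (\<phi> n)", OF HF H0 _ r])
    fix q :: real assume q: "q \<in> \<rat>" "q > 0"
    obtain l where "(\<lambda>n. F (\<phi> n) q / (m q + 1)) \<longlonglongrightarrow> l" using \<phi>(2)[of "(q, 0)"] q by (auto simp: X_def)
    then have "(\<lambda>n. F (\<phi> n) q / (m q + 1) * (m q + 1)) \<longlonglongrightarrow> l * (m q + 1)" by (intro tendsto_intros)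
    then show "convergent (\<lambda>n. F (\<phi> n) q)" using m0[OF q(2)] by (auto simp: convergent_def)
  qed
  have cG: "convergent (\<lambda>n. G (\<phi> n) r)" if r: "r > 0" for r
  proof (rule convergent_from_rationals[of "\<lambda>n. G (\<phi> n)", OF HG H0 _ r])
    fix q :: real assume q: "q \<in> \<rat>" "q > 0"
    obtain l where "(\<lambda>n. G (\<phi> n) q / (m q + 1)) \<longlonglongrightarrow> l" using \<phi>(2)[of "(q, 1)"] q by (auto simp: X_def)
    then have "(\<lambda>n. G (\<phi> n) q / (m q + 1) * (m q + 1)) \<longlonglongrightarrow> l * (m q + 1)" by (intro tendsto_intros)
    then show "convergent (\<lambda>n. G (\<phi> n) q)" using m0[OF q(2)] by (auto simp: convergent_def)
  qed
  have cc: "convergent (\<lambda>n. c (\<phi> n) j)" for j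
  proof -
    obtain l where "(\<lambda>n. X (\<phi> n) (1, j + 2)) \<longlonglongrightarrow> l" using \<phi>(2)[of "(1, j + 2)"] by auto
    then show ?thesis by (auto simp: X_def convergent_def)
  qed
  show thesis
  proof (rule that[of \<phi> "\<lambda>r. if r > 0 then lim (\<lambda>n. F (\<phi> n) r) else 0" "\<lambda>r. if r > 0 then lim (\<lambda>n. G (\<phi> n) r) else 0" "\<lambda>j. lim (\<lambda>n. c (\<phi> n) j)"])
  qed (use \<phi>(1) cF cG cc in \<open>auto simp: convergent_LIMSEQ_iff\<close>)
qed

lemma below_mu_limit:
  assumes B: "\<And>n. below_mu TYPE('n::finite) M (F n)" and lim: "\<And>r. r > 0 \<Longrightarrow> (\<lambda>n. F n r) \<longlonglongrightarrow> Fl r" and 0: "\<And>r. r \<le> 0 \<Longrightarrow> Fl r = 0"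
  shows "below_mu TYPE('n) M Fl"
  unfolding below_mu_def
proof (intro conjI allI impI)
  show "M \<ge> 0" using below_muD(1)[OF B] .
  show "0 \<le> Fl r" for r
    using LIMSEQ_le_const[OF lim, of r 0] below_muD(2)[OF B] 0[of r] by (cases "r > 0") auto
  show "Fl r \<le> M * mu TYPE('n) r" if "r > 0" for r
    using LIMSEQ_le_const2[OF lim[OF that]] below_muD(3)[OF B that] by blast
qed

lemma Lp_int_nonneg: "0 \<le> Lp_int p u"
  unfolding Lp_int_def by (rule Bochner_Integration.integral_nonneg) simp

lemma below_mu_dom0:
  assumes N: "CARD('n::finite) \<ge> 3" and B: "below_mu TYPE('n) M F" and r: "r > 0"
  shows "\<bar>F r\<bar> \<le> M * dom0 TYPE('n) r"
proof -
  have "mu TYPE('n) r powr 1 \<le> dom0 TYPE('n) r" using crit_gt_2[OF N] by (intro mu_le_dom0 N r) auto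
  then have "mu TYPE('n) r \<le> dom0 TYPE('n) r" using mu_pos[OF r, where 'n='n] by simp
  from mult_left_mono[OF this below_muD(1)[OF B]] show ?thesis using below_muD(2,3)[OF B, of r] r by linarith
qed

text \<open>The critical integrals stay bounded because the Dirichlet energies converge.\<close>

lemma critical_term_vanishes:
  fixes U V :: "nat \<Rightarrow> real^'n::finite \<Rightarrow> real"
  assumes N: "CARD('n) \<ge> 3" and ab: "\<alpha> > 1" "\<beta> > 1" and sub: "\<alpha> + \<beta> < crit TYPE('n)" and sup: "\<alpha> + \<beta> > 2 + 4 / real CARD('n)"
    and U: "\<And>n. H1 (U n)" and V: "\<And>n. V n \<in> borel_measurable lebesgue" and P: "\<And>n. profile (U n) (F n)" "\<And>n. profile (V n) (G n)"
    and B: "\<And>n. below_mu TYPE('n) M (F n)" "\<And>n. below_mu TYPE('n) M (G n)"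
    and K: "\<And>n r. r > 0 \<Longrightarrow> (F n r)\<^sup>2 * r ^ (CARD('n) - 2) \<le> K"
    and e: "\<And>n. 0 \<le> \<epsilon> n" "\<And>n. \<epsilon> n \<le> 1" "\<epsilon> \<longlonglongrightarrow> 0" and ws: "\<And>n. weak_sol (L n) (U n) (sys_rhs (\<epsilon> n) \<alpha> \<beta> (U n) (V n))"
    and d: "(\<lambda>n. dirichlet (U n)) \<longlonglongrightarrow> d"
  shows "(\<lambda>n. \<epsilon> n * Lp_int (crit TYPE('n)) (U n)) \<longlonglongrightarrow> 0"
proof (rule tendsto_sandwich[OF _ _ tendsto_const])
  let ?b = "\<lambda>d. sph_area TYPE('n) * (K powr (2 / (real CARD('n) - 2)) * (2 / (real CARD('n) - 2) * (K + 2 / (real CARD('n) - 2) * (d / sph_area TYPE('n)))))"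
  have "Lp_int (crit TYPE('n)) (U n) \<le> ?b (dirichlet (U n))" for n
    by (rule system_solution(2)[OF N ab sub sup U V P B _ e(1,2) ws]) (use K in auto)
  then show "\<forall>\<^sub>F n in sequentially. \<epsilon> n * Lp_int (crit TYPE('n)) (U n) \<le> \<epsilon> n * ?b (dirichlet (U n))"
    by (intro always_eventually allI mult_left_mono e(1))
  have "(\<lambda>n. \<epsilon> n * ?b (dirichlet (U n))) \<longlonglongrightarrow> 0 * ?b d" by (intro tendsto_intros e(3) d) simp
  then show "(\<lambda>n. \<epsilon> n * ?b (dirichlet (U n))) \<longlonglongrightarrow> 0" by simp
qed (use e(1) in \<open>simp add: Lp_int_nonneg\<close>)

text \<open>The energy identities force equality in both Fatou inequalities because the limit multiplier is positive.\<close>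

lemma component_limit:
  fixes U V :: "nat \<Rightarrow> real^'n::finite \<Rightarrow> real"
  assumes N: "CARD('n) = 3 \<or> CARD('n) = 4" and ab: "\<alpha> > 1" "\<beta> > 1" and sub: "\<alpha> + \<beta> < crit TYPE('n)" and sup: "\<alpha> + \<beta> > 2 + 4 / real CARD('n)"
    and U: "\<And>n. H1 (U n)" and V: "\<And>n. V n \<in> borel_measurable lebesgue" and P: "\<And>n. profile (U n) (F n)" "\<And>n. profile (V n) (G n)"
    and B: "\<And>n. below_mu TYPE('n) M (F n)" "\<And>n. below_mu TYPE('n) M (G n)"
    and H: "\<And>n r s. 0 < r \<Longrightarrow> r \<le> s \<Longrightarrow> (F n s - F n r)\<^sup>2 \<le> H * ((s - r) / r ^ (CARD('n) - 1))"
      "\<And>n r s. 0 < r \<Longrightarrow> r \<le> s \<Longrightarrow> (G n s - G n r)\<^sup>2 \<le> H * ((s - r) / r ^ (CARD('n) - 1))" and H0: "H \<ge> 0"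
    and K: "\<And>n r. r > 0 \<Longrightarrow> (F n r)\<^sup>2 * r ^ (CARD('n) - 2) \<le> K"
    and e: "\<And>n. 0 \<le> \<epsilon> n" "\<And>n. \<epsilon> n \<le> 1" "\<epsilon> \<longlonglongrightarrow> 0" and ws: "\<And>n. weak_sol (L n) (U n) (sys_rhs (\<epsilon> n) \<alpha> \<beta> (U n) (V n))"
    and L: "L \<longlonglongrightarrow> l" "\<And>n. L n > 0" and d: "(\<lambda>n. dirichlet (U n)) \<longlonglongrightarrow> d"
    and A: "\<And>n. (\<integral>x. (U n x)\<^sup>2 \<partial>lebesgue) = A"
    and lim: "\<And>r. r > 0 \<Longrightarrow> (\<lambda>n. F n r) \<longlonglongrightarrow> Fl r" "\<And>r. r > 0 \<Longrightarrow> (\<lambda>n. G n r) \<longlonglongrightarrow> Gl r"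
    and 0: "\<And>r. r \<le> 0 \<Longrightarrow> Fl r = 0" "\<And>r. r \<le> 0 \<Longrightarrow> Gl r = 0"
    and ud: "u = (\<lambda>x. Fl (norm x))" and vd: "v = (\<lambda>x. Gl (norm x))"
    and cp: "coup \<alpha> \<beta> u v \<noteq> 0" "(\<lambda>n. coup \<alpha> \<beta> (U n) (V n)) \<longlonglongrightarrow> coup \<alpha> \<beta> u v"
  shows "H1 u" "l > 0" "weak_sol l u (sys_rhs 0 \<alpha> \<beta> u v)" "(\<integral>x. (u x)\<^sup>2 \<partial>lebesgue) = A" "dirichlet u = d"
    "(\<lambda>n. (H1norm (\<lambda>x. U n x - u x))\<^sup>2) \<longlonglongrightarrow> 0"
proof -
  have N3: "CARD('n) \<ge> 3" using N by auto
  have BFl: "below_mu TYPE('n) M Fl" by (rule below_mu_limit[OF B(1) lim(1) 0(1)])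
  have BGl: "below_mu TYPE('n) M Gl" by (rule below_mu_limit[OF B(2) lim(2) 0(2)])
  have Glc: "continuous_on {0<..} Gl" by (rule holder_limit_continuous[OF H(2) H0 lim(2)])
  have Flc: "continuous_on {0<..} Fl" by (rule holder_limit_continuous[OF H(1) H0 lim(1)])
  have Glm [measurable]: "Gl \<in> borel_measurable borel" by (rule borel_measurable_pos_continuous[OF Glc 0(2)])
  have Flm [measurable]: "Fl \<in> borel_measurable borel" by (rule borel_measurable_pos_continuous[OF Flc 0(1)])
  have vm: "v \<in> borel_measurable lebesgue" unfolding vd by (intro measurable_completion) simp
  have um: "U n \<in> borel_measurable lebesgue" for n using U[of n] by (simp add: H1_def)
  have Fm: "F n \<in> borel_measurable borel" "G n \<in> borel_measurable borel" for n using P profile_borel by auto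
  have Pv: "profile v Gl" using Glc 0(2) by (simp add: profile_def vd)
  obtain Lb where Lb: "\<And>n. \<bar>L n\<bar> \<le> Lb" using convergent_imp_Bseq[of L] L(1) by (auto simp: convergent_def Bseq_def)
  \<comment> \<open>C1 bounds the nonlinearity and Lb times M the multiplier term, both as multiples
    of \<open>dom0\<close>.\<close>
  define C1 where "C1 = M powr (crit TYPE('n) - 1) + \<alpha> * M powr (\<alpha> + \<beta> - 1)"
  have M0: "M \<ge> 0" by (rule below_muD(1)[OF BFl])
  have Lb0: "Lb \<ge> 0" using Lb[of 0] by linarith
  have nb: "\<bar>profile_rhs TYPE('n) (\<epsilon> n) \<alpha> \<beta> (F n) (G n) r\<bar> \<le> C1 * dom0 TYPE('n) r" if "r > 0" for n r
    unfolding C1_def by (rule profile_rhs_bound[OF N3 ab sub]) (use below_muD[OF B(1)] below_muD[OF B(2)] that e in auto)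
  have fb: "\<bar>F n r\<bar> \<le> M * dom0 TYPE('n) r" if "r > 0" for n r by (rule below_mu_dom0[OF N3 B(1) that])
  have dp: "dom0 TYPE('n) r > 0" for r by (rule dom0_pos)
  interpret R: radial_sequence U "\<lambda>n. sys_rhs (\<epsilon> n) \<alpha> \<beta> (U n) (V n)" F "\<lambda>n. profile_rhs TYPE('n) (\<epsilon> n) \<alpha> \<beta> (F n) (G n)" L Fl "profile_rhs TYPE('n) 0 \<alpha> \<beta> Fl Gl" l A d M "C1 + Lb * M" H K
  proof
    show "3 \<le> CARD('n)" by (rule N3)
    fix n
    show "H1 (U n)" "profile (U n) (F n)" by (rule U P)+
    show "sys_rhs (\<epsilon> n) \<alpha> \<beta> (U n) (V n) \<in> borel_measurable lebesgue" by (rule sys_rhs_measurable[OF um V])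
    have "AE x in lebesgue. U n x = F n (norm x)" "AE x in lebesgue. V n x = G n (norm x)" using P by (auto simp: profile_def)
    then show "AE x in lebesgue. sys_rhs (\<epsilon> n) \<alpha> \<beta> (U n) (V n) x = profile_rhs TYPE('n) (\<epsilon> n) \<alpha> \<beta> (F n) (G n) (norm x)"
      by eventually_elim (use below_muD[OF B(1)] below_muD[OF B(2)] in \<open>auto intro!: sys_rhs_profile\<close>)
    show "continuous_on {0<..} (profile_rhs TYPE('n) (\<epsilon> n) \<alpha> \<beta> (F n) (G n))"
      by (rule profile_rhs_continuous[OF N3 ab]) (use P below_muD[OF B(1)] below_muD[OF B(2)] in \<open>auto simp: profile_def\<close>)
    show "profile_rhs TYPE('n) (\<epsilon> n) \<alpha> \<beta> (F n) (G n) \<in> borel_measurable borel" by (rule profile_rhs_borel[OF Fm])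
    show "profile_rhs TYPE('n) 0 \<alpha> \<beta> Fl Gl \<in> borel_measurable borel" by (rule profile_rhs_borel[OF Flm Glm])
    show "weak_sol (L n) (U n) (sys_rhs (\<epsilon> n) \<alpha> \<beta> (U n) (V n))" by (rule ws)
    show "(\<integral>x. (U n x)\<^sup>2 \<partial>lebesgue) = A" by (rule A)
    show "continuous_on {0<..} (profile_rhs TYPE('n) 0 \<alpha> \<beta> Fl Gl)"
      by (rule profile_rhs_continuous[OF N3 ab Flc _ Glc]) (use below_muD[OF BFl] below_muD[OF BGl] in auto)
    fix r :: real assume r: "r > 0"
    have "\<bar>L n * F n r\<bar> \<le> Lb * (M * dom0 TYPE('n) r)"
      unfolding abs_mult using Lb[of n] fb[OF r, of n] Lb0 by (intro mult_mono) auto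
    then show "\<bar>profile_rhs TYPE('n) (\<epsilon> n) \<alpha> \<beta> (F n) (G n) r - L n * F n r\<bar> \<le> (C1 + Lb * M) * dom0 TYPE('n) r"
      using nb[OF r, of n] by (simp add: distrib_right)
    have "0 \<le> Lb * M * dom0 TYPE('n) r" using Lb0 M0 dp[of r] by (intro mult_nonneg_nonneg) auto
    then show "\<bar>profile_rhs TYPE('n) (\<epsilon> n) \<alpha> \<beta> (F n) (G n) r\<bar> \<le> (C1 + Lb * M) * dom0 TYPE('n) r"
      using nb[OF r, of n] unfolding distrib_right by linarith
    show "\<bar>F n r\<bar> \<le> M * dom0 TYPE('n) r" by (rule fb[OF r])
    show "(\<lambda>n. profile_rhs TYPE('n) (\<epsilon> n) \<alpha> \<beta> (F n) (G n) r) \<longlonglongrightarrow> profile_rhs TYPE('n) 0 \<alpha> \<beta> Fl Gl r"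
      by (rule profile_rhs_tendsto[OF N3 ab]) (use lim r e below_muD[OF B(1)] below_muD[OF B(2)] in auto)
  qed (use K H H0 lim L(1) d 0 in auto)
  have u: "u = R.ul" by (simp add: ud R.ul_def[abs_def])
  show H1u: "H1 u" unfolding u by (rule R.H1_ul)
  have Pu: "profile u Fl" unfolding u by (rule R.profile_ul)
  have um': "u \<in> borel_measurable lebesgue" using H1u by (simp add: H1_def)
  have "(\<lambda>x. profile_rhs TYPE('n) 0 \<alpha> \<beta> Fl Gl (norm x)) = sys_rhs 0 \<alpha> \<beta> u v"
    by (rule ext) (use below_muD[OF BFl] below_muD[OF BGl] in \<open>auto simp: ud vd intro!: sys_rhs_profile[symmetric]\<close>)
  then show wsl: "weak_sol l u (sys_rhs 0 \<alpha> \<beta> u v)" using R.weak_sol_ul unfolding u by simp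
  have en: "dirichlet (U n) + L n * A = \<epsilon> n * Lp_int (crit TYPE('n)) (U n) + \<alpha> * coup \<alpha> \<beta> (U n) (V n)" for n
    unfolding A[of n, symmetric] by (rule system_solution(1)[OF N3 ab sub sup U V P B _ e(1,2) ws]) (use K in auto)
  have e0: "dirichlet u + l * (\<integral>x. (u x)\<^sup>2 \<partial>lebesgue) = 0 * Lp_int (crit TYPE('n)) u + \<alpha> * coup \<alpha> \<beta> u v"
    by (rule system_solution(1)[OF N3 ab sub sup H1u vm Pu Pv BFl BGl _ _ _ wsl]) (use R.Kl in auto)
  have "(\<lambda>n. dirichlet (U n) + L n * A) \<longlonglongrightarrow> d + l * A" by (intro tendsto_intros d L)
  moreover have "(\<lambda>n. dirichlet (U n) + L n * A) \<longlonglongrightarrow> 0 + \<alpha> * coup \<alpha> \<beta> u v"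
    unfolding en by (intro tendsto_intros cp critical_term_vanishes[OF N3 ab sub sup U V P B K e ws d])
  ultimately have e1: "d + l * A = \<alpha> * coup \<alpha> \<beta> u v" using LIMSEQ_unique by fastforce
  have l0: "l \<ge> 0" by (rule LIMSEQ_le_const[OF L(1)]) (use L(2) less_imp_le in auto)
  \<comment> \<open>For l = 0 the limit would be superharmonic; \<open>liouville_radial\<close> then
    makes its right-hand side vanish, and with it the coupling integral, contrary to
    \<open>cp\<close>.\<close>
  have "l \<noteq> 0"
  proof
    assume l: "l = 0"
    have wl: "R.wl r = profile_rhs TYPE('n) 0 \<alpha> \<beta> Fl Gl r" for r unfolding R.wl_def using l by simp
    have z: "R.wl r = 0" if r: "r > 0" for r
    proof (rule liouville_radial[where 'n='n and F=Fl and C="C1 + Lb * M", OF N _ R.wc R.wm(2) _ _ _ _ r])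
      show "0 \<le> R.wl r" for r unfolding wl profile_rhs_def using ab by simp
      show "0 \<le> Fl r" for r using below_muD(2)[OF BFl] .
      show "(Fl has_real_derivative - flux TYPE('n) R.wl r / r ^ (CARD('n) - 1)) (at r)" if "r > 0" for r
        using R.FlD[OF that] by (simp add: R.Fl'_def)
      have "AE x in lebesgue. (u x)\<^sup>2 = (Fl (norm x))\<^sup>2" by (simp add: ud)
      then show "integrable lborel (\<lambda>r. indicator {0<..} r * (r ^ (CARD('n) - 1) * (Fl r)\<^sup>2))"
        using radial_integral(1)[of "\<lambda>r. (Fl r)\<^sup>2" "\<lambda>x. (u x)\<^sup>2"] R.ul2(1) um' unfolding u[symmetric] by simp
    qed (use R.wlC in auto)
    have zero: "indicator {0<..} r * (r ^ (CARD('n) - 1) * (Fl r powr \<alpha> * Gl r powr \<beta>)) = 0" for r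
    proof (cases "r > 0")
      case True
      then have "Fl r powr (\<alpha> - 1) * Gl r powr \<beta> = 0" using z[OF True, unfolded wl] ab by (simp add: profile_rhs_def)
      then show ?thesis by auto
    qed simp
    have "coup \<alpha> \<beta> u v = 0"
      unfolding coup_profile(2)[OF N3 ab sub sup um' vm Pu Pv BFl BGl] by (simp only: zero Bochner_Integration.integral_zero mult_zero_right)
    then show False using cp by simp
  qed
  then show l: "l > 0" using l0 by simp
  have le: "dirichlet u \<le> d" "(\<integral>x. (u x)\<^sup>2 \<partial>lebesgue) \<le> A" unfolding u by (rule R.dirichlet_ul R.ul2)+
  have "l * (\<integral>x. (u x)\<^sup>2 \<partial>lebesgue) = l * A" "dirichlet u = d"
    using e0 e1 le mult_left_mono[OF le(2) l0] by linarith+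
  then show m: "(\<integral>x. (u x)\<^sup>2 \<partial>lebesgue) = A" and D: "dirichlet u = d" using l by auto
  show "(\<lambda>n. (H1norm (\<lambda>x. U n x - u x))\<^sup>2) \<longlonglongrightarrow> 0"
    unfolding u by (rule R.strong_convergence) (use m D u in auto)
qed


lemma Tset_mass:
  assumes "(u, v) \<in> Tset a b"
  shows "H1 u" "H1 v" "(\<integral>x. (u x)\<^sup>2 \<partial>lebesgue) = a\<^sup>2" "(\<integral>x. (v x)\<^sup>2 \<partial>lebesgue) = b\<^sup>2"
  using assms by (auto simp: Tset_def L2norm_def real_sqrt_unique)

text \<open>Drop the Dirichlet energy from the energy identity; the critical and coupling terms are
  bounded through M, K and D. B is chosen before the functions, hence serves a whole
  sequence.\<close>

lemma multiplier_bound: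
  fixes u v :: "real^'n::finite \<Rightarrow> real"
  assumes N: "CARD('n) \<ge> 3" and ab: "\<alpha> > 1" "\<beta> > 1" and sub: "\<alpha> + \<beta> < crit TYPE('n)" and sup: "\<alpha> + \<beta> > 2 + 4 / real CARD('n)"
  obtains B where "\<And>(u::real^'n \<Rightarrow> real) v F G \<epsilon> l. H1 u \<Longrightarrow> v \<in> borel_measurable lebesgue \<Longrightarrow> profile u F \<Longrightarrow> profile v G \<Longrightarrow>
    below_mu TYPE('n) M F \<Longrightarrow> below_mu TYPE('n) M G \<Longrightarrow> (\<And>r. r > 0 \<Longrightarrow> (F r)\<^sup>2 * r ^ (CARD('n) - 2) \<le> K) \<Longrightarrow>
    0 \<le> \<epsilon> \<Longrightarrow> \<epsilon> \<le> 1 \<Longrightarrow> dirichlet u \<le> D \<Longrightarrow> weak_sol l u (sys_rhs \<epsilon> \<alpha> \<beta> u v) \<Longrightarrow> l * (\<integral>x. (u x)\<^sup>2 \<partial>lebesgue) \<le> B"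
proof -
  let ?b = "\<lambda>d. sph_area TYPE('n) * (K powr (2 / (real CARD('n) - 2)) * (2 / (real CARD('n) - 2) * (K + 2 / (real CARD('n) - 2) * (d / sph_area TYPE('n)))))"
  let ?c = "sph_area TYPE('n) * (M powr (\<alpha> + \<beta>) * (\<integral>r. indicator {0<..} r * (r ^ (CARD('n) - 1) * mu TYPE('n) r powr (\<alpha> + \<beta>)) \<partial>lborel))"
  have n2: "real CARD('n) - 2 > 0" using N by simp
  show thesis
  proof (rule that[of "?b D + \<alpha> * ?c"])
    fix u v :: "real^'n \<Rightarrow> real" and F G :: "real \<Rightarrow> real" and \<epsilon> l :: real
    assume u: "H1 u" and v: "v \<in> borel_measurable lebesgue" and P: "profile u F" "profile v G"
      and B: "below_mu TYPE('n) M F" "below_mu TYPE('n) M G" and K: "\<And>r. r > 0 \<Longrightarrow> (F r)\<^sup>2 * r ^ (CARD('n) - 2) \<le> K"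
      and e: "0 \<le> \<epsilon>" "\<epsilon> \<le> 1" and D: "dirichlet u \<le> D" and ws: "weak_sol l u (sys_rhs \<epsilon> \<alpha> \<beta> u v)"
    have um: "u \<in> borel_measurable lebesgue" using u by (simp add: H1_def)
    have 1: "dirichlet u + l * (\<integral>x. (u x)\<^sup>2 \<partial>lebesgue) = \<epsilon> * Lp_int (crit TYPE('n)) u + \<alpha> * coup \<alpha> \<beta> u v"
      by (rule system_solution(1)[OF N ab sub sup u v P B _ e ws]) (rule K)
    have "Lp_int (crit TYPE('n)) u \<le> ?b (dirichlet u)"
      by (rule system_solution(2)[OF N ab sub sup u v P B _ e ws]) (rule K)
    also have "\<dots> \<le> ?b D" using D n2 by (intro mult_left_mono add_left_mono divide_right_mono) (auto simp: less_imp_le)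
    finally have 2: "Lp_int (crit TYPE('n)) u \<le> ?b D" .
    have "\<epsilon> * Lp_int (crit TYPE('n)) u \<le> 1 * ?b D" using e 2 Lp_int_nonneg[of "crit TYPE('n)" u] by (intro mult_mono) auto
    moreover have "\<alpha> * coup \<alpha> \<beta> u v \<le> \<alpha> * ?c" using coup_bound[OF N ab sub sup um v P B] ab by (intro mult_left_mono) auto
    ultimately show "l * (\<integral>x. (u x)\<^sup>2 \<partial>lebesgue) \<le> ?b D + \<alpha> * ?c" using 1 dirichlet_nonneg[of u] by linarith
  qed
qed

text \<open>Vanishing is excluded here: the critical term disappears in the limit of the Pohozaev
  identity, so d0 <= g times the limit coupling integral. Then \<open>component_limit\<close>
  applies to both components, to the second with \<alpha> and \<beta> exchanged.\<close>

lemma radial_system_compact: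
  fixes U V :: "nat \<Rightarrow> real^'n::finite \<Rightarrow> real"
  assumes N: "CARD('n) = 3 \<or> CARD('n) = 4" and ab: "\<alpha> > 1" "\<beta> > 1" and sub: "\<alpha> + \<beta> < crit TYPE('n)" and sup: "\<alpha> + \<beta> > 2 + 4 / real CARD('n)"
    and ab0: "a > 0" "b > 0" and T: "\<And>n. (U n, V n) \<in> Tset a b"
    and rad: "\<And>n. radial (U n)" "\<And>n. radial (V n)" and pos: "\<And>n x. U n x > 0" "\<And>n x. V n x > 0"
    and L: "\<And>n. L1 n > 0" "\<And>n. L2 n > 0" and e: "\<And>n. 0 \<le> \<epsilon> n" "\<And>n. \<epsilon> n \<le> 1" "\<epsilon> \<longlonglongrightarrow> 0"
    and ws: "\<And>n. weak_sol (L1 n) (U n) (sys_rhs (\<epsilon> n) \<alpha> \<beta> (U n) (V n))" "\<And>n. weak_sol (L2 n) (V n) (sys_rhs (\<epsilon> n) \<beta> \<alpha> (V n) (U n))"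
    and Dm: "\<And>n. dirichlet (U n) + dirichlet (V n) \<le> Dm"
    and poh: "\<And>n. dirichlet (U n) + dirichlet (V n) = \<epsilon> n * (Lp_int (crit TYPE('n)) (U n) + Lp_int (crit TYPE('n)) (V n)) + g * coup \<alpha> \<beta> (U n) (V n)"
    and d0: "d0 > 0" "\<And>n. d0 \<le> dirichlet (U n) + dirichlet (V n)"
  obtains \<phi> u v l1 l2 where "strict_mono (\<phi> :: nat \<Rightarrow> nat)" "(u, v) \<in> Tset a b" "l1 > 0" "l2 > 0"
    "weak_sol l1 u (sys_rhs 0 \<alpha> \<beta> u v)" "weak_sol l2 v (sys_rhs 0 \<beta> \<alpha> v u)"
    "(\<lambda>n. dirichlet (U (\<phi> n)) + dirichlet (V (\<phi> n))) \<longlonglongrightarrow> dirichlet u + dirichlet v"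
    "(\<lambda>n. coup \<alpha> \<beta> (U (\<phi> n)) (V (\<phi> n))) \<longlonglongrightarrow> coup \<alpha> \<beta> u v"
    "(\<lambda>n. \<epsilon> (\<phi> n) * (Lp_int (crit TYPE('n)) (U (\<phi> n)) + Lp_int (crit TYPE('n)) (V (\<phi> n)))) \<longlonglongrightarrow> 0"
    "(\<lambda>n. Hdist (U (\<phi> n), V (\<phi> n)) (u, v)) \<longlonglongrightarrow> 0"
proof -
  have N3: "CARD('n) \<ge> 3" using N by auto
  have sub': "\<beta> + \<alpha> < crit TYPE('n)" and sup': "\<beta> + \<alpha> > 2 + 4 / real CARD('n)" using sub sup by auto
  note H1U = Tset_mass(1)[OF T] and H1V = Tset_mass(2)[OF T] and mU = Tset_mass(3)[OF T] and mV = Tset_mass(4)[OF T]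
  have Um: "U n \<in> borel_measurable lebesgue" and Vm: "V n \<in> borel_measurable lebesgue" for n
    using H1U[of n] H1V[of n] by (auto simp: H1_def)
  let ?A = "a\<^sup>2 + b\<^sup>2"
  define M where "M = profM TYPE('n) ?A Dm"
  define H where "H = Dm / sph_area TYPE('n)"
  define K where "K = Dm / (sph_area TYPE('n) * (real CARD('n) - 2))"
  have DU: "dirichlet (U n) \<le> Dm" and DV: "dirichlet (V n) \<le> Dm" for n
    using Dm[of n] dirichlet_nonneg[of "U n"] dirichlet_nonneg[of "V n"] by linarith+
  have Dm0: "Dm \<ge> 0" using DU[of 0] dirichlet_nonneg[of "U 0"] by linarith
  have H0: "H \<ge> 0" using Dm0 by (simp add: H_def)
  have "\<exists>F. profile (U n) F \<and> below_mu TYPE('n) M F \<and>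
      (\<forall>r s. 0 < r \<longrightarrow> r \<le> s \<longrightarrow> (F s - F r)\<^sup>2 \<le> H * ((s - r) / r ^ (CARD('n) - 1))) \<and> (\<forall>r>0. (F r)\<^sup>2 * r ^ (CARD('n) - 2) \<le> K)" for n
    by (rule radial_profile_uniform[OF N3 H1U[of n] rad(1) pos(1) _ DU, of ?A]) (use mU in \<open>auto simp: M_def H_def K_def\<close>)
  then obtain F where F: "\<And>n. profile (U n) (F n)" "\<And>n. below_mu TYPE('n) M (F n)"
      "\<And>n r s. 0 < r \<Longrightarrow> r \<le> s \<Longrightarrow> (F n s - F n r)\<^sup>2 \<le> H * ((s - r) / r ^ (CARD('n) - 1))" "\<And>n r. r > 0 \<Longrightarrow> (F n r)\<^sup>2 * r ^ (CARD('n) - 2) \<le> K"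
    by metis
  have "\<exists>F. profile (V n) F \<and> below_mu TYPE('n) M F \<and>
      (\<forall>r s. 0 < r \<longrightarrow> r \<le> s \<longrightarrow> (F s - F r)\<^sup>2 \<le> H * ((s - r) / r ^ (CARD('n) - 1))) \<and> (\<forall>r>0. (F r)\<^sup>2 * r ^ (CARD('n) - 2) \<le> K)" for n
    by (rule radial_profile_uniform[OF N3 H1V[of n] rad(2) pos(2) _ DV, of ?A]) (use mV in \<open>auto simp: M_def H_def K_def\<close>)
  then obtain G where G: "\<And>n. profile (V n) (G n)" "\<And>n. below_mu TYPE('n) M (G n)"
      "\<And>n r s. 0 < r \<Longrightarrow> r \<le> s \<Longrightarrow> (G n s - G n r)\<^sup>2 \<le> H * ((s - r) / r ^ (CARD('n) - 1))" "\<And>n r. r > 0 \<Longrightarrow> (G n r)\<^sup>2 * r ^ (CARD('n) - 2) \<le> K"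
    by metis
  obtain B1 where B1: "\<And>n. L1 n * a\<^sup>2 \<le> B1"
  proof (rule multiplier_bound[OF N3 ab sub sup, where M=M and K=K and D=Dm])
    fix B assume "\<And>(u::real^'n \<Rightarrow> real) v F G \<epsilon> l. H1 u \<Longrightarrow> v \<in> borel_measurable lebesgue \<Longrightarrow> profile u F \<Longrightarrow> profile v G \<Longrightarrow>
      below_mu TYPE('n) M F \<Longrightarrow> below_mu TYPE('n) M G \<Longrightarrow> (\<And>r. r > 0 \<Longrightarrow> (F r)\<^sup>2 * r ^ (CARD('n) - 2) \<le> K) \<Longrightarrow>
      0 \<le> \<epsilon> \<Longrightarrow> \<epsilon> \<le> 1 \<Longrightarrow> dirichlet u \<le> Dm \<Longrightarrow> weak_sol l u (sys_rhs \<epsilon> \<alpha> \<beta> u v) \<Longrightarrow> l * (\<integral>x. (u x)\<^sup>2 \<partial>lebesgue) \<le> B"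
    from this[OF H1U Vm F(1) G(1) F(2) G(2) F(4) e(1,2) DU ws(1)] have "L1 n * a\<^sup>2 \<le> B" for n by (simp add: mU)
    then show thesis by (rule that)
  qed
  obtain B2 where B2: "\<And>n. L2 n * b\<^sup>2 \<le> B2"
  proof (rule multiplier_bound[OF N3 ab(2,1) sub' sup', where M=M and K=K and D=Dm])
    fix B assume "\<And>(u::real^'n \<Rightarrow> real) v F G \<epsilon> l. H1 u \<Longrightarrow> v \<in> borel_measurable lebesgue \<Longrightarrow> profile u F \<Longrightarrow> profile v G \<Longrightarrow>
      below_mu TYPE('n) M F \<Longrightarrow> below_mu TYPE('n) M G \<Longrightarrow> (\<And>r. r > 0 \<Longrightarrow> (F r)\<^sup>2 * r ^ (CARD('n) - 2) \<le> K) \<Longrightarrow>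
      0 \<le> \<epsilon> \<Longrightarrow> \<epsilon> \<le> 1 \<Longrightarrow> dirichlet u \<le> Dm \<Longrightarrow> weak_sol l u (sys_rhs \<epsilon> \<beta> \<alpha> u v) \<Longrightarrow> l * (\<integral>x. (u x)\<^sup>2 \<partial>lebesgue) \<le> B"
    from this[OF H1V Um G(1) F(1) G(2) F(2) G(4) e(1,2) DV ws(2)] have "L2 n * b\<^sup>2 \<le> B" for n by (simp add: mV)
    then show thesis by (rule that)
  qed
  \<comment> \<open>Multipliers and Dirichlet energies go through the diagonal argument together
    with the profiles, so that one subsequence serves all of them. From index 3 on the entry is the
    energy of the second component.\<close>
  define c where "c n j = (if j = 0 then L1 n else if j = 1 then L2 n else if j = 2 then dirichlet (U n) else dirichlet (V n))" for n j :: nat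
  have L1b: "L1 n \<le> B1 / a\<^sup>2" and L2b: "L2 n \<le> B2 / b\<^sup>2" for n using B1[of n] B2[of n] ab0 by (simp_all add: pos_le_divide_eq)
  have cb: "\<bar>c n j\<bar> \<le> B1 / a\<^sup>2 + B2 / b\<^sup>2 + Dm" for n j
  proof -
    have "0 \<le> B1 / a\<^sup>2" "0 \<le> B2 / b\<^sup>2" using L1b[of n] L2b[of n] L[of n] by linarith+
    then show ?thesis using L1b[of n] L2b[of n] L[of n] DU[of n] DV[of n] Dm0 dirichlet_nonneg[of "U n"] dirichlet_nonneg[of "V n"]
      by (auto simp: c_def)
  qed
  have bF: "\<bar>F n r\<bar> \<le> M * mu TYPE('n) r" "\<bar>G n r\<bar> \<le> M * mu TYPE('n) r" if "r > 0" for n r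
    using below_muD(2,3)[OF F(2)] below_muD(2,3)[OF G(2)] that by auto
  obtain \<phi> Fl Gl cl where \<phi>: "strict_mono \<phi>"
    and lim: "\<And>r. r > 0 \<Longrightarrow> (\<lambda>n. F (\<phi> n) r) \<longlonglongrightarrow> Fl r" "\<And>r. r > 0 \<Longrightarrow> (\<lambda>n. G (\<phi> n) r) \<longlonglongrightarrow> Gl r"
    and 0: "\<And>r. r \<le> 0 \<Longrightarrow> Fl r = 0" "\<And>r. r \<le> 0 \<Longrightarrow> Gl r = 0" and cl: "\<And>j. (\<lambda>n. c (\<phi> n) j) \<longlonglongrightarrow> cl j"
    by (rule radial_subsequence[of F H "CARD('n) - 1" G "\<lambda>r. M * mu TYPE('n) r" c]) (use F(3) G(3) H0 bF cb in auto)
  have l1: "(\<lambda>n. L1 (\<phi> n)) \<longlonglongrightarrow> cl 0" and l2: "(\<lambda>n. L2 (\<phi> n)) \<longlonglongrightarrow> cl 1"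
    and d1: "(\<lambda>n. dirichlet (U (\<phi> n))) \<longlonglongrightarrow> cl 2" and d2: "(\<lambda>n. dirichlet (V (\<phi> n))) \<longlonglongrightarrow> cl 3"
    using cl[of 0] cl[of 1] cl[of 2] cl[of 3] by (simp_all add: c_def)
  have e': "(\<lambda>n. \<epsilon> (\<phi> n)) \<longlonglongrightarrow> 0" using LIMSEQ_subseq_LIMSEQ[OF e(3) \<phi>] by (simp add: o_def)
  define u where "u = (\<lambda>x::real^'n. Fl (norm x))"
  define v where "v = (\<lambda>x::real^'n. Gl (norm x))"
  have BFl: "below_mu TYPE('n) M Fl" by (rule below_mu_limit[OF F(2) lim(1) 0(1)])
  have BGl: "below_mu TYPE('n) M Gl" by (rule below_mu_limit[OF G(2) lim(2) 0(2)])
  have Flc: "continuous_on {0<..} Fl" by (rule holder_limit_continuous[OF F(3) H0 lim(1)])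
  have Glc: "continuous_on {0<..} Gl" by (rule holder_limit_continuous[OF G(3) H0 lim(2)])
  have Pu: "profile u Fl" and Pv: "profile v Gl" using Flc Glc 0 by (auto simp: profile_def u_def v_def)
  have [measurable]: "Fl \<in> borel_measurable borel" "Gl \<in> borel_measurable borel" using Pu Pv profile_borel by auto
  have um: "u \<in> borel_measurable lebesgue" and vm: "v \<in> borel_measurable lebesgue"
    unfolding u_def v_def by (intro measurable_completion; simp)+
  have cp: "(\<lambda>n. coup \<alpha> \<beta> (U (\<phi> n)) (V (\<phi> n))) \<longlonglongrightarrow> coup \<alpha> \<beta> u v"
    by (rule coup_tendsto[OF N3 ab sub sup Um Vm um vm F(1) G(1) Pu Pv F(2) G(2) BFl BGl]) (use lim in auto)
  then have cp': "(\<lambda>n. coup \<beta> \<alpha> (V (\<phi> n)) (U (\<phi> n))) \<longlonglongrightarrow> coup \<beta> \<alpha> v u" by (subst (1 2) coup_commute)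
  have z1: "(\<lambda>n. \<epsilon> (\<phi> n) * Lp_int (crit TYPE('n)) (U (\<phi> n))) \<longlonglongrightarrow> 0"
    by (rule critical_term_vanishes[OF N3 ab sub sup H1U Vm F(1) G(1) F(2) G(2) _ e(1,2) e' ws(1) d1]) (rule F(4))
  have z2: "(\<lambda>n. \<epsilon> (\<phi> n) * Lp_int (crit TYPE('n)) (V (\<phi> n))) \<longlonglongrightarrow> 0"
    by (rule critical_term_vanishes[OF N3 ab(2,1) sub' sup' H1V Um G(1) F(1) G(2) F(2) _ e(1,2) e' ws(2) d2]) (rule G(4))
  have z: "(\<lambda>n. \<epsilon> (\<phi> n) * (Lp_int (crit TYPE('n)) (U (\<phi> n)) + Lp_int (crit TYPE('n)) (V (\<phi> n)))) \<longlonglongrightarrow> 0"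
    using tendsto_add[OF z1 z2] by (simp add: distrib_left)
  have "(\<lambda>n. dirichlet (U (\<phi> n)) + dirichlet (V (\<phi> n))) \<longlonglongrightarrow> cl 2 + cl 3" by (intro tendsto_intros d1 d2)
  then have "d0 \<le> cl 2 + cl 3" by (rule LIMSEQ_le_const) (use d0(2) in auto)
  moreover have "(\<lambda>n. dirichlet (U (\<phi> n)) + dirichlet (V (\<phi> n))) \<longlonglongrightarrow> 0 + g * coup \<alpha> \<beta> u v"
    unfolding poh by (intro tendsto_intros z cp)
  ultimately have "d0 \<le> g * coup \<alpha> \<beta> u v" using tendsto_add[OF d1 d2] LIMSEQ_unique by fastforce
  then have cp0: "coup \<alpha> \<beta> u v \<noteq> 0" using d0(1) by auto
  then have cp0': "coup \<beta> \<alpha> v u \<noteq> 0" using coup_commute[of \<alpha> \<beta> u v] by simp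
  note CU = component_limit[OF N ab sub sup H1U Vm F(1) G(1) F(2) G(2) _ _ H0 _ e(1,2) e' ws(1) l1 L(1) d1 mU lim 0 u_def v_def cp0 cp, where K=K]
  note CV = component_limit[OF N ab(2,1) sub' sup' H1V Um G(1) F(1) G(2) F(2) _ _ H0 _ e(1,2) e' ws(2) l2 L(2) d2 mV lim(2,1) 0(2,1) v_def u_def cp0' cp', where K=K]
  have u1: "H1 u" by (rule CU(1)) (use F(3,4) G(3) in auto)
  have u2: "cl 0 > 0" by (rule CU(2)) (use F(3,4) G(3) in auto)
  have u3: "weak_sol (cl 0) u (sys_rhs 0 \<alpha> \<beta> u v)" by (rule CU(3)) (use F(3,4) G(3) in auto)
  have u4: "(\<integral>x. (u x)\<^sup>2 \<partial>lebesgue) = a\<^sup>2" by (rule CU(4)) (use F(3,4) G(3) in auto)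
  have u5: "dirichlet u = cl 2" by (rule CU(5)) (use F(3,4) G(3) in auto)
  have u6: "(\<lambda>n. (H1norm (\<lambda>x. U (\<phi> n) x - u x))\<^sup>2) \<longlonglongrightarrow> 0" by (rule CU(6)) (use F(3,4) G(3) in auto)
  have v1: "H1 v" by (rule CV(1)) (use G(3,4) F(3) in auto)
  have v2: "cl 1 > 0" by (rule CV(2)) (use G(3,4) F(3) in auto)
  have v3: "weak_sol (cl 1) v (sys_rhs 0 \<beta> \<alpha> v u)" by (rule CV(3)) (use G(3,4) F(3) in auto)
  have v4: "(\<integral>x. (v x)\<^sup>2 \<partial>lebesgue) = b\<^sup>2" by (rule CV(4)) (use G(3,4) F(3) in auto)
  have v5: "dirichlet v = cl 3" by (rule CV(5)) (use G(3,4) F(3) in auto)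
  have v6: "(\<lambda>n. (H1norm (\<lambda>x. V (\<phi> n) x - v x))\<^sup>2) \<longlonglongrightarrow> 0" by (rule CV(6)) (use G(3,4) F(3) in auto)
  show thesis
  proof (rule that[OF \<phi> _ u2 v2 u3 v3 _ cp z])
    show "(u, v) \<in> Tset a b" using u1 v1 u4 v4 ab0 by (simp add: Tset_def L2norm_def)
    show "(\<lambda>n. dirichlet (U (\<phi> n)) + dirichlet (V (\<phi> n))) \<longlonglongrightarrow> dirichlet u + dirichlet v"
      unfolding u5 v5 by (intro tendsto_intros d1 d2)
    show "(\<lambda>n. Hdist (U (\<phi> n), V (\<phi> n)) (u, v)) \<longlonglongrightarrow> 0"
      using tendsto_real_sqrt[OF tendsto_add[OF u6 v6]] by (simp add: Hdist_def)
  qed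
qed

subsection \<open>Rescaling of the coupled system\<close>

text \<open>\<open>I_nu\<close> in dilated variables, up to the factor exp(2 s); for \<epsilon> = 0
  this is \<open>K_fun\<close>.\<close>

definition scaled_energy :: "real \<Rightarrow> real \<Rightarrow> real \<Rightarrow> (real^'n::finite \<Rightarrow> real) \<Rightarrow> (real^'n \<Rightarrow> real) \<Rightarrow> real" where
  "scaled_energy \<alpha> \<beta> \<epsilon> u v = 1/2 * (dirichlet u + dirichlet v)
     - \<epsilon> / crit TYPE('n) * (Lp_int (crit TYPE('n)) u + Lp_int (crit TYPE('n)) v) - coup \<alpha> \<beta> u v"

definition scaled_pohozaev :: "real \<Rightarrow> real \<Rightarrow> real \<Rightarrow> (real^'n::finite \<Rightarrow> real) \<Rightarrow> (real^'n \<Rightarrow> real) \<Rightarrow> real" where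
  "scaled_pohozaev \<alpha> \<beta> \<epsilon> u v = (dirichlet u + dirichlet v)
     - \<epsilon> * (Lp_int (crit TYPE('n)) u + Lp_int (crit TYPE('n)) v) - gam TYPE('n) \<alpha> \<beta> * coup \<alpha> \<beta> u v"

text \<open>Multiply the two conditions on \<alpha> + \<beta> - 2 by N/2; at the upper end N
  (\<open>crit\<close> - 2) / 2 equals \<open>crit\<close> again.\<close>

lemma gam_range:
  assumes N: "CARD('n::finite) \<ge> 3" and sub: "\<alpha> + \<beta> < crit TYPE('n)" and sup: "\<alpha> + \<beta> > 2 + 4 / real CARD('n)"
  shows "2 < gam TYPE('n) \<alpha> \<beta>" "gam TYPE('n) \<alpha> \<beta> < crit TYPE('n)"
proof -
  define n where "n = real CARD('n)"
  have n: "n \<ge> 3" using N by (simp add: n_def)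
  have "n * (4 / n) < n * (\<alpha> + \<beta> - 2)" using sup n by (intro mult_strict_left_mono) (auto simp: n_def)
  then show "2 < gam TYPE('n) \<alpha> \<beta>" using n by (simp add: gam_def n_def[symmetric])
  have "n * (\<alpha> + \<beta> - 2) < n * (crit TYPE('n) - 2)" using sub n by (intro mult_strict_left_mono) auto
  also have "\<dots> = 2 * crit TYPE('n)" using n by (simp add: crit_def n_def[symmetric] field_simps)
  finally show "gam TYPE('n) \<alpha> \<beta> < crit TYPE('n)" by (simp add: gam_def n_def[symmetric])
qed

lemma scaled_functionals_star:
  fixes u v :: "real^'n::finite \<Rightarrow> real"
  assumes N: "CARD('n) \<ge> 3" and u: "H1 u" and v: "H1 v"
  shows "scaled_energy \<alpha> \<beta> \<epsilon> (star s u) (star s v) = exp (2 * s) / 2 * (dirichlet u + dirichlet v)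
      - \<epsilon> * exp (crit TYPE('n) * s) / crit TYPE('n) * (Lp_int (crit TYPE('n)) u + Lp_int (crit TYPE('n)) v) - exp (gam TYPE('n) \<alpha> \<beta> * s) * coup \<alpha> \<beta> u v"
    and "scaled_pohozaev \<alpha> \<beta> \<epsilon> (star s u) (star s v) = exp (2 * s) * (dirichlet u + dirichlet v)
      - \<epsilon> * exp (crit TYPE('n) * s) * (Lp_int (crit TYPE('n)) u + Lp_int (crit TYPE('n)) v) - gam TYPE('n) \<alpha> \<beta> * exp (gam TYPE('n) \<alpha> \<beta> * s) * coup \<alpha> \<beta> u v"
proof -
  have m: "u \<in> borel_measurable lebesgue" "v \<in> borel_measurable lebesgue" using u v by (auto simp: H1_def)
  show "scaled_energy \<alpha> \<beta> \<epsilon> (star s u) (star s v) = exp (2 * s) / 2 * (dirichlet u + dirichlet v)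
      - \<epsilon> * exp (crit TYPE('n) * s) / crit TYPE('n) * (Lp_int (crit TYPE('n)) u + Lp_int (crit TYPE('n)) v) - exp (gam TYPE('n) \<alpha> \<beta> * s) * coup \<alpha> \<beta> u v"
    unfolding scaled_energy_def dirichlet_star[OF u] dirichlet_star[OF v] star_Lp_crit[OF N m(1)] star_Lp_crit[OF N m(2)] coup_star[OF m]
    by (simp add: distrib_left add_divide_distrib)
  show "scaled_pohozaev \<alpha> \<beta> \<epsilon> (star s u) (star s v) = exp (2 * s) * (dirichlet u + dirichlet v)
      - \<epsilon> * exp (crit TYPE('n) * s) * (Lp_int (crit TYPE('n)) u + Lp_int (crit TYPE('n)) v) - gam TYPE('n) \<alpha> \<beta> * exp (gam TYPE('n) \<alpha> \<beta> * s) * coup \<alpha> \<beta> u v"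
    unfolding scaled_pohozaev_def dirichlet_star[OF u] dirichlet_star[OF v] star_Lp_crit[OF N m(1)] star_Lp_crit[OF N m(2)] coup_star[OF m]
    by (simp add: distrib_left)
qed

text \<open>The choice s = ln \<nu> / (\<gamma> - 2) turns the factor exp(\<gamma> s) of the dilated
  coupling integral into exp(2 s) \<nu>, so the coupling constant becomes 1 after the common factor
  exp(2 s) is removed; \<epsilon> is what this leaves in front of the critical term.\<close>

lemma functionals_rescaled:
  fixes u v :: "real^'n::finite \<Rightarrow> real"
  assumes N: "CARD('n) \<ge> 3" and u: "H1 u" and v: "H1 v"
    and nu: "\<nu> = exp ((gam TYPE('n) \<alpha> \<beta> - 2) * s)" and eps: "\<epsilon> = exp ((2 - crit TYPE('n)) * s)"
  shows "exp (2 * s) * I_nu \<alpha> \<beta> \<nu> u v = scaled_energy \<alpha> \<beta> \<epsilon> (star s u) (star s v)"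
    and "exp (2 * s) * P_nu \<alpha> \<beta> \<nu> u v = scaled_pohozaev \<alpha> \<beta> \<epsilon> (star s u) (star s v)"
proof -
  have 1: "\<epsilon> * exp (crit TYPE('n) * s) = exp (2 * s)" unfolding eps exp_add[symmetric] by (simp add: algebra_simps)
  have 2: "exp (gam TYPE('n) \<alpha> \<beta> * s) = exp (2 * s) * \<nu>" unfolding nu exp_add[symmetric] by (simp add: algebra_simps)
  show "exp (2 * s) * I_nu \<alpha> \<beta> \<nu> u v = scaled_energy \<alpha> \<beta> \<epsilon> (star s u) (star s v)"
    unfolding scaled_functionals_star[OF N u v] I_nu_def 1 2 right_diff_distrib by simp
  show "exp (2 * s) * P_nu \<alpha> \<beta> \<nu> u v = scaled_pohozaev \<alpha> \<beta> \<epsilon> (star s u) (star s v)"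
    unfolding scaled_functionals_star[OF N u v] P_nu_def 1 2 by (simp add: algebra_simps)
qed

lemma coup_nonneg: "0 \<le> coup \<alpha> \<beta> u v"
  unfolding coup_def by (rule Bochner_Integration.integral_nonneg) simp

text \<open>Eliminating the coupling integral by the Pohozaev constraint leaves the critical
  integral with coefficient 1/\<gamma> - 1/\<open>crit\<close>, which is positive because \<gamma> <
  \<open>crit\<close>.\<close>

lemma scaled_energy_lower:
  fixes u v :: "real^'n::finite \<Rightarrow> real"
  assumes g: "2 < gam TYPE('n) \<alpha> \<beta>" "gam TYPE('n) \<alpha> \<beta> < crit TYPE('n)" and e: "\<epsilon> \<ge> 0" and p: "scaled_pohozaev \<alpha> \<beta> \<epsilon> u v = 0"
  shows "(1/2 - 1 / gam TYPE('n) \<alpha> \<beta>) * (dirichlet u + dirichlet v) \<le> scaled_energy \<alpha> \<beta> \<epsilon> u v"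
proof -
  let ?g = "gam TYPE('n) \<alpha> \<beta>"
  define L where "L = Lp_int (crit TYPE('n)) u + Lp_int (crit TYPE('n)) v"
  define d where "d = dirichlet u + dirichlet v"
  have "?g * coup \<alpha> \<beta> u v = d - \<epsilon> * L" using p by (simp add: scaled_pohozaev_def d_def L_def)
  then have c: "coup \<alpha> \<beta> u v = (d - \<epsilon> * L) / ?g" using g by (simp add: field_simps)
  have "0 \<le> (1 / ?g - 1 / crit TYPE('n)) * (\<epsilon> * L)"
    using g e Lp_int_nonneg[of "crit TYPE('n)" u] Lp_int_nonneg[of "crit TYPE('n)" v] by (intro mult_nonneg_nonneg) (auto simp: L_def frac_le)
  then show ?thesis unfolding scaled_energy_def c d_def[symmetric] L_def[symmetric] by (simp add: algebra_simps diff_divide_distrib)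
qed

lemma Tset_dirichlet_pos:
  assumes "(u, v) \<in> Tset a b" "a > 0" "b > 0"
  shows "dirichlet u > 0" "dirichlet v > 0"
  using dirichlet_pos[OF Tset_mass(1)[OF assms(1)]] dirichlet_pos[OF Tset_mass(2)[OF assms(1)]] Tset_mass(3,4)[OF assms(1)] assms(2,3) by auto

text \<open>Along the dilations, exp(-2t) times the Pohozaev functional is positive for t near minus
  infinity and at most 0 at t = 0, where L vanishes; so it has a zero. The critical term only lowers
  the energy, and without it the energy along the dilations is largest at t = 0, where it equals
  K.\<close>

lemma Lset_fibre_projection:
  fixes w z :: "real^'n::finite \<Rightarrow> real"
  assumes N: "CARD('n) \<ge> 3" and g: "2 < gam TYPE('n) \<alpha> \<beta>" and ab: "a > 0" "b > 0" and wz: "(w, z) \<in> Lset \<alpha> \<beta> a b" and e: "\<epsilon> \<ge> 0"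
  obtains t where "scaled_pohozaev \<alpha> \<beta> \<epsilon> (star t w) (star t z) = 0" "scaled_energy \<alpha> \<beta> \<epsilon> (star t w) (star t z) \<le> K_fun \<alpha> \<beta> w z"
proof -
  let ?g = "gam TYPE('n) \<alpha> \<beta>" let ?c = "crit TYPE('n)"
  have T: "(w, z) \<in> Tset a b" and L: "L_fun \<alpha> \<beta> w z = 0" using wz by (auto simp: Lset_def)
  note H = Tset_mass(1,2)[OF T]
  define d where "d = dirichlet w + dirichlet z"
  define l where "l = Lp_int ?c w + Lp_int ?c z"
  have d: "d > 0" using Tset_dirichlet_pos[OF T ab] by (simp add: d_def)
  have l: "l \<ge> 0" unfolding l_def by (simp add: Lp_int_nonneg)
  have cp: "coup \<alpha> \<beta> w z = d / ?g" using L g by (simp add: L_fun_def d_def field_simps)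
  have c2: "?c > 2" by (rule crit_gt_2[OF N])
  define q where "q t = d - \<epsilon> * l * exp ((?c - 2) * t) - d * exp ((?g - 2) * t)" for t
  have q0: "q 0 \<le> 0" using e l by (simp add: q_def)
  have e1: "((\<lambda>t::real. exp (k * t)) \<longlongrightarrow> 0) at_bot" if "k > 0" for k :: real
    using that by (intro filterlim_compose[OF exp_at_bot] filterlim_tendsto_pos_mult_at_bot[OF tendsto_const]) (auto simp: filterlim_ident)
  have "(q \<longlongrightarrow> d - \<epsilon> * l * 0 - d * 0) at_bot"
    unfolding q_def[abs_def] by (intro tendsto_intros e1) (use c2 g in auto)
  then have "\<forall>\<^sub>F t in at_bot. 0 < q t" using d by (intro order_tendstoD(1)) auto
  then obtain T0 where T0: "\<And>t. t \<le> T0 \<Longrightarrow> 0 < q t" by (auto simp: eventually_at_bot_linorder)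
  have "\<exists>t. min T0 0 \<le> t \<and> t \<le> 0 \<and> q t = 0"
  proof (rule IVT2')
    show "q 0 \<le> 0" by (rule q0)
    show "0 \<le> q (min T0 0)" using T0[of "min T0 0"] by simp
    show "continuous_on {min T0 0..0} q" unfolding q_def[abs_def] by (intro continuous_intros)
  qed simp
  then obtain t where t: "q t = 0" by blast
  have x1: "exp (2 * t) * exp ((?c - 2) * t) = exp (?c * t)" "exp (2 * t) * exp ((?g - 2) * t) = exp (?g * t)"
    unfolding exp_add[symmetric] by (simp_all add: algebra_simps)
  have g0: "?g \<noteq> 0" using g by simp
  show thesis
  proof (rule that[of t])
    have "scaled_pohozaev \<alpha> \<beta> \<epsilon> (star t w) (star t z) = exp (2 * t) * q t"
      unfolding scaled_functionals_star(2)[OF N H] d_def[symmetric] l_def[symmetric] cp q_def right_diff_distrib x1[symmetric]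
      using g0 by (simp add: mult_ac)
    then show "scaled_pohozaev \<alpha> \<beta> \<epsilon> (star t w) (star t z) = 0" using t by simp
    \<comment> \<open>Convexity of exp, with 2t written as the convex combination of \<gamma>t and 0
      with weight 2/\<gamma>. It expresses that the energy without critical term peaks at t =
      0.\<close>
    have cv: "exp (2 * t) \<le> 2 / ?g * exp (?g * t) + (1 - 2 / ?g)"
    proof -
      have "exp ((1 - 2 / ?g) *\<^sub>R 0 + (2 / ?g) *\<^sub>R (?g * t)) \<le> (1 - 2 / ?g) * exp 0 + 2 / ?g * exp (?g * t)"
        using g by (intro convex_onD[OF exp_convex]) auto
      then show ?thesis using g0 by simp
    qed
    have "scaled_energy \<alpha> \<beta> \<epsilon> (star t w) (star t z) \<le> exp (2 * t) / 2 * d - exp (?g * t) * (d / ?g)"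
      unfolding scaled_functionals_star(1)[OF N H] d_def[symmetric] l_def[symmetric] cp using e l c2 by simp
    also have "\<dots> = d / 2 * (exp (2 * t) - 2 / ?g * exp (?g * t))" using g0 by (simp add: field_simps)
    also have "\<dots> \<le> d / 2 * (1 - 2 / ?g)" using d cv by (intro mult_left_mono) auto
    also have "\<dots> = K_fun \<alpha> \<beta> w z" unfolding K_fun_def cp d_def[symmetric] by (simp add: right_diff_distrib)
    finally show "scaled_energy \<alpha> \<beta> \<epsilon> (star t w) (star t z) \<le> K_fun \<alpha> \<beta> w z" .
  qed
qed

text \<open>The projection produces a competitor in rescaled variables. Dilating the original pair
  by t - s instead of t carries it back to the constraint set for \<nu>, because dilations compose
  additively.\<close>

lemma m_nu_upper:
  fixes w z :: "real^'n::finite \<Rightarrow> real"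
  assumes N: "CARD('n) \<ge> 3" and g: "2 < gam TYPE('n) \<alpha> \<beta>" "gam TYPE('n) \<alpha> \<beta> < crit TYPE('n)" and ab: "a > 0" "b > 0"
    and wz: "(w, z) \<in> Lset \<alpha> \<beta> a b" and nu: "\<nu> = exp ((gam TYPE('n) \<alpha> \<beta> - 2) * s)"
  shows "exp (2 * s) * m_nu TYPE('n) \<alpha> \<beta> \<nu> a b \<le> K_fun \<alpha> \<beta> w z"
proof -
  define \<epsilon> where "\<epsilon> = exp ((2 - crit TYPE('n)) * s)"
  have e: "\<epsilon> \<ge> 0" by (simp add: \<epsilon>_def)
  obtain t where t: "scaled_pohozaev \<alpha> \<beta> \<epsilon> (star t w) (star t z) = 0" "scaled_energy \<alpha> \<beta> \<epsilon> (star t w) (star t z) \<le> K_fun \<alpha> \<beta> w z"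
    using Lset_fibre_projection[OF N g(1) ab wz e] by blast
  let ?w = "star (t - s) w" and ?z = "star (t - s) z"
  have T: "(w, z) \<in> Tset a b" using wz by (auto simp: Lset_def)
  have T': "(?w, ?z) \<in> Tset a b" by (rule star2_Tset[OF T])
  note H = Tset_mass(1,2)[OF T']
  have ss: "star s ?w = star t w" "star s ?z = star t z" by (simp_all add: star_star)
  have "P_nu \<alpha> \<beta> \<nu> ?w ?z = 0" using functionals_rescaled(2)[OF N H nu \<epsilon>_def] t(1) unfolding ss by simp
  then have P: "(?w, ?z) \<in> Pset \<alpha> \<beta> \<nu> a b" using T' by (simp add: Pset_def)
  have "m_nu TYPE('n) \<alpha> \<beta> \<nu> a b \<le> I_nu \<alpha> \<beta> \<nu> ?w ?z"
    unfolding m_nu_def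
  proof (rule cInf_lower)
    show "I_nu \<alpha> \<beta> \<nu> ?w ?z \<in> (\<lambda>(u, v). I_nu \<alpha> \<beta> \<nu> u v) ` (Pset \<alpha> \<beta> \<nu> a b :: ((real^'n \<Rightarrow> real) \<times> _) set)"
      using P by force
    \<comment> \<open>The energies are nonnegative on the constraint set by
      \<open>scaled_energy_lower\<close>; the infimum of reals is informative only once a lower
      bound is known.\<close>
    show "bdd_below ((\<lambda>(u, v). I_nu \<alpha> \<beta> \<nu> u v) ` (Pset \<alpha> \<beta> \<nu> a b :: ((real^'n \<Rightarrow> real) \<times> _) set))"
    proof (rule bdd_belowI2[of _ 0])
      fix x :: "(real^'n \<Rightarrow> real) \<times> (real^'n \<Rightarrow> real)" assume x: "x \<in> Pset \<alpha> \<beta> \<nu> a b"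
      obtain u v where uv: "x = (u, v)" by fastforce
      have T: "(u, v) \<in> Tset a b" and P: "P_nu \<alpha> \<beta> \<nu> u v = 0" using x uv by (auto simp: Pset_def)
      note H = Tset_mass(1,2)[OF T]
      have "scaled_pohozaev \<alpha> \<beta> \<epsilon> (star s u) (star s v) = 0" using functionals_rescaled(2)[OF N H nu \<epsilon>_def] P by simp
      from scaled_energy_lower[OF g e this]
      have "(1/2 - 1 / gam TYPE('n) \<alpha> \<beta>) * (dirichlet (star s u) + dirichlet (star s v)) \<le> exp (2 * s) * I_nu \<alpha> \<beta> \<nu> u v"
        unfolding functionals_rescaled(1)[OF N H nu \<epsilon>_def] .
      moreover have "0 \<le> (1/2 - 1 / gam TYPE('n) \<alpha> \<beta>) * (dirichlet (star s u) + dirichlet (star s v))"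
        using g dirichlet_nonneg[of "star s u"] dirichlet_nonneg[of "star s v"] by (intro mult_nonneg_nonneg) (auto simp: divide_simps)
      ultimately have "0 \<le> exp (2 * s) * I_nu \<alpha> \<beta> \<nu> u v" by linarith
      then show "0 \<le> (case x of (u, v) \<Rightarrow> I_nu \<alpha> \<beta> \<nu> u v)" using uv by (simp add: zero_le_mult_iff)
    qed
  qed
  then have "exp (2 * s) * m_nu TYPE('n) \<alpha> \<beta> \<nu> a b \<le> exp (2 * s) * I_nu \<alpha> \<beta> \<nu> ?w ?z" by simp
  also have "\<dots> = scaled_energy \<alpha> \<beta> \<epsilon> (star t w) (star t z)" using functionals_rescaled(1)[OF N H nu \<epsilon>_def] unfolding ss .
  also have "\<dots> \<le> K_fun \<alpha> \<beta> w z" by (rule t(2))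
  finally show ?thesis .
qed

text \<open>The amplitude exp(N s / 2) to the power \<open>crit\<close> - 2 is
  exp(\<open>crit\<close> s), which \<epsilon> reduces to exp(2 s). To the total power \<alpha> +
  \<beta> - 2 of the coupling it is exp(\<gamma> s), that is exp(2 s) \<nu>.\<close>

lemma sys_rhs_star:
  fixes u v :: "real^'n::finite \<Rightarrow> real"
  assumes N: "CARD('n) \<ge> 3" and nu: "\<nu> = exp ((gam TYPE('n) \<alpha> \<beta> - 2) * s)" and eps: "\<epsilon> = exp ((2 - crit TYPE('n)) * s)"
    and f: "\<And>x. f x = \<bar>u x\<bar> powr (crit TYPE('n) - 2) * u x + \<nu> * \<alpha> * (\<bar>u x\<bar> powr (\<alpha> - 2) * \<bar>v x\<bar> powr \<beta> * u x)"
  shows "exp (2 * s) * exp (real CARD('n) * s / 2) * f (exp s *\<^sub>R x) = sys_rhs \<epsilon> \<alpha> \<beta> (star s u) (star s v) x"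
proof -
  let ?E = "exp (real CARD('n) * s / 2)" let ?y = "exp s *\<^sub>R x" let ?c = "crit TYPE('n)"
  have pe: "exp k powr p = exp (k * p)" for k p :: real by (simp add: powr_def mult.commute)
  have "real CARD('n) * (?c - 2) / 2 = ?c" using N by (simp add: crit_def field_simps)
  then have "real CARD('n) * s / 2 * (?c - 2) = ?c * s" by (simp add: algebra_simps)
  then have 1: "\<epsilon> * ?E powr (?c - 2) = exp (2 * s)"
    unfolding eps pe exp_add[symmetric] by (simp add: algebra_simps)
  have "real CARD('n) * s / 2 * (\<alpha> - 2) + real CARD('n) * s / 2 * \<beta> = gam TYPE('n) \<alpha> \<beta> * s" by (simp add: gam_def field_simps)
  then have 2: "?E powr (\<alpha> - 2) * ?E powr \<beta> = exp (2 * s) * \<nu>"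
    unfolding nu pe exp_add[symmetric] by (simp add: algebra_simps)
  have "sys_rhs \<epsilon> \<alpha> \<beta> (star s u) (star s v) x =
      (\<epsilon> * ?E powr (?c - 2)) * (?E * (\<bar>u ?y\<bar> powr (?c - 2) * u ?y)) +
      (?E powr (\<alpha> - 2) * ?E powr \<beta>) * (?E * \<alpha> * (\<bar>u ?y\<bar> powr (\<alpha> - 2) * \<bar>v ?y\<bar> powr \<beta> * u ?y))"
    by (simp add: sys_rhs_def star_def abs_mult powr_mult mult_ac)
  also have "\<dots> = exp (2 * s) * ?E * f ?y" unfolding 1 2 f by (simp add: distrib_left mult_ac)
  finally show ?thesis by simp
qed

lemma coupled_sol_star:
  fixes u v :: "real^'n::finite \<Rightarrow> real"
  assumes N: "CARD('n) \<ge> 3" and u: "H1 u" and v: "H1 v" and sol: "coupled_sol \<alpha> \<beta> \<nu> l1 l2 u v"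
    and nu: "\<nu> = exp ((gam TYPE('n) \<alpha> \<beta> - 2) * s)" and eps: "\<epsilon> = exp ((2 - crit TYPE('n)) * s)"
  shows "weak_sol (exp (2 * s) * l1) (star s u) (sys_rhs \<epsilon> \<alpha> \<beta> (star s u) (star s v))"
    and "weak_sol (exp (2 * s) * l2) (star s v) (sys_rhs \<epsilon> \<beta> \<alpha> (star s v) (star s u))"
proof -
  have m [measurable]: "u \<in> borel_measurable lebesgue" "v \<in> borel_measurable lebesgue" using u v by (auto simp: H1_def)
  define f1 where "f1 x = \<bar>u x\<bar> powr (crit TYPE('n) - 2) * u x + \<nu> * \<alpha> * (\<bar>u x\<bar> powr (\<alpha> - 2) * \<bar>v x\<bar> powr \<beta> * u x)" for x
  \<comment> \<open>The factors are ordered as in the first equation with the components exchanged,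
    so that \<open>sys_rhs_star\<close> serves both.\<close>
  define f2 where "f2 x = \<bar>v x\<bar> powr (crit TYPE('n) - 2) * v x + \<nu> * \<beta> * (\<bar>v x\<bar> powr (\<beta> - 2) * \<bar>u x\<bar> powr \<alpha> * v x)" for x
  have w: "weak_sol l1 u f1" "weak_sol l2 v f2"
    using sol unfolding coupled_sol_def f1_def[abs_def] f2_def[abs_def] by (simp_all add: mult_ac)
  have fm: "f1 \<in> borel_measurable lebesgue" "f2 \<in> borel_measurable lebesgue" unfolding f1_def[abs_def] f2_def[abs_def] by measurable
  have nu': "\<nu> = exp ((gam TYPE('n) \<beta> \<alpha> - 2) * s)" unfolding nu by (simp add: gam_def add.commute)
  show "weak_sol (exp (2 * s) * l1) (star s u) (sys_rhs \<epsilon> \<alpha> \<beta> (star s u) (star s v))"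
  proof -
    have "(\<lambda>x. exp (2 * s) * exp (real CARD('n) * s / 2) * f1 (exp s *\<^sub>R x)) = sys_rhs \<epsilon> \<alpha> \<beta> (star s u) (star s v)"
      by (rule ext, rule sys_rhs_star[OF N nu eps]) (rule f1_def)
    then show ?thesis using weak_sol_star[OF u w(1) fm(1), of s] by simp
  qed
  show "weak_sol (exp (2 * s) * l2) (star s v) (sys_rhs \<epsilon> \<beta> \<alpha> (star s v) (star s u))"
  proof -
    have "(\<lambda>x. exp (2 * s) * exp (real CARD('n) * s / 2) * f2 (exp s *\<^sub>R x)) = sys_rhs \<epsilon> \<beta> \<alpha> (star s v) (star s u)"
      by (rule ext, rule sys_rhs_star[OF N nu' eps]) (rule f2_def)
    then show ?thesis using weak_sol_star[OF v w(2) fm(2), of s] by simp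
  qed
qed


section \<open>Nonemptiness of \<open>Lset\<close> and energy bounds from below\<close>

lemma coup_pos:
  fixes u v :: "real^'n::finite \<Rightarrow> real"
  assumes i: "integrable lebesgue (\<lambda>x. \<bar>u x\<bar> powr \<alpha> * \<bar>v x\<bar> powr \<beta>)" and p: "\<And>x. u x > 0" "\<And>x. v x > 0"
  shows "coup \<alpha> \<beta> u v > 0"
proof -
  have "coup \<alpha> \<beta> u v \<noteq> 0"
  proof
    assume "coup \<alpha> \<beta> u v = 0"
    then have "AE x in lebesgue. \<bar>u x\<bar> powr \<alpha> * \<bar>v x\<bar> powr \<beta> = 0"
      unfolding coup_def using integral_nonneg_eq_0_iff_AE[OF i] by simp
    then have "AE x::real^'n in lebesgue. False"
      by eventually_elim (use p in \<open>auto simp: less_le\<close>)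
    then have "AE x::real^'n in lebesgue. x \<notin> UNIV" by simp
    then have "(UNIV :: (real^'n) set) \<in> null_sets lebesgue" by (subst (asm) AE_iff_null_sets[symmetric]) auto
    then have "emeasure lebesgue (UNIV :: (real^'n) set) = 0" by (rule null_setsD1)
    then show False by simp
  qed
  then show ?thesis using coup_nonneg[of \<alpha> \<beta> u v] by linarith
qed

text \<open>Along the dilations the condition L = 0 reads exp((\<gamma> - 2) t) times \<gamma> times
  the coupling integral equals the Dirichlet energy, which is solved explicitly for t.\<close>

lemma Lset_star:
  fixes u v :: "real^'n::finite \<Rightarrow> real"
  assumes g: "2 < gam TYPE('n) \<alpha> \<beta>" and ab: "a > 0" "b > 0" and T: "(u, v) \<in> Tset a b" and c: "coup \<alpha> \<beta> u v > 0"
  shows "\<exists>t. (star t u, star t v) \<in> Lset \<alpha> \<beta> a b"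
proof -
  let ?g = "gam TYPE('n) \<alpha> \<beta>"
  note H = Tset_mass(1,2)[OF T]
  have m: "u \<in> borel_measurable lebesgue" "v \<in> borel_measurable lebesgue" using H by (auto simp: H1_def)
  define d where "d = dirichlet u + dirichlet v"
  have d: "d > 0" using Tset_dirichlet_pos[OF T ab] by (simp add: d_def)
  define t where "t = ln (d / (?g * coup \<alpha> \<beta> u v)) / (?g - 2)"
  have "exp ((?g - 2) * t) = d / (?g * coup \<alpha> \<beta> u v)" unfolding t_def using g d c by simp
  then have "exp ((?g - 2) * t) * (?g * coup \<alpha> \<beta> u v) = d" using g c by simp
  moreover have "exp (?g * t) = exp (2 * t) * exp ((?g - 2) * t)" unfolding exp_add[symmetric] by (simp add: algebra_simps)
  ultimately have "?g * (exp (?g * t) * coup \<alpha> \<beta> u v) = exp (2 * t) * d" by (simp add: mult_ac)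
  then have "L_fun \<alpha> \<beta> (star t u) (star t v) = 0"
    unfolding L_fun_def dirichlet_star[OF H(1)] dirichlet_star[OF H(2)] coup_star[OF m] d_def by (simp add: distrib_left)
  then show ?thesis using star2_Tset[OF T] by (auto simp: Lset_def)
qed

lemma K_fun_Lset:
  fixes w z :: "real^'n::finite \<Rightarrow> real"
  assumes g: "2 < gam TYPE('n) \<alpha> \<beta>" and wz: "(w, z) \<in> Lset \<alpha> \<beta> a b"
  shows "K_fun \<alpha> \<beta> w z = (1/2 - 1 / gam TYPE('n) \<alpha> \<beta>) * (dirichlet w + dirichlet z)" "0 \<le> K_fun \<alpha> \<beta> w z"
proof -
  have "gam TYPE('n) \<alpha> \<beta> * coup \<alpha> \<beta> w z = dirichlet w + dirichlet z" using wz by (simp add: Lset_def L_fun_def)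
  then have "coup \<alpha> \<beta> w z = (dirichlet w + dirichlet z) / gam TYPE('n) \<alpha> \<beta>" using g by (simp add: field_simps)
  then show 1: "K_fun \<alpha> \<beta> w z = (1/2 - 1 / gam TYPE('n) \<alpha> \<beta>) * (dirichlet w + dirichlet z)"
    unfolding K_fun_def by (simp add: left_diff_distrib)
  show "0 \<le> K_fun \<alpha> \<beta> w z" unfolding 1 using g dirichlet_nonneg[of w] dirichlet_nonneg[of z]
    by (intro mult_nonneg_nonneg) (auto simp: divide_simps)
qed

text \<open>Both integrals in the Pohozaev identity are homogeneous in the Dirichlet energy of degree larger than 1, the coupling term by dilating to unit Dirichlet energy.\<close>

lemma dirichlet_lower_bound:
  fixes \<alpha> \<beta> a b :: real
  assumes N: "CARD('n::finite) \<ge> 3" and ab: "\<alpha> > 1" "\<beta> > 1" and sub: "\<alpha> + \<beta> < crit TYPE('n)" and sup: "\<alpha> + \<beta> > 2 + 4 / real CARD('n)"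
    and ab0: "a > 0" "b > 0"
  obtains d0 where "d0 > 0"
    "\<And>(u::real^'n \<Rightarrow> real) v \<epsilon> l1 l2. (u, v) \<in> Tset a b \<Longrightarrow> radial u \<Longrightarrow> radial v \<Longrightarrow> (\<And>x. u x > 0) \<Longrightarrow> (\<And>x. v x > 0) \<Longrightarrow>
      0 \<le> \<epsilon> \<Longrightarrow> \<epsilon> \<le> 1 \<Longrightarrow> weak_sol l1 u (sys_rhs \<epsilon> \<alpha> \<beta> u v) \<Longrightarrow> weak_sol l2 v (sys_rhs \<epsilon> \<beta> \<alpha> v u) \<Longrightarrow>
      scaled_pohozaev \<alpha> \<beta> \<epsilon> u v = 0 \<Longrightarrow> d0 \<le> dirichlet u + dirichlet v"
proof -
  let ?g = "gam TYPE('n) \<alpha> \<beta>" let ?s = "sph_area TYPE('n)" let ?n = "real CARD('n) - 2"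
  let ?A = "a\<^sup>2 + b\<^sup>2"
  have sub': "\<beta> + \<alpha> < crit TYPE('n)" and sup': "\<beta> + \<alpha> > 2 + 4 / real CARD('n)" using sub sup by auto
  have g2: "?g > 2" by (rule gam_range(1)[OF N sub sup])
  have n: "?n > 0" using N by simp
  have s: "?s > 0" by simp
  \<comment> \<open>c1 and C2 collect the constants of the critical and the coupling estimate, so
    that the Pohozaev identity becomes d <= d h(d).\<close>
  define c1 where "c1 = ?s * (2 / ?n * (1 / (?s * ?n) + 2 / ?n * (1 / ?s)))"
  define C2 where "C2 = ?s * (profM TYPE('n) ?A 1 powr (\<alpha> + \<beta>) * (\<integral>r. indicator {0<..} r * (r ^ (CARD('n) - 1) * mu TYPE('n) r powr (\<alpha> + \<beta>)) \<partial>lborel))"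
  define h where "h d = 2 * (c1 * (d / (?s * ?n)) powr (2 / ?n)) + ?g * (C2 * d powr ((?g - 2) / 2))" for d
  \<comment> \<open>Both exponents of d in h are positive, so h is below 1 near 0, while d <= d h(d)
    requires h(d) >= 1.\<close>
  have "(h \<longlongrightarrow> 2 * (c1 * (0 / (?s * ?n)) powr (2 / ?n)) + ?g * (C2 * 0 powr ((?g - 2) / 2))) (at_right 0)"
    unfolding h_def[abs_def]
  proof (intro tendsto_add tendsto_mult tendsto_const tendsto_powr' tendsto_divide tendsto_ident_at)
    have "\<forall>\<^sub>F d::real in at_right 0. d > 0" by (rule eventually_at_right_less)
    then show "0 / (?s * ?n) \<noteq> 0 \<or> 0 < 2 / ?n \<and> (\<forall>\<^sub>F d in at_right 0. 0 \<le> d / (?s * ?n))"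
      using n s by (auto elim!: eventually_mono intro!: disjI2)
    show "(0::real) \<noteq> 0 \<or> 0 < (?g - 2) / 2 \<and> (\<forall>\<^sub>F d::real in at_right 0. 0 \<le> d)"
      using g2 \<open>\<forall>\<^sub>F d::real in at_right 0. d > 0\<close> by (auto elim!: eventually_mono)
  qed (use n s in auto)
  then have "(h \<longlongrightarrow> 0) (at_right 0)" by simp
  then have "\<forall>\<^sub>F d in at_right 0. h d < 1" by (rule order_tendstoD(2)) simp
  then obtain d0 where d0: "d0 > 0" "\<And>d. 0 < d \<Longrightarrow> d < d0 \<Longrightarrow> h d < 1" by (auto simp: eventually_at_right_field)
  show thesis
  proof (rule that[OF d0(1)])
    fix u v :: "real^'n \<Rightarrow> real" and \<epsilon> l1 l2 :: real
    assume T: "(u, v) \<in> Tset a b" and rad: "radial u" "radial v" and pos: "\<And>x. u x > 0" "\<And>x. v x > 0" and e: "0 \<le> \<epsilon>" "\<epsilon> \<le> 1"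
      and ws: "weak_sol l1 u (sys_rhs \<epsilon> \<alpha> \<beta> u v)" "weak_sol l2 v (sys_rhs \<epsilon> \<beta> \<alpha> v u)" and P: "scaled_pohozaev \<alpha> \<beta> \<epsilon> u v = 0"
    note H = Tset_mass(1,2)[OF T] and ms = Tset_mass(3,4)[OF T]
    have m: "u \<in> borel_measurable lebesgue" "v \<in> borel_measurable lebesgue" using H by (auto simp: H1_def)
    define d where "d = dirichlet u + dirichlet v"
    have dp: "dirichlet u > 0" "dirichlet v > 0" using Tset_dirichlet_pos[OF T ab0] by auto
    then have d: "d > 0" and du: "dirichlet u \<le> d" "dirichlet v \<le> d" by (auto simp: d_def)
    let ?K = "d / (?s * ?n)"
    have mA: "(\<integral>x. (u x)\<^sup>2 \<partial>lebesgue) \<le> ?A" "(\<integral>x. (v x)\<^sup>2 \<partial>lebesgue) \<le> ?A" using ms by auto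
    obtain F where F: "profile u F" "below_mu TYPE('n) (profM TYPE('n) ?A d) F" "\<And>r. r > 0 \<Longrightarrow> (F r)\<^sup>2 * r ^ (CARD('n) - 2) \<le> ?K"
      using radial_profile_uniform[OF N H(1) rad(1) pos(1) mA(1) du(1)] by metis
    obtain G where G: "profile v G" "below_mu TYPE('n) (profM TYPE('n) ?A d) G" "\<And>r. r > 0 \<Longrightarrow> (G r)\<^sup>2 * r ^ (CARD('n) - 2) \<le> ?K"
      using radial_profile_uniform[OF N H(2) rad(2) pos(2) mA(2) du(2)] by metis
    have Lb: "?s * (?K powr (2 / ?n) * (2 / ?n * (?K + 2 / ?n * (x / ?s)))) \<le> d * (c1 * ?K powr (2 / ?n))" if "x \<le> d" for x
    proof -
      have "?s * (?K powr (2 / ?n) * (2 / ?n * (?K + 2 / ?n * (x / ?s)))) \<le> ?s * (?K powr (2 / ?n) * (2 / ?n * (?K + 2 / ?n * (d / ?s))))"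
        using that n s by (intro mult_left_mono add_left_mono divide_right_mono) (auto simp: less_imp_le)
      also have "?K + 2 / ?n * (d / ?s) = d * (1 / (?s * ?n) + 2 / ?n * (1 / ?s))" by (simp add: distrib_left)
      finally show ?thesis by (simp add: c1_def mult_ac)
    qed
    have L1: "Lp_int (crit TYPE('n)) u \<le> d * (c1 * ?K powr (2 / ?n))"
      by (rule order_trans[OF system_solution(2)[OF N ab sub sup H(1) m(2) F(1) G(1) F(2) G(2) _ e ws(1)] Lb[OF du(1)]]) (rule F(3))
    have L2: "Lp_int (crit TYPE('n)) v \<le> d * (c1 * ?K powr (2 / ?n))"
      by (rule order_trans[OF system_solution(2)[OF N ab(2,1) sub' sup' H(2) m(1) G(1) F(1) G(2) F(2) _ e ws(2)] Lb[OF du(2)]]) (rule G(3))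
    \<comment> \<open>Dilation to total Dirichlet energy 1, so that the coupling bound C2 does not
      depend on d.\<close>
    define t where "t = - ln d / 2"
    let ?u = "star t u" let ?v = "star t v"
    have T': "(?u, ?v) \<in> Tset a b" by (rule star2_Tset[OF T])
    note H' = Tset_mass(1,2)[OF T'] and ms' = Tset_mass(3,4)[OF T']
    have m': "?u \<in> borel_measurable lebesgue" "?v \<in> borel_measurable lebesgue" using H' by (auto simp: H1_def)
    have "2 * t = - ln d" by (simp add: t_def)
    then have e2: "exp (2 * t) = 1 / d" using d by (simp only: exp_minus exp_ln inverse_eq_divide)
    have du': "dirichlet ?u \<le> 1" "dirichlet ?v \<le> 1" unfolding dirichlet_star[OF H(1)] dirichlet_star[OF H(2)] e2 using du d by auto
    have mA': "(\<integral>x. (?u x)\<^sup>2 \<partial>lebesgue) \<le> ?A" "(\<integral>x. (?v x)\<^sup>2 \<partial>lebesgue) \<le> ?A" using ms' by auto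
    have pos': "?u x > 0" "?v x > 0" for x using pos by (auto simp: star_def)
    obtain F' where F': "profile ?u F'" "below_mu TYPE('n) (profM TYPE('n) ?A 1) F'"
      using radial_profile_uniform[OF N H'(1) radial_star[OF rad(1)] pos'(1) mA'(1) du'(1)] by metis
    obtain G' where G': "profile ?v G'" "below_mu TYPE('n) (profM TYPE('n) ?A 1) G'"
      using radial_profile_uniform[OF N H'(2) radial_star[OF rad(2)] pos'(2) mA'(2) du'(2)] by metis
    have c2: "exp (?g * t) * coup \<alpha> \<beta> u v \<le> C2"
      using coup_bound[OF N ab sub sup m' F'(1) G'(1) F'(2) G'(2)] unfolding coup_star[OF m] C2_def .
    \<comment> \<open>y is d to the power \<gamma>/2, the inverse of exp(\<gamma> t), and undoes the
      dilation in the coupling integral. One factor d is split off to be cancelled later.\<close>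
    define y where "y = d * d powr ((?g - 2) / 2)"
    have "y = exp (ln d + (?g - 2) / 2 * ln d)"
      unfolding exp_add y_def using d by (simp only: powr_def exp_ln) simp
    then have "exp (?g * t) * y = exp (?g * t + (ln d + (?g - 2) / 2 * ln d))" by (simp only: exp_add)
    also have "?g * t + (ln d + (?g - 2) / 2 * ln d) = 0"
    proof -
      have "k * (- l / 2) + (l + (k - 2) / 2 * l) = 0" for k l :: real by (simp add: field_simps)
      then show ?thesis unfolding t_def .
    qed
    finally have y: "exp (?g * t) * y = 1" by simp
    have "coup \<alpha> \<beta> u v = exp (?g * t) * y * coup \<alpha> \<beta> u v" unfolding y by simp
    also have "\<dots> = y * (exp (?g * t) * coup \<alpha> \<beta> u v)" by (simp only: mult_ac)
    also have "\<dots> \<le> y * C2" by (rule mult_left_mono[OF c2]) (use d in \<open>simp add: y_def\<close>)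
    finally have cb: "coup \<alpha> \<beta> u v \<le> d * (C2 * d powr ((?g - 2) / 2))" by (simp add: y_def mult_ac)
    have "d = \<epsilon> * (Lp_int (crit TYPE('n)) u + Lp_int (crit TYPE('n)) v) + ?g * coup \<alpha> \<beta> u v"
      using P by (simp add: scaled_pohozaev_def d_def)
    also have "\<dots> \<le> 1 * (d * (c1 * ?K powr (2 / ?n)) + d * (c1 * ?K powr (2 / ?n))) + ?g * (d * (C2 * d powr ((?g - 2) / 2)))"
      using L1 L2 cb e g2 Lp_int_nonneg[of "crit TYPE('n)" u] Lp_int_nonneg[of "crit TYPE('n)" v] coup_nonneg[of \<alpha> \<beta> u v] by (intro add_mono mult_mono) auto
    also have "\<dots> = d * h d" by (simp add: h_def algebra_simps)
    finally have "1 \<le> h d" using d by simp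
    then have "\<not> d < d0" using d0(2)[OF d] by force
    then show "d0 \<le> dirichlet u + dirichlet v" unfolding d_def by simp
  qed
qed


section \<open>Convergence of the rescaled ground states\<close>

lemma ground_state_rescaled:
  fixes u v w z :: "real^'n::finite \<Rightarrow> real"
  assumes N: "CARD('n) \<ge> 3" and g: "2 < gam TYPE('n) \<alpha> \<beta>" "gam TYPE('n) \<alpha> \<beta> < crit TYPE('n)" and ab: "a > 0" "b > 0"
    and gs: "norm_ground_state \<alpha> \<beta> \<nu> a b u v"
    and nu: "\<nu> = exp ((gam TYPE('n) \<alpha> \<beta> - 2) * s)" and eps: "\<epsilon> = exp ((2 - crit TYPE('n)) * s)"
  shows "(star s u, star s v) \<in> Tset a b" "scaled_pohozaev \<alpha> \<beta> \<epsilon> (star s u) (star s v) = 0"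
    "(w, z) \<in> Lset \<alpha> \<beta> a b \<Longrightarrow> scaled_energy \<alpha> \<beta> \<epsilon> (star s u) (star s v) \<le> K_fun \<alpha> \<beta> w z"
proof -
  have T: "(u, v) \<in> Tset a b" and P: "P_nu \<alpha> \<beta> \<nu> u v = 0" and I: "I_nu \<alpha> \<beta> \<nu> u v = m_nu TYPE('n) \<alpha> \<beta> \<nu> a b"
    using gs by (auto simp: norm_ground_state_def Pset_def)
  note H = Tset_mass(1,2)[OF T]
  show "(star s u, star s v) \<in> Tset a b" by (rule star2_Tset[OF T])
  show "scaled_pohozaev \<alpha> \<beta> \<epsilon> (star s u) (star s v) = 0" using functionals_rescaled(2)[OF N H nu eps] P by simp
  show "scaled_energy \<alpha> \<beta> \<epsilon> (star s u) (star s v) \<le> K_fun \<alpha> \<beta> w z" if "(w, z) \<in> Lset \<alpha> \<beta> a b"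
    unfolding functionals_rescaled(1)[OF N H nu eps, symmetric] I by (rule m_nu_upper[OF N g ab that nu])
qed

lemma Hdist_set_le:
  assumes "z \<in> G" shows "0 \<le> Hdist_set w G" "Hdist_set w G \<le> Hdist w z"
proof -
  have nn: "0 \<le> Hdist w z" for z by (simp add: Hdist_def)
  show "Hdist_set w G \<le> Hdist w z" unfolding Hdist_set_def
    by (rule cInf_lower) (use assms nn in \<open>auto intro!: bdd_belowI2[of _ 0]\<close>)
  show "0 \<le> Hdist_set w G" unfolding Hdist_set_def by (rule cInf_greatest) (use assms nn in auto)
qed

text \<open>If the limit failed, the filter would provide points of \<Lambda> beyond every bound
  with values away from 0, and no subsequence of these values could tend to 0. Taking \<nu> >= 1
  keeps ln \<nu> nonnegative, which later gives \<epsilon> <= 1.\<close>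

lemma sequential_limit:
  fixes \<Lambda> :: "real set" and f :: "real \<Rightarrow> real"
  assumes "\<And>\<nu> :: nat \<Rightarrow> real. (\<And>n. \<nu> n \<in> \<Lambda>) \<Longrightarrow> (\<And>n. \<nu> n \<ge> 1) \<Longrightarrow> filterlim \<nu> at_top sequentially \<Longrightarrow>
      \<exists>\<phi>. strict_mono (\<phi> :: nat \<Rightarrow> nat) \<and> (\<lambda>n. f (\<nu> (\<phi> n))) \<longlonglongrightarrow> 0"
  shows "(f \<longlongrightarrow> 0) (inf at_top (principal \<Lambda>))"
proof (rule tendstoI, rule ccontr)
  fix e :: real assume e: "e > 0" and c: "\<not> (\<forall>\<^sub>F x in inf at_top (principal \<Lambda>). dist (f x) 0 < e)"
  have "\<exists>\<nu>. real n + 1 \<le> \<nu> \<and> \<nu> \<in> \<Lambda> \<and> \<not> dist (f \<nu>) 0 < e" for n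
    using c unfolding eventually_inf_principal eventually_at_top_linorder by blast
  then obtain \<nu> where \<nu>: "\<And>n. real n + 1 \<le> \<nu> n" "\<And>n. \<nu> n \<in> \<Lambda>" "\<And>n. \<not> dist (f (\<nu> n)) 0 < e" by metis
  have \<nu>1: "\<nu> n \<ge> 1" for n using \<nu>(1)[of n] by simp
  have \<nu>lim: "filterlim \<nu> at_top sequentially"
    by (rule filterlim_at_top_mono[OF filterlim_real_sequentially]) (use \<nu>(1) in \<open>auto intro!: always_eventually simp: order_trans[OF _ \<nu>(1)]\<close>)
  obtain \<phi> where "(\<lambda>n. f (\<nu> (\<phi> n))) \<longlonglongrightarrow> 0" using assms[OF \<nu>(2) \<nu>1 \<nu>lim] by blast
  then have "\<forall>\<^sub>F n in sequentially. dist (f (\<nu> (\<phi> n))) 0 < e" using e by (rule tendstoD)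
  then show False using \<nu>(3) by simp
qed

theorem theorem1p7:
  fixes a b \<alpha> \<beta> :: real
    and \<Lambda> :: "real set"
    and uv :: "real \<Rightarrow> (real^'n::finite \<Rightarrow> real) \<times> (real^'n \<Rightarrow> real)"
  assumes N: "CARD('n) = 3 \<or> CARD('n) = 4"
    and ab: "a > 0" "b > 0"
    and \<alpha>: "\<alpha> > 1" and \<beta>: "\<beta> > 1"
    and sub: "\<alpha> + \<beta> < crit TYPE('n)"
    and sup: "\<alpha> + \<beta> > 2 + 4 / real CARD('n)"
    and \<Lambda>: "\<Lambda> \<subseteq> {0<..}" "\<not> bdd_above \<Lambda>"
    and gs: "\<And>\<nu>. \<nu> \<in> \<Lambda> \<Longrightarrow>
        norm_ground_state \<alpha> \<beta> \<nu> a b (fst (uv \<nu>)) (snd (uv \<nu>)) \<and>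
        (\<forall>x. fst (uv \<nu>) x > 0 \<and> snd (uv \<nu>) x > 0) \<and>
        radial (fst (uv \<nu>)) \<and> radial (snd (uv \<nu>)) \<and>
        (\<exists>lam1 lam2. lam1 > 0 \<and> lam2 > 0 \<and>
           coupled_sol \<alpha> \<beta> \<nu> lam1 lam2 (fst (uv \<nu>)) (snd (uv \<nu>)))"
  shows "((\<lambda>\<nu>. Hdist_set (star2 (ln \<nu> / (gam TYPE('n) \<alpha> \<beta> - 2)) (uv \<nu>)) (Gset \<alpha> \<beta> a b))
           \<longlongrightarrow> 0) (inf at_top (principal \<Lambda>))"
proof (rule sequential_limit)
  fix \<nu> :: "nat \<Rightarrow> real" assume \<nu>: "\<And>n. \<nu> n \<in> \<Lambda>" "\<And>n. \<nu> n \<ge> 1" "filterlim \<nu> at_top sequentially"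
  let ?g = "gam TYPE('n) \<alpha> \<beta>" let ?c = "crit TYPE('n)"
  have N3: "CARD('n) \<ge> 3" using N by auto
  note g = gam_range[OF N3 sub sup]
  define s where "s n = ln (\<nu> n) / (?g - 2)" for n
  define \<epsilon> where "\<epsilon> n = exp ((2 - ?c) * s n)" for n
  define U where "U n = star (s n) (fst (uv (\<nu> n)))" for n
  define V where "V n = star (s n) (snd (uv (\<nu> n)))" for n
  have s0: "s n \<ge> 0" for n using \<nu>(2)[of n] g by (simp add: s_def)
  have \<nu>s: "\<nu> n = exp ((?g - 2) * s n)" for n using \<nu>(2)[of n] g by (simp add: s_def)
  have e01: "0 \<le> \<epsilon> n" "\<epsilon> n \<le> 1" for n using s0[of n] g by (auto simp: \<epsilon>_def mult_le_0_iff)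
  have "filterlim s at_top sequentially"
    unfolding s_def[abs_def] divide_inverse using g
    by (intro filterlim_at_top_mult_tendsto_pos[OF tendsto_const] filterlim_compose[OF ln_at_top \<nu>(3)]) auto
  then have "filterlim (\<lambda>n. (2 - ?c) * s n) at_bot sequentially"
    using g by (intro filterlim_tendsto_neg_mult_at_bot[OF tendsto_const]) auto
  then have elim: "\<epsilon> \<longlonglongrightarrow> 0" unfolding \<epsilon>_def[abs_def] by (rule filterlim_compose[OF exp_at_bot])
  note G = gs[OF \<nu>(1)]
  have gsn: "norm_ground_state \<alpha> \<beta> (\<nu> n) a b (fst (uv (\<nu> n))) (snd (uv (\<nu> n)))" for n using G[of n] by blast
  note R = ground_state_rescaled[OF N3 g ab gsn \<nu>s \<epsilon>_def, folded U_def V_def]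
  have rad: "radial (U n)" "radial (V n)" for n using G[of n] by (auto simp: U_def V_def intro: radial_star)
  have pos: "U n x > 0" "V n x > 0" for n x using G[of n] by (auto simp: U_def V_def star_def)
  have "\<exists>l1 l2. l1 > 0 \<and> l2 > 0 \<and> weak_sol l1 (U n) (sys_rhs (\<epsilon> n) \<alpha> \<beta> (U n) (V n)) \<and> weak_sol l2 (V n) (sys_rhs (\<epsilon> n) \<beta> \<alpha> (V n) (U n))" for n
  proof -
    obtain l1 l2 where l: "l1 > 0" "l2 > 0" "coupled_sol \<alpha> \<beta> (\<nu> n) l1 l2 (fst (uv (\<nu> n))) (snd (uv (\<nu> n)))" using G[of n] by blast
    have T: "(fst (uv (\<nu> n)), snd (uv (\<nu> n))) \<in> Tset a b" using gsn[of n] by (auto simp: norm_ground_state_def Pset_def)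
    note C = coupled_sol_star[OF N3 Tset_mass(1,2)[OF T] l(3) \<nu>s \<epsilon>_def, folded U_def V_def]
    have "exp (2 * s n) * l1 > 0" "exp (2 * s n) * l2 > 0" using l by auto
    with C show ?thesis by blast
  qed
  then obtain L1 L2 where L: "\<And>n. L1 n > 0" "\<And>n. L2 n > 0" and ws: "\<And>n. weak_sol (L1 n) (U n) (sys_rhs (\<epsilon> n) \<alpha> \<beta> (U n) (V n))"
      "\<And>n. weak_sol (L2 n) (V n) (sys_rhs (\<epsilon> n) \<beta> \<alpha> (V n) (U n))" by metis
  \<comment> \<open>The first rescaled ground state provides an element of \<open>Lset\<close>:
    positivity of its components makes the coupling integral positive, and a dilation then reaches
    the constraint.\<close>
  have "\<exists>w z. (w, z) \<in> (Lset \<alpha> \<beta> a b :: ((real^'n \<Rightarrow> real) \<times> _) set)"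
  proof -
    note H = Tset_mass(1,2)[OF R(1)[of 0]]
    let ?A = "(\<integral>x. (U 0 x)\<^sup>2 \<partial>lebesgue) + (\<integral>x. (V 0 x)\<^sup>2 \<partial>lebesgue)" let ?D = "dirichlet (U 0) + dirichlet (V 0)"
    have m: "U 0 \<in> borel_measurable lebesgue" "V 0 \<in> borel_measurable lebesgue" using H by (auto simp: H1_def)
    have b: "(\<integral>x. (U 0 x)\<^sup>2 \<partial>lebesgue) \<le> ?A" "(\<integral>x. (V 0 x)\<^sup>2 \<partial>lebesgue) \<le> ?A" "dirichlet (U 0) \<le> ?D" "dirichlet (V 0) \<le> ?D"
      by (simp_all add: dirichlet_nonneg)
    obtain F where F: "profile (U 0) F" "below_mu TYPE('n) (profM TYPE('n) ?A ?D) F"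
      using radial_profile_uniform[OF N3 H(1) rad(1) pos(1) b(1,3)] by metis
    obtain G where G: "profile (V 0) G" "below_mu TYPE('n) (profM TYPE('n) ?A ?D) G"
      using radial_profile_uniform[OF N3 H(2) rad(2) pos(2) b(2,4)] by metis
    have "coup \<alpha> \<beta> (U 0) (V 0) > 0"
      by (rule coup_pos[OF coup_profile(3)[OF N3 \<alpha> \<beta> sub sup m F(1) G(1) F(2) G(2)] pos])
    then show ?thesis using Lset_star[OF g(1) ab R(1)] by blast
  qed
  then obtain w0 z0 :: "real^'n \<Rightarrow> real" where wz: "(w0, z0) \<in> Lset \<alpha> \<beta> a b" by blast
  have g': "1/2 - 1 / ?g > 0" using g by (simp add: divide_simps)
  \<comment> \<open>One fixed element of \<open>Lset\<close> as competitor bounds all rescaled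
    energies from above, and these control the Dirichlet energies.\<close>
  have Dm: "dirichlet (U n) + dirichlet (V n) \<le> K_fun \<alpha> \<beta> w0 z0 / (1/2 - 1 / ?g)" for n
  proof -
    have "(1/2 - 1 / ?g) * (dirichlet (U n) + dirichlet (V n)) \<le> K_fun \<alpha> \<beta> w0 z0"
      by (rule order_trans[OF scaled_energy_lower[OF g e01(1) R(2)] R(3)[OF wz]])
    then show ?thesis using g' by (simp add: pos_le_divide_eq mult.commute)
  qed
  obtain d0 where d0: "d0 > 0" and d0n: "\<And>n. d0 \<le> dirichlet (U n) + dirichlet (V n)"
  proof (rule dirichlet_lower_bound[OF N3 \<alpha> \<beta> sub sup ab])
    fix d0 :: real assume d0: "d0 > 0" and b: "\<And>(u::real^'n \<Rightarrow> real) v \<epsilon> l1 l2. (u, v) \<in> Tset a b \<Longrightarrow> radial u \<Longrightarrow> radial v \<Longrightarrow>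
      (\<And>x. u x > 0) \<Longrightarrow> (\<And>x. v x > 0) \<Longrightarrow> 0 \<le> \<epsilon> \<Longrightarrow> \<epsilon> \<le> 1 \<Longrightarrow> weak_sol l1 u (sys_rhs \<epsilon> \<alpha> \<beta> u v) \<Longrightarrow>
      weak_sol l2 v (sys_rhs \<epsilon> \<beta> \<alpha> v u) \<Longrightarrow> scaled_pohozaev \<alpha> \<beta> \<epsilon> u v = 0 \<Longrightarrow> d0 \<le> dirichlet u + dirichlet v"
    show thesis by (rule that[OF d0 b[OF R(1) rad pos e01 ws R(2)]])
  qed
  have poh: "dirichlet (U n) + dirichlet (V n) = \<epsilon> n * (Lp_int ?c (U n) + Lp_int ?c (V n)) + ?g * coup \<alpha> \<beta> (U n) (V n)" for n
    using R(2)[of n] by (simp add: scaled_pohozaev_def)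
  obtain \<phi> u v l1 l2 where \<phi>: "strict_mono (\<phi> :: nat \<Rightarrow> nat)" and T: "(u, v) \<in> Tset a b" and l: "l1 > 0" "l2 > 0"
    and w: "weak_sol l1 u (sys_rhs 0 \<alpha> \<beta> u v)" "weak_sol l2 v (sys_rhs 0 \<beta> \<alpha> v u)"
    and limD: "(\<lambda>n. dirichlet (U (\<phi> n)) + dirichlet (V (\<phi> n))) \<longlonglongrightarrow> dirichlet u + dirichlet v"
    and limC: "(\<lambda>n. coup \<alpha> \<beta> (U (\<phi> n)) (V (\<phi> n))) \<longlonglongrightarrow> coup \<alpha> \<beta> u v"
    and limE: "(\<lambda>n. \<epsilon> (\<phi> n) * (Lp_int ?c (U (\<phi> n)) + Lp_int ?c (V (\<phi> n)))) \<longlonglongrightarrow> 0"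
    and limH: "(\<lambda>n. Hdist (U (\<phi> n), V (\<phi> n)) (u, v)) \<longlonglongrightarrow> 0"
    by (rule radial_system_compact[OF N \<alpha> \<beta> sub sup ab R(1) rad pos L e01 elim ws Dm poh d0 d0n])
  \<comment> \<open>The Pohozaev identity in the limit, where its critical part has vanished, is the
    constraint L = 0.\<close>
  have "(\<lambda>n. dirichlet (U (\<phi> n)) + dirichlet (V (\<phi> n))) \<longlonglongrightarrow> 0 + ?g * coup \<alpha> \<beta> u v"
    unfolding poh by (intro tendsto_intros limE limC)
  then have "L_fun \<alpha> \<beta> u v = 0" using LIMSEQ_unique[OF limD] by (simp add: L_fun_def)
  then have Ls: "(u, v) \<in> Lset \<alpha> \<beta> a b" using T by (simp add: Lset_def)
  have "(\<lambda>n. 1/2 * (dirichlet (U (\<phi> n)) + dirichlet (V (\<phi> n))) - 1 / ?c * (\<epsilon> (\<phi> n) * (Lp_int ?c (U (\<phi> n)) + Lp_int ?c (V (\<phi> n)))) - coup \<alpha> \<beta> (U (\<phi> n)) (V (\<phi> n)))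
      \<longlonglongrightarrow> 1/2 * (dirichlet u + dirichlet v) - 1 / ?c * 0 - coup \<alpha> \<beta> u v" by (intro tendsto_intros limD limC limE)
  then have limK: "(\<lambda>n. scaled_energy \<alpha> \<beta> (\<epsilon> (\<phi> n)) (U (\<phi> n)) (V (\<phi> n))) \<longlonglongrightarrow> K_fun \<alpha> \<beta> u v"
    by (simp add: scaled_energy_def K_fun_def)
  \<comment> \<open>Each rescaled energy is at most K of any competitor, and along the subsequence
    these energies converge to K of the limit.\<close>
  have le: "K_fun \<alpha> \<beta> u v \<le> K_fun \<alpha> \<beta> w' z'" if "(w', z') \<in> Lset \<alpha> \<beta> a b" for w' z' :: "real^'n \<Rightarrow> real"
    by (rule LIMSEQ_le_const2[OF limK]) (use R(3)[OF that] in auto)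
  have "K_fun \<alpha> \<beta> u v = Inf ((\<lambda>(w, z). K_fun \<alpha> \<beta> w z) ` (Lset \<alpha> \<beta> a b :: ((real^'n \<Rightarrow> real) \<times> _) set))"
  proof (rule antisym)
    show "K_fun \<alpha> \<beta> u v \<le> Inf ((\<lambda>(w, z). K_fun \<alpha> \<beta> w z) ` (Lset \<alpha> \<beta> a b :: ((real^'n \<Rightarrow> real) \<times> _) set))"
      by (rule cInf_greatest) (use Ls le in auto)
    show "Inf ((\<lambda>(w, z). K_fun \<alpha> \<beta> w z) ` (Lset \<alpha> \<beta> a b :: ((real^'n \<Rightarrow> real) \<times> _) set)) \<le> K_fun \<alpha> \<beta> u v"
    proof (rule cInf_lower)
      show "K_fun \<alpha> \<beta> u v \<in> (\<lambda>(w, z). K_fun \<alpha> \<beta> w z) ` (Lset \<alpha> \<beta> a b :: ((real^'n \<Rightarrow> real) \<times> _) set)" using Ls by force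
      show "bdd_below ((\<lambda>(w, z). K_fun \<alpha> \<beta> w z) ` (Lset \<alpha> \<beta> a b :: ((real^'n \<Rightarrow> real) \<times> _) set))"
        by (rule bdd_belowI2[of _ 0]) (use K_fun_Lset(2)[OF g(1)] in auto)
    qed
  qed
  moreover have "limit_sol \<alpha> \<beta> l1 l2 u v"
    using w unfolding limit_sol_def sys_rhs_def[abs_def] by (simp add: mult_ac)
  ultimately have Gs: "(u, v) \<in> Gset \<alpha> \<beta> a b" using T l by (auto simp: Gset_def)
  \<comment> \<open>The limit pair belongs to \<open>Gset\<close>, so the distance to the set is at
    most the distance to this pair.\<close>
  have "(\<lambda>n. Hdist_set (U (\<phi> n), V (\<phi> n)) (Gset \<alpha> \<beta> a b)) \<longlonglongrightarrow> 0"
    by (rule tendsto_sandwich[OF _ _ tendsto_const limH]) (use Hdist_set_le[OF Gs] in auto)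
  then show "\<exists>\<phi>. strict_mono (\<phi> :: nat \<Rightarrow> nat) \<and> (\<lambda>n. Hdist_set (star2 (ln (\<nu> (\<phi> n)) / (?g - 2)) (uv (\<nu> (\<phi> n)))) (Gset \<alpha> \<beta> a b)) \<longlonglongrightarrow> 0"
    using \<phi> by (auto simp: U_def V_def star2_def s_def)
qed

end
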